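(* Let $n\ge 2$. For every $\gamma\in(0,1)$ there exists a constant $C=C(\gamma,n)>0$ such that the following holds. Let $\Omega\subset\mathbb{R}^n$ be a nonempty open set, let $V\in L^1_{loc}(\Omega)$ be real-valued with $V\ge0$, and let $a=(a_1,\dots,a_n)$ be real-valued with $a\in L^\infty_{loc}(\bar\Omega)$. Let $\lambda$ be the bottom of the spectrum of the magnetic Schrödinger operator $H_{a,V}$ with Dirichlet boundary conditions in $L^2(\Omega)$, i.e. the best (largest) constant $\lambda\ge0$ such that $\lambda\int_\Omega|u|^2dx\le h_{a,V}(u,u)$ for all $u\in C_0^\infty(\Omega)$. Let $D=D(\Omega,\gamma,a,V)\in(0,+\infty]$ be the capacitary interior diameter (with either of the two options for the choice of pairs $(F,\omega)$ in its definition). Then $$C^{-1}D^{-2}\le\lambda\le CD^{-2}.$$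
   Context: Operator: $\nabla_a u=\nabla u+iau$, and $h_{a,V}(u,u)=\int_\Omega(|\nabla_a u|^2+V|u|^2)\,dx$ for $u\in C_0^\infty(\Omega)$ (complex-valued). This form is closable in $L^2(\Omega)$, and $H_{a,V}=-\sum_{j}(\partial_{x^j}+ia_j)^2+V$ denotes the self-adjoint operator in $L^2(\Omega)$ defined by its closure. The condition $a\in L^\infty_{loc}(\bar\Omega)$ means that each $a_j$, extended by $0$ to $\mathbb{R}^n\setminus\Omega$, is in $L^\infty_{loc}(\mathbb{R}^n)$. Cubes and capacity: $Q_d$ denotes a closed cube in $\mathbb{R}^n$ with edges of length $d$ parallel to the coordinate axes. For compact $F\subset\mathbb{R}^n$, $\mathrm{cap}(F)$ is the Wiener capacity: for $n\ge3$, $\mathrm{cap}(F)=\inf\int_{\mathbb{R}^n}|\nabla u|^2dx$ over $u\in C_0^\infty(\mathbb{R}^n)$ with $u=1$ in a neighborhood of $F$; for $n=2$ the capacity of $F\subset Q_d$ is taken with respect to the interior of the concentric cube $Q_{2d}$ with edge length $2d$ (i.e. $u\in C_0^\infty$ of that interior). Capacitary interior diameter: $$D(\Omega,\gamma,a,V)=\sup_{Q_d}\left\{d:\ d^{n-2}\ge\inf_{F,\omega}\int_{Q_d\setminus F}\left(\left|\frac{\nabla\omega}{i\omega}+a\right|^2+V\right)dx\right\},$$ the supremum being over all cubes $Q_d$ (all $d>0$ and all positions). Here $F$ runs over compact sets with $Q_d\setminus\Omega\subset F\subset Q_d$ and $\mathrm{cap}(F)\le\gamma\,\mathrm{cap}(Q_d)$,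 and there are two options for $\omega$: (i) $\omega\in C^\infty(Q_d\setminus e)$ complex-valued for some compact $e\subset\mathrm{Int}\,F$ (interior relative to $Q_d$), with $|\omega|=1$ on $Q_d\setminus e$; or (ii) $\omega=P/|P|$ on $Q_d\setminus P^{-1}(0)$, chosen independently of $F$, where $P$ is a complex polynomial generic on $Q_d$, meaning that for some neighborhood $\mathcal U$ of $Q_d$ in $\mathbb{R}^n$ the gradients of $\mathrm{Re}\,P$ and $\mathrm{Im}\,P$ are linearly independent at every point of $\mathcal U\cap P^{-1}(0)$. If no admissible $F$ exists for a cube, the infimum is $+\infty$. The integrals may take the value $+\infty$. Convention: $D^{-2}=0$ if $D=+\infty$. *)

theory Defs
  imports "HOL-Analysis.Analysis"
begin

definition grad :: "(real^'n \<Rightarrow> 'b::real_normed_vector) \<Rightarrow> real^'n \<Rightarrow> 'b^'n" where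
  "grad f x = (\<chi> j. frechet_derivative f (at x) (axis j 1))"

text \<open>Only used for open \<open>S\<close>.\<close>

primrec Ck_on :: "nat \<Rightarrow> (real^'n \<Rightarrow> 'b::real_normed_vector) \<Rightarrow> (real^'n) set \<Rightarrow> bool" where
  "Ck_on 0 f S \<longleftrightarrow> continuous_on S f"
| "Ck_on (Suc k) f S \<longleftrightarrow> f differentiable_on S \<and> (\<forall>j. Ck_on k (\<lambda>x. grad f x $ j) S)"

definition smooth_on :: "(real^'n) set \<Rightarrow> (real^'n \<Rightarrow> 'b::real_normed_vector) \<Rightarrow> bool" where
  "smooth_on S f \<longleftrightarrow> (\<forall>k. Ck_on k f S)"

text \<open>The space $C_0^\infty(G)$; its elements are functions on the whole space, zero off \<open>G\<close>.\<close>

definition test_functions :: "(real^'n) set \<Rightarrow> (real^'n \<Rightarrow> 'b::real_normed_vector) set" where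
  "test_functions G =
     {u. smooth_on UNIV u \<and> compact (closure {x. u x \<noteq> 0}) \<and> closure {x. u x \<noteq> 0} \<subseteq> G}"

definition L1_loc :: "(real^'n) set \<Rightarrow> (real^'n \<Rightarrow> real) \<Rightarrow> bool" where
  "L1_loc G f \<longleftrightarrow> (\<forall>K. compact K \<and> K \<subseteq> G \<longrightarrow> set_integrable lebesgue K f)"

definition Linf_loc :: "(real^'n \<Rightarrow> real) \<Rightarrow> bool" where
  "Linf_loc f \<longleftrightarrow> f \<in> borel_measurable lebesgue \<and>
     (\<forall>K. compact K \<longrightarrow> (\<exists>M. AE x in lebesgue. x \<in> K \<longrightarrow> \<bar>f x\<bar> \<le> M))"

text \<open>The condition $a \in L^\infty_{loc}(\bar\Omega)$, which includes boundedness up to the boundary.\<close>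

definition Linf_loc_closure :: "(real^'n) set \<Rightarrow> (real^'n \<Rightarrow> real^'n) \<Rightarrow> bool" where
  "Linf_loc_closure G a \<longleftrightarrow> (\<forall>j. Linf_loc (\<lambda>x. if x \<in> G then a x $ j else 0))"

definition mag_grad ::
  "(real^'n \<Rightarrow> real^'n) \<Rightarrow> (real^'n \<Rightarrow> complex) \<Rightarrow> real^'n \<Rightarrow> complex^'n" where
  "mag_grad a u x = (\<chi> j. grad u x $ j + \<i> * complex_of_real (a x $ j) * u x)"

definition mag_energy ::
  "(real^'n) set \<Rightarrow> (real^'n \<Rightarrow> real^'n) \<Rightarrow> (real^'n \<Rightarrow> real) \<Rightarrow> (real^'n \<Rightarrow> complex) \<Rightarrow> real" where
  "mag_energy G a V u = (LINT x:G|lebesgue. (norm (mag_grad a u x))\<^sup>2 + V x * (cmod (u x))\<^sup>2)"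

definition mag_form ::
  "(real^'n) set \<Rightarrow> (real^'n \<Rightarrow> real^'n) \<Rightarrow> (real^'n \<Rightarrow> real) \<Rightarrow>
   (real^'n \<Rightarrow> complex) \<Rightarrow> (real^'n \<Rightarrow> complex) \<Rightarrow> complex" where
  "mag_form G a V u v =
     (LINT x:G|lebesgue. (\<Sum>j\<in>UNIV. mag_grad a u x $ j * cnj (mag_grad a v x $ j))
                          + complex_of_real (V x) * u x * cnj (v x))"

text \<open>
  Elements of $L^2(G)$ are represented by functions. All notions below depend only on their
  restrictions to \<open>G\<close> up to null sets.
\<close>

definition L2 :: "(real^'n) set \<Rightarrow> (real^'n \<Rightarrow> complex) set" where
  "L2 G = {u. set_borel_measurable lebesgue G u \<and> set_integrable lebesgue G (\<lambda>x. (cmod (u x))\<^sup>2)}"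

definition L2_inner :: "(real^'n) set \<Rightarrow> (real^'n \<Rightarrow> complex) \<Rightarrow> (real^'n \<Rightarrow> complex) \<Rightarrow> complex" where
  "L2_inner G u v = (LINT x:G|lebesgue. u x * cnj (v x))"

definition L2_norm :: "(real^'n) set \<Rightarrow> (real^'n \<Rightarrow> complex) \<Rightarrow> real" where
  "L2_norm G u = sqrt (LINT x:G|lebesgue. (cmod (u x))\<^sup>2)"

text \<open>\<open>u\<close> lies in the domain of the closure of the form, as witnessed by the sequence \<open>\<phi>\<close>.\<close>

definition form_approx ::
  "(real^'n) set \<Rightarrow> (real^'n \<Rightarrow> real^'n) \<Rightarrow> (real^'n \<Rightarrow> real) \<Rightarrow>
   (nat \<Rightarrow> real^'n \<Rightarrow> complex) \<Rightarrow> (real^'n \<Rightarrow> complex) \<Rightarrow> bool" where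
  "form_approx G a V \<phi> u \<longleftrightarrow>
     u \<in> L2 G \<and> (\<forall>k. \<phi> k \<in> test_functions G) \<and>
     (\<lambda>k. L2_norm G (\<lambda>x. \<phi> k x - u x)) \<longlonglongrightarrow> 0 \<and>
     (\<forall>\<epsilon>>0. \<exists>N. \<forall>k\<ge>N. \<forall>m\<ge>N. mag_energy G a V (\<lambda>x. \<phi> k x - \<phi> m x) < \<epsilon>)"

definition form_dom ::
  "(real^'n) set \<Rightarrow> (real^'n \<Rightarrow> real^'n) \<Rightarrow> (real^'n \<Rightarrow> real) \<Rightarrow> (real^'n \<Rightarrow> complex) set" where
  "form_dom G a V = {u. \<exists>\<phi>. form_approx G a V \<phi> u}"

definition closed_form ::
  "(real^'n) set \<Rightarrow> (real^'n \<Rightarrow> real^'n) \<Rightarrow> (real^'n \<Rightarrow> real) \<Rightarrow>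
   (real^'n \<Rightarrow> complex) \<Rightarrow> (real^'n \<Rightarrow> complex) \<Rightarrow> complex" where
  "closed_form G a V u v =
     (THE c. \<exists>\<phi> \<psi>. form_approx G a V \<phi> u \<and> form_approx G a V \<psi> v \<and>
                    (\<lambda>k. mag_form G a V (\<phi> k) (\<psi> k)) \<longlonglongrightarrow> c)"

text \<open>
  The graph of $H_{a,V}$: \<open>mag_op G a V u f\<close> says that \<open>u\<close> is in the domain of the self-adjoint
  operator defined by the closed form and that $H_{a,V} u = f$ almost everywhere on \<open>G\<close>.
\<close>

definition mag_op ::
  "(real^'n) set \<Rightarrow> (real^'n \<Rightarrow> real^'n) \<Rightarrow> (real^'n \<Rightarrow> real) \<Rightarrow>
   (real^'n \<Rightarrow> complex) \<Rightarrow> (real^'n \<Rightarrow> complex) \<Rightarrow> bool" where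
  "mag_op G a V u f \<longleftrightarrow>
     u \<in> form_dom G a V \<and> f \<in> L2 G \<and>
     (\<forall>v\<in>form_dom G a V. closed_form G a V u v = L2_inner G f v)"

text \<open>
  The resolvent set: \<open>H - z\<close> maps its domain onto $L^2(G)$ and has a bounded inverse
  (the bound contains injectivity).
\<close>

definition mag_resolvent_set ::
  "(real^'n) set \<Rightarrow> (real^'n \<Rightarrow> real^'n) \<Rightarrow> (real^'n \<Rightarrow> real) \<Rightarrow> complex set" where
  "mag_resolvent_set G a V =
     {z. (\<forall>g\<in>L2 G. \<exists>u. mag_op G a V u (\<lambda>x. g x + z * u x)) \<and>
         (\<exists>M. \<forall>u f. mag_op G a V u f \<longrightarrow> L2_norm G u \<le> M * L2_norm G (\<lambda>x. f x - z * u x))}"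

definition mag_spectrum ::
  "(real^'n) set \<Rightarrow> (real^'n \<Rightarrow> real^'n) \<Rightarrow> (real^'n \<Rightarrow> real) \<Rightarrow> complex set" where
  "mag_spectrum G a V = - mag_resolvent_set G a V"

definition spectrum_bottom ::
  "(real^'n) set \<Rightarrow> (real^'n \<Rightarrow> real^'n) \<Rightarrow> (real^'n \<Rightarrow> real) \<Rightarrow> real" where
  "spectrum_bottom G a V = Inf (Re ` mag_spectrum G a V)"

definition best_constant ::
  "(real^'n) set \<Rightarrow> (real^'n \<Rightarrow> real^'n) \<Rightarrow> (real^'n \<Rightarrow> real) \<Rightarrow> real \<Rightarrow> bool" where
  "best_constant G a V l \<longleftrightarrow>
     (let S = {c. 0 \<le> c \<and> (\<forall>u\<in>test_functions G.
                    c * (LINT x:G|lebesgue. (cmod (u x))\<^sup>2) \<le> mag_energy G a V u)}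
      in l \<in> S \<and> (\<forall>c\<in>S. c \<le> l))"

definition cube :: "real^'n \<Rightarrow> real \<Rightarrow> (real^'n) set" where
  "cube p d = cbox (p - (\<chi> i. d / 2)) (p + (\<chi> i. d / 2))"

definition rel_cap :: "(real^'n) set \<Rightarrow> (real^'n) set \<Rightarrow> ennreal" where
  "rel_cap G F =
     (INF u \<in> {u :: real^'n \<Rightarrow> real. u \<in> test_functions G \<and>
                  (\<exists>N. open N \<and> F \<subseteq> N \<and> (\<forall>x\<in>N. u x = 1))}.
        \<integral>\<^sup>+x. ennreal ((norm (grad u x))\<^sup>2) \<partial>lebesgue)"

text \<open>
  The Wiener capacity of a compact \<open>F \<subseteq> cube p d\<close>; the cube matters only in dimension two.
\<close>

definition wiener_cap :: "real^'n \<Rightarrow> real \<Rightarrow> (real^'n) set \<Rightarrow> ennreal" where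
  "wiener_cap p d F =
     (if CARD('n) = 2 then rel_cap (interior (cube p (2 * d))) F else rel_cap UNIV F)"

definition admissible_sets :: "(real^'n) set \<Rightarrow> real \<Rightarrow> real^'n \<Rightarrow> real \<Rightarrow> (real^'n) set set" where
  "admissible_sets G \<gamma> p d =
     {F. compact F \<and> cube p d - G \<subseteq> F \<and> F \<subseteq> cube p d \<and>
         wiener_cap p d F \<le> ennreal \<gamma> * wiener_cap p d (cube p d)}"

text \<open>
  First option for pairs \<open>(F, \<omega>)\<close>. Since \<open>Q - e\<close> is not open, $C^\infty(Q \setminus e)$ is
  read as the smooth functions on an open neighbourhood of \<open>Q - e\<close>.
\<close>

definition smooth_pairs :: "(real^'n) set \<Rightarrow> (real^'n) set \<Rightarrow> (real^'n \<Rightarrow> complex) \<Rightarrow> bool" where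
  "smooth_pairs Q F \<omega> \<longleftrightarrow>
     (\<exists>e U. compact e \<and> e \<subseteq> top_of_set Q interior_of F \<and>
            open U \<and> Q - e \<subseteq> U \<and> smooth_on U \<omega> \<and> (\<forall>x\<in>Q - e. cmod (\<omega> x) = 1))"

definition generic_poly :: "(real^'n) set \<Rightarrow> (real^'n \<Rightarrow> complex) \<Rightarrow> bool" where
  "generic_poly Q P \<longleftrightarrow> polynomial_function P \<and>
     (\<exists>U. open U \<and> Q \<subseteq> U \<and>
        (\<forall>x\<in>U. P x = 0 \<longrightarrow>
           (let g = grad (\<lambda>y. Re (P y)) x; h = grad (\<lambda>y. Im (P y)) x
            in g \<noteq> h \<and> independent {g, h})))"

text \<open>
  Second option: \<open>\<omega> = P/|P|\<close> for a generic polynomial, with no condition linking \<open>\<omega>\<close> to \<open>F\<close>.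
  The junk values of \<open>\<omega>\<close> on the zero set of \<open>P\<close> are harmless, as this is a null set in \<open>Q\<close>.
\<close>

definition polynomial_pairs :: "(real^'n) set \<Rightarrow> (real^'n) set \<Rightarrow> (real^'n \<Rightarrow> complex) \<Rightarrow> bool" where
  "polynomial_pairs Q F \<omega> \<longleftrightarrow>
     (\<exists>P. generic_poly Q P \<and> \<omega> = (\<lambda>x. P x / complex_of_real (cmod (P x))))"

definition gauge_energy ::
  "(real^'n \<Rightarrow> real^'n) \<Rightarrow> (real^'n \<Rightarrow> real) \<Rightarrow> (real^'n) set \<Rightarrow> (real^'n \<Rightarrow> complex) \<Rightarrow> ennreal" where
  "gauge_energy a V S \<omega> =
     (\<integral>\<^sup>+x\<in>S. ennreal ((norm (\<chi> j. grad \<omega> x $ j / (\<i> * \<omega> x) + complex_of_real (a x $ j)))\<^sup>2 + V x)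
        \<partial>lebesgue)"

text \<open>
  \<open>A\<close> is the option for pairs \<open>(F, \<omega>)\<close>. The value is taken in \<open>[0, \<infinity>]\<close>, where an infimum over the
  empty set is \<open>\<infinity>\<close>.
\<close>

definition cap_diam ::
  "((real^'n) set \<Rightarrow> (real^'n) set \<Rightarrow> (real^'n \<Rightarrow> complex) \<Rightarrow> bool) \<Rightarrow>
   (real^'n) set \<Rightarrow> real \<Rightarrow> (real^'n \<Rightarrow> real^'n) \<Rightarrow> (real^'n \<Rightarrow> real) \<Rightarrow> ennreal" where
  "cap_diam A G \<gamma> a V =
     Sup {ennreal d | p d. d > 0 \<and>
            ennreal (d ^ (CARD('n) - 2)) \<ge>
              (INF (F, \<omega>) \<in> {(F, \<omega>). F \<in> admissible_sets G \<gamma> p d \<and> A (cube p d) F \<omega>}.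
                 gauge_energy a V (cube p d - F) \<omega>)}"

end

theory Submission
  imports Defs
begin

text \<open>
  Upper bound: if \<open>F\<close> has capacity at most \<open>\<gamma>\<close> times that of the cube \<open>Q\<close>, there is a bounded real cutoff
  \<open>g\<close> supported in \<open>Q - F\<close> with Dirichlet integral of order \<open>d ^ (n - 2)\<close> and \<open>L2\<close> norm squared of order
  \<open>d ^ n\<close>; the test function \<open>g * \<omega>\<close> turns the gauge energy of \<open>\<omega>\<close> into magnetic energy. For \<open>\<omega> = P / |P|\<close>
  one also cuts off near the zeros of \<open>P\<close>; genericity and finiteness of the gauge energy make \<open>1 / |P|^2\<close>
  integrable, so that this costs nothing in the limit.

  Lower bound: for \<open>\<mu> > \<lambda>\<close> take \<open>u\<close> with energy below \<open>\<mu>\<close> and a cube of size \<open>d\<close>, \<open>d^2 \<sim> 1 / \<mu>\<close>, on which \<open>u\<close>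
  still has small energy. By the diamagnetic and Poincare inequalities \<open>|u|\<close> is close to a constant \<open>m\<close>
  outside the sublevel set \<open>F\<close> of \<open>|u|\<close>, which has small capacity, and \<open>\<omega> = P / |P|\<close> with a generic
  polynomial \<open>P\<close> close to \<open>u\<close> serves for both options.

  The bottom of the spectrum is the best constant \<open>l\<close>: the resolvent exists on \<open>Re z < l\<close> by minimising the
  shifted form and a contraction argument, and a bounded inverse at \<open>l\<close> would improve the constant.
\<close>

text \<open>Admitting every \<gamma> < 1 is what shapes the upper bound: even if \<open>F\<close>
  has almost full capacity, the cutoff must keep \<open>L2\<close> mass of order
  \<open>d ^ n\<close>. The mass comes from a contradiction. Let P be a nearly optimal potential of
  \<open>F\<close>, q a bounded substitute for 1 - P, \<eta> a cutoff that is 1 on a slightly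
  smaller cube, and g = \<eta> q. Then 1 - (1 - \<eta>^2) q competes for the capacity of the smaller
  cube, and its gradient is that of q, damped, plus a term with the factor 2 g. Were the mass of g
  small, the smaller cube would have at most about \<gamma> times the capacity of the full one,
  against the continuity of the capacity under shrinking. The lower bound needs polynomials close to
  u in C^1 with regular zeros. Almost every affine perturbation makes the zeros regular, because the
  bad perturbations are the smooth image of a space of one dimension less. All competitors have to
  be smooth, which is why truncations use a sine or a smooth step and |u| is replaced by the square
  root of |u|^2 + \<epsilon>^2.\<close>

lemma frechet_derivative_cong_open:
 assumes "open S" "x \<in> S" "!!y. y \<in> S ==> f y = g y"
 shows "frechet_derivative f (at x) = frechet_derivative g (at x)"
proof -
 have "(f has_derivative D) (at x) \<longleftrightarrow> (g has_derivative D) (at x)" for D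
  using has_derivative_transform_within_open[OF _ assms(1,2)] assms(3) by metis
 then show ?thesis by (simp add: frechet_derivative_def)
qed

lemma grad_cong_open:
 assumes "open S" "x \<in> S" "!!y. y \<in> S ==> f y = g y"
 shows "grad f x = grad g x"
 unfolding grad_def by (simp add: frechet_derivative_cong_open[OF assms])

lemma grad_nth: "grad f x $ j = frechet_derivative f (at x) (axis j 1)"
 by (simp add: grad_def)

lemma grad_eqI: "(f has_derivative f') (at x) ==> grad f x $ j = f' (axis j 1)"
 by (simp add: grad_nth frechet_derivative_at[symmetric])

lemma Ck_on_cong:
 assumes "open S"
 shows "(!!x. x \<in> S ==> f x = g x) ==> Ck_on k f S \<longleftrightarrow> Ck_on k g S"
proof (induction k arbitrary: f g)
 case 0
 then show ?case by (simp cong: continuous_on_cong)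
next
 case (Suc k)
 have "f differentiable_on S \<longleftrightarrow> g differentiable_on S"
  unfolding differentiable_on_eq_differentiable_at[OF assms] differentiable_def
  using Suc.prems has_derivative_transform_within_open[OF _ assms] by metis
 moreover have "Ck_on k (%x. grad f x $ j) S \<longleftrightarrow> Ck_on k (%x. grad g x $ j) S" for j
  by (rule Suc.IH) (simp add: grad_cong_open[OF assms _ Suc.prems])
 ultimately show ?case by simp
qed

lemma Ck_on_subset: "Ck_on k f T ==> S \<subseteq> T ==> Ck_on k f S"
 by (induction k arbitrary: f) (auto intro: continuous_on_subset differentiable_on_subset)

lemma Ck_on_Union:
 assumes "!!U. U \<in> \<U> ==> open U"
 shows "(!!U. U \<in> \<U> ==> Ck_on k f U) ==> Ck_on k f (\<Union>\<U>)"
proof (induction k arbitrary: f)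
 case 0
 then show ?case using assms by (auto intro: continuous_on_open_Union)
next
 case (Suc k)
 have "f differentiable_on \<Union>\<U>"
  using Suc.prems assms by (auto simp: differentiable_on_eq_differentiable_at open_Union)
 then show ?case using Suc by auto
qed

lemma Ck_on_SucD: "Ck_on (Suc k) f S ==> Ck_on k f S"
 by (induction k arbitrary: f) (auto intro: differentiable_imp_continuous_on)

text \<open>Reduces one order of smoothness to an explicit derivative formula, so that
  \<open>grad\<close>, which is defined through a choice of derivative, need not be unfolded. The
  closure rules below all run through it.\<close>

lemma Ck_on_Suc_openI:
 assumes S: "open S" and der: "!!x. x \<in> S ==> (f has_derivative f' x) (at x)"
  and C: "!!j. Ck_on k (%x. f' x (axis j 1)) S"
 shows "Ck_on (Suc k) f S"
proof -
 have "f differentiable_on S"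
  using der S by (auto simp: differentiable_on_eq_differentiable_at differentiable_def)
 moreover have "Ck_on k (%x. grad f x $ j) S" for j
  using C Ck_on_cong[OF S, of "%x. grad f x $ j" "%x. f' x (axis j 1)"] grad_eqI[OF der] by simp
 ultimately show ?thesis by simp
qed

lemma Ck_on_Suc_has_derivative:
 assumes "open S" "Ck_on (Suc k) f S" "x \<in> S"
 shows "(f has_derivative frechet_derivative f (at x)) (at x)"
 using assms frechet_derivative_works by (auto simp: differentiable_on_eq_differentiable_at)

lemma Ck_on_Suc_grad: "Ck_on (Suc k) f S ==> Ck_on k (%x. frechet_derivative f (at x) (axis j 1)) S"
 by (simp add: grad_nth)

lemma Ck_on_const:
 assumes "open S" shows "Ck_on k (%x. c) S"
proof (induction k arbitrary: c)
 case (Suc k)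
 show ?case by (rule Ck_on_Suc_openI[OF assms has_derivative_const]) (simp add: Suc)
qed simp

lemma Ck_on_bounded_linear:
 assumes "open S" "bounded_linear f" shows "Ck_on k f S"
proof (cases k)
 case 0
 then show ?thesis by (simp add: assms(2) linear_continuous_on)
next
 case (Suc m)
 show ?thesis unfolding Suc
  by (rule Ck_on_Suc_openI[OF assms(1) bounded_linear_imp_has_derivative[OF assms(2)] Ck_on_const[OF assms(1)]])
qed

lemma Ck_on_add:
 assumes S: "open S"
 shows "Ck_on k f S ==> Ck_on k g S ==> Ck_on k (%x. f x + g x) S"
proof (induction k arbitrary: f g)
 case (Suc k)
 show ?case
  by (rule Ck_on_Suc_openI[OF S has_derivative_add[OF Ck_on_Suc_has_derivative[OF S Suc.prems(1)]
   Ck_on_Suc_has_derivative[OF S Suc.prems(2)]]]) (auto intro!: Suc.IH Ck_on_Suc_grad Suc.prems)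
qed (auto intro: continuous_on_add)

lemma Ck_on_bilinear:
 assumes bb: "bounded_bilinear prd" and S: "open S"
 shows "Ck_on k f S ==> Ck_on k g S ==> Ck_on k (%x. prd (f x) (g x)) S"
proof (induction k arbitrary: f g)
 case 0
 then show ?case using bounded_bilinear.continuous_on[OF bb] by simp
next
 case (Suc k)
 show ?case
  by (rule Ck_on_Suc_openI[OF S bounded_bilinear.FDERIV[OF bb Ck_on_Suc_has_derivative[OF S Suc.prems(1)]
   Ck_on_Suc_has_derivative[OF S Suc.prems(2)]]])
   (assumption | intro Ck_on_add[OF S] Suc.IH Ck_on_Suc_grad Suc.prems Ck_on_SucD[OF Suc.prems(1)] Ck_on_SucD[OF Suc.prems(2)])+
qed

lemma Ck_on_linear_compose:
 assumes L: "bounded_linear L" and S: "open S"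
 shows "Ck_on k f S ==> Ck_on k (%x. L (f x)) S"
proof (induction k arbitrary: f)
 case 0
 then show ?case using bounded_linear.continuous_on[OF L] by simp
next
 case (Suc k)
 show ?case
  by (rule Ck_on_Suc_openI[OF S bounded_linear.has_derivative[OF L Ck_on_Suc_has_derivative[OF S Suc.prems]]])
   (auto intro!: Suc.IH Ck_on_Suc_grad Suc.prems)
qed

lemma Ck_on_sum:
 assumes S: "open S" and "!!i. i \<in> I ==> Ck_on k (f i) S"
 shows "Ck_on k (%x. \<Sum>i\<in>I. f i x) S"
 using assms(2) by (induction I rule: infinite_finite_induct) (auto intro: Ck_on_const[OF S] Ck_on_add[OF S])

text \<open>A smooth function of one variable is presented as a sequence \<open>G\<close> of
  successive derivatives. The chain rule turns \<open>G m\<close> into \<open>G (Suc m)\<close>, so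
  the induction on \<open>k\<close> has to be general in \<open>m\<close>.\<close>

lemma Ck_on_real_compose:
 fixes G :: "nat => real => real"
 assumes S: "open S" and G: "!!m t. t \<in> T ==> (G m has_real_derivative G (Suc m) t) (at t)"
  and T: "f ` S \<subseteq> T"
 shows "Ck_on k f S ==> Ck_on k (%x. G m (f x)) S"
proof (induction k arbitrary: m)
 case 0
 have "continuous_on T (G m)" by (meson G DERIV_isCont continuous_at_imp_continuous_on)
 then show ?case using 0 T by (auto intro: continuous_on_compose2)
next
 case (Suc k)
 have "((%x. G m (f x)) has_derivative (%h. G (Suc m) (f x) * frechet_derivative f (at x) h)) (at x)"
  if "x \<in> S" for x
  using has_derivative_compose[OF Ck_on_Suc_has_derivative[OF S Suc.prems that]
   G[unfolded has_field_derivative_def, of "f x" m]] that T by auto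
 then show ?case
  by (rule Ck_on_Suc_openI[OF S])
   (auto intro!: Ck_on_bilinear[OF bounded_bilinear_mult S] Suc.IH Ck_on_SucD[OF Suc.prems]
    Ck_on_Suc_grad Suc.prems)
qed

lemma linear_axis_expansion:
 fixes L :: "real^'m => 'b::real_vector"
 assumes "linear L" shows "L v = (\<Sum>i\<in>UNIV. v $ i *\<^sub>R L (axis i 1))"
proof -
 have "L v = L (\<Sum>i\<in>UNIV. v $ i *\<^sub>R axis i 1)"
  using basis_expansion[of v] by (simp add: scalar_mult_eq_scaleR)
 also have "\<dots> = (\<Sum>i\<in>UNIV. v $ i *\<^sub>R L (axis i 1))"
  using assms by (simp add: linear_sum linear_cmul)
 finally show ?thesis .
qed

lemma Ck_on_compose:
 fixes T :: "real^'n => real^'m" and f :: "real^'m => 'b::real_normed_vector"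
 assumes S: "open S" and R: "open R" and TS: "T ` S \<subseteq> R" 
 shows "(!!i. Ck_on k (%x. T x $ i) S) ==> Ck_on k f R ==> Ck_on k (%x. f (T x)) S"
proof (induction k arbitrary: f)
 case 0
 have "continuous_on S (%x. \<chi> i. T x $ i)"
  using 0 by (intro continuous_on_vec_lambda) auto
 then show ?case using 0 TS by (auto intro: continuous_on_compose2)
next
 case (Suc k)
 define DT where "DT x h = (\<chi> i. frechet_derivative (%x. T x $ i) (at x) h)" for x h
 have T: "(T has_derivative DT x) (at x)" if "x \<in> S" for x
  unfolding has_derivative_componentwise_within[of T]
 proof
  fix b :: "real^'m" assume "b \<in> Basis"
  then obtain i where "b = axis i 1" by (auto simp: Basis_vec_def)
  then show "((%x. T x \<bullet> b) has_derivative (%y. DT x y \<bullet> b)) (at x)"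
   using Ck_on_Suc_has_derivative[OF S Suc.prems(1) that, of i] by (simp add: DT_def inner_axis)
 qed
 have der: "((%x. f (T x)) has_derivative (%h. frechet_derivative f (at (T x)) (DT x h))) (at x)"
  if "x \<in> S" for x
  using has_derivative_compose[OF T[OF that] Ck_on_Suc_has_derivative[OF R Suc.prems(2)]] that TS by auto
 have eq: "frechet_derivative f (at (T x)) (DT x (axis j 1)) =
   (\<Sum>i\<in>UNIV. frechet_derivative (%x. T x $ i) (at x) (axis j 1) *\<^sub>R grad f (T x) $ i)"
  if "x \<in> S" for x j
  using linear_axis_expansion[OF has_derivative_linear[OF Ck_on_Suc_has_derivative[OF R Suc.prems(2)]]]
   that TS by (auto simp: DT_def grad_nth)
 have "Ck_on k (%x. frechet_derivative f (at (T x)) (DT x (axis j 1))) S" for j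
 proof (subst Ck_on_cong[OF S eq], assumption, rule Ck_on_sum[OF S], rule Ck_on_bilinear[OF bounded_bilinear_scaleR S])
  fix i
  show "Ck_on k (%x. frechet_derivative (%x. T x $ i) (at x) (axis j 1)) S"
   using Suc.prems(1) Ck_on_Suc_grad by blast
  show "Ck_on k (%x. grad f (T x) $ i) S"
   by (rule Suc.IH) (use Suc.prems in \<open>auto intro: Ck_on_SucD[OF Suc.prems(1)] simp del: Ck_on.simps(2)\<close>, simp)
 qed
 with der show ?case by (rule Ck_on_Suc_openI[OF S])
qed

subsection \<open>Smooth functions\<close>

lemma smooth_on_cong:
 assumes "open S" "smooth_on S f" "!!x. x \<in> S ==> f x = g x"
 shows "smooth_on S g"
 using assms Ck_on_cong[of S f g] by (auto simp: smooth_on_def)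

lemma smooth_on_subset: "smooth_on T f ==> S \<subseteq> T ==> smooth_on S f"
 unfolding smooth_on_def by (blast intro: Ck_on_subset)

text \<open>Used to extend a function by zero: it is smooth near its support and also on the
  complement of the support, and these two open sets cover the space.\<close>

lemma smooth_on_Un:
 assumes "open S" "open T" "smooth_on S f" "smooth_on T f"
 shows "smooth_on (S \<union> T) f"
 using Ck_on_Union[of "{S,T}" _ f] assms by (auto simp: smooth_on_def)

lemma smooth_on_pd: "smooth_on S f ==> smooth_on S (%x. grad f x $ j)"
 unfolding smooth_on_def by (metis Ck_on.simps(2))

lemma smooth_on_continuous: "smooth_on S f ==> continuous_on S f"
 unfolding smooth_on_def by (metis Ck_on.simps(1))

lemma smooth_on_const: "open S ==> smooth_on S (%x. c)"
 by (simp add: smooth_on_def Ck_on_const)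

lemma smooth_on_bounded_linear: "open S ==> bounded_linear f ==> smooth_on S f"
 by (simp add: smooth_on_def Ck_on_bounded_linear)

lemma smooth_on_coord: "open S ==> smooth_on S (%x. x $ i)"
 by (simp add: smooth_on_bounded_linear bounded_linear_vec_nth)

lemma smooth_on_add: "open S ==> smooth_on S f ==> smooth_on S g ==> smooth_on S (%x. f x + g x)"
 by (simp add: smooth_on_def Ck_on_add)

lemma smooth_on_bilinear:
 "bounded_bilinear prd ==> open S ==> smooth_on S f ==> smooth_on S g ==> smooth_on S (%x. prd (f x) (g x))"
 by (simp add: smooth_on_def Ck_on_bilinear)

lemmas smooth_on_mult = smooth_on_bilinear[OF bounded_bilinear_mult]
lemmas smooth_on_scaleR = smooth_on_bilinear[OF bounded_bilinear_scaleR]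

lemma smooth_on_linear_compose:
 "bounded_linear L ==> open S ==> smooth_on S f ==> smooth_on S (%x. L (f x))"
 by (simp add: smooth_on_def Ck_on_linear_compose)

lemmas smooth_on_Re = smooth_on_linear_compose[OF bounded_linear_Re]
lemmas smooth_on_Im = smooth_on_linear_compose[OF bounded_linear_Im]
lemmas smooth_on_cnj = smooth_on_linear_compose[OF bounded_linear_cnj]
lemmas smooth_on_complex_of_real = smooth_on_linear_compose[OF bounded_linear_of_real]

lemma smooth_on_minus: "open S ==> smooth_on S f ==> smooth_on S (%x. - f x)"
 by (rule smooth_on_linear_compose[OF bounded_linear_minus[OF bounded_linear_ident]])

lemma smooth_on_diff: "open S ==> smooth_on S f ==> smooth_on S g ==> smooth_on S (%x. f x - g x)"
 using smooth_on_add[of S f "%x. - g x"] smooth_on_minus[of S g] by simp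

lemma smooth_on_sum: "open S ==> (!!i. i \<in> I ==> smooth_on S (f i)) ==> smooth_on S (%x. \<Sum>i\<in>I. f i x)"
 by (simp add: smooth_on_def Ck_on_sum)

lemma smooth_on_prod:
 fixes f :: "'i => real^'n => real"
 shows "open S ==> (!!i. i \<in> I ==> smooth_on S (f i)) ==> smooth_on S (%x. \<Prod>i\<in>I. f i x)"
 by (induction I rule: infinite_finite_induct) (auto intro: smooth_on_const smooth_on_mult)

lemma smooth_on_power:
 fixes f :: "real^'n => real"
 shows "open S ==> smooth_on S f ==> smooth_on S (%x. f x ^ m)"
 by (induction m) (auto intro: smooth_on_const smooth_on_mult)

lemma smooth_on_real_compose:
 fixes G :: "nat => real => real"
 assumes "open S" "!!m t. t \<in> T ==> (G m has_real_derivative G (Suc m) t) (at t)"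
  "f ` S \<subseteq> T" "smooth_on S f"
 shows "smooth_on S (%x. G m (f x))"
 using assms(4) Ck_on_real_compose[of S T G f, OF assms(1-3)] by (simp add: smooth_on_def)

lemma smooth_on_compose:
 assumes "open S" "open R" "T ` S \<subseteq> R" "!!i. smooth_on S (%x. T x $ i)" "smooth_on R f"
 shows "smooth_on S (%x. f (T x))"
 using assms(4,5) Ck_on_compose[OF assms(1-3)] unfolding smooth_on_def by blast

lemma smooth_on_powr:
 fixes f :: "real^'n => real"
 assumes S: "open S" and pos: "!!x. x \<in> S ==> f x > 0" and f: "smooth_on S f"
 shows "smooth_on S (%x. f x powr s)"
proof -
 define G where "G m t = (\<Prod>i<m. s - real i) * t powr (s - real m)" for m t
 have "(G m has_real_derivative G (Suc m) t) (at t)" if "t \<in> {0<..}" for m t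
  unfolding G_def using that
  by (auto intro!: derivative_eq_intros simp: algebra_simps)
 then have "smooth_on S (%x. G 0 (f x))"
  by (rule smooth_on_real_compose[of S "{0<..}" G, OF S]) (use pos f in auto)
 then show ?thesis by (simp add: G_def)
qed

lemma smooth_on_inverse:
 fixes f :: "real^'n => real"
 assumes S: "open S" and pos: "!!x. x \<in> S ==> f x \<noteq> 0" and f: "smooth_on S f"
 shows "smooth_on S (%x. inverse (f x))"
proof -
 \<comment> \<open>\<open>powr\<close> wants a positive base, while \<open>f\<close> may have either
   sign; hence the detour through the square.\<close>
 have "smooth_on S (%x. f x * ((f x * f x) powr (- 1)))"
  using pos by (intro smooth_on_mult smooth_on_powr S f) (metis not_real_square_gt_zero)
 then show ?thesis
  by (rule smooth_on_cong[OF S]) (use pos in \<open>auto simp: powr_minus field_simps\<close>)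
qed

lemma smooth_on_divide:
 fixes f :: "real^'n => real"
 assumes S: "open S" and pos: "!!x. x \<in> S ==> g x \<noteq> 0" and f: "smooth_on S f" "smooth_on S g"
 shows "smooth_on S (%x. f x / g x)"
 using smooth_on_mult[OF S f(1) smooth_on_inverse[OF S pos f(2)]] by (simp add: divide_inverse)

lemma smooth_on_sin:
 fixes f :: "real^'n => real"
 assumes S: "open S" and f: "smooth_on S f"
 shows "smooth_on S (%x. sin (f x))"
proof -
 \<comment> \<open>Differentiation shifts the phase by a quarter period, so one formula covers all
   derivatives.\<close>
 define G where "G m t = sin (t + real m * (pi / 2))" for m t
 have "(G m has_real_derivative G (Suc m) t) (at t)" if "t \<in> UNIV" for m t
 proof -
  have "G (Suc m) t = cos (t + real m * (pi / 2))"
   using sin_add[of "t + real m * (pi / 2)" "pi / 2"]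
   by (simp add: G_def algebra_simps add_divide_distrib)
  then show ?thesis unfolding G_def by (auto intro!: derivative_eq_intros)
 qed
 then have "smooth_on S (%x. G 0 (f x))"
  by (rule smooth_on_real_compose[of S UNIV G, OF S]) (use f in auto)
 then show ?thesis by (simp add: G_def)
qed

lemma smooth_on_has_derivative:
 assumes "open S" "smooth_on S f" "x \<in> S"
 shows "(f has_derivative frechet_derivative f (at x)) (at x)"
 using assms Ck_on_Suc_has_derivative[OF assms(1), of 0] by (auto simp only: smooth_on_def)

lemma smooth_on_frechet_expansion:
 assumes "open S" "smooth_on S f" "x \<in> S"
 shows "frechet_derivative f (at x) h = (\<Sum>i\<in>UNIV. h $ i *\<^sub>R grad f x $ i)"
 unfolding grad_nth
 by (rule linear_axis_expansion[OF has_derivative_linear[OF smooth_on_has_derivative[OF assms]]])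

subsection \<open>A smooth step function\<close>

text \<open>Functions of the form polynomial in 1/t times exp(-1/t), continued by 0. Carrying the
  polynomial as a parameter makes the family closed under differentiation, as
  \<open>smooth_on_real_compose\<close> requires.\<close>

definition flat_family :: "real poly => real => real" where
 "flat_family p t = (if t > 0 then poly p (1 / t) * exp (- 1 / t) else 0)"

lemma poly_exp_tendsto_0: "((%s::real. poly p s * exp (- s)) \<longlongrightarrow> 0) at_top"
proof -
 have "((%s::real. \<Sum>i\<le>degree p. coeff p i * (s ^ i / exp s)) \<longlongrightarrow> (\<Sum>i\<le>degree p. coeff p i * 0)) at_top"
  by (intro tendsto_sum tendsto_mult tendsto_const tendsto_power_div_exp_0)
 then show ?thesis by (simp add: poly_altdef sum_distrib_right sum_divide_distrib exp_minus field_simps)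
qed

text \<open>For t > 0 the product rule sends p(1/t) exp(-1/t) to (1/t)^2 (p - p')(1/t) exp(-1/t).
  The only delicate point is t = 0, where the exponential beats every power of 1/t.\<close>

lemma flat_family_deriv:
 "(flat_family p has_real_derivative flat_family ([:0,0,1:] * (p - pderiv p)) t) (at t)"
proof -
 consider "t > 0" | "t < 0" | "t = 0" by linarith
 then show ?thesis
 proof cases
  case 1
  have "((%t. poly p (1 / t) * exp (- 1 / t)) has_real_derivative
    flat_family ([:0,0,1:] * (p - pderiv p)) t) (at t)"
   using 1 by (auto intro!: derivative_eq_intros poly_DERIV[THEN DERIV_chain2]
     simp: flat_family_def field_simps power2_eq_square)
  then show ?thesis
   by (rule has_field_derivative_transform_within_open[of _ _ _ "{0<..}"]) (use 1 in \<open>auto simp: flat_family_def\<close>)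
 next
  case 2
  have "((%t. 0) has_real_derivative 0) (at t)" by simp
  then have "(flat_family p has_real_derivative 0) (at t)"
   by (rule has_field_derivative_transform_within_open[of _ _ _ "{..<0}"]) (use 2 in \<open>auto simp: flat_family_def\<close>)
  then show ?thesis using 2 by (simp add: flat_family_def)
 next
  case 3
  \<comment> \<open>From the right, the difference quotient at 0 is p(1/h) exp(-1/h) / h, which is
    of the same type with the polynomial X p.\<close>
  have "((%h. poly ([:0,1:] * p) (inverse h) * exp (- inverse h)) \<longlongrightarrow> 0) (at_right 0)"
   using filterlim_compose[OF poly_exp_tendsto_0 filterlim_inverse_at_top_right] .
  then have "((%h. flat_family p h / h) \<longlongrightarrow> 0) (at_right 0)"
   by (rule Lim_transform_eventually)
    (auto simp: eventually_at_filter flat_family_def field_simps)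
  moreover have "((%h. flat_family p h / h) \<longlongrightarrow> 0) (at_left 0)"
   by (rule Lim_transform_eventually[OF tendsto_const])
    (auto simp: eventually_at_filter flat_family_def)
  ultimately have "((%h. flat_family p h / h) \<longlongrightarrow> 0) (at 0)"
   by (simp add: filterlim_split_at)
  then show ?thesis using 3 by (simp add: has_field_derivative_iff flat_family_def)
 qed
qed

text \<open>The usual smooth transition from 0 to 1 over the unit interval. The denominator is
  positive because t and 1 - t are never both nonpositive.\<close>

definition smooth_step :: "real => real" where
 "smooth_step t = flat_family 1 t / (flat_family 1 t + flat_family 1 (1 - t))"

lemma flat_family_1_pos: "t > 0 ==> flat_family 1 t > 0"
 and flat_family_1_zero: "t <= 0 ==> flat_family p t = 0"
 by (auto simp: flat_family_def)

lemma flat_family_1_nonneg: "flat_family 1 t >= 0"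
 by (auto simp: flat_family_def)

lemma step_denominator_pos: "flat_family 1 t + flat_family 1 (1 - t) > 0"
 using flat_family_1_pos[of t] flat_family_1_pos[of "1 - t"] flat_family_1_nonneg[of t]
  flat_family_1_nonneg[of "1-t"] by (cases "t > 0") (auto intro: add_pos_nonneg add_nonneg_pos)

lemma smooth_step_range: "0 <= smooth_step t" "smooth_step t <= 1"
 using step_denominator_pos[of t] flat_family_1_nonneg[of "1-t"] flat_family_1_nonneg[of t]
 by (auto simp: smooth_step_def divide_simps)

lemma smooth_step_0: "t <= 0 ==> smooth_step t = 0"
 by (simp add: smooth_step_def flat_family_def)

lemma smooth_step_1: "t >= 1 ==> smooth_step t = 1"
 using step_denominator_pos[of t] by (simp add: smooth_step_def flat_family_1_zero)

lemma smooth_on_flat: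
 fixes f :: "real^'n => real"
 assumes S: "open S" and f: "smooth_on S f"
 shows "smooth_on S (%x. flat_family q (f x))"
proof -
 define P where "P m = ((%p. [:0,0,1:] * (p - pderiv p)) ^^ m) q" for m
 have "(flat_family (P m) has_real_derivative flat_family (P (Suc m)) t) (at t)" if "t \<in> UNIV" for m t
  unfolding P_def using flat_family_deriv by simp
 then have "smooth_on S (%x. flat_family (P 0) (f x))"
  by (rule smooth_on_real_compose[of S UNIV "%m. flat_family (P m)", OF S]) (use f in auto)
 then show ?thesis by (simp add: P_def)
qed

lemma smooth_on_step:
 fixes f :: "real^'n => real"
 assumes S: "open S" and f: "smooth_on S f"
 shows "smooth_on S (%x. smooth_step (f x))"
proof -
 have "flat_family 1 t + flat_family 1 (1 - t) \<noteq> 0" for t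
  using step_denominator_pos[of t] by linarith
 moreover have "smooth_on S (%x. flat_family 1 (1 - f x))"
  by (rule smooth_on_flat[OF S smooth_on_diff[OF S smooth_on_const[OF S] f]])
 ultimately show ?thesis
  unfolding smooth_step_def
  by (intro smooth_on_divide[OF S] smooth_on_add[OF S] smooth_on_flat[OF S f])
qed

lemma smooth_step_deriv_ex:
 "\<exists>M\<ge>1. \<exists>S'. \<forall>t. (smooth_step has_real_derivative S' t) (at t) \<and> \<bar>S' t\<bar> <= M"
proof -
 let ?e = "flat_family 1" and ?e' = "flat_family ([:0,0,1:] * (1 - pderiv 1))"
 define S' where "S' t = (?e' t * (?e t + ?e (1 - t)) - ?e t * (?e' t - ?e' (1 - t))) / (?e t + ?e (1 - t))^2" for t
 have der: "(smooth_step has_real_derivative S' t) (at t)" for t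
  unfolding smooth_step_def[abs_def] S'_def
  using step_denominator_pos[of t]
  by (auto intro!: derivative_eq_intros flat_family_deriv flat_family_deriv[THEN DERIV_chain2]
    simp: power2_eq_square)
 have cont: "continuous_on A (flat_family p)" for A p
  by (meson flat_family_deriv DERIV_isCont continuous_at_imp_continuous_on)
 have "continuous_on {0..1} S'"
  unfolding S'_def using step_denominator_pos
  by (intro continuous_intros continuous_on_compose2[OF cont]) (auto simp: less_le)
 then have "bounded (S' ` {0..1})"
  by (intro compact_imp_bounded compact_continuous_image) auto
 then obtain M where M: "!!t. t \<in> {0..1} ==> \<bar>S' t\<bar> <= M"
  by (auto simp: bounded_iff) (metis atLeastAtMost_iff)
 have "\<bar>S' t\<bar> <= max 1 M" for t
 proof (cases "t \<in> {0..1}")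
  case False
  then have "S' t = 0" by (auto simp: S'_def flat_family_1_zero power2_eq_square)
  then show ?thesis by simp
 qed (use M in force)
 with der show ?thesis by (intro exI[of _ "max 1 M"]) auto
qed

text \<open>One slope fixed once for all, so that the constants built from it depend on the
  dimension and \<gamma> alone. The bound from below by 1 keeps it positive in products.\<close>

definition step_slope :: real where
 "step_slope = (SOME M. M >= 1 \<and> (\<exists>S'. \<forall>t. (smooth_step has_real_derivative S' t) (at t) \<and> \<bar>S' t\<bar> <= M))"

lemma step_slope: "step_slope >= 1"
  "\<exists>S'. \<forall>t. (smooth_step has_real_derivative S' t) (at t) \<and> \<bar>S' t\<bar> <= step_slope"
 using someI_ex[OF smooth_step_deriv_ex] unfolding step_slope_def by auto

lemma smooth_step_deriv:
 "(smooth_step has_real_derivative deriv smooth_step t) (at t)" "\<bar>deriv smooth_step t\<bar> <= step_slope"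
proof -
 obtain S' where S': "!!t. (smooth_step has_real_derivative S' t) (at t)" "!!t. \<bar>S' t\<bar> <= step_slope"
  using step_slope(2) by blast
 then show "(smooth_step has_real_derivative deriv smooth_step t) (at t)" "\<bar>deriv smooth_step t\<bar> <= step_slope"
  using DERIV_imp_deriv[OF S'(1)] by simp_all
qed

lemma deriv_smooth_step_zero: "t < 0 \<or> t > 1 ==> deriv smooth_step t = 0"
proof -
 assume t: "t < 0 \<or> t > 1"
 have "((%t. if t < 0 then 0 else 1) has_real_derivative 0) (at t)"
  by (rule has_field_derivative_transform_within_open[of "%_. if t < 0 then 0 else 1" _ _ "if t < 0 then {..<0} else {1<..}"])
   (use t in \<open>auto split: if_splits\<close>)
 then have "(smooth_step has_real_derivative 0) (at t)"
  by (rule has_field_derivative_transform_within_open[of _ _ _ "if t < 0 then {..<0} else {1<..}"])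
   (use t in \<open>auto simp: smooth_step_0 smooth_step_1 split: if_splits\<close>)
 then show ?thesis by (rule DERIV_imp_deriv)
qed

lemma grad_real_compose:
 fixes f :: "real^'n => real"
 assumes "f differentiable (at x)" "(g has_real_derivative g') (at (f x))"
 shows "grad (%x. g (f x)) x $ j = g' * grad f x $ j"
 using grad_eqI[OF has_derivative_compose[OF assms(1)[unfolded frechet_derivative_works]
  assms(2)[unfolded has_field_derivative_def]]] by (simp add: grad_nth)

lemma smooth_on_differentiable: "open S ==> smooth_on S f ==> x \<in> S ==> f differentiable (at x)"
 using smooth_on_has_derivative differentiable_def by blast

lemma grad_add:
 assumes "f differentiable (at x)" "g differentiable (at x)"
 shows "grad (%x. f x + g x) x = grad f x + grad g x"
 using grad_eqI[OF has_derivative_add[OF assms[unfolded frechet_derivative_works]]]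
 by (simp add: vec_eq_iff grad_nth)

lemma grad_diff:
 assumes "f differentiable (at x)" "g differentiable (at x)"
 shows "grad (%x. f x - g x) x = grad f x - grad g x"
 using grad_eqI[OF has_derivative_diff[OF assms[unfolded frechet_derivative_works]]]
 by (simp add: vec_eq_iff grad_nth)

lemma grad_bilinear:
 assumes "bounded_bilinear prd" "f differentiable (at x)" "g differentiable (at x)"
 shows "grad (%x. prd (f x) (g x)) x $ j = prd (f x) (grad g x $ j) + prd (grad f x $ j) (g x)"
 using grad_eqI[OF bounded_bilinear.FDERIV[OF assms(1) assms(2,3)[unfolded frechet_derivative_works]]]
 by (simp add: grad_nth)

lemmas grad_mult = grad_bilinear[OF bounded_bilinear_mult]

lemma grad_linear_compose:
 assumes "bounded_linear L" "f differentiable (at x)"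
 shows "grad (%x. L (f x)) x $ j = L (grad f x $ j)"
 using grad_eqI[OF bounded_linear.has_derivative[OF assms(1) assms(2)[unfolded frechet_derivative_works]]]
 by (simp add: grad_nth)

lemma grad_const: "grad (%x. c) x = 0"
 by (simp add: vec_eq_iff grad_eqI[OF has_derivative_const])

lemma grad_coord: "grad (%x. x $ i) x $ j = (if i = j then 1 else 0)"
 by (subst grad_eqI[OF bounded_linear_imp_has_derivative[OF bounded_linear_vec_nth]]) (simp add: axis_def)

subsection \<open>Test functions and cutoffs\<close>

lemma test_functionsI:
 assumes "smooth_on UNIV u" "compact K" "K \<subseteq> G" "!!x. x \<notin> K ==> u x = 0"
 shows "u \<in> test_functions G"
proof -
 have "closure {x. u x \<noteq> 0} \<subseteq> K"
  using assms by (intro closure_minimal compact_imp_closed) auto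
 then show ?thesis
  using assms bounded_subset[of K "closure {x. u x \<noteq> 0}"]
  by (auto simp: test_functions_def compact_eq_bounded_closed)
qed

lemma test_functionsD:
 assumes "u \<in> test_functions G"
 obtains K where "smooth_on UNIV u" "compact K" "K \<subseteq> G" "!!x. x \<notin> K ==> u x = 0"
  "!!x. x \<notin> K ==> grad u x = 0"
proof -
 define K where "K = closure {x. u x \<noteq> 0}"
 have K: "smooth_on UNIV u" "compact K" "K \<subseteq> G" "open (- K)"
  using assms by (auto simp: test_functions_def K_def open_Compl)
 have 0: "u x = 0" if "x \<notin> K" for x
  using that closure_subset[of "{x. u x \<noteq> 0}"] unfolding K_def by auto
 have "grad u x = 0" if "x \<notin> K" for x
 proof -
  have "grad u x = grad (%x. 0) x"
   by (rule grad_cong_open[OF K(4)]) (use that 0 in auto)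
  then show ?thesis by (simp only: grad_const)
 qed
 with K 0 that show ?thesis by blast
qed

lemma test_functions_mono: "G \<subseteq> H ==> test_functions G \<subseteq> test_functions H"
 by (auto simp: test_functions_def)

lemma test_functions_smooth: "u \<in> test_functions G ==> smooth_on UNIV u"
 by (simp add: test_functions_def)

lemma mem_cube: "x \<in> cube p d \<longleftrightarrow> (\<forall>i. \<bar>x $ i - p $ i\<bar> <= d / 2)"
 unfolding cube_def mem_box_cart vector_minus_component vector_add_component vec_lambda_beta
 by (intro iff_allI) linarith

lemma mem_interior_cube: "x \<in> interior (cube p d) \<longleftrightarrow> (\<forall>i. \<bar>x $ i - p $ i\<bar> < d / 2)"
 unfolding cube_def interior_cbox mem_box_cart vector_minus_component vector_add_component vec_lambda_beta
 by (intro iff_allI) linarith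

lemma compact_cube: "compact (cube p d)"
 by (simp add: cube_def)

text \<open>A product of one-variable steps adapted to cubes: 1 up to half-width \<open>a\<close>, 0
  from half-width \<open>b\<close> on. Squares replace absolute values to keep it smooth at the
  centre.\<close>

definition cutoff :: "real^'n => real => real => real^'n => real" where
 "cutoff p a b x = (\<Prod>i\<in>UNIV. smooth_step ((b^2 - (x $ i - p $ i)^2) / (b^2 - a^2)))"

context
 fixes p :: "real^'n" and a b :: real
 assumes ab: "0 < a" "a < b"
begin

lemma smooth_on_cutoff: "smooth_on UNIV (cutoff p a b)"
proof -
 have "smooth_on UNIV (%x::real^'n. smooth_step (b^2 * inverse (b^2 - a^2) - (x $ i - p $ i)^2 * inverse (b^2 - a^2)))" for i
  by (intro smooth_on_step smooth_on_diff smooth_on_mult smooth_on_power smooth_on_const smooth_on_coord open_UNIV)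
 then have "smooth_on UNIV (%x::real^'n. smooth_step ((b^2 - (x $ i - p $ i)^2) / (b^2 - a^2)))" for i
  by (simp add: divide_inverse left_diff_distrib)
 then show ?thesis unfolding cutoff_def[abs_def] by (intro smooth_on_prod) auto
qed

lemma cutoff_range: "0 <= cutoff p a b x" "cutoff p a b x <= 1"
 unfolding cutoff_def by (auto intro!: prod_nonneg prod_le_1 simp: smooth_step_range)

lemma square_diff_pos: "b^2 - a^2 > 0"
 using ab by (simp add: power_strict_mono)

lemma cutoff_eq_1: "(!!i. \<bar>x $ i - p $ i\<bar> <= a) ==> cutoff p a b x = 1"
proof -
 assume x: "\<bar>x $ i - p $ i\<bar> <= a" for i
 have "1 <= (b^2 - (x $ i - p $ i)^2) / (b^2 - a^2)" for i
  using abs_le_square_iff[of "x $ i - p $ i" a] x[of i] ab square_diff_pos by (simp add: le_divide_eq)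
 then show ?thesis unfolding cutoff_def by (simp add: smooth_step_1)
qed

lemma cutoff_eq_0: "\<bar>x $ i - p $ i\<bar> >= b ==> cutoff p a b x = 0"
proof -
 assume x: "\<bar>x $ i - p $ i\<bar> >= b"
 have "(b^2 - (x $ i - p $ i)^2) / (b^2 - a^2) <= 0"
  using abs_le_square_iff[of b "x $ i - p $ i"] x ab square_diff_pos by (intro divide_nonpos_pos) auto
 then show ?thesis unfolding cutoff_def by (intro prod_zero bexI[of _ i]) (auto simp: smooth_step_0)
qed

lemma cutoff_eq_0_cube: "x \<notin> cube p (2 * b) ==> cutoff p a b x = 0"
 using cutoff_eq_0[OF less_imp_le] by (auto simp: mem_cube not_le)

lemma cutoff_test: "2 * b < r ==> cutoff p a b \<in> test_functions (interior (cube p r))"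
 by (rule test_functionsI[OF smooth_on_cutoff compact_cube[of p "2 * b"]])
  (auto simp: mem_interior_cube intro: cutoff_eq_0_cube, smt (verit, best) mem_cube field_sum_of_halves)

text \<open>Along the j-th axis only one factor of the product varies, and the remaining ones lie
  between 0 and 1. The partial derivative is therefore at most that of a single step, estimated
  where the step is not constant.\<close>

lemma grad_cutoff_nth: "\<bar>grad (cutoff p a b) x $ j\<bar> <= 2 * step_slope / (b - a)"
proof -
 define R where "R x = (\<Prod>i\<in>UNIV - {j}. smooth_step ((b^2 - (x $ i - p $ i)^2) / (b^2 - a^2)))" for x
 define s where "s t = smooth_step ((b^2 - (t - p $ j)^2) / (b^2 - a^2))" for t
 define L where "L = deriv smooth_step ((b\<^sup>2 - (x $ j - p $ j)\<^sup>2) / (b\<^sup>2 - a\<^sup>2)) * (- (2 * (x $ j - p $ j)) / (b\<^sup>2 - a\<^sup>2))"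
 have R: "0 <= R x" "R x <= 1"
  unfolding R_def by (auto intro!: prod_nonneg prod_le_1 simp: smooth_step_range)
 have split: "cutoff p a b y = R y * s (y $ j)" for y
  unfolding cutoff_def R_def s_def by (subst prod.remove[of _ j]) auto
 have "(s has_real_derivative L) (at (x $ j))"
  unfolding s_def L_def
 proof (rule DERIV_chain2[OF smooth_step_deriv(1)])
  show "((%t. (b^2 - (t - p $ j)^2) / (b^2 - a^2)) has_real_derivative
    - (2 * (x $ j - p $ j)) / (b^2 - a^2)) (at (x $ j))"
   using square_diff_pos by (intro derivative_eq_intros) auto
 qed
 have line: "((%t. x + t *\<^sub>R axis j 1) has_derivative (%t. t *\<^sub>R axis j 1)) (at 0)"
  by (rule has_derivative_eq_rhs, (rule derivative_intros)+, simp)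
 have "((%t. cutoff p a b (x + t *\<^sub>R axis j 1)) has_derivative
   (%t. frechet_derivative (cutoff p a b) (at x) (t *\<^sub>R axis j 1))) (at 0)"
  using has_derivative_compose[OF line, of "cutoff p a b" "frechet_derivative (cutoff p a b) (at x)"]
   smooth_on_has_derivative[OF open_UNIV smooth_on_cutoff, of x] by simp
 moreover have "(%t. frechet_derivative (cutoff p a b) (at x) (t *\<^sub>R axis j 1)) = (*) (grad (cutoff p a b) x $ j)"
  using linear_cmul[OF has_derivative_linear[OF smooth_on_has_derivative[OF open_UNIV smooth_on_cutoff, of x]]]
  by (auto simp: grad_nth)
 ultimately have 1: "((%t. cutoff p a b (x + t *\<^sub>R axis j 1)) has_real_derivative grad (cutoff p a b) x $ j) (at 0)"
  by (simp add: has_field_derivative_def)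
 have "R (x + t *\<^sub>R axis j 1) = R x" for t
  unfolding R_def by (rule prod.cong) (auto simp: axis_def)
 then have "(%t. cutoff p a b (x + t *\<^sub>R axis j 1)) = (%t. R x * s (x $ j + t))"
  by (simp add: split)
 moreover have "((%t. R x * s (x $ j + t)) has_real_derivative R x * L) (at 0)"
  using DERIV_chain2[of s L "%t. x $ j + t" 0 1 UNIV] \<open>(s has_real_derivative L) (at (x $ j))\<close>
   DERIV_add[OF DERIV_const DERIV_ident, of "x $ j" 0 UNIV]
  by (intro DERIV_cmult) simp
 ultimately have eq: "grad (cutoff p a b) x $ j = R x * L"
  using 1 DERIV_unique by metis
 have "\<bar>L\<bar> <= step_slope * (2 * b / (b^2 - a^2))"
 proof (cases "\<bar>x $ j - p $ j\<bar> <= b")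
  case True
  have "\<bar>- (2 * (x $ j - p $ j)) / (b\<^sup>2 - a\<^sup>2)\<bar> <= 2 * b / (b\<^sup>2 - a\<^sup>2)"
   using True square_diff_pos by (auto simp: abs_mult abs_divide intro!: divide_right_mono)
  then show ?thesis unfolding L_def abs_mult using smooth_step_deriv(2) step_slope(1)
   by (intro mult_mono) auto
 next
  case False
  then have "b^2 < (x $ j - p $ j)^2"
   using ab abs_le_square_iff[of "x $ j - p $ j" b] by linarith
  then have "deriv smooth_step ((b^2 - (x $ j - p $ j)^2) / (b^2 - a^2)) = 0"
   using square_diff_pos by (intro deriv_smooth_step_zero) (auto simp: divide_neg_pos)
  then show ?thesis using ab square_diff_pos step_slope(1) by (simp add: L_def)
 qed
 also have "2 * b / (b^2 - a^2) <= 2 / (b - a)"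
 proof -
  have "2 * b / (b^2 - a^2) = 2 / (b - a) * (b / (b + a))"
   using ab square_diff_pos by (simp add: power2_eq_square field_simps)
  also have "\<dots> <= 2 / (b - a) * 1" using ab by (intro mult_left_mono) auto
  finally show ?thesis by simp
 qed
 finally have L: "\<bar>L\<bar> <= 2 * step_slope / (b - a)" using step_slope(1) by (simp add: mult_left_mono mult.commute)
 have "\<bar>grad (cutoff p a b) x $ j\<bar> <= 1 * \<bar>L\<bar>"
  unfolding eq abs_mult using R by (intro mult_right_mono) auto
 with L show ?thesis by simp
qed

lemma norm_grad_cutoff: "norm (grad (cutoff p a b) x) <= 2 * real CARD('n) * step_slope / (b - a)"
proof -
 have "norm (grad (cutoff p a b) x) <= (\<Sum>j\<in>UNIV. \<bar>grad (cutoff p a b) x $ j\<bar>)"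
  by (rule norm_le_l1_cart)
 also have "\<dots> <= (\<Sum>j\<in>(UNIV::'n set). 2 * step_slope / (b - a))"
  by (intro sum_mono grad_cutoff_nth)
 finally show ?thesis by (simp add: mult.commute mult.left_commute)
qed

end

section \<open>Integration of smooth functions with compact support\<close>

lemma integrable_compact_support:
 fixes f :: "real^'n => 'b::{banach, second_countable_topology}"
 assumes "continuous_on UNIV f" "compact K" "!!x. x \<notin> K ==> f x = 0"
 shows "integrable lborel f" "integrable lebesgue f"
proof -
 have "(%x. indicator K x *\<^sub>R f x) = f"
  using assms(3) by (auto simp: indicator_def)
 then show 1: "integrable lborel f"
  using borel_integrable_compact[OF assms(2) continuous_on_subset[OF assms(1)]] by simp
 then show "integrable lebesgue f"
  by (simp add: integrable_completion borel_measurable_integrable)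
qed

lemma smooth_borel: "smooth_on UNIV f ==> f \<in> borel_measurable borel"
 by (simp add: borel_measurable_continuous_onI smooth_on_continuous)

lemma smooth_line_derivative:
 assumes "open S" "smooth_on S f" "x + t *\<^sub>R v \<in> S"
 shows "((%t. f (x + t *\<^sub>R v)) has_vector_derivative frechet_derivative f (at (x + t *\<^sub>R v)) v) (at t)"
proof -
 let ?D = "frechet_derivative f (at (x + t *\<^sub>R v))"
 have D: "(f has_derivative ?D) (at (x + t *\<^sub>R v))"
  by (rule smooth_on_has_derivative[OF assms])
 have line: "((%t. x + t *\<^sub>R v) has_derivative (%t. t *\<^sub>R v)) (at t)"
  by (rule has_derivative_eq_rhs, (rule derivative_intros)+, simp)
 show ?thesis
  using has_derivative_compose[OF line D] linear_cmul[OF has_derivative_linear[OF D]]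
  by (simp add: has_vector_derivative_def)
qed

lemma vector_derivative_bound:
 fixes f :: "real => 'b::real_normed_vector"
 assumes "!!s. s \<in> closed_segment a b ==> (f has_vector_derivative f' s) (at s)"
  and "!!s. s \<in> closed_segment a b ==> norm (f' s) <= B"
 shows "norm (f b - f a) <= B * \<bar>b - a\<bar>"
proof -
 have "norm (f b - f a) <= B * norm (b - a)"
 proof (rule differentiable_bound[of "closed_segment a b"])
  show "(f has_derivative (%h. h *\<^sub>R f' s)) (at s within closed_segment a b)" if "s \<in> closed_segment a b" for s
   using assms(1)[OF that] by (simp add: has_vector_derivative_def has_derivative_at_withinI)
  show "onorm (%h. h *\<^sub>R f' s) <= B" if "s \<in> closed_segment a b" for s
  proof (rule onorm_le)
   fix h :: real
   show "norm (h *\<^sub>R f' s) <= B * norm h"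
    using mult_left_mono[OF assms(2)[OF that] abs_ge_zero[of h]] by (simp add: mult.commute)
  qed
 qed auto
 then show ?thesis by simp
qed

text \<open>Translation invariance of Lebesgue measure gives every difference quotient the integral
  0, and dominated convergence passes to the derivative.\<close>

lemma integral_pd_zero:
 fixes f :: "real^'n => 'b::euclidean_space"
 assumes f: "smooth_on UNIV f" and K: "compact K" and 0: "!!x. x \<notin> K ==> f x = 0"
 shows "(\<integral>x. grad f x $ j \<partial>lborel) = 0"
proof -
 define e :: "real^'n" where "e = axis j 1"
 define h where "h k = 1 / real (Suc k)" for k
 obtain R where "\<forall>x\<in>K. norm x <= R"
  using compact_imp_bounded[OF K] unfolding bounded_iff by blast
 then have R: "K \<subseteq> cball 0 R" by auto
 have g0: "grad f x = 0" if "x \<notin> cball 0 R" for x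
 proof -
  have "grad f x = grad (%x. 0) x"
  proof (rule grad_cong_open[of "- cball 0 R"])
   show "f y = 0" if "y \<in> - cball 0 R" for y using 0[of y] R that by blast
  qed (use that in auto)
  then show ?thesis by (simp only: grad_const)
 qed
 have gc: "continuous_on UNIV (%x. grad f x $ j)"
  using smooth_on_continuous[OF smooth_on_pd[OF f]] .
 have "compact ((%x. grad f x $ j) ` cball 0 R)"
  by (intro compact_continuous_image continuous_on_subset[OF gc]) auto
 from compact_imp_bounded[OF this] obtain B where "\<forall>y\<in>(%x. grad f x $ j) ` cball 0 R. norm y <= B"
  unfolding bounded_iff by blast
 then have B: "norm (grad f x $ j) <= B" if "x \<in> cball 0 R" for x using that by blast
 have B': "norm (grad f x $ j) <= max 0 B" for x
  using B[of x] g0[of x] by (cases "x \<in> cball 0 R") auto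
 have fi: "integrable lborel f"
  using integrable_compact_support[OF smooth_on_continuous[OF f] K 0] by blast
 have fm: "f \<in> borel_measurable borel" by (rule smooth_borel[OF f])
 have h: "0 < h k" "h k <= 1" for k by (auto simp: h_def)
 have trans: "integrable lborel (%x. f (x + c))" "(\<integral>x. f (x + c) \<partial>lborel) = (\<integral>x. f x \<partial>lborel)" for c
 proof -
  have "integrable (distr lborel borel ((+) c)) f"
   unfolding lborel_distr_plus by (rule fi)
  then have "integrable lborel (%x. f (c + x))"
   by (subst (asm) integrable_distr_eq) (use fm in auto)
  then show "integrable lborel (%x. f (x + c))" by (simp add: add.commute)
  have "(\<integral>x. f x \<partial>lborel) = (\<integral>x. f x \<partial>distr lborel borel ((+) c))"
   unfolding lborel_distr_plus ..
  also have "\<dots> = (\<integral>x. f (c + x) \<partial>lborel)"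
   by (rule integral_distr) (use fm in auto)
  finally show "(\<integral>x. f (x + c) \<partial>lborel) = (\<integral>x. f x \<partial>lborel)" by (simp add: add.commute)
 qed
 have "(%k. \<integral>x. (f (x + h k *\<^sub>R e) - f x) /\<^sub>R h k \<partial>lborel) \<longlonglongrightarrow> (\<integral>x. grad f x $ j \<partial>lborel)"
 proof (rule integral_dominated_convergence)
  show "(%x. grad f x $ j) \<in> borel_measurable lborel"
   using borel_measurable_continuous_onI[OF gc] by simp
  show "(%x. (f (x + h k *\<^sub>R e) - f x) /\<^sub>R h k) \<in> borel_measurable lborel" for k
   using fm by measurable
  \<comment> \<open>The increments \<open>h k\<close> are at most 1, so the difference quotients all
    vanish outside the ball enlarged by 1.\<close>
  show "integrable lborel (%x::real^'n. indicator (cball 0 (R + 1)) x *\<^sub>R max 0 B)"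
   by (intro borel_integrable_compact) auto
  show "AE x in lborel. (%k. (f (x + h k *\<^sub>R e) - f x) /\<^sub>R h k) \<longlonglongrightarrow> grad f x $ j"
  proof (rule AE_I2)
   fix x
   have "((%t. f (x + t *\<^sub>R e)) has_vector_derivative grad f x $ j) (at 0)"
    using smooth_line_derivative[OF open_UNIV f, of x 0 e] by (simp add: grad_nth e_def)
   then have "((%t. norm (f (x + t *\<^sub>R e) - f x - t *\<^sub>R grad f x $ j) / norm t) \<longlongrightarrow> 0) (at 0)"
    by (simp add: has_vector_derivative_def has_derivative_at)
   moreover have "norm (f (x + t *\<^sub>R e) - f x - t *\<^sub>R grad f x $ j) / norm t =
     norm ((f (x + t *\<^sub>R e) - f x) /\<^sub>R t - grad f x $ j)" if "t \<noteq> 0" for t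
   proof -
    have "f (x + t *\<^sub>R e) - f x - t *\<^sub>R grad f x $ j = t *\<^sub>R ((f (x + t *\<^sub>R e) - f x) /\<^sub>R t - grad f x $ j)"
     using that by (simp add: scaleR_diff_right)
    then show ?thesis using that by (simp only: norm_scaleR) simp
   qed
   ultimately have "((%t. norm ((f (x + t *\<^sub>R e) - f x) /\<^sub>R t - grad f x $ j)) \<longlongrightarrow> 0) (at 0)"
    by (elim Lim_transform_eventually) (simp add: eventually_at_filter)
   then have "((%t. (f (x + t *\<^sub>R e) - f x) /\<^sub>R t - grad f x $ j) \<longlongrightarrow> 0) (at 0)"
    by (rule tendsto_norm_zero_cancel)
   then have lim: "((%t. (f (x + t *\<^sub>R e) - f x) /\<^sub>R t) \<longlongrightarrow> grad f x $ j) (at 0)"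
    by (rule LIM_zero_cancel)
   have "h \<longlonglongrightarrow> 0"
    unfolding h_def using LIMSEQ_Suc[OF lim_1_over_n[where 'a=real]] by simp
   moreover have "h k \<noteq> 0" for k using h(1)[of k] by linarith
   ultimately have "filterlim h (at 0) sequentially" by (simp add: filterlim_at)
   from filterlim_compose[OF lim this]
   show "(%k. (f (x + h k *\<^sub>R e) - f x) /\<^sub>R h k) \<longlonglongrightarrow> grad f x $ j" .
  qed
  show "AE x in lborel. norm ((f (x + h k *\<^sub>R e) - f x) /\<^sub>R h k) <= indicator (cball 0 (R + 1)) x *\<^sub>R max 0 B" for k
  proof (rule AE_I2)
   fix x
   have ne: "norm e = 1" by (simp add: e_def)
   show "norm ((f (x + h k *\<^sub>R e) - f x) /\<^sub>R h k) <= indicator (cball 0 (R + 1)) x *\<^sub>R max 0 B"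
   proof (cases "x \<in> cball 0 (R + 1)")
    case True
    have "norm (f (x + h k *\<^sub>R e) - f (x + 0 *\<^sub>R e)) <= max 0 B * \<bar>h k - 0\<bar>"
     by (rule vector_derivative_bound[OF smooth_line_derivative[OF open_UNIV f UNIV_I]])
      (use B' in \<open>simp add: grad_nth e_def\<close>)
    then show ?thesis using True h[of k] by (simp add: divide_simps mult.commute)
   next
    case False
    have "norm (x + h k *\<^sub>R e) >= norm x - norm (h k *\<^sub>R e)"
     using norm_diff_ineq by blast
    with False h[of k] have "norm (x + h k *\<^sub>R e) > R" by (simp add: ne)
    then have "f (x + h k *\<^sub>R e) = 0" "f x = 0"
     using 0[of x] 0[of "x + h k *\<^sub>R e"] R False by (force simp: subset_iff)+
    then show ?thesis by simp
   qed
  qed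
 qed
 moreover have eq0: "(\<integral>x. (f (x + h k *\<^sub>R e) - f x) /\<^sub>R h k \<partial>lborel) = 0" for k
  using trans[of "h k *\<^sub>R e"] fi by simp
 ultimately show ?thesis unfolding eq0 by (simp only: LIMSEQ_const_iff)
qed

text \<open>Only the products have to vanish outside \<open>K\<close>; one factor may be any smooth
  function. This is the form in which a derivative is moved from a test function on the domain to
  one on the whole space.\<close>

lemma integral_by_parts:
 fixes f :: "real^'n => 'b::real_normed_vector" and prd :: "'b => 'c::real_normed_vector => 'd::euclidean_space"
 assumes prd: "bounded_bilinear prd" and f: "smooth_on UNIV f" and g: "smooth_on UNIV g"
  and K: "compact K" and 0: "!!x. x \<notin> K ==> prd (f x) (g x) = 0"
   "!!x. x \<notin> K ==> prd (f x) (grad g x $ j) = 0"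
 shows "(\<integral>x. prd (grad f x $ j) (g x) \<partial>lborel) = - (\<integral>x. prd (f x) (grad g x $ j) \<partial>lborel)"
  "integrable lborel (%x. prd (grad f x $ j) (g x))" "integrable lborel (%x. prd (f x) (grad g x $ j))"
proof -
 have p: "smooth_on UNIV (%x. prd (f x) (g x))"
  by (intro smooth_on_bilinear[OF prd] f g open_UNIV)
 have eq: "grad (%x. prd (f x) (g x)) x $ j = prd (f x) (grad g x $ j) + prd (grad f x $ j) (g x)" for x
  by (intro grad_bilinear prd smooth_on_differentiable[OF open_UNIV f] smooth_on_differentiable[OF open_UNIV g] UNIV_I)
 have i2: "integrable lborel (%x. prd (f x) (grad g x $ j))"
  by (rule integrable_compact_support(1)[OF smooth_on_continuous K])
   (use 0 in \<open>auto intro!: smooth_on_bilinear[OF prd] f smooth_on_pd g\<close>)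
 have i3: "integrable lborel (%x. grad (%x. prd (f x) (g x)) x $ j)"
 proof (rule integrable_compact_support(1)[OF smooth_on_continuous K])
  show "smooth_on UNIV (%x. grad (%x. prd (f x) (g x)) x $ j)" by (rule smooth_on_pd[OF p])
  fix x assume x: "x \<notin> K"
  have "grad (%x. prd (f x) (g x)) x = grad (%x. 0) x"
   by (rule grad_cong_open[of "- K"]) (use 0 x K in \<open>auto simp: open_Compl compact_imp_closed\<close>)
  then show "grad (%x. prd (f x) (g x)) x $ j = 0" by (simp only: grad_const zero_index)
 qed
 show i1: "integrable lborel (%x. prd (grad f x $ j) (g x))"
  using Bochner_Integration.integrable_diff[OF i3 i2] by (simp add: eq)
 have "(\<integral>x. grad (%x. prd (f x) (g x)) x $ j \<partial>lborel) = 0"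
  by (rule integral_pd_zero[OF p K 0(1)])
 then show "(\<integral>x. prd (grad f x $ j) (g x) \<partial>lborel) = - (\<integral>x. prd (f x) (grad g x $ j) \<partial>lborel)"
  using i1 i2 by (simp add: eq eq_neg_iff_add_eq_0 add.commute)
 show "integrable lborel (%x. prd (f x) (grad g x $ j))" by (rule i2)
qed

section \<open>Averages over cubes and the Poincare inequality\<close>

lemma nn_integral_affine:
 fixes f :: "real^'n => ennreal"
 assumes [measurable]: "f \<in> borel_measurable borel" and c: "c \<noteq> 0"
 shows "(\<integral>\<^sup>+x. f x \<partial>lborel) = ennreal (\<bar>c\<bar> ^ CARD('n)) * (\<integral>\<^sup>+x. f (t + c *\<^sub>R x) \<partial>lborel)"
 by (subst lborel_affine[OF c, of t])
  (simp add: nn_integral_density nn_integral_distr nn_integral_cmult)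

text \<open>A function cannot exceed its average everywhere on \<open>A\<close>. Otherwise the
  subtraction of \<open>c\<close>, exact on \<open>A\<close> although truncated in
  \<open>ennreal\<close>, would leave a positive function with integral 0.\<close>

lemma nn_integral_exists_le:
 assumes [measurable]: "I \<in> borel_measurable M" "A \<in> sets M" and A: "0 < emeasure M A" "emeasure M A < \<infinity>"
  and c: "c < \<infinity>" and le: "(\<integral>\<^sup>+x. I x * indicator A x \<partial>M) <= c * emeasure M A"
 shows "\<exists>y\<in>A. I y <= c"
proof (rule ccontr)
 assume "\<not> ?thesis"
 then have gt: "I y > c" if "y \<in> A" for y using that by (auto simp: not_le)
 have "(\<integral>\<^sup>+x. (I x - c) * indicator A x + c * indicator A x \<partial>M) = (\<integral>\<^sup>+x. I x * indicator A x \<partial>M)"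
  using gt by (intro nn_integral_cong) (auto simp: indicator_def less_imp_le diff_add_cancel_ennreal)
 then have "(\<integral>\<^sup>+x. (I x - c) * indicator A x \<partial>M) + c * emeasure M A <= c * emeasure M A"
  using le by (simp add: nn_integral_add nn_integral_cmult)
 moreover have "c * emeasure M A < \<infinity>" using c A by (simp add: ennreal_mult_less_top)
 ultimately have "(\<integral>\<^sup>+x. (I x - c) * indicator A x \<partial>M) = 0"
  using ennreal_add_left_cancel_le[of "c * emeasure M A" "\<integral>\<^sup>+x. (I x - c) * indicator A x \<partial>M" 0]
  by (auto simp: add.commute)
 then have "AE x in M. (I x - c) * indicator A x = 0"
  by (subst (asm) nn_integral_0_iff_AE) auto
 then have "AE x in M. x \<notin> A"
  by eventually_elim (use gt in \<open>auto simp: indicator_def diff_eq_0_iff_ennreal split: if_splits dest: leD\<close>)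
 then have "emeasure M A = 0"
  by (subst (asm) AE_iff_measurable[OF assms(2)]) (use sets.sets_into_space[OF assms(2)] in auto)
 then show False using A by simp
qed

lemma cube_borel [measurable]: "cube p d \<in> sets borel"
 by (simp add: cube_def)

lemma emeasure_cube: "d >= 0 ==> emeasure lborel (cube (p :: real^'n) d) = ennreal (d ^ CARD('n))"
proof -
 assume d: "d >= 0"
 have "emeasure lborel (cube p d) = (\<Prod>b\<in>Basis. (p + (\<chi> i. d / 2) - (p - (\<chi> i. d / 2))) \<bullet> b)"
  unfolding cube_def by (rule emeasure_lborel_cbox) (use d in \<open>auto simp: Basis_vec_def inner_axis\<close>)
 also have "(\<Prod>b\<in>Basis. (p + (\<chi> i. d / 2) - (p - (\<chi> i. d / 2))) \<bullet> b) = (\<Prod>b\<in>(Basis :: (real^'n) set). d)"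
  by (rule prod.cong) (auto simp: Basis_vec_def inner_axis)
 finally show ?thesis by simp
qed

text \<open>Tonelli: membership of x in the cube about p is symmetric in x and p, so integrating
  over p gives the volume of a cube. It is used to average over all positions of a cube.\<close>

lemma cube_average:
 fixes f :: "real^'n => ennreal"
 assumes [measurable]: "f \<in> borel_measurable borel" and r: "r >= 0"
 shows "(\<integral>\<^sup>+p. (\<integral>\<^sup>+x. f x * indicator (cube p r) x \<partial>lborel) \<partial>lborel) = ennreal (r ^ CARD('n)) * (\<integral>\<^sup>+x. f x \<partial>lborel)"
proof -
 have sym: "indicator (cube p r) x = (indicator (cube x r) p :: ennreal)" for p x :: "real^'n"
  by (auto simp: indicator_def mem_cube abs_minus_commute)
 have "{z :: (real^'n) \<times> (real^'n). snd z \<in> cube (fst z) r} = (\<Inter>i. {z. \<bar>snd z $ i - fst z $ i\<bar> <= r / 2})"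
  by (auto simp: mem_cube)
 moreover have "closed (\<Inter>i. {z :: (real^'n) \<times> (real^'n). \<bar>snd z $ i - fst z $ i\<bar> <= r / 2})"
  by (intro closed_INT ballI closed_Collect_le continuous_intros)
 ultimately have "{z :: (real^'n) \<times> (real^'n). snd z \<in> cube (fst z) r} \<in> sets borel"
  by (simp add: borel_closed)
 then have [measurable]: "{z :: (real^'n) \<times> (real^'n). snd z \<in> cube (fst z) r} \<in> sets (lborel \<Otimes>\<^sub>M lborel)"
  by (simp only: lborel_prod sets_lborel)
 have ind: "(%z :: (real^'n) \<times> (real^'n). indicator (cube (fst z) r) (snd z) :: ennreal)
   = indicator {z. snd z \<in> cube (fst z) r}"
  by (auto simp: indicator_def)
 have [measurable]: "(%z :: (real^'n) \<times> (real^'n). indicator (cube (fst z) r) (snd z) :: ennreal)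
   \<in> borel_measurable (lborel \<Otimes>\<^sub>M lborel)"
  unfolding ind by measurable
 have "(\<integral>\<^sup>+p. (\<integral>\<^sup>+x. f x * indicator (cube p r) x \<partial>lborel) \<partial>lborel)
   = (\<integral>\<^sup>+x. (\<integral>\<^sup>+p. f x * indicator (cube p r) x \<partial>lborel) \<partial>lborel)"
  by (rule lborel_pair.Fubini'[of "%p x. f x * indicator (cube p r) x", symmetric])
   (simp add: split_beta')
 also have "\<dots> = (\<integral>\<^sup>+x. f x * ennreal (r ^ CARD('n)) \<partial>lborel)"
 proof (rule nn_integral_cong)
  fix x :: "real^'n"
  have "(\<integral>\<^sup>+p. f x * indicator (cube p r) x \<partial>lborel) = (\<integral>\<^sup>+p. f x * indicator (cube x r) p \<partial>lborel)"
   by (intro nn_integral_cong arg_cong2[where f="(*)"] refl sym)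
  then show "(\<integral>\<^sup>+p. f x * indicator (cube p r) x \<partial>lborel) = f x * ennreal (r ^ CARD('n))"
   by (simp add: nn_integral_cmult emeasure_cube r)
 qed
 finally show ?thesis by (simp add: nn_integral_multc mult.commute)
qed


text \<open>The Jacobian is at least 2 to the power -n. Among t and 1 - t one is always at least
  1/2, and the bound is meant for that one.\<close>

lemma nn_integral_affine_le:
 fixes f :: "real^'n => ennreal"
 assumes [measurable]: "f \<in> borel_measurable borel" and c: "1 / 2 <= c"
 shows "(\<integral>\<^sup>+x. f (t + c *\<^sub>R x) \<partial>lborel) <= ennreal (2 ^ CARD('n)) * (\<integral>\<^sup>+x. f x \<partial>lborel)"
proof -
 have "1 <= (2 * c) ^ CARD('n)" using c by (intro one_le_power) auto
 then have "1 <= ennreal (2 ^ CARD('n)) * ennreal (\<bar>c\<bar> ^ CARD('n))"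
  using c by (simp add: ennreal_mult[symmetric] power_mult_distrib)
 from mult_right_mono[OF this, of "\<integral>\<^sup>+x. f (t + c *\<^sub>R x) \<partial>lborel"]
 show ?thesis using nn_integral_affine[OF assms(1), of c t] c by (simp add: mult.assoc)
qed

text \<open>The Cauchy-Schwarz inequality on the unit interval, read off from the nonnegative
  integral of the square of h - I, where I is the integral of h.\<close>

lemma FTC_square_le:
 fixes W h :: "real => real"
 assumes W: "!!t. (W has_vector_derivative h t) (at t)" and h: "continuous_on {0..1} h"
 shows "ennreal ((W 1 - W 0)^2) <= (\<integral>\<^sup>+t. ennreal ((h t)^2) * indicator {0..1} t \<partial>lborel)"
proof -
 define I where "I = W 1 - W 0"
 have h1: "integrable lborel (%t. indicator {0..1} t *\<^sub>R h t)" "integrable lborel (%t. indicator {0..1} t *\<^sub>R (h t)^2)"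
  by (intro borel_integrable_compact h continuous_on_power compact_Icc)+
 have hI: "(\<integral>t. indicator {0..1} t *\<^sub>R h t \<partial>lborel) = I"
  unfolding I_def by (rule integral_FTC_Icc) (auto intro: has_vector_derivative_at_within W h)
 have "0 <= (\<integral>t. indicator {0..1} t *\<^sub>R (h t - I)^2 \<partial>lborel)"
  by (rule integral_nonneg_AE) auto
 also have "(%t. indicator {0..1} t *\<^sub>R (h t - I)^2) =
   (%t. indicator {0..1::real} t *\<^sub>R (h t)^2 - (2 * I) * (indicator {0..1} t *\<^sub>R h t) + indicator {0..1} t *\<^sub>R I^2)"
  by (auto simp: indicator_def power2_eq_square algebra_simps)
 also have "(\<integral>t. indicator {0..1::real} t *\<^sub>R (h t)^2 - (2 * I) * (indicator {0..1} t *\<^sub>R h t) + indicator {0..1} t *\<^sub>R I^2 \<partial>lborel)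
   = (\<integral>t. indicator {0..1::real} t *\<^sub>R (h t)^2 \<partial>lborel) - (2 * I) * I + I^2"
  using h1 hI by (subst Bochner_Integration.integral_add) (auto simp: Bochner_Integration.integral_diff)
 finally have "I^2 <= (\<integral>t. indicator {0..1::real} t *\<^sub>R (h t)^2 \<partial>lborel)"
  by (simp add: power2_eq_square)
 then have "ennreal (I^2) <= ennreal (\<integral>t. indicator {0..1::real} t *\<^sub>R (h t)^2 \<partial>lborel)"
  by (rule ennreal_leI)
 also have "\<dots> = (\<integral>\<^sup>+t. ennreal (indicator {0..1::real} t *\<^sub>R (h t)^2) \<partial>lborel)"
  by (rule nn_integral_eq_integral[symmetric, OF h1(2)]) auto
 also have "\<dots> = (\<integral>\<^sup>+t. ennreal ((h t)^2) * indicator {0..1} t \<partial>lborel)"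
  by (intro nn_integral_cong) (auto simp: indicator_def)
 finally show ?thesis by (simp add: I_def)
qed

lemma cube_convex_comb:
 assumes "x \<in> cube p d" "y \<in> cube p d" "0 <= t" "t <= 1"
 shows "y + t *\<^sub>R (x - y) \<in> cube p d"
proof -
 have "(1 - t) *\<^sub>R y + t *\<^sub>R x \<in> cube p d"
  using convex_box(1)[of "p - (\<chi> i. d / 2)" "p + (\<chi> i. d / 2)"] assms
  unfolding cube_def[symmetric] by (intro convexD) auto
 then show ?thesis by (simp add: algebra_simps)
qed

lemma cube_dist: "x \<in> cube p d ==> y \<in> cube (p :: real^'n) d ==> (norm (x - y))^2 <= real CARD('n) * d^2"
proof -
 assume xy: "x \<in> cube p d" "y \<in> cube p d"
 have "(norm (x - y))^2 = (\<Sum>i\<in>UNIV. (x $ i - y $ i)^2)"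
  by (simp add: norm_vec_def L2_set_def sum_nonneg)
 also have "\<dots> <= (\<Sum>i\<in>(UNIV :: 'n set). d^2)"
 proof (rule sum_mono)
  fix i
  have "\<bar>x $ i - p $ i\<bar> <= d / 2" "\<bar>y $ i - p $ i\<bar> <= d / 2" using xy by (auto simp: mem_cube)
  then have "\<bar>x $ i - y $ i\<bar> <= \<bar>d\<bar>" by linarith
  then show "(x $ i - y $ i)^2 <= d^2" by (simp add: abs_le_square_iff)
 qed
 finally show ?thesis by simp
qed

lemma frechet_grad_bound:
 fixes w :: "real^'n => real"
 assumes "smooth_on UNIV w"
 shows "(frechet_derivative w (at x) h)^2 <= (norm h)^2 * (norm (grad w x))^2"
proof -
 have "frechet_derivative w (at x) h = h \<bullet> grad w x"
  using smooth_on_frechet_expansion[OF open_UNIV assms, of x h] by (simp add: inner_vec_def)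
 then show ?thesis
  using Cauchy_Schwarz_ineq2[of h "grad w x"] abs_le_square_iff[of "h \<bullet> grad w x" "norm h * norm (grad w x)"]
  by (simp add: power_mult_distrib)
qed

lemma smooth_grad_continuous: "smooth_on UNIV f ==> continuous_on UNIV (grad f)"
proof -
 assume "smooth_on UNIV f"
 then have "continuous_on UNIV (%x. \<chi> j. grad f x $ j)"
  by (intro continuous_on_vec_lambda smooth_on_continuous smooth_on_pd)
 then show ?thesis by simp
qed

lemma smooth_grad_borel: "smooth_on UNIV f ==> grad f \<in> borel_measurable borel"
 by (rule borel_measurable_continuous_onI[OF smooth_grad_continuous])

text \<open>The squared difference of w at x and y is bounded by an integral of the squared gradient
  along the segment, then averaged over all pairs in the cube; some y does not exceed the average.
  Comparing w with a value \<open>w y\<close> rather than with its mean makes the constant positive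
  as soon as w is.\<close>

lemma cube_poincare:
 fixes w :: "real^'n => real"
 assumes w: "smooth_on UNIV w" and d: "d > 0"
 shows "\<exists>y\<in>cube p d. (\<integral>\<^sup>+x. ennreal ((w x - w y)^2) * indicator (cube p d) x \<partial>lborel)
   <= ennreal (real CARD('n) * d^2 * 2 ^ CARD('n)) * (\<integral>\<^sup>+x. ennreal ((norm (grad w x))^2) * indicator (cube p d) x \<partial>lborel)"
proof -
 let ?Q = "cube p d" and ?n = "real CARD('n)"
 define G where "G x = ennreal ((norm (grad w x))^2) * indicator ?Q x" for x
 have [measurable]: "w \<in> borel_measurable borel" "grad w \<in> borel_measurable borel"
  using smooth_borel[OF w] smooth_grad_borel[OF w] by auto
 have G[measurable]: "G \<in> borel_measurable borel" unfolding G_def by measurable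
 define L where "L = (\<integral>\<^sup>+x. G x \<partial>lborel)"
 have Lfin: "L < \<infinity>"
 proof -
  have "integrable lborel (%x. indicator ?Q x *\<^sub>R (norm (grad w x))^2)"
   by (intro borel_integrable_compact compact_cube continuous_intros
    continuous_on_subset[OF smooth_grad_continuous[OF w]]) auto
  then have "(\<integral>\<^sup>+x. ennreal (norm (indicator ?Q x *\<^sub>R (norm (grad w x))^2)) \<partial>lborel) < \<infinity>"
   unfolding integrable_iff_bounded by simp
  also have "(\<integral>\<^sup>+x. ennreal (norm (indicator ?Q x *\<^sub>R (norm (grad w x))^2)) \<partial>lborel) = L"
   unfolding L_def G_def by (intro nn_integral_cong) (auto simp: indicator_def)
  finally show ?thesis .
 qed
 \<comment> \<open>The squared gradient at the point with parameter t of the segment from y to x,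
   with x and y restricted to the cube.\<close>
 define H where "H t x y = indicator ?Q x * indicator ?Q y * (indicator {0..1} t * G (y + t *\<^sub>R (x - y)))"
  for t :: real and x y :: "real^'n"
 have [measurable]: "(%z. H (fst z) (fst (snd z)) (snd (snd z))) \<in> borel_measurable (lborel \<Otimes>\<^sub>M lborel \<Otimes>\<^sub>M lborel)"
  unfolding H_def by measurable
 have point: "ennreal ((w x - w y)^2) * indicator ?Q x * indicator ?Q y <= ennreal (?n * d^2) * (\<integral>\<^sup>+t. H t x y \<partial>lborel)" for x y
 proof (cases "x \<in> ?Q \<and> y \<in> ?Q")
  case True
  let ?h = "%t. frechet_derivative w (at (y + t *\<^sub>R (x - y))) (x - y)"
  have heq: "?h = (%t. (x - y) \<bullet> grad w (y + t *\<^sub>R (x - y)))"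
   using smooth_on_frechet_expansion[OF open_UNIV w] by (simp add: inner_vec_def)
  have "continuous_on {0..1} ?h"
   unfolding heq by (auto intro!: continuous_intros continuous_on_compose2[OF smooth_grad_continuous[OF w]])
  from FTC_square_le[OF smooth_line_derivative[OF open_UNIV w UNIV_I], OF this]
  have "ennreal ((w x - w y)^2) <= (\<integral>\<^sup>+t. ennreal ((?h t)^2) * indicator {0..1} t \<partial>lborel)"
   by simp
  also have "\<dots> <= (\<integral>\<^sup>+t. ennreal (?n * d^2) * H t x y \<partial>lborel)"
  proof (rule nn_integral_mono)
   fix t :: real
   show "ennreal ((?h t)^2) * indicator {0..1} t <= ennreal (?n * d^2) * H t x y"
   proof (cases "t \<in> {0..1}")
    case t: True
    have "(?h t)^2 <= (norm (x - y))^2 * (norm (grad w (y + t *\<^sub>R (x - y))))^2"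
     by (rule frechet_grad_bound[OF w])
    also have "\<dots> <= (?n * d^2) * (norm (grad w (y + t *\<^sub>R (x - y))))^2"
     using True cube_dist by (intro mult_right_mono) auto
    finally show ?thesis
     using True t cube_convex_comb[of x p d y t]
     by (simp add: H_def G_def ennreal_mult[symmetric] ennreal_leI)
   qed simp
  qed
  also have "\<dots> = ennreal (?n * d^2) * (\<integral>\<^sup>+t. H t x y \<partial>lborel)"
   by (rule nn_integral_cmult) (simp add: H_def)
  finally show ?thesis using True by simp
 qed auto
 have ball: "(\<integral>\<^sup>+y. (\<integral>\<^sup>+x. (\<integral>\<^sup>+t. H t x y \<partial>lborel) \<partial>lborel) \<partial>lborel) <= ennreal (2 ^ CARD('n)) * L * emeasure lborel ?Q"
 proof -
  have "(\<integral>\<^sup>+y. (\<integral>\<^sup>+x. (\<integral>\<^sup>+t. H t x y \<partial>lborel) \<partial>lborel) \<partial>lborel) = (\<integral>\<^sup>+y. (\<integral>\<^sup>+t. (\<integral>\<^sup>+x. H t x y \<partial>lborel) \<partial>lborel) \<partial>lborel)"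
   by (intro nn_integral_cong lborel_pair.Fubini') (simp add: H_def split_beta')
  also have "\<dots> = (\<integral>\<^sup>+t. (\<integral>\<^sup>+y. (\<integral>\<^sup>+x. H t x y \<partial>lborel) \<partial>lborel) \<partial>lborel)"
   by (rule lborel_pair.Fubini') (simp add: H_def split_beta')
  also have "\<dots> <= (\<integral>\<^sup>+t. indicator {0..1::real} t * (ennreal (2 ^ CARD('n)) * L * emeasure lborel ?Q) \<partial>lborel)"
  proof (rule nn_integral_mono)
   fix t :: real
   \<comment> \<open>The point of the segment depends on x with factor t and on y with factor 1 - t.
     Integrating first over the variable whose factor is at least 1/2 keeps the Jacobian away from
     0.\<close>
   consider "t \<notin> {0..1}" | "t \<in> {0..1}" "t >= 1/2" | "t \<in> {0..1}" "1 - t >= 1/2" by fastforce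
   then show "(\<integral>\<^sup>+y. (\<integral>\<^sup>+x. H t x y \<partial>lborel) \<partial>lborel) <= indicator {0..1} t * (ennreal (2 ^ CARD('n)) * L * emeasure lborel ?Q)"
   proof cases
    case 1
    then show ?thesis by (simp add: H_def)
   next
    case 2
    have "(\<integral>\<^sup>+x. H t x y \<partial>lborel) <= indicator ?Q y * (ennreal (2 ^ CARD('n)) * L)" for y
    proof (cases "y \<in> ?Q")
     case True
     have "(\<integral>\<^sup>+x. H t x y \<partial>lborel) <= (\<integral>\<^sup>+x. G ((1 - t) *\<^sub>R y + t *\<^sub>R x) \<partial>lborel)"
      by (intro nn_integral_mono) (auto simp: H_def indicator_def algebra_simps)
     also have "\<dots> <= ennreal (2 ^ CARD('n)) * L"
      unfolding L_def using 2 by (intro nn_integral_affine_le) auto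
     finally show ?thesis using True by simp
    qed (simp add: H_def)
    then have "(\<integral>\<^sup>+y. (\<integral>\<^sup>+x. H t x y \<partial>lborel) \<partial>lborel) <= (\<integral>\<^sup>+y. indicator ?Q y * (ennreal (2 ^ CARD('n)) * L) \<partial>lborel)"
     by (intro nn_integral_mono)
    then show ?thesis using 2 by (simp add: nn_integral_multc mult.commute)
   next
    case 3
    have "(\<integral>\<^sup>+y. H t x y \<partial>lborel) <= indicator ?Q x * (ennreal (2 ^ CARD('n)) * L)" for x
    proof (cases "x \<in> ?Q")
     case True
     have "(\<integral>\<^sup>+y. H t x y \<partial>lborel) <= (\<integral>\<^sup>+y. G (t *\<^sub>R x + (1 - t) *\<^sub>R y) \<partial>lborel)"
      by (intro nn_integral_mono) (auto simp: H_def indicator_def algebra_simps)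
     also have "\<dots> <= ennreal (2 ^ CARD('n)) * L"
      unfolding L_def using 3 by (intro nn_integral_affine_le) auto
     finally show ?thesis using True by simp
    qed (simp add: H_def)
    then have "(\<integral>\<^sup>+x. (\<integral>\<^sup>+y. H t x y \<partial>lborel) \<partial>lborel) <= (\<integral>\<^sup>+x. indicator ?Q x * (ennreal (2 ^ CARD('n)) * L) \<partial>lborel)"
     by (intro nn_integral_mono)
    moreover have "(\<integral>\<^sup>+y. (\<integral>\<^sup>+x. H t x y \<partial>lborel) \<partial>lborel) = (\<integral>\<^sup>+x. (\<integral>\<^sup>+y. H t x y \<partial>lborel) \<partial>lborel)"
     by (rule lborel_pair.Fubini') (simp add: H_def split_beta')
    ultimately show ?thesis using 3 by (simp add: nn_integral_multc mult.commute)
   qed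
  qed
  finally show ?thesis by (simp add: nn_integral_multc)
 qed
 define I where "I y = (\<integral>\<^sup>+x. ennreal ((w x - w y)^2) * indicator ?Q x \<partial>lborel)" for y
 have [measurable]: "I \<in> borel_measurable lborel" unfolding I_def by measurable
 have "(\<integral>\<^sup>+y. I y * indicator ?Q y \<partial>lborel) = (\<integral>\<^sup>+y. (\<integral>\<^sup>+x. ennreal ((w x - w y)^2) * indicator ?Q x * indicator ?Q y \<partial>lborel) \<partial>lborel)"
  unfolding I_def by (intro nn_integral_cong nn_integral_multc[symmetric]) measurable
 also have "\<dots> <= (\<integral>\<^sup>+y. (\<integral>\<^sup>+x. ennreal (?n * d^2) * (\<integral>\<^sup>+t. H t x y \<partial>lborel) \<partial>lborel) \<partial>lborel)"
  by (intro nn_integral_mono point)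
 also have "\<dots> = ennreal (?n * d^2) * (\<integral>\<^sup>+y. (\<integral>\<^sup>+x. (\<integral>\<^sup>+t. H t x y \<partial>lborel) \<partial>lborel) \<partial>lborel)"
  by (simp add: nn_integral_cmult H_def)
 also have "\<dots> <= ennreal (?n * d^2) * (ennreal (2 ^ CARD('n)) * L * emeasure lborel ?Q)"
  by (intro mult_left_mono ball) auto
 also have "\<dots> = (ennreal (?n * d^2 * 2 ^ CARD('n)) * L) * emeasure lborel ?Q"
  by (simp add: ennreal_mult mult.assoc)
 finally have "\<exists>y\<in>?Q. I y <= ennreal (?n * d^2 * 2 ^ CARD('n)) * L"
  using d Lfin by (intro nn_integral_exists_le[of I lborel]) (auto simp: emeasure_cube ennreal_mult_less_top)
 then show ?thesis by (simp add: I_def L_def G_def)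
qed

subsection \<open>Coordinatewise change of variables\<close>

text \<open>A map acting on each coordinate separately has the Jacobian given by the product of the
  one-variable derivatives. Uniqueness of Lebesgue measure turns the change of variables into a
  computation on boxes, where the fundamental theorem of calculus applies in each
  coordinate.\<close>

lemma coordinate_change_le:
 fixes f :: "real^'n => ennreal" and \<theta> \<theta>' :: "real => real"
 assumes [measurable]: "f \<in> borel_measurable borel" and m: "m > 0"
  and der: "!!t. (\<theta> has_real_derivative \<theta>' t) (at t)" and cont: "continuous_on UNIV \<theta>'" and ge: "!!t. m <= \<theta>' t"
 shows "ennreal (m ^ CARD('n)) * (\<integral>\<^sup>+x. f (\<chi> i. \<theta> (x $ i)) \<partial>lborel) <= (\<integral>\<^sup>+x. f x \<partial>lborel)"
proof -
 have c\<theta>: "continuous_on A \<theta>" for A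
  using der DERIV_isCont continuous_at_imp_continuous_on by blast
 have [measurable]: "\<theta> \<in> borel_measurable borel" "\<theta>' \<in> borel_measurable borel"
  by (auto intro: borel_measurable_continuous_onI c\<theta> cont)
 have mono: "m * (t - s) <= \<theta> t - \<theta> s" if st: "s <= t" for s t
 proof (cases "s = t")
  case False
  then obtain z where "\<theta> t - \<theta> s = (t - s) * \<theta>' z" using MVT2[OF _ der, of s t] st by (auto simp: less_le)
  then show ?thesis using mult_right_mono[OF ge[of z], of "t - s"] st by (simp add: mult.commute)
 qed simp
 have smono: "\<theta> s < \<theta> t \<longleftrightarrow> s < t" for s t
 proof (cases "s < t")
  case True
  then show ?thesis using mono[of s t] mult_pos_pos[of m "t - s"] m by linarith
 next
  case False
  then show ?thesis using mono[of t s] mult_nonneg_nonneg[of m "s - t"] m by linarith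
 qed
 have surj: "\<exists>t. \<theta> t = y" for y
 proof -
  define T where "T = (\<bar>y\<bar> + \<bar>\<theta> 0\<bar>) / m"
  have "T >= 0" "m * T = \<bar>y\<bar> + \<bar>\<theta> 0\<bar>" using m by (auto simp: T_def)
  then have "\<theta> (- T) <= y" "y <= \<theta> T" using mono[of "-T" 0] mono[of 0 T] by auto
  then show ?thesis using IVT'[of \<theta> "-T" y T] \<open>T >= 0\<close> c\<theta> by auto
 qed
 let ?T = "%x :: real^'n. \<chi> i. \<theta> (x $ i)"
 have Tm[measurable]: "?T \<in> borel \<rightarrow>\<^sub>M borel"
  by (intro borel_measurable_continuous_onI continuous_on_vec_lambda continuous_on_compose2[OF c\<theta>]) (auto intro: continuous_intros)
 define J where "J x = (\<Prod>i\<in>UNIV. ennreal (\<theta>' (x $ i)))" for x :: "real^'n"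
 have [measurable]: "J \<in> borel_measurable borel" unfolding J_def by measurable
 have one: "(\<integral>\<^sup>+t. ennreal (\<theta>' t) * indicator {t. l < \<theta> t \<and> \<theta> t < u} t \<partial>lborel) = ennreal (u - l)" if "l <= u" for l u
 proof -
  obtain a b where ab: "\<theta> a = l" "\<theta> b = u" using surj by meson
  then have "a <= b" using that smono[of b a] by linarith
  have "(\<integral>\<^sup>+t. ennreal (\<theta>' t) * indicator {t. l < \<theta> t \<and> \<theta> t < u} t \<partial>lborel)
    = (\<integral>\<^sup>+t. ennreal (\<theta>' t) * indicator {a..b} t \<partial>lborel)"
  proof (rule nn_integral_cong_AE)
   have "AE t in lborel. t \<noteq> a" "AE t in lborel. t \<noteq> b" by (auto intro: AE_lborel_singleton)
   then show "AE t in lborel. ennreal (\<theta>' t) * indicator {t. l < \<theta> t \<and> \<theta> t < u} t = ennreal (\<theta>' t) * indicator {a..b} t"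
    by eventually_elim (use ab smono in \<open>auto simp: indicator_def less_le\<close>)
  qed
  also have "\<dots> = ennreal (u - l)"
   using ab \<open>a <= b\<close> der ge m by (subst nn_integral_FTC_Icc[of \<theta>' a b \<theta>]) (auto intro: order_trans[OF less_imp_le])
  finally show ?thesis .
 qed
 \<comment> \<open>Lebesgue measure is determined by its values on boxes. The preimage of a box
   under the map is a product of intervals, so the integral of \<open>J\<close> factorises.\<close>
 have eq: "lborel = distr (density lborel J) borel ?T"
 proof (rule lborel_eqI)
  fix l u :: "real^'n" assume lu: "!!b. b \<in> Basis ==> l \<bullet> b <= u \<bullet> b"
  define g where "g b t = ennreal (\<theta>' t) * indicator {t. l \<bullet> b < \<theta> t \<and> \<theta> t < u \<bullet> b} t" for b :: "real^'n" and t
  have [measurable]: "?T -` box l u \<in> sets borel"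
   using measurable_sets[OF Tm, of "box l u"] by simp
  have B: "(\<Prod>b\<in>Basis. F b) = (\<Prod>i\<in>UNIV. F (axis i 1))" for F :: "real^'n => ennreal"
   by (rule prod.reindex_bij_witness[where i="%i. axis i 1" and j="%b. THE i. b = axis i 1"])
    (auto simp: Basis_vec_def axis_eq_axis)
  have "emeasure (distr (density lborel J) borel ?T) (box l u) = (\<integral>\<^sup>+x. J x * indicator (?T -` box l u) x \<partial>lborel)"
   by (subst emeasure_distr) (auto simp: emeasure_density)
  also have "\<dots> = (\<integral>\<^sup>+x. (\<Prod>b\<in>Basis. g b (x \<bullet> b)) \<partial>lborel)"
   unfolding B g_def J_def prod.distrib
   by (intro nn_integral_cong arg_cong2[where f="(*)"] refl)
    (auto simp: indicator_def inner_axis mem_box_cart of_bool_def)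
  also have "\<dots> = (\<Prod>b\<in>Basis. (\<integral>\<^sup>+t. g b t \<partial>lborel))"
   by (rule nn_integral_lborel_prod) (auto simp: g_def)
  also have "\<dots> = (\<Prod>b\<in>Basis. ennreal ((u - l) \<bullet> b))"
   unfolding g_def using lu by (intro prod.cong refl) (simp add: one inner_diff_left)
  also have "\<dots> = ennreal (\<Prod>b\<in>Basis. (u - l) \<bullet> b)"
   using lu by (intro prod_ennreal) (simp add: inner_diff_left)
  finally show "emeasure (distr (density lborel J) borel ?T) (box l u) = ennreal (\<Prod>b\<in>Basis. (u - l) \<bullet> b)" .
 qed simp
 have "ennreal (m ^ CARD('n)) <= J x" for x
 proof -
  have "ennreal (m ^ CARD('n)) = (\<Prod>i\<in>(UNIV :: 'n set). ennreal m)"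
   using m by (simp add: ennreal_power)
  also have "\<dots> <= J x" unfolding J_def using ge by (intro prod_mono_ennreal) (auto intro: ennreal_leI)
  finally show ?thesis .
 qed
 then have "ennreal (m ^ CARD('n)) * (\<integral>\<^sup>+x. f (?T x) \<partial>lborel) <= (\<integral>\<^sup>+x. J x * f (?T x) \<partial>lborel)"
  by (subst nn_integral_cmult[symmetric]) (auto intro!: nn_integral_mono mult_right_mono)
 also have "\<dots> = (\<integral>\<^sup>+x. f x \<partial>distr (density lborel J) borel ?T)"
  by (simp add: nn_integral_distr nn_integral_density)
 finally show ?thesis by (simp only: eq[symmetric])
qed

section \<open>Dirichlet integrals and the capacity of cubes\<close>

definition dirichlet :: "(real^'n => real) => real" where
 "dirichlet u = (\<integral>x. (norm (grad u x))^2 \<partial>lborel)"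

lemma test_integrable_grad:
 fixes u :: "real^'n => real"
 assumes "u \<in> test_functions G"
 shows "integrable lborel (%x. (norm (grad u x))^2)"
proof -
 obtain K where K: "smooth_on UNIV u" "compact K" "!!x. x \<notin> K ==> grad u x = 0"
  using test_functionsD[OF assms] by metis
 show ?thesis
  by (rule integrable_compact_support(1)[OF _ K(2)])
   (auto intro!: continuous_intros smooth_grad_continuous K(1) simp: K(3))
qed

lemma dirichlet_eq:
 fixes u :: "real^'n => real"
 assumes "u \<in> test_functions G"
 shows "(\<integral>\<^sup>+x. ennreal ((norm (grad u x))^2) \<partial>lborel) = ennreal (dirichlet u)"
 unfolding dirichlet_def by (rule nn_integral_eq_integral[OF test_integrable_grad[OF assms]]) auto

lemma dirichlet_nonneg: "0 <= dirichlet u"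
 by (simp add: dirichlet_def)

definition cap_dom :: "real^'n => real => (real^'n) set" where
 "cap_dom p d = (if CARD('n) = 2 then interior (cube p (2 * d)) else UNIV)"

lemma cap_dom_subset: "interior (cube p (2 * d)) \<subseteq> cap_dom p d"
 by (simp add: cap_dom_def)

lemma wiener_cap_alt: "wiener_cap p d F = rel_cap (cap_dom p d) F"
 by (simp add: wiener_cap_def cap_dom_def)

lemma wiener_cap_le:
 assumes "u \<in> test_functions (cap_dom p d)" "open N" "F \<subseteq> N" "!!x. x \<in> N ==> u x = 1"
 shows "wiener_cap p d F <= ennreal (dirichlet u)"
 unfolding wiener_cap_alt rel_cap_def nn_integral_completion dirichlet_eq[OF assms(1), symmetric]
 by (rule INF_lower) (use assms in auto)

lemma wiener_cap_less:
 fixes p :: "real^'n"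
 assumes "wiener_cap p d F < c"
 obtains u N where "u \<in> test_functions (cap_dom p d)" "open N" "F \<subseteq> N" "!!x. x \<in> N ==> u x = 1"
  "ennreal (dirichlet u) < c"
proof -
 have "\<exists>u :: real^'n => real. u \<in> test_functions (cap_dom p d) \<and> (\<exists>N. open N \<and> F \<subseteq> N \<and> (\<forall>x\<in>N. u x = 1)) \<and>
   (\<integral>\<^sup>+x. ennreal ((norm (grad u x))^2) \<partial>lborel) < c"
  using assms unfolding wiener_cap_alt rel_cap_def nn_integral_completion INF_less_iff Bex_def mem_Collect_eq conj_assoc .
 then obtain u :: "real^'n => real" where u: "u \<in> test_functions (cap_dom p d)" "\<exists>N. open N \<and> F \<subseteq> N \<and> (\<forall>x\<in>N. u x = 1)"
   "(\<integral>\<^sup>+x. ennreal ((norm (grad u x))^2) \<partial>lborel) < c" by blast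
 then show ?thesis using that dirichlet_eq[OF u(1)] by metis
qed

lemma wiener_cap_ge:
 assumes "!!u N. u \<in> test_functions (cap_dom p d) ==> open N ==> F \<subseteq> N ==> (!!x. x \<in> N ==> u x = 1) ==> c <= ennreal (dirichlet u)"
 shows "c <= wiener_cap p d F"
proof (rule ccontr)
 assume "\<not> ?thesis"
 then have "wiener_cap p d F < c" by simp
 then obtain u N where u: "u \<in> test_functions (cap_dom p d)" "open N" "F \<subseteq> N" "!!x. x \<in> N ==> u x = 1"
  "ennreal (dirichlet u) < c"
  by (rule wiener_cap_less) blast
 with assms[OF u(1-4)] show False by simp
qed

lemma cube_subset_interior: "r < s ==> cube p r \<subseteq> interior (cube p s)"
proof
 fix x assume "r < s" "x \<in> cube p r"
 then have "r / 2 < s / 2" "\<forall>i. \<bar>x $ i - p $ i\<bar> <= r / 2" by (simp_all only: mem_cube) simp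
 then show "x \<in> interior (cube p s)" unfolding mem_interior_cube by (meson le_less_trans)
qed

lemma norm_grad_sum: "(norm (grad u x))^2 = (\<Sum>j\<in>UNIV. (norm (grad u x $ j))^2)"
 by (simp add: norm_vec_def L2_set_def sum_nonneg)

lemma young_square: "s > 0 ==> 2 * (a * b) <= s * a^2 + b^2 / (s :: real)"
proof -
 assume s: "s > 0"
 have "0 <= (s * a - b)^2 / s" using s by simp
 also have "(s * a - b)^2 / s = s * a^2 + b^2 / s - 2 * (a * b)"
  using s by (simp add: power2_eq_square field_simps)
 finally show ?thesis by simp
qed

text \<open>The parameter lets the first term enter with a factor as close to 1 as desired, which
  the capacity argument needs; with s = 1 both factors are 2.\<close>

lemma norm_add_square_le:
 fixes x y :: "'a::real_inner"
 assumes "s > 0"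
 shows "(norm (x + y))^2 <= (1 + s) * (norm x)^2 + (1 + 1 / s) * (norm y)^2"
proof -
 have "(norm (x + y))^2 <= (norm x + norm y)^2"
  by (intro power_mono norm_triangle_ineq) auto
 also have "\<dots> = (norm x)^2 + (norm y)^2 + 2 * (norm x * norm y)"
  by (simp add: power2_eq_square algebra_simps)
 also have "\<dots> <= (1 + s) * (norm x)^2 + (1 + 1 / s) * (norm y)^2"
  using young_square[OF assms, of "norm x" "norm y"] by (simp add: algebra_simps)
 finally show ?thesis .
qed

text \<open>The divergence of the field u^2 \<phi> (x - p) integrates to 0. Hypothesis
  \<open>D\<close> says that the divergence of \<phi> (x - p) is at least \<phi>, and the cross term
  with the gradient of u is absorbed by the Young inequality with the help of \<open>B\<close>. The
  weight is chosen differently in dimension 2 and above.\<close>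

lemma hardy_inequality:
 fixes u \<phi> :: "real^'n => real"
 assumes u: "u \<in> test_functions G" and \<phi>: "smooth_on UNIV \<phi>" "!!x. 0 <= \<phi> x"
  and D: "!!x. \<phi> x <= (\<Sum>j\<in>UNIV. \<phi> x + (x $ j - p $ j) * grad \<phi> x $ j)"
  and B: "!!x. u x \<noteq> 0 ==> (norm (x - p))^2 * \<phi> x <= C"
 shows "(\<integral>x. (u x)^2 * \<phi> x \<partial>lborel) <= 4 * C * dirichlet u" "integrable lborel (%x. (u x)^2 * \<phi> x)"
proof -
 obtain K where K: "smooth_on UNIV u" "compact K" "!!x. x \<notin> K ==> u x = 0"
  using test_functionsD[OF u] by metis
 \<comment> \<open>The j-th component of the vector field u^2 \<phi> (x - p).\<close>
 define Y where "Y j x = (u x * u x) * ((x $ j - p $ j) * \<phi> x)" for j x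
 have Y: "smooth_on UNIV (Y j)" for j
  unfolding Y_def[abs_def]
  by (intro smooth_on_mult smooth_on_diff smooth_on_coord smooth_on_const open_UNIV K(1) \<phi>(1))
 have diff: "f differentiable at x" if "smooth_on UNIV f" for f :: "real^'n => real" and x
  by (rule smooth_on_differentiable[OF open_UNIV that UNIV_I])
 have gY: "grad (Y j) x $ j = (u x)^2 * (\<phi> x + (x $ j - p $ j) * grad \<phi> x $ j) + 2 * (u x * ((grad u x $ j * (x $ j - p $ j)) * \<phi> x))" for j x
 proof -
  have c: "grad (%x. x $ j - p $ j) x $ j = 1"
   by (subst grad_diff) (auto intro!: diff smooth_on_coord smooth_on_const simp: grad_coord grad_const)
  show ?thesis
   unfolding Y_def[abs_def]
   by (subst grad_mult, (intro diff smooth_on_mult smooth_on_diff smooth_on_coord smooth_on_const open_UNIV K(1) \<phi>(1))+)+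
    (simp add: c power2_eq_square algebra_simps)
 qed
 have iY: "integrable lborel (%x. grad (Y j) x $ j)" for j
 proof -
  have "Y j \<in> test_functions UNIV"
   by (rule test_functionsI[OF Y K(2)]) (auto simp: Y_def K(3))
  then obtain K' where "compact K'" "!!x. x \<notin> K' ==> grad (Y j) x = 0" using test_functionsD by metis
  then show ?thesis
   by (intro integrable_compact_support(1)[OF smooth_on_continuous[OF smooth_on_pd[OF Y]]]) auto
 qed
 have 0: "(\<integral>x. (\<Sum>j\<in>UNIV. grad (Y j) x $ j) \<partial>lborel) = 0"
 proof -
  have "(\<integral>x. grad (Y j) x $ j \<partial>lborel) = 0" for j
   by (rule integral_pd_zero[OF Y K(2)]) (simp add: Y_def K(3))
  then show ?thesis by (subst Bochner_Integration.integral_sum) (auto intro: iY)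
 qed
 show i1: "integrable lborel (%x. (u x)^2 * \<phi> x)"
 proof (rule integrable_compact_support(1)[OF _ K(2)])
  show "continuous_on UNIV (%x. (u x)^2 * \<phi> x)"
   by (intro smooth_on_continuous smooth_on_mult smooth_on_power K(1) \<phi>(1) open_UNIV)
 qed (simp add: K(3))
 have point: "(u x)^2 * \<phi> x / 2 - 2 * C * (norm (grad u x))^2 <= (\<Sum>j\<in>UNIV. grad (Y j) x $ j)" for x
 proof (cases "u x = 0")
  case True
  have "0 <= C \<or> u x = 0 " using True by simp
  \<comment> \<open>Here the claim needs a nonnegative \<open>C\<close>. The hypothesis
    \<open>B\<close> supplies the sign at any point where u is nonzero, and such a point exists if
    the gradient does not vanish.\<close>
  show ?thesis
  proof (cases "grad u x = 0")
   case False
   have "\<exists>y. u y \<noteq> 0"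
   proof (rule ccontr)
    assume "\<nexists>y. u y \<noteq> 0"
    then have "u = (%x. 0)" by auto
    then show False using False by (simp add: grad_const)
   qed
   then obtain y where "u y \<noteq> 0" ..
   then have "0 <= C" using B[of y] \<phi>(2)[of y] by (meson mult_nonneg_nonneg order_trans zero_le_power2)
   then show ?thesis unfolding gY by (simp add: True)
  qed (simp add: gY True)
 next
  case False
  have "(\<Sum>j\<in>UNIV. grad (Y j) x $ j) = (u x)^2 * (\<Sum>j\<in>UNIV. \<phi> x + (x $ j - p $ j) * grad \<phi> x $ j)
    + 2 * (u x * ((\<Sum>j\<in>UNIV. grad u x $ j * (x $ j - p $ j)) * \<phi> x))"
   unfolding gY by (simp only: sum.distrib sum_distrib_left[symmetric] sum_distrib_right[symmetric])
  also have "(\<Sum>j\<in>UNIV. grad u x $ j * (x $ j - p $ j)) = grad u x \<bullet> (x - p)"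
   by (simp add: inner_vec_def)
  finally have eq: "(\<Sum>j\<in>UNIV. grad (Y j) x $ j) = (u x)^2 * (\<Sum>j\<in>UNIV. \<phi> x + (x $ j - p $ j) * grad \<phi> x $ j)
    + 2 * (u x * ((grad u x \<bullet> (x - p)) * \<phi> x))" .
  have 1: "(u x)^2 * \<phi> x <= (u x)^2 * (\<Sum>j\<in>UNIV. \<phi> x + (x $ j - p $ j) * grad \<phi> x $ j)"
   by (intro mult_left_mono D) auto
  have "- (2 * (u x * ((grad u x \<bullet> (x - p)) * \<phi> x))) <= \<phi> x * (2 * ((- u x) * (grad u x \<bullet> (x - p))))"
   by (simp add: algebra_simps)
  also have "\<dots> <= \<phi> x * ((1 / 2) * (- u x)\<^sup>2 + (grad u x \<bullet> (x - p))\<^sup>2 / (1 / 2))"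
   by (intro mult_left_mono young_square \<phi>(2)) auto
  also have "\<dots> = (u x)^2 * \<phi> x / 2 + 2 * (\<phi> x * (grad u x \<bullet> (x - p))^2)"
   by (simp add: algebra_simps)
  also have "\<phi> x * (grad u x \<bullet> (x - p))^2 <= \<phi> x * ((norm (grad u x))^2 * (norm (x - p))^2)"
   using abs_le_square_iff[of "grad u x \<bullet> (x - p)" "norm (grad u x) * norm (x - p)"] Cauchy_Schwarz_ineq2[of "grad u x" "x - p"]
   by (intro mult_left_mono \<phi>(2)) (simp add: power_mult_distrib)
  also have "\<phi> x * ((norm (grad u x))^2 * (norm (x - p))^2) = (norm (grad u x))^2 * ((norm (x - p))^2 * \<phi> x)"
   by simp
  also have "\<dots> <= (norm (grad u x))^2 * C"
   by (intro mult_left_mono B False) auto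
  finally show ?thesis using 1 unfolding eq by (simp add: algebra_simps)
 qed
 have "(\<integral>x. (u x)^2 * \<phi> x / 2 - 2 * C * (norm (grad u x))^2 \<partial>lborel) <= (\<integral>x. (\<Sum>j\<in>UNIV. grad (Y j) x $ j) \<partial>lborel)"
  using i1 test_integrable_grad[OF u] iY point by (intro integral_mono) auto
 then show "(\<integral>x. (u x)^2 * \<phi> x \<partial>lborel) <= 4 * C * dirichlet u"
  using i1 test_integrable_grad[OF u] by (simp add: 0 dirichlet_def)
qed

lemma dist_square_derivative:
 "((%x::real^'n. (norm (x - p))^2) has_derivative (%h. 2 * ((x - p) \<bullet> h))) (at x)"
 unfolding power2_norm_eq_inner by (auto intro!: derivative_eq_intros simp: inner_commute)

lemma smooth_dist_square: "smooth_on UNIV (%x::real^'n. (norm (x - p))^2)"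
proof -
 have "smooth_on UNIV (%x::real^'n. \<Sum>i\<in>UNIV. (x $ i - p $ i)^2)"
  by (intro smooth_on_sum smooth_on_power smooth_on_diff smooth_on_coord smooth_on_const open_UNIV)
 then show ?thesis by (simp add: norm_vec_def L2_set_def sum_nonneg)
qed

lemma cube_norm: "x \<in> cube p d ==> (norm (x - (p::real^'n)))^2 <= real CARD('n) * (d / 2)^2"
proof -
 assume x: "x \<in> cube p d"
 have "(norm (x - p))^2 = (\<Sum>i\<in>UNIV. (x $ i - p $ i)^2)"
  by (simp add: norm_vec_def L2_set_def sum_nonneg)
 also have "\<dots> <= (\<Sum>i\<in>(UNIV :: 'n set). (d / 2)^2)"
 proof (rule sum_mono)
  fix i have "\<bar>x $ i - p $ i\<bar> <= d / 2" using x by (auto simp: mem_cube)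
  then show "(x $ i - p $ i)^2 <= (d / 2)^2" by (simp add: abs_le_square_iff[symmetric])
 qed
 finally show ?thesis by simp
qed

lemma integral_cube_lower:
 fixes f :: "real^'n => real"
 assumes f: "integrable lborel f" and d: "d >= 0" and c: "!!x. x \<in> cube p d ==> c <= f x" and nn: "!!x. 0 <= f x"
 shows "c * d ^ CARD('n) <= (\<integral>x. f x \<partial>lborel)"
proof -
 have i: "integrable lborel (%x. indicator (cube p d) x *\<^sub>R c)"
  by (intro borel_integrable_compact compact_cube) auto
 have "c * d ^ CARD('n) = (\<integral>x. indicator (cube p d) x *\<^sub>R c \<partial>lborel)"
  using d by (simp add: measure_def emeasure_cube)
 also have "\<dots> <= (\<integral>x. f x \<partial>lborel)"
  by (intro integral_mono i f) (use c nn in \<open>auto simp: indicator_def\<close>)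
 finally show ?thesis .
qed

text \<open>A competitor equals 1 on the cube, so the weighted mass in the Hardy inequality is
  bounded from below by the mass over the cube.\<close>

lemma wiener_cap_cube_lower:
 assumes n: "CARD('n) >= 2" and d: "d > 0"
 shows "ennreal (d ^ (CARD('n) - 2) / (8 * real CARD('n))) <= wiener_cap (p :: real^'n) d (cube p d)"
proof (rule wiener_cap_ge)
 let ?n = "real CARD('n)"
 fix u :: "real^'n => real" and N
 assume u: "u \<in> test_functions (cap_dom p d)" and N: "open N" "cube p d \<subseteq> N" and 1: "!!x. x \<in> N ==> u x = 1"
 have pow: "d ^ CARD('n) = d ^ (CARD('n) - 2) * d^2"
  using n by (metis le_add_diff_inverse2 power_add)
 have "d ^ (CARD('n) - 2) / (8 * ?n) <= dirichlet u"
 proof (cases "CARD('n) = 2")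
  case True
  \<comment> \<open>In dimension 2 the competitor lives in the doubled cube, so the constant weight
    1 already satisfies the boundedness condition.\<close>
  have B: "(norm (x - p))^2 * 1 <= 2 * d^2" if "u x \<noteq> 0" for x
  proof -
   from that have "x \<in> cap_dom p d" using u test_functionsD[OF u] by (metis subsetD)
   then have "x \<in> cube p (2 * d)" using True interior_subset by (auto simp: cap_dom_def)
   from cube_norm[OF this] show "(norm (x - p))^2 * 1 <= 2 * d^2" by (simp add: True)
  qed
  have s: "smooth_on UNIV (%x :: real^'n. 1 :: real)" by (rule smooth_on_const[OF open_UNIV])
  have D: "1 <= (\<Sum>j\<in>UNIV. 1 + (x $ j - p $ j) * grad (%x :: real^'n. 1 :: real) x $ j)" for x
   by (simp add: grad_const Suc_le_eq)
  note * = hardy_inequality[OF u s zero_le_one D B]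
  have "1 * d ^ CARD('n) <= (\<integral>x. (u x)^2 * 1 \<partial>lborel)"
   by (rule integral_cube_lower[OF *(2), of d p]) (use d N 1 in auto)
  with *(1) have "d^2 * 1 <= d^2 * (8 * dirichlet u)" by (simp add: True)
  then have "1 <= 8 * dirichlet u" using d by (subst (asm) mult_le_cancel_left_pos) auto
  then show ?thesis by (simp add: True)
 next
  case False
  then have n3: "CARD('n) >= 3" using n by simp
  \<comment> \<open>In higher dimension the Hardy weight is the inverse square of the distance;
    adding \<open>d^2\<close> makes it smooth at the centre and keeps it of order 1 / d^2 on the
    cube. The divergence condition amounts to n - 2 >= 1.\<close>
  define q where "q x = (norm (x - p))^2 + d^2" for x :: "real^'n"
  have q: "q x > 0" for x using d by (simp add: q_def add_nonneg_pos)
  have sq: "smooth_on UNIV q"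
   unfolding q_def[abs_def] by (intro smooth_on_add smooth_on_const smooth_dist_square open_UNIV)
  have s: "smooth_on UNIV (%x. inverse (q x))"
   by (intro smooth_on_inverse sq open_UNIV) (use q in \<open>auto simp: less_le\<close>)
  have "grad q x $ j = 2 * (x $ j - p $ j)" for x j
  proof -
   have "(q has_derivative (%h. 2 * ((x - p) \<bullet> h))) (at x)"
    using has_derivative_add[OF dist_square_derivative has_derivative_const[of "d^2"]]
    by (simp add: q_def[abs_def])
   from grad_eqI[OF this] show ?thesis by (simp add: inner_axis)
  qed
  then have gq: "grad (%x. inverse (q x)) x $ j = - (inverse (q x))\<^sup>2 * (2 * (x $ j - p $ j))" for x j
   using q[of x] by (subst grad_real_compose[where g=inverse and g'="- (inverse (q x))\<^sup>2"])
    (auto intro!: smooth_on_differentiable[OF open_UNIV sq] derivative_eq_intros simp: power2_eq_square)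
  have D: "inverse (q x) <= (\<Sum>j\<in>UNIV. inverse (q x) + (x $ j - p $ j) * grad (%x. inverse (q x)) x $ j)" for x
  proof -
   have "(\<Sum>j\<in>UNIV. (x $ j - p $ j) * grad (%x. inverse (q x)) x $ j) = - 2 * (inverse (q x))\<^sup>2 * (norm (x - p))\<^sup>2"
   proof -
    have "(\<Sum>j\<in>UNIV. (x $ j - p $ j) * grad (%x. inverse (q x)) x $ j) = (\<Sum>j\<in>UNIV. (- 2 * (inverse (q x))\<^sup>2) * ((x - p) $ j)\<^sup>2)"
     unfolding gq by (intro sum.cong refl) (simp add: power2_eq_square)
    also have "\<dots> = (- 2 * (inverse (q x))\<^sup>2) * (\<Sum>j\<in>UNIV. ((x - p) $ j)\<^sup>2)"
     by (rule sum_distrib_left[symmetric])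
    also have "(\<Sum>j\<in>UNIV. ((x - p) $ j)^2) = (norm (x - p))^2"
     by (simp add: norm_vec_def L2_set_def sum_nonneg)
    finally show ?thesis .
   qed
   moreover have "(inverse (q x))^2 * (norm (x - p))^2 <= inverse (q x)"
    using q[of x] by (simp add: q_def power2_eq_square divide_simps)
   moreover have "3 * inverse (q x) <= ?n * inverse (q x)"
    using n3 q[of x] by (intro mult_right_mono) auto
   ultimately show ?thesis by (simp add: sum.distrib)
  qed
  have *: "(\<integral>x. (u x)^2 * inverse (q x) \<partial>lborel) <= 4 * 1 * dirichlet u" "integrable lborel (%x. (u x)^2 * inverse (q x))"
  proof (atomize(full), intro conjI hardy_inequality[OF u s _ D])
   fix x show "0 <= inverse (q x)" using q[of x] by simp
   show "(norm (x - p))^2 * inverse (q x) <= 1" using q[of x] by (simp add: q_def divide_simps)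
   show "0 <= inverse (q x)" using q[of x] by simp
   show "(norm (x - p))^2 * inverse (q x) <= 1" using q[of x] by (simp add: q_def divide_simps)
  qed
  have "inverse (2 * ?n * d^2) * d ^ CARD('n) <= (\<integral>x. (u x)^2 * inverse (q x) \<partial>lborel)"
  proof (rule integral_cube_lower[OF *(2), of d p])
   fix x assume x: "x \<in> cube p d"
   have "q x <= 2 * ?n * d^2"
   proof -
    have "1 * d^2 <= ?n * d^2" using n by (intro mult_right_mono) auto
    moreover have "?n * (d / 2)^2 <= ?n * d^2" by (intro mult_left_mono) (auto simp: power_divide)
    ultimately show ?thesis using cube_norm[OF x] unfolding q_def mult.assoc by linarith
   qed
   then have "inverse (2 * ?n * d^2) <= inverse (q x)" using q[of x] by (intro le_imp_inverse_le) auto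
   then show "inverse (2 * ?n * d^2) <= (u x)^2 * inverse (q x)" using 1[of x] x N by auto
  qed (use d q in \<open>auto intro!: mult_nonneg_nonneg simp: less_imp_le\<close>)
  with *(1) have "inverse (2 * ?n * d^2) * (d ^ (CARD('n) - 2) * d^2) <= 4 * dirichlet u" by (simp add: pow)
  then show ?thesis using d by (simp add: field_simps)
 qed
 then show "ennreal (d ^ (CARD('n) - 2) / (8 * ?n)) <= ennreal (dirichlet u)" by (rule ennreal_leI)
qed

lemma dirichlet_le_cube:
 fixes u :: "real^'n => real"
 assumes u: "u \<in> test_functions G" and r: "r >= 0" and B: "!!x. x \<in> cube p r ==> norm (grad u x) <= B" and 0: "!!x. x \<notin> cube p r ==> grad u x = 0"
 shows "dirichlet u <= B^2 * r ^ CARD('n)"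
proof -
 have i: "integrable lborel (%x. indicator (cube p r) x *\<^sub>R B^2)"
  by (intro borel_integrable_compact compact_cube) auto
 have "dirichlet u <= (\<integral>x. indicator (cube p r) x *\<^sub>R B^2 \<partial>lborel)"
  unfolding dirichlet_def
  by (intro integral_mono test_integrable_grad[OF u] i) (use B 0 in \<open>auto simp: indicator_def power_mono\<close>)
 also have "\<dots> = B^2 * r ^ CARD('n)" using r by (simp add: measure_def emeasure_cube)
 finally show ?thesis .
qed

lemma wiener_cap_cube_upper:
 assumes n: "CARD('n) >= 2"
 shows "\<exists>C>0. \<forall>(p :: real^'n) d. d > 0 \<longrightarrow> wiener_cap p d (cube p d) <= ennreal (C * d ^ (CARD('n) - 2))"
proof (intro exI conjI allI impI)
 let ?n = "real CARD('n)"
 let ?C = "(20 * ?n * step_slope)^2 * 2 ^ CARD('n)"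
 have "?n > 0" by simp
 then show "?C > 0" using step_slope(1) by (intro mult_pos_pos zero_less_power) auto
 fix p :: "real^'n" and d :: real assume d: "d > 0"
 have pow: "d ^ CARD('n) = d ^ (CARD('n) - 2) * d^2"
  using n by (metis le_add_diff_inverse2 power_add)
 \<comment> \<open>Half-widths strictly between d / 2 and d: the cutoff is 1 around the cube, and
   its support lies inside the doubled cube, as dimension 2 demands.\<close>
 let ?a = "3 / 5 * d" and ?b = "9 / 10 * d"
 have ab: "0 < ?a" "?a < ?b" using d by auto
 have test: "cutoff p ?a ?b \<in> test_functions (cap_dom p d)"
  using cutoff_test[OF ab, of "2 * d" p] d test_functions_mono[OF cap_dom_subset] by auto
 have "wiener_cap p d (cube p d) <= ennreal (dirichlet (cutoff p ?a ?b))"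
 proof (rule wiener_cap_le[OF test, of "interior (cube p (2 * ?a))"])
  show "cube p d \<subseteq> interior (cube p (2 * ?a))" using d by (intro cube_subset_interior) simp
  show "cutoff p ?a ?b x = 1" if "x \<in> interior (cube p (2 * ?a))" for x
   using that by (intro cutoff_eq_1[OF ab]) (auto simp: mem_interior_cube intro: less_imp_le)
 qed auto
 also have "dirichlet (cutoff p ?a ?b) <= (20 * ?n * step_slope / d)^2 * (2 * d) ^ CARD('n)"
 proof (rule dirichlet_le_cube[OF test])
  fix x :: "real^'n"
  have "norm (grad (cutoff p ?a ?b) x) <= 2 * ?n * step_slope / (?b - ?a)"
   by (rule norm_grad_cutoff[OF ab])
  also have "\<dots> <= 20 * ?n * step_slope / d"
   using d step_slope(1) by (simp add: field_simps)
  finally show "norm (grad (cutoff p ?a ?b) x) <= 20 * ?n * step_slope / d" .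
  assume x: "x \<notin> cube p (2 * d)"
  have "grad (cutoff p ?a ?b) x = grad (%x. 0) x"
  proof (rule grad_cong_open[of "- cube p (2 * d)"])
   fix y assume "y \<in> - cube p (2 * d)"
   then obtain i where "\<bar>y $ i - p $ i\<bar> > d" by (auto simp: mem_cube not_le)
   then show "cutoff p ?a ?b y = 0" using d by (intro cutoff_eq_0[OF ab, where i = i]) auto
  qed (use x compact_cube compact_imp_closed in \<open>auto simp: open_Compl\<close>)
  then show "grad (cutoff p ?a ?b) x = 0" by (simp only: grad_const)
 qed (use d in auto)
 also have "(20 * ?n * step_slope / d)^2 * (2 * d) ^ CARD('n) = ?C * d ^ (CARD('n) - 2)"
  using d by (simp add: power_mult_distrib pow power_divide)
 finally show "wiener_cap p d (cube p d) <= ennreal (?C * d ^ (CARD('n) - 2))" by (simp add: ennreal_leI)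
qed

text \<open>A competitor for the smaller cube is pulled back by the coordinatewise map, which sends
  the cube of size \<open>d\<close> into the one of size \<open>r\<close>. The gradient grows by at
  most \<open>M\<close> and the Jacobian is at least \<open>m ^ n\<close>. In dimension 2 the
  hypothesis \<open>outer\<close> keeps the support inside the doubled cube.\<close>

lemma wiener_cap_deform:
 fixes \<theta> \<theta>' :: "real => real" and \<psi> :: "real^'n => real"
 assumes \<psi>: "\<psi> \<in> test_functions (cap_dom p d)" and N: "open N" "cube p r \<subseteq> N" "!!x. x \<in> N ==> \<psi> x = 1"
  and der: "!!t. (\<theta> has_real_derivative \<theta>' t) (at t)" and cont: "continuous_on UNIV \<theta>'"
  and ge: "!!t. m <= \<theta>' t" and m: "m > 0" and \<theta>0: "\<theta> 0 = 0"
  and sm: "!!i. smooth_on UNIV (%x::real^'n. \<theta> (x $ i - p $ i))"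
  and inner: "!!t. \<bar>t\<bar> <= d / 2 ==> \<bar>\<theta> t\<bar> <= r / 2"
  and outer: "!!t. CARD('n) = 2 ==> \<bar>\<theta> t\<bar> < d ==> \<bar>t\<bar> < d"
  and M: "!!t. (CARD('n) = 2 \<longrightarrow> \<bar>t\<bar> < d) ==> \<theta>' t <= M"
 shows "ennreal (m ^ CARD('n)) * wiener_cap p d (cube p d) <= ennreal (M^2) * ennreal (dirichlet \<psi>)"
proof -
 define T where "T x = (\<chi> i. p $ i + \<theta> (x $ i - p $ i))" for x :: "real^'n"
 define v where "v x = \<psi> (T x)" for x
 have s\<psi>: "smooth_on UNIV \<psi>" using test_functions_smooth[OF \<psi>] .
 have sT: "smooth_on UNIV (%x. T x $ i)" for i
  unfolding T_def by (simp, intro smooth_on_add smooth_on_const sm open_UNIV)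
 have sv: "smooth_on UNIV v"
  unfolding v_def[abs_def] by (rule smooth_on_compose[OF open_UNIV open_UNIV _ sT s\<psi>]) auto
 have cT: "continuous_on UNIV T"
  using continuous_on_vec_lambda[of UNIV "%i x. T x $ i"] smooth_on_continuous[OF sT] by simp
 obtain K where K: "compact K" "K \<subseteq> cap_dom p d" "!!x. x \<notin> K ==> \<psi> x = 0" "!!x. x \<notin> K ==> grad \<psi> x = 0"
  using test_functionsD[OF \<psi>] by metis
 \<comment> \<open>The map expands distances from the origin by at least \<open>m\<close>; hence the
   preimage of the compact support stays bounded.\<close>
 have lower: "m * \<bar>t\<bar> <= \<bar>\<theta> t\<bar>" for t
 proof -
  have c\<theta>: "m * (t - s) <= \<theta> t - \<theta> s" if st: "s <= t" for s t
  proof (cases "s = t")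
   case False
   then obtain z where "\<theta> t - \<theta> s = (t - s) * \<theta>' z" using MVT2[OF _ der, of s t] st by (auto simp: less_le)
   then show ?thesis using mult_right_mono[OF ge[of z], of "t - s"] st by (simp add: mult.commute)
  qed simp
  show ?thesis
  proof (cases "t >= 0")
   case True
   then show ?thesis using c\<theta>[of 0 t] \<theta>0 by simp
  next
   case False
   then show ?thesis using c\<theta>[of t 0] \<theta>0 by simp
  qed
 qed
 define K' where "K' = T -` K"
 have "closed K'" unfolding K'_def
  using continuous_closed_vimage[of K T] compact_imp_closed[OF K(1)] cT continuous_on_eq_continuous_within by blast
 moreover have "bounded K'"
 proof -
  obtain R where R: "!!y. y \<in> K ==> norm y <= R" using compact_imp_bounded[OF K(1)] unfolding bounded_iff by blast
  have "\<forall>x\<in>K'. norm x <= (\<Sum>i\<in>(UNIV :: 'n set). \<bar>p $ i\<bar> + (R + \<bar>p $ i\<bar>) / m)"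
  proof
   fix x assume "x \<in> K'"
   then have "norm (T x) <= R" using R by (auto simp: K'_def)
   have "\<bar>x $ i\<bar> <= \<bar>p $ i\<bar> + (R + \<bar>p $ i\<bar>) / m" for i
   proof -
    have "\<bar>T x $ i\<bar> <= R" using component_le_norm_cart[of "T x" i] \<open>norm (T x) <= R\<close> by linarith
    then have "\<bar>\<theta> (x $ i - p $ i)\<bar> <= R + \<bar>p $ i\<bar>" by (simp add: T_def)
    with lower[of "x $ i - p $ i"] have "m * \<bar>x $ i - p $ i\<bar> <= R + \<bar>p $ i\<bar>" by linarith
    then have "\<bar>x $ i - p $ i\<bar> <= (R + \<bar>p $ i\<bar>) / m" using m by (simp add: field_simps)
    then show ?thesis by linarith
   qed
   then have "(\<Sum>i\<in>UNIV. \<bar>x $ i\<bar>) <= (\<Sum>i\<in>(UNIV :: 'n set). \<bar>p $ i\<bar> + (R + \<bar>p $ i\<bar>) / m)"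
    by (intro sum_mono)
   then show "norm x <= (\<Sum>i\<in>(UNIV :: 'n set). \<bar>p $ i\<bar> + (R + \<bar>p $ i\<bar>) / m)"
    using norm_le_l1_cart[of x] by linarith
  qed
  then show ?thesis unfolding bounded_iff by blast
 qed
 ultimately have K': "compact K'" by (simp add: compact_eq_bounded_closed)
 have in_dom: "CARD('n) = 2 ==> \<bar>x $ i - p $ i\<bar> < d" if "T x \<in> cap_dom p d" for x i
  using that outer[of "x $ i - p $ i"] by (auto simp: cap_dom_def mem_interior_cube T_def)
 have K'dom: "K' \<subseteq> cap_dom p d"
  using in_dom K(2) by (auto simp: K'_def cap_dom_def mem_interior_cube)
 have v: "v \<in> test_functions (cap_dom p d)"
  by (rule test_functionsI[OF sv K' K'dom]) (auto simp: v_def K'_def K(3))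
 have "wiener_cap p d (cube p d) <= ennreal (dirichlet v)"
 proof (rule wiener_cap_le[OF v, of "T -` N"])
  show "open (T -` N)" using cT N(1) by (simp add: continuous_on_open_vimage)
  show "cube p d \<subseteq> T -` N"
   using N(2) inner by (auto simp: mem_cube T_def subset_iff)
 qed (auto simp: v_def N(3))
 also have "ennreal (dirichlet v) = (\<integral>\<^sup>+x. ennreal ((norm (grad v x))^2) \<partial>lborel)"
  by (rule dirichlet_eq[OF v, symmetric])
 also have "\<dots> <= (\<integral>\<^sup>+x. ennreal (M^2) * ennreal ((norm (grad \<psi> (T x)))^2) \<partial>lborel)"
 proof (rule nn_integral_mono)
  fix x :: "real^'n"
  have g: "grad v x $ j = \<theta>' (x $ j - p $ j) * grad \<psi> (T x) $ j" for j
  proof -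
   have "(T has_derivative (%h. \<chi> i. \<theta>' (x $ i - p $ i) * h $ i)) (at x)"
    unfolding has_derivative_componentwise_within[of T]
   proof
    fix b :: "real^'n" assume "b \<in> Basis"
    then obtain i where b: "b = axis i 1" by (auto simp: Basis_vec_def)
    have "((%x. x $ i - p $ i) has_derivative (%h. h $ i)) (at x)"
     by (auto intro!: derivative_eq_intros bounded_linear_imp_has_derivative bounded_linear_vec_nth)
    from has_derivative_compose[OF this der[unfolded has_field_derivative_def]]
    have "((%x. p $ i + \<theta> (x $ i - p $ i)) has_derivative (%h. \<theta>' (x $ i - p $ i) * h $ i)) (at x)"
     by (auto intro!: derivative_eq_intros)
    then show "((%x. T x \<bullet> b) has_derivative (%h. (\<chi> i. \<theta>' (x $ i - p $ i) * h $ i) \<bullet> b)) (at x)"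
     by (simp add: b inner_axis T_def)
   qed
   from has_derivative_compose[OF this smooth_on_has_derivative[OF open_UNIV s\<psi> UNIV_I]]
   have "grad v x $ j = frechet_derivative \<psi> (at (T x)) (\<chi> i. \<theta>' (x $ i - p $ i) * axis j 1 $ i)"
    unfolding v_def[abs_def] by (rule grad_eqI)
   also have "(\<chi> i. \<theta>' (x $ i - p $ i) * axis j 1 $ i) = \<theta>' (x $ j - p $ j) *\<^sub>R axis j 1"
    by (auto simp: vec_eq_iff axis_def)
   also have "frechet_derivative \<psi> (at (T x)) (\<theta>' (x $ j - p $ j) *\<^sub>R axis j 1) = \<theta>' (x $ j - p $ j) * grad \<psi> (T x) $ j"
    using linear_cmul[OF has_derivative_linear[OF smooth_on_has_derivative[OF open_UNIV s\<psi>, of "T x"]]]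
    by (simp add: grad_nth)
   finally show ?thesis .
  qed
  have "(norm (grad v x))^2 <= M^2 * (norm (grad \<psi> (T x)))^2"
  proof (cases "T x \<in> K")
   case True
   have "(grad v x $ j)^2 <= M^2 * (grad \<psi> (T x) $ j)^2" for j
   proof -
    have "\<theta>' (x $ j - p $ j) <= M" using M in_dom[of x j] True K(2) by blast
    moreover have "0 <= \<theta>' (x $ j - p $ j)" using ge[of "x $ j - p $ j"] m by linarith
    ultimately show ?thesis unfolding g power_mult_distrib by (intro mult_right_mono power_mono) auto
   qed
   then show ?thesis unfolding norm_grad_sum sum_distrib_left by (intro sum_mono) simp
  next
   case False
   then have "grad v x = 0" by (simp add: vec_eq_iff g K(4))
   then show ?thesis by simp
  qed
  then show "ennreal ((norm (grad v x))^2) <= ennreal (M^2) * ennreal ((norm (grad \<psi> (T x)))^2)"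
   by (simp add: ennreal_mult[symmetric] ennreal_leI)
 qed
 also have "\<dots> = ennreal (M^2) * (\<integral>\<^sup>+x. ennreal ((norm (grad \<psi> (T x)))^2) \<partial>lborel)"
 proof (rule nn_integral_cmult)
  have [measurable]: "T \<in> borel_measurable borel" "grad \<psi> \<in> borel_measurable borel"
   using borel_measurable_continuous_onI[OF cT] smooth_grad_borel[OF s\<psi>] by auto
  show "(%x. ennreal ((norm (grad \<psi> (T x)))^2)) \<in> borel_measurable lborel" by measurable
 qed
 finally have 1: "wiener_cap p d (cube p d) <= ennreal (M^2) * (\<integral>\<^sup>+x. ennreal ((norm (grad \<psi> (T x)))^2) \<partial>lborel)" .
 define F where "F y = ennreal ((norm (grad \<psi> (p + y)))^2)" for y
 have [measurable]: "grad \<psi> \<in> borel_measurable borel" by (rule smooth_grad_borel[OF s\<psi>])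
 have [measurable]: "F \<in> borel_measurable borel" unfolding F_def by measurable
 have c\<theta>: "continuous_on UNIV \<theta>" using der DERIV_isCont continuous_at_imp_continuous_on by blast
 have [measurable]: "(%x :: real^'n. \<chi> i. \<theta> (x $ i)) \<in> borel_measurable borel"
  by (intro borel_measurable_continuous_onI continuous_on_vec_lambda continuous_on_compose2[OF c\<theta>]) (auto intro: continuous_intros)
 have "(\<integral>\<^sup>+x. ennreal ((norm (grad \<psi> (T x)))\<^sup>2) \<partial>lborel) = (\<integral>\<^sup>+x. F (\<chi> i. \<theta> ((- p + 1 *\<^sub>R x) $ i)) \<partial>lborel)"
  by (intro nn_integral_cong) (simp add: F_def T_def vec_eq_iff plus_vec_def)
 also have "\<dots> = (\<integral>\<^sup>+x. F (\<chi> i. \<theta> (x $ i)) \<partial>lborel)"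
  using nn_integral_affine[of "%x. F (\<chi> i. \<theta> (x $ i))" 1 "- p"] by simp
 finally have 2: "ennreal (m ^ CARD('n)) * (\<integral>\<^sup>+x. ennreal ((norm (grad \<psi> (T x)))^2) \<partial>lborel) <= (\<integral>\<^sup>+x. F x \<partial>lborel)"
  using coordinate_change_le[of F m \<theta> \<theta>', OF _ m der cont ge] by simp
 have 3: "(\<integral>\<^sup>+x. F x \<partial>lborel) = ennreal (dirichlet \<psi>)"
  using nn_integral_affine[of "%x. ennreal ((norm (grad \<psi> x))^2)" 1 p] dirichlet_eq[OF \<psi>] by (simp add: F_def)
 have "ennreal (m ^ CARD('n)) * wiener_cap p d (cube p d)
   <= ennreal (M^2) * (ennreal (m ^ CARD('n)) * (\<integral>\<^sup>+x. ennreal ((norm (grad \<psi> (T x)))^2) \<partial>lborel))"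
  using mult_left_mono[OF 1, of "ennreal (m ^ CARD('n))"] by (simp add: mult.left_commute)
 also have "\<dots> <= ennreal (M^2) * ennreal (dirichlet \<psi>)"
  using 2 3 by (intro mult_left_mono) auto
 finally show ?thesis .
qed


lemma continuous_witness:
 fixes f :: "real => real"
 assumes "isCont f 0" "f 0 > c" "b > 0"
 shows "\<exists>t. 0 < t \<and> t < b \<and> f t > c"
proof -
 obtain e where e: "e > 0" "!!x. \<bar>x\<bar> < e ==> \<bar>f x - f 0\<bar> < f 0 - c"
  using assms(1,2) unfolding continuous_at_eps_delta dist_real_def by (metis diff_gt_0_iff_gt diff_zero)
 then have "\<bar>f (min e b / 2) - f 0\<bar> < f 0 - c" using assms(3) by (intro e(2)) auto
 then show ?thesis using e(1) assms(3) by (intro exI[of _ "min e b / 2"]) (auto simp: min_def)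
qed

text \<open>Continuity of the capacity of cubes from inside, stated for competitors: to be 1 near a
  slightly smaller cube costs almost the capacity of the full cube. Above dimension 2 a dilation
  compares the two cubes. In dimension 2 a dilation would move the outer cube as well, and a
  deformation fixing its boundary replaces it.\<close>

lemma wiener_cap_shrink:
 assumes n: "CARD('n) >= 2" and \<kappa>: "\<kappa> < 1" "0 < \<kappa>"
 shows "\<exists>\<delta>>0. \<delta> < 1 \<and> (\<forall>(p :: real^'n) d \<psi> N. d > 0 \<and> \<psi> \<in> test_functions (cap_dom p d) \<and> open N \<and>
   cube p ((1 - \<delta>) * d) \<subseteq> N \<and> (\<forall>x\<in>N. \<psi> x = 1) \<longrightarrow> ennreal \<kappa> * wiener_cap p d (cube p d) <= ennreal (dirichlet \<psi>))"
proof -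
 have fin: "ennreal \<kappa> * w <= ennreal D" if "ennreal a * w <= ennreal (M^2) * ennreal D" "\<kappa> * M^2 <= a" "M > 0" "D >= 0" for w a M D
 proof -
  have "ennreal (M^2) * (ennreal \<kappa> * w) = ennreal (\<kappa> * M^2) * w"
   using \<kappa> by (simp add: ennreal_mult mult.assoc mult.left_commute mult.commute)
  also have "\<dots> <= ennreal a * w" using that by (intro mult_right_mono ennreal_leI) auto
  also note that(1)
  finally show ?thesis
   using that(3) by (simp add: ennreal_mult_le_mult_iff)
 qed
 show ?thesis
 proof (cases "CARD('n) = 2")
  case True
  have "isCont (%c::real. ((1 - c) / (1 + 2 * c))^2) 0" by (intro continuous_intros) auto
  then obtain c :: real where c: "0 < c" "c < 1" "((1 - c) / (1 + 2 * c))^2 > \<kappa>"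
   using continuous_witness[of "%c. ((1 - c) / (1 + 2 * c))^2" \<kappa> 1] \<kappa> by auto
  have "ennreal \<kappa> * wiener_cap p d (cube p d) <= ennreal (dirichlet \<psi>)"
   if d: "d > 0" and \<psi>: "\<psi> \<in> test_functions (cap_dom p d)" and N: "open N" "cube p ((1 - 3 / 4 * c) * d) \<subseteq> N" "!!x. x \<in> N ==> \<psi> x = 1"
   for p :: "real^'n" and d \<psi> N
  proof -
   \<comment> \<open>With this coefficient the cubic \<theta> fixes the points d and -d, that is the
     outer boundary, while it maps d / 2 to (1 - 3 c / 4) d / 2. On the doubled cube its derivative
     lies between 1 - c and 1 + 2 c.\<close>
   define k where "k = c / d^2"
   have k: "k >= 0" "k * t^2 = c * (t^2 / d^2)" for t using c by (auto simp: k_def)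
   define \<theta> where "\<theta> s = (1 - c) * s + k * s ^ 3" for s
   define \<theta>' where "\<theta>' s = (1 - c) + 3 * (k * s^2)" for s
   have "ennreal ((1 - c) ^ CARD('n)) * wiener_cap p d (cube p d) <= ennreal ((1 + 2 * c)^2) * ennreal (dirichlet \<psi>)"
   proof (rule wiener_cap_deform[OF \<psi> N, of \<theta> \<theta>'])
    show "(\<theta> has_real_derivative \<theta>' t) (at t)" for t
     unfolding \<theta>_def[abs_def] \<theta>'_def by (auto intro!: derivative_eq_intros simp: algebra_simps)
    show "continuous_on UNIV \<theta>'" unfolding \<theta>'_def[abs_def] by (intro continuous_intros)
    show "1 - c <= \<theta>' t" for t using k(1) by (simp add: \<theta>'_def)
    show "smooth_on UNIV (%x::real^'n. \<theta> (x $ i - p $ i))" for i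
     unfolding \<theta>_def
     by (intro smooth_on_add smooth_on_mult smooth_on_power smooth_on_diff smooth_on_coord smooth_on_const open_UNIV)
    have abs\<theta>: "\<bar>\<theta> t\<bar> = \<bar>t\<bar> * ((1 - c) + c * (t^2 / d^2))" for t
    proof -
     have "\<theta> t = t * ((1 - c) + c * (t^2 / d^2))"
      unfolding k(2)[symmetric] by (simp add: \<theta>_def power2_eq_square power3_eq_cube algebra_simps)
     then show ?thesis using c by (simp add: abs_mult)
    qed
    show "\<bar>\<theta> t\<bar> <= (1 - 3 / 4 * c) * d / 2" if "\<bar>t\<bar> <= d / 2" for t
    proof -
     have "t^2 <= (d / 2)^2" using that d by (simp add: abs_le_square_iff[symmetric])
     then have "t^2 / d^2 <= 1 / 4" using d by (simp add: divide_simps power2_eq_square)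
     then have "(1 - c) + c * (t^2 / d^2) <= (1 - c) + c * (1 / 4)" using c by (intro add_left_mono mult_left_mono) auto
     then have "\<bar>\<theta> t\<bar> <= (d / 2) * ((1 - c) + c * (1 / 4))" unfolding abs\<theta> using that c d by (intro mult_mono) auto
     then show ?thesis by (simp add: algebra_simps)
    qed
    show "\<bar>t\<bar> < d" if "\<bar>\<theta> t\<bar> < d" for t
    proof (rule ccontr)
     assume "\<not> \<bar>t\<bar> < d"
     then have t: "d <= \<bar>t\<bar>" by simp
     then have "d^2 <= t^2" using d by (simp add: abs_le_square_iff[symmetric])
     then have "1 <= t^2 / d^2" using d by simp
     then have "c * 1 <= c * (t^2 / d^2)" using c by (intro mult_left_mono) auto
     then have "d * 1 <= \<bar>t\<bar> * ((1 - c) + c * (t^2 / d^2))" using t d by (intro mult_mono) auto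
     with that show False unfolding abs\<theta> by simp
    qed
    show "\<theta>' t <= 1 + 2 * c" if "CARD('n) = 2 \<longrightarrow> \<bar>t\<bar> < d" for t
    proof -
     have "t^2 <= d^2" using that True d by (simp add: abs_le_square_iff[symmetric])
     then have "t^2 / d^2 <= 1" using d by simp
     then have "3 * c * (t^2 / d^2) <= 3 * c * 1" using c by (intro mult_left_mono) auto
     then show ?thesis by (simp add: \<theta>'_def k(2))
    qed
   qed (use c in \<open>auto simp: \<theta>_def\<close>)
   moreover have "\<kappa> * (1 + 2 * c)^2 <= (1 - c) ^ CARD('n)"
    using c by (simp add: True power_divide pos_less_divide_eq less_imp_le)
   ultimately show ?thesis using c by (intro fin[of "(1 - c) ^ CARD('n)" _ "1 + 2 * c"]) (auto intro: dirichlet_nonneg)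
  qed
  then show ?thesis using c by (intro exI[of _ "3 / 4 * c"]) auto
 next
  case False
  have "isCont (%c::real. (1 - c) ^ CARD('n)) 0" by (intro continuous_intros)
  then obtain c :: real where c: "0 < c" "c < 1" "(1 - c) ^ CARD('n) > \<kappa>"
   using continuous_witness[of "%c. (1 - c) ^ CARD('n)" \<kappa> 1] \<kappa> by auto
  have "ennreal \<kappa> * wiener_cap p d (cube p d) <= ennreal (dirichlet \<psi>)"
   if d: "d > 0" and \<psi>: "\<psi> \<in> test_functions (cap_dom p d)" and N: "open N" "cube p ((1 - c) * d) \<subseteq> N" "!!x. x \<in> N ==> \<psi> x = 1"
   for p :: "real^'n" and d \<psi> N
  proof -
   have "ennreal ((1 - c) ^ CARD('n)) * wiener_cap p d (cube p d) <= ennreal (1^2) * ennreal (dirichlet \<psi>)"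
   proof (rule wiener_cap_deform[OF \<psi> N, of "%s. (1 - c) * s" "%s. 1 - c"])
    show "smooth_on UNIV (%x::real^'n. (1 - c) * (x $ i - p $ i))" for i
     by (intro smooth_on_mult smooth_on_diff smooth_on_coord smooth_on_const open_UNIV)
    show "\<bar>(1 - c) * t\<bar> <= (1 - c) * d / 2" if "\<bar>t\<bar> <= d / 2" for t
     using mult_left_mono[OF that, of "1 - c"] c by (simp add: abs_mult)
   qed (use c False in \<open>auto intro!: derivative_eq_intros\<close>)
   then show ?thesis using c by (intro fin[of "(1 - c) ^ CARD('n)" _ "1"]) (auto intro: dirichlet_nonneg)
  qed
  then show ?thesis using c by (intro exI[of _ c]) auto
 qed
qed

lemma sin_ratio_witness:
 assumes "c > (1::real)"
 shows "\<exists>k. 0 < k \<and> k < 1 \<and> sin k > 0 \<and> (k / sin k)^2 < c"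
proof -
 have "((%k::real. sin k / k) \<longlongrightarrow> 1) (at 0)"
  using DERIV_sin[of 0] by (simp add: has_field_derivative_iff)
 then have "((%k::real. (1 / (sin k / k))^2) \<longlongrightarrow> (1 / 1)^2) (at 0)"
  by (intro tendsto_intros) auto
 then have "\<forall>\<^sub>F k::real in at 0. (1 / (sin k / k))^2 < c"
  using assms by (intro order_tendstoD(2)[where y="(1/1)^2"]) auto
 then have ev: "\<forall>\<^sub>F k::real in at_right 0. (1 / (sin k / k))^2 < c"
  by (simp add: eventually_at_split)
 have "\<forall>\<^sub>F k::real in at_right 0. 0 < k \<and> k < 1"
  by (simp add: eventually_at_right_less eventually_conj_iff eventually_at_right_field) (metis zero_less_one)
 from eventually_happens'[OF _ eventually_conj[OF ev this]]
 obtain k :: real where k: "(1 / (sin k / k))^2 < c" "0 < k" "k < 1" by auto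
 then have "sin k > 0" using pi_gt3 by (intro sin_gt_zero) auto
 with k show ?thesis by auto
qed

text \<open>The heart of the upper bound. From a nearly optimal potential of \<open>F\<close> a
  cutoff is formed that vanishes near \<open>F\<close> and near the boundary of the cube. Its mass
  is bounded from below because otherwise a competitor for a slightly smaller cube would have too
  little energy; this is where \<gamma> < 1 is used.\<close>

lemma capacity_cutoff:
 assumes n: "CARD('n) >= 2" and \<gamma>: "0 < \<gamma>" "\<gamma> < 1"
 shows "\<exists>B C c. B > 0 \<and> C > 0 \<and> c > 0 \<and> (\<forall>(p :: real^'n) d F. d > 0 \<and> compact F \<and>
   wiener_cap p d F <= ennreal \<gamma> * wiener_cap p d (cube p d) \<longrightarrow>
   (\<exists>g::real^'n => real. g \<in> test_functions (interior (cube p d) - F) \<and> (\<forall>x. \<bar>g x\<bar> <= B) \<and>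
    dirichlet g <= C * d ^ (CARD('n) - 2) \<and> c * d ^ CARD('n) <= (\<integral>x. (g x)^2 \<partial>lborel)))"
proof -
 let ?n = "real CARD('n)"
 \<comment> \<open>The gap between \<gamma> and 1 is cut into five equal pieces. They pay in turn
   for the non-optimal potential (\<open>\<gamma>1\<close>), the sine (\<open>\<gamma>2\<close>),
   the Young inequality (\<open>\<gamma>3\<close>), the mass of the cutoff (\<open>\<kappa>\<close>)
   and the shrinking of the cube.\<close>
 define h where "h = (1 - \<gamma>) / 5"
 define \<gamma>1 where "\<gamma>1 = \<gamma> + h"
 define \<gamma>2 where "\<gamma>2 = \<gamma> + 2 * h"
 define \<gamma>3 where "\<gamma>3 = \<gamma> + 3 * h"
 define \<kappa> where "\<kappa> = \<gamma> + 4 * h"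
 have h: "h > 0" using \<gamma> by (simp add: h_def)
 have "\<kappa> < 1" using \<gamma> by (simp add: \<kappa>_def h_def field_simps)
 moreover have "\<kappa> > 0" using \<gamma> h by (simp add: \<kappa>_def)
 ultimately obtain \<delta> where \<delta>: "\<delta> > 0" "\<delta> < 1" and shrink: "!!(p :: real^'n) d \<psi> N. d > 0 ==> \<psi> \<in> test_functions (cap_dom p d) ==> open N ==>
   cube p ((1 - \<delta>) * d) \<subseteq> N ==> (!!x. x \<in> N ==> \<psi> x = 1) ==> ennreal \<kappa> * wiener_cap p d (cube p d) <= ennreal (dirichlet \<psi>)"
  using wiener_cap_shrink[OF n, of \<kappa>] by meson
 obtain C0 where C0: "C0 > 0" "!!(p :: real^'n) d. d > 0 ==> wiener_cap p d (cube p d) <= ennreal (C0 * d ^ (CARD('n) - 2))"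
  using wiener_cap_cube_upper[OF n] by meson
 have "\<gamma>2 / \<gamma>1 > 1" using h \<gamma> by (simp add: \<gamma>1_def \<gamma>2_def)
 then obtain k where k: "0 < k" "k < 1" "sin k > 0" "(k / sin k)^2 < \<gamma>2 / \<gamma>1" using sin_ratio_witness by blast
 define s where "s = \<gamma>3 / \<gamma>2 - 1"
 have s: "s > 0" "(1 + s) * \<gamma>2 = \<gamma>3" using h \<gamma> by (auto simp: s_def \<gamma>2_def \<gamma>3_def field_simps)
 define B where "B = 1 / sin k"
 define A where "A = 16 * ?n * step_slope / \<delta>"
 have A: "A > 0" using step_slope(1) \<delta> by (simp add: A_def)
 define C where "C = 2 * \<gamma>2 * C0 + 2 * (B^2 * A^2)"
 define c where "c = h / (8 * ?n * ((1 + 1 / s) * (4 * A^2)))"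
 have B: "B > 0" using k by (simp add: B_def)
 have C: "C > 0" unfolding C_def using A B C0 \<gamma> h by (intro add_pos_pos mult_pos_pos) (auto simp: \<gamma>2_def)
 have c: "c > 0" unfolding c_def using A h s by (intro divide_pos_pos mult_pos_pos add_pos_pos zero_less_power) auto
 have main: "\<exists>g::real^'n => real. g \<in> test_functions (interior (cube p d) - F) \<and> (\<forall>x. \<bar>g x\<bar> <= B) \<and>
    dirichlet g <= C * d ^ (CARD('n) - 2) \<and> c * d ^ CARD('n) <= (\<integral>x. (g x)^2 \<partial>lborel)"
  if d: "d > 0" and F: "compact F" "wiener_cap p d F <= ennreal \<gamma> * wiener_cap p d (cube p d)" for p :: "real^'n" and d F
 proof -
  have pow: "d ^ CARD('n) = d ^ (CARD('n) - 2) * d^2"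
   using n by (metis le_add_diff_inverse2 power_add)
  define W where "W = enn2real (wiener_cap p d (cube p d))"
  have "wiener_cap p d (cube p d) < \<infinity>" using C0(2)[OF d, of p] le_less_trans by fastforce
  then have W: "wiener_cap p d (cube p d) = ennreal W" "W >= 0" by (auto simp: W_def)
  have W1: "d ^ (CARD('n) - 2) / (8 * ?n) <= W"
   using wiener_cap_cube_lower[OF n d, of p] W by simp
  have W2: "W <= C0 * d ^ (CARD('n) - 2)"
   using C0(2)[OF d, of p] W C0(1) d by simp
  have "d ^ (CARD('n) - 2) / (8 * ?n) > 0" using d by simp
  with W1 have W0: "W > 0" by linarith
  have "wiener_cap p d F < ennreal (\<gamma>1 * W)"
  proof -
   have "wiener_cap p d F <= ennreal (\<gamma> * W)" using F(2) W \<gamma> by (simp add: ennreal_mult)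
   also have "\<dots> < ennreal (\<gamma>1 * W)" using W0 h \<gamma> by (intro ennreal_lessI) (auto simp: \<gamma>1_def)
   finally show ?thesis .
  qed
  then obtain P N where P: "P \<in> test_functions (cap_dom p d)" and N: "open N" "F \<subseteq> N" "!!x. x \<in> N ==> P x = 1"
   and "ennreal (dirichlet P) < ennreal (\<gamma>1 * W)" by (rule wiener_cap_less) blast
  then have DP: "dirichlet P < \<gamma>1 * W" by (simp add: ennreal_less_iff dirichlet_nonneg)
  have sP: "smooth_on UNIV P" by (rule test_functions_smooth[OF P])
  obtain K where K: "compact K" "K \<subseteq> cap_dom p d" "!!x. x \<notin> K ==> P x = 0" using test_functionsD[OF P] by metis
  \<comment> \<open>The cutoff \<eta> is 1 around the cube of size (1 - \<delta>) d and vanishes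
    before the boundary of the cube of size d.\<close>
  define a where "a = (1 - \<delta> / 2) * d / 2"
  define b where "b = (1 - \<delta> / 4) * d / 2"
  have ab: "0 < a" "a < b" "b < d / 2" "b - a = \<delta> * d / 8"
   using d \<delta> by (auto simp: a_def b_def field_simps)
  define \<eta> where "\<eta> = cutoff p a b"
  have s\<eta>: "smooth_on UNIV \<eta>" unfolding \<eta>_def by (rule smooth_on_cutoff[OF ab(1,2)])
  have \<eta>r: "0 <= \<eta> x" "\<eta> x <= 1" for x unfolding \<eta>_def using cutoff_range[OF ab(1,2)] by auto
  have \<eta>0: "\<eta> x = 0" if "x \<notin> cube p (2 * b)" for x unfolding \<eta>_def using cutoff_eq_0_cube[OF ab(1,2) that] .
  have G\<eta>: "norm (grad \<eta> x) <= A / d" for x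
  proof -
   have "norm (grad \<eta> x) <= 2 * ?n * step_slope / (b - a)" unfolding \<eta>_def by (rule norm_grad_cutoff[OF ab(1,2)])
   also have "\<dots> = A / d" using d \<delta> by (simp add: ab(4) A_def field_simps)
   finally show ?thesis .
  qed
  \<comment> \<open>A smooth and bounded substitute for 1 - P, as a competitor P need not take
    values between 0 and 1. It is 0 where P = 1, so near \<open>F\<close>, and 1 where P = 0; the
    energy grows by at most the factor (k / sin k)^2, which is close to 1 for small k.\<close>
  define q where "q x = sin (k * (1 - P x)) / sin k" for x
  have sq: "smooth_on UNIV q"
  proof -
   have "smooth_on UNIV (%x. sin (k * (1 - P x)) * inverse (sin k))"
    by (intro smooth_on_mult smooth_on_sin smooth_on_diff smooth_on_const sP open_UNIV)
   then show ?thesis by (simp add: q_def[abs_def] divide_inverse)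
  qed
  have diff: "f differentiable at x" if "smooth_on UNIV f" for f :: "real^'n => real" and x
   by (rule smooth_on_differentiable[OF open_UNIV that UNIV_I])
  have qB: "\<bar>q x\<bar> <= B" for x
   unfolding q_def B_def using k by (simp add: abs_mult abs_divide divide_right_mono)
  have gq: "(norm (grad q x))^2 <= \<gamma>2 / \<gamma>1 * (norm (grad P x))^2" for x
  proof -
   have "grad q x $ j = (- (k * cos (k * (1 - P x))) / sin k) * grad P x $ j" for j
    unfolding q_def[abs_def] using k
    by (intro grad_real_compose[where g="%t. sin (k * (1 - t)) / sin k"] diff sP) (auto intro!: derivative_eq_intros)
   then have "grad q x = (- (k * cos (k * (1 - P x))) / sin k) *\<^sub>R grad P x" by (simp add: vec_eq_iff)
   then have "(norm (grad q x))^2 = (k / sin k)^2 * (cos (k * (1 - P x)))^2 * (norm (grad P x))^2"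
    by (simp add: power_mult_distrib power_divide)
   also have "\<dots> <= \<gamma>2 / \<gamma>1 * 1 * (norm (grad P x))^2"
    using k(4) less_trans[OF zero_less_one \<open>\<gamma>2 / \<gamma>1 > 1\<close>]
    by (intro mult_right_mono mult_mono) (auto simp: abs_square_le_1 simp del: zero_less_divide_iff)
   finally show ?thesis by simp
  qed
  define g where "g x = \<eta> x * q x" for x
  have sg: "smooth_on UNIV g" unfolding g_def[abs_def] by (intro smooth_on_mult s\<eta> sq open_UNIV)
  have gtest: "g \<in> test_functions (interior (cube p d) - F)"
  proof (rule test_functionsI[OF sg, of "cube p (2 * b) - N"])
   show "compact (cube p (2 * b) - N)" using compact_cube N(1) by (rule compact_diff)
   show "cube p (2 * b) - N \<subseteq> interior (cube p d) - F"
    using N(2) ab(3) cube_subset_interior[of "2 * b" d p] by auto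
   show "g x = 0" if "x \<notin> cube p (2 * b) - N" for x
    using that \<eta>0 N(3) by (cases "x \<in> N") (auto simp: g_def q_def)
  qed
  have gB: "\<bar>g x\<bar> <= B" for x
   using mult_mono[OF \<eta>r(2) qB, of x x] \<eta>r(1)[of x] by (simp add: g_def abs_mult)
  have g0: "g x = 0" if "x \<notin> cube p d" for x
   using that test_functionsD[OF gtest] interior_subset by (metis Diff_subset subset_iff)
  have g2i: "integrable lborel (%x. (g x)^2)"
   by (rule integrable_compact_support(1)[OF _ compact_cube[of p d]])
    (auto intro!: smooth_on_continuous smooth_on_power sg simp: g0)
  have \<eta>0g: "grad \<eta> x = 0" if "x \<notin> cube p d" for x
  proof -
   have "grad \<eta> x = grad (%x. 0) x"
   proof (rule grad_cong_open[of "- cube p d"])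
    fix y assume "y \<in> - cube p d"
    then obtain i where "\<bar>y $ i - p $ i\<bar> > d / 2" by (auto simp: mem_cube not_le)
    then show "\<eta> y = 0" unfolding \<eta>_def using ab by (intro cutoff_eq_0[OF ab(1,2), where i = i]) auto
   qed (use that compact_cube compact_imp_closed in \<open>auto simp: open_Compl\<close>)
   then show ?thesis by (simp only: grad_const)
  qed
  have Di: "integrable lborel (%x. (norm (grad P x))^2)" by (rule test_integrable_grad[OF P])
  have Dg: "dirichlet g <= C * d ^ (CARD('n) - 2)"
  proof -
   have ci: "integrable lborel (%x. indicator (cube p d) x *\<^sub>R (2 * (B^2 * (A / d)^2)))"
    by (intro borel_integrable_compact compact_cube) auto
   have "dirichlet g <= (\<integral>x. 2 * (\<gamma>2 / \<gamma>1) * (norm (grad P x))^2 + indicator (cube p d) x *\<^sub>R (2 * (B^2 * (A / d)^2)) \<partial>lborel)"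
    unfolding dirichlet_def
   proof (intro integral_mono test_integrable_grad[OF gtest])
    show "integrable lborel (%x. 2 * (\<gamma>2 / \<gamma>1) * (norm (grad P x))^2 + indicator (cube p d) x *\<^sub>R (2 * (B^2 * (A / d)^2)))"
     by (intro Bochner_Integration.integrable_add ci integrable_mult_right Di)
    fix x
    have "grad g x = \<eta> x *\<^sub>R grad q x + q x *\<^sub>R grad \<eta> x"
     unfolding g_def[abs_def] by (simp add: vec_eq_iff grad_mult[OF diff[OF s\<eta>] diff[OF sq]])
    then have "(norm (grad g x))^2 <= (1 + 1) * (norm (\<eta> x *\<^sub>R grad q x))^2 + (1 + 1 / 1) * (norm (q x *\<^sub>R grad \<eta> x))^2"
     by (simp only: norm_add_square_le zero_less_one)
    also have "(norm (\<eta> x *\<^sub>R grad q x))^2 <= 1 * (\<gamma>2 / \<gamma>1 * (norm (grad P x))^2)"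
     unfolding norm_scaleR power_mult_distrib using \<eta>r by (intro mult_mono gq) (auto simp: abs_square_le_1)
    also have "(norm (q x *\<^sub>R grad \<eta> x))^2 <= indicator (cube p d) x *\<^sub>R (B^2 * (A / d)^2)"
    proof (cases "x \<in> cube p d")
     case True
     have "\<bar>q x\<bar>^2 * (norm (grad \<eta> x))^2 <= B^2 * (A / d)^2"
      using qB G\<eta> by (intro mult_mono power_mono) auto
     then show ?thesis using True by (simp add: power_mult_distrib)
    qed (simp add: \<eta>0g)
    finally show "(norm (grad g x))^2 <= 2 * (\<gamma>2 / \<gamma>1) * (norm (grad P x))^2 + indicator (cube p d) x *\<^sub>R (2 * (B^2 * (A / d)^2))"
     by simp
   qed
   also have "\<dots> = 2 * (\<gamma>2 / \<gamma>1) * dirichlet P + 2 * (B^2 * (A / d)^2) * d ^ CARD('n)"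
    unfolding dirichlet_def using d
    by (subst Bochner_Integration.integral_add[OF integrable_mult_right[OF Di] ci]) (simp add: measure_def emeasure_cube)
   also have "2 * (\<gamma>2 / \<gamma>1) * dirichlet P <= 2 * (\<gamma>2 / \<gamma>1) * (\<gamma>1 * W)"
    using DP h \<gamma> by (intro mult_left_mono) (auto simp: \<gamma>1_def \<gamma>2_def)
   also have "2 * (\<gamma>2 / \<gamma>1) * (\<gamma>1 * W) = 2 * \<gamma>2 * W" using h \<gamma> by (simp add: \<gamma>1_def)
   also have "2 * \<gamma>2 * W <= 2 * \<gamma>2 * (C0 * d ^ (CARD('n) - 2))"
    using W2 h \<gamma> by (intro mult_left_mono) (auto simp: \<gamma>2_def)
   finally show ?thesis unfolding C_def pow using d by (simp add: power_divide algebra_simps)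
  qed
  \<comment> \<open>The competitor for the smaller cube: it is 1 where \<eta> = 1, and equals 1 - q
    outside the support of \<eta>, hence vanishes where P does. Since \<eta> enters as a square, the
    derivative of the factor contributes 2 \<eta> q = 2 g times the gradient of \<eta>.\<close>
  define \<psi> where "\<psi> x = 1 - (1 - \<eta> x * \<eta> x) * q x" for x
  have s\<psi>: "smooth_on UNIV \<psi>" unfolding \<psi>_def[abs_def]
   by (intro smooth_on_diff smooth_on_mult smooth_on_const s\<eta> sq open_UNIV)
  have \<psi>test: "\<psi> \<in> test_functions (cap_dom p d)"
  proof (rule test_functionsI[OF s\<psi>, of "K \<union> cube p (2 * b)"])
   show "compact (K \<union> cube p (2 * b))" using K(1) compact_cube by (rule compact_Un)
   have "cube p (2 * b) \<subseteq> interior (cube p (2 * d))" using ab(3) d by (intro cube_subset_interior) simp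
   then show "K \<union> cube p (2 * b) \<subseteq> cap_dom p d" using K(2) cap_dom_subset by blast
   show "\<psi> x = 0" if "x \<notin> K \<union> cube p (2 * b)" for x
    using that K(3)[of x] \<eta>0[of x] k by (simp add: \<psi>_def q_def)
  qed
  have "ennreal \<kappa> * wiener_cap p d (cube p d) <= ennreal (dirichlet \<psi>)"
  proof (rule shrink[OF d \<psi>test, of "interior (cube p (2 * a))"])
   show "cube p ((1 - \<delta>) * d) \<subseteq> interior (cube p (2 * a))"
   proof
    fix x assume x: "x \<in> cube p ((1 - \<delta>) * d)"
    have "(1 - \<delta>) * d / 2 < a" using d \<delta> by (simp add: a_def field_simps)
    then have "\<bar>x $ i - p $ i\<bar> < a" for i using x unfolding mem_cube by (meson le_less_trans)
    then show "x \<in> interior (cube p (2 * a))" by (simp add: mem_interior_cube)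
   qed
   show "\<psi> x = 1" if "x \<in> interior (cube p (2 * a))" for x
   proof -
    have "\<eta> x = 1" unfolding \<eta>_def using that by (intro cutoff_eq_1[OF ab(1,2)]) (auto simp: mem_interior_cube intro: less_imp_le)
    then show ?thesis by (simp add: \<psi>_def)
   qed
  qed auto
  then have "\<kappa> * W <= dirichlet \<psi>"
   using W \<open>\<kappa> > 0\<close> by (simp add: ennreal_mult[symmetric] dirichlet_nonneg)
  also have "dirichlet \<psi> <= (\<integral>x. (1 + s) * (\<gamma>2 / \<gamma>1) * (norm (grad P x))^2 + (1 + 1 / s) * (4 * (A / d)^2) * (g x)^2 \<partial>lborel)"
   unfolding dirichlet_def
  proof (intro integral_mono test_integrable_grad[OF \<psi>test])
   show "integrable lborel (%x. (1 + s) * (\<gamma>2 / \<gamma>1) * (norm (grad P x))^2 + (1 + 1 / s) * (4 * (A / d)^2) * (g x)^2)"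
    by (intro Bochner_Integration.integrable_add integrable_mult_right Di g2i)
   fix x
   have "grad \<psi> x = (- (1 - \<eta> x * \<eta> x)) *\<^sub>R grad q x + (2 * g x) *\<^sub>R grad \<eta> x"
   proof -
    have s2: "smooth_on UNIV (%x. \<eta> x * \<eta> x)" by (intro smooth_on_mult s\<eta> open_UNIV)
    have s1: "smooth_on UNIV (%x. 1 - \<eta> x * \<eta> x)" by (intro smooth_on_diff smooth_on_const s2 open_UNIV)
    have g1: "grad (%x. 1 - \<eta> x * \<eta> x) x $ j = - (2 * \<eta> x * grad \<eta> x $ j)" for j
     by (subst grad_diff) (auto intro!: diff smooth_on_const s2 simp: grad_const grad_mult[OF diff[OF s\<eta>] diff[OF s\<eta>]])
    have "grad \<psi> x = grad (%x. 1) x - grad (%x. (1 - \<eta> x * \<eta> x) * q x) x"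
     unfolding \<psi>_def[abs_def] by (intro grad_diff diff smooth_on_const smooth_on_mult s1 sq open_UNIV)
    moreover have "grad (%x. (1 - \<eta> x * \<eta> x) * q x) x $ j = (1 - \<eta> x * \<eta> x) * grad q x $ j + - (2 * \<eta> x * grad \<eta> x $ j) * q x" for j
     by (simp only: grad_mult[OF diff[OF s1] diff[OF sq]] g1)
    ultimately have "grad \<psi> x $ j = - ((1 - \<eta> x * \<eta> x) * grad q x $ j + - (2 * \<eta> x * grad \<eta> x $ j) * q x)" for j
     by (simp only: grad_const vector_minus_component vector_uminus_component zero_index diff_0)
    then show ?thesis
     by (simp add: vec_eq_iff g_def algebra_simps)
   qed
   then have "(norm (grad \<psi> x))\<^sup>2 <= (1 + s) * (norm ((- (1 - \<eta> x * \<eta> x)) *\<^sub>R grad q x))\<^sup>2 + (1 + 1 / s) * (norm ((2 * g x) *\<^sub>R grad \<eta> x))\<^sup>2"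
    by (simp only: norm_add_square_le s(1))
   also have "(norm ((- (1 - \<eta> x * \<eta> x)) *\<^sub>R grad q x))\<^sup>2 <= 1 * (\<gamma>2 / \<gamma>1 * (norm (grad P x))\<^sup>2)"
   proof -
    have "0 <= 1 - \<eta> x * \<eta> x" "1 - \<eta> x * \<eta> x <= 1" using \<eta>r[of x] by (auto simp: mult_le_one)
    then have "\<bar>- (1 - \<eta> x * \<eta> x)\<bar>\<^sup>2 <= 1" by (simp add: abs_square_le_1)
    then show ?thesis unfolding norm_scaleR power_mult_distrib by (intro mult_mono gq) auto
   qed
   also have "(norm ((2 * g x) *\<^sub>R grad \<eta> x))^2 <= (4 * (A / d)^2) * (g x)^2"
   proof -
    have "(norm (grad \<eta> x))^2 <= (A / d)^2" using G\<eta> by (intro power_mono) auto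
    from mult_left_mono[OF this, of "4 * (g x)^2"] show ?thesis by (simp add: power_mult_distrib algebra_simps)
   qed
   finally show "(norm (grad \<psi> x))^2 <= (1 + s) * (\<gamma>2 / \<gamma>1) * (norm (grad P x))^2 + (1 + 1 / s) * (4 * (A / d)^2) * (g x)^2"
    using s(1) by (simp add: mult_left_mono mult.assoc)
  qed
  also have "\<dots> = (1 + s) * (\<gamma>2 / \<gamma>1) * dirichlet P + (1 + 1 / s) * (4 * (A / d)^2) * (\<integral>x. (g x)^2 \<partial>lborel)"
   unfolding dirichlet_def
   by (subst Bochner_Integration.integral_add[OF integrable_mult_right[OF Di] integrable_mult_right[OF g2i]]) simp
  also have "(1 + s) * (\<gamma>2 / \<gamma>1) * dirichlet P <= (1 + s) * (\<gamma>2 / \<gamma>1) * (\<gamma>1 * W)"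
   using DP h \<gamma> s by (intro mult_left_mono) (auto simp: \<gamma>1_def \<gamma>2_def)
  also have "(1 + s) * (\<gamma>2 / \<gamma>1) * (\<gamma>1 * W) = \<gamma>3 * W" using h \<gamma> s(2) by (simp add: \<gamma>1_def)
  \<comment> \<open>The energy of the competitor is at least \<open>\<kappa> * W\<close> and the
    potential accounts for \<open>\<gamma>3 * W\<close>. The difference \<open>h * W\<close> must
    come from the mass of \<open>g\<close>.\<close>
  finally have "h * W <= (1 + 1 / s) * (4 * (A / d)^2) * (\<integral>x. (g x)^2 \<partial>lborel)"
   by (simp add: \<kappa>_def \<gamma>3_def algebra_simps)
  moreover have "h * (d ^ (CARD('n) - 2) / (8 * ?n)) <= h * W" using W1 h by (intro mult_left_mono) auto
  ultimately have "h * (d ^ (CARD('n) - 2) / (8 * ?n)) <= (1 + 1 / s) * (4 * A^2) * (\<integral>x. (g x)^2 \<partial>lborel) / d^2"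
   by (simp add: power_divide)
  then have "d^2 * (h * (d ^ (CARD('n) - 2) / (8 * ?n))) <= (1 + 1 / s) * (4 * A^2) * (\<integral>x. (g x)^2 \<partial>lborel)"
   using d by (simp add: pos_le_divide_eq mult.commute)
  moreover have pos: "(1 + 1 / s) * (4 * A^2) > 0" using s A by (intro mult_pos_pos add_pos_pos) auto
  ultimately have "d^2 * (h * (d ^ (CARD('n) - 2) / (8 * ?n))) / ((1 + 1 / s) * (4 * A^2)) <= (\<integral>x. (g x)^2 \<partial>lborel)"
   by (simp only: pos_divide_le_eq mult.commute)
  moreover have "c * d ^ CARD('n) = d^2 * (h * (d ^ (CARD('n) - 2) / (8 * ?n))) / ((1 + 1 / s) * (4 * A^2))"
   unfolding c_def pow by simp
  ultimately have "c * d ^ CARD('n) <= (\<integral>x. (g x)^2 \<partial>lborel)" by simp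
  with gtest gB Dg show ?thesis by blast
 qed
 show ?thesis
  by (intro exI[of _ B] exI[of _ C] exI[of _ c] conjI B C c allI impI main) auto
qed

section \<open>Polynomial approximation together with first derivatives\<close>

lemma real_polynomial_smooth:
 fixes q :: "real^'n => real"
 shows "real_polynomial_function q ==> smooth_on UNIV q"
 by (induction rule: real_polynomial_function.induct)
  (auto intro: smooth_on_bounded_linear smooth_on_const smooth_on_add smooth_on_mult)

definition coord_free :: "'n => (real^'n => real) => bool" where
 "coord_free i c \<longleftrightarrow> (\<forall>x t. c (x + t *\<^sub>R axis i 1) = c x)"

text \<open>Polynomial functions are given inductively and have no monomials to inspect. Sorting by
  powers of one coordinate is what makes them integrable in that coordinate; the vanishing of high
  coefficients is carried along for the product case.\<close>

lemma real_polynomial_coordinate_expansion: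
 fixes q :: "real^'n => real"
 assumes "real_polynomial_function q"
 shows "\<exists>N c. (\<forall>k. real_polynomial_function (c k) \<and> coord_free i (c k)) \<and> (\<forall>k>N. c k = (%x. 0)) \<and>
  (\<forall>x. q x = (\<Sum>k\<le>N. c k x * (x $ i) ^ k))"
 using assms
proof (induction rule: real_polynomial_function.induct)
 case (linear f)
 \<comment> \<open>A linear function splits into its value on the projection off the i-th axis,
   which is free of the i-th coordinate, and a constant times that coordinate.\<close>
 define c where "c k = (if k = 0 then (%x. f (x - (x $ i) *\<^sub>R axis i 1)) else if k = 1 then (%x. f (axis i 1)) else (%x. 0))" for k :: nat
 have bl: "bounded_linear f" by (rule linear)
 interpret bounded_linear f by (rule bl)
 have "bounded_linear (%x. f (x - (x $ i) *\<^sub>R axis i 1))"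
  by (intro bounded_linear_compose[OF bl] bounded_linear_sub bounded_linear_ident
   bounded_linear_compose[OF bounded_linear_scaleR_left] bounded_linear_vec_nth)
 then have 1: "real_polynomial_function (c k)" for k
  unfolding c_def by (auto intro: real_polynomial_function.intros)
 have "x + t *\<^sub>R axis i 1 - ((x + t *\<^sub>R axis i 1) $ i) *\<^sub>R axis i 1 = x - (x $ i) *\<^sub>R axis i 1" for x :: "real^'n" and t
  by (auto simp: vec_eq_iff axis_def)
 then have fx: "f (x + t *\<^sub>R axis i 1 - ((x + t *\<^sub>R axis i 1) $ i) *\<^sub>R axis i 1) = f (x - (x $ i) *\<^sub>R axis i 1)" for x :: "real^'n" and t
  by (simp only:)
 have 2: "coord_free i (c k)" for k
  unfolding coord_free_def by (cases "k = 0"; cases "k = 1") (simp_all add: c_def fx del: vector_add_component)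
 have 3: "c k = (%x. 0)" if "k > 1" for k using that by (simp add: c_def)
 have 4: "f x = (\<Sum>k\<le>1. c k x * (x $ i) ^ k)" for x
  by (simp add: c_def diff scaleR)
 show ?case by (rule exI[of _ 1], rule exI[of _ c], intro conjI allI impI 1 2 3 4)
next
 case (const a)
 show ?case
  by (rule exI[of _ 0], rule exI[of _ "%k x. if k = 0 then a else 0"])
   (auto simp: coord_free_def intro!: real_polynomial_function.intros(2))
next
 case (add f g)
 obtain N c where c: "!!k. real_polynomial_function (c k)" "!!k. coord_free i (c k)" "!!k. k > N ==> c k = (%x. 0)" "!!x. f x = (\<Sum>k\<le>N. c k x * (x $ i) ^ k)"
  using add.IH(1) by blast
 obtain M b where b: "!!k. real_polynomial_function (b k)" "!!k. coord_free i (b k)" "!!k. k > M ==> b k = (%x. 0)" "!!x. g x = (\<Sum>k\<le>M. b k x * (x $ i) ^ k)"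
  using add.IH(2) by blast
 have "f x = (\<Sum>k\<le>max N M. c k x * (x $ i) ^ k)" "g x = (\<Sum>k\<le>max N M. b k x * (x $ i) ^ k)" for x
  unfolding c(4) b(4) by (rule sum.mono_neutral_left; simp add: c(3) b(3))+
 then show ?case
  using c b by (intro exI[of _ "max N M"] exI[of _ "%k x. c k x + b k x"])
   (auto intro: real_polynomial_function.intros simp: coord_free_def sum.distrib algebra_simps)
next
 case (mult f g)
 obtain N c where c: "!!k. real_polynomial_function (c k)" "!!k. coord_free i (c k)" "!!k. k > N ==> c k = (%x. 0)" "!!x. f x = (\<Sum>k\<le>N. c k x * (x $ i) ^ k)"
  using mult.IH(1) by blast
 obtain M b where b: "!!k. real_polynomial_function (b k)" "!!k. coord_free i (b k)" "!!k. k > M ==> b k = (%x. 0)" "!!x. g x = (\<Sum>k\<le>M. b k x * (x $ i) ^ k)"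
  using mult.IH(2) by blast
 define e where "e r x = (\<Sum>k\<le>r. c k x * b (r - k) x)" for r x
 have "real_polynomial_function (e r)" for r
  unfolding e_def[abs_def] by (intro real_polynomial_function_sum real_polynomial_function.intros(4) c b) auto
 moreover have "coord_free i (e r)" for r
  using c(2) b(2) by (simp add: e_def coord_free_def)
 moreover have "e r = (%x. 0)" if "r > N + M" for r
 proof -
  have cb: "c k x * b (r - k) x = 0" for k x using that c(3)[of k] b(3)[of "r - k"] by (cases "k > N") auto
  show ?thesis unfolding e_def by (intro ext sum.neutral ballI cb)
 qed
 moreover have "f x * g x = (\<Sum>r\<le>N + M. e r x * (x $ i) ^ r)" for x
  unfolding c(4) b(4) e_def by (rule polynomial_product) (auto simp: c(3) b(3))
 ultimately show ?case by (intro exI[of _ "N + M"] exI[of _ e]) auto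
qed

text \<open>Termwise integration of the expansion. The constants are chosen so that the
  antiderivative vanishes on the hyperplane at \<open>s\<close>, from which approximation errors
  will be measured.\<close>

lemma real_polynomial_antiderivative:
 fixes q :: "real^'n => real"
 assumes "real_polynomial_function q"
 shows "\<exists>A. real_polynomial_function A \<and> (\<forall>x. x $ i = s \<longrightarrow> A x = 0) \<and> (\<forall>x. grad A x $ i = q x)"
proof -
 obtain N c where c: "!!k. real_polynomial_function (c k)" "!!k. coord_free i (c k)" "!!x. q x = (\<Sum>k\<le>N. c k x * (x $ i) ^ k)"
  using real_polynomial_coordinate_expansion[OF assms, of i] by blast
 define A where "A x = (\<Sum>k\<le>N. c k x * (((x $ i) ^ Suc k + - (s ^ Suc k)) * (1 / real (Suc k))))" for x
 have x: "real_polynomial_function (%x::real^'n. x $ i)"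
  by (intro real_polynomial_function.intros(1) bounded_linear_vec_nth)
 have A: "real_polynomial_function A"
  unfolding A_def[abs_def]
  by (intro real_polynomial_function_sum real_polynomial_function.intros(4) real_polynomial_function.intros(3) real_polynomial_function_power
   real_polynomial_function.intros(2) c x) auto
 have "grad A x $ i = q x" for x
 proof -
  have 1: "((%t. A (x + t *\<^sub>R axis i 1)) has_vector_derivative grad A x $ i) (at 0)"
   using smooth_line_derivative[OF open_UNIV real_polynomial_smooth[OF A], of x 0 "axis i 1"] by (simp add: grad_nth)
  have "A (x + t *\<^sub>R axis i 1) = (\<Sum>k\<le>N. c k x * (((x $ i + t) ^ Suc k + - (s ^ Suc k)) * (1 / real (Suc k))))" for t
   using c(2) by (simp add: A_def coord_free_def)
  moreover have "((%t. \<Sum>k\<le>N. c k x * (((x $ i + t) ^ Suc k + - (s ^ Suc k)) * (1 / real (Suc k)))) has_real_derivative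
    (\<Sum>k\<le>N. c k x * (x $ i) ^ k)) (at 0)"
  proof (rule DERIV_sum)
   fix k
   have "((%t. (x $ i + t) ^ Suc k) has_real_derivative (real (Suc k) * (x $ i) ^ k)) (at 0)"
    by (auto intro!: derivative_eq_intros simp del: power_Suc)
   then have "((%t. c k x * (((x $ i + t) ^ Suc k + - (s ^ Suc k)) * (1 / real (Suc k)))) has_real_derivative
     c k x * ((real (Suc k) * (x $ i) ^ k + 0) * (1 / real (Suc k)))) (at 0)"
    by (intro DERIV_cmult DERIV_cmult_right DERIV_add DERIV_const)
   then show "((%t. c k x * (((x $ i + t) ^ Suc k + - (s ^ Suc k)) * (1 / real (Suc k)))) has_real_derivative
     c k x * (x $ i) ^ k) (at 0)" by (simp del: power_Suc of_nat_Suc)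
  qed
  ultimately have "((%t. A (x + t *\<^sub>R axis i 1)) has_vector_derivative q x) (at 0)"
   unfolding has_real_derivative_iff_has_vector_derivative c(3) by simp
  with 1 show ?thesis by (rule vector_derivative_unique_at)
 qed
 with A show ?thesis by (intro exI[of _ A]) (auto simp: A_def)
qed

text \<open>If the derivative exists, increments on one side suffice to bound it. This is needed at
  boundary points of a cube, where only one side is available.\<close>

lemma right_difference_bound:
 fixes f :: "real => 'a::real_normed_vector"
 assumes f: "(f has_vector_derivative v) (at 0)" and b: "b > 0" "!!s. 0 < s ==> s < b ==> norm (f s - f 0) <= C * s"
 shows "norm v <= C"
proof -
 have "((%s. norm (f s - f 0 - s *\<^sub>R v) / norm s) \<longlongrightarrow> 0) (at_right 0)"
  using f by (auto simp: has_vector_derivative_def has_derivative_at filterlim_at_split)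
 then have lim: "((%s. C + norm (f s - f 0 - s *\<^sub>R v) / norm s) \<longlongrightarrow> C + 0) (at_right 0)"
  by (intro tendsto_intros)
 have ev: "\<forall>\<^sub>F s in at_right 0. norm v <= C + norm (f s - f 0 - s *\<^sub>R v) / norm s"
  unfolding eventually_at_right_field
 proof (intro exI[of _ b] conjI allI impI b(1))
  fix s :: real assume s: "0 < s" "s < b"
  have "s * norm v = norm (s *\<^sub>R v)" using s by simp
  also have "\<dots> <= norm (f s - f 0) + norm (f s - f 0 - s *\<^sub>R v)"
   using norm_triangle_ineq4[of "f s - f 0" "f s - f 0 - s *\<^sub>R v"] by simp
  also have "\<dots> <= C * s + norm (f s - f 0 - s *\<^sub>R v)" using b(2)[OF s] by simp
  finally show "norm v <= C + norm (f s - f 0 - s *\<^sub>R v) / norm s" using s by (simp add: field_simps)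
 qed
 from tendsto_lowerbound[OF lim ev] show ?thesis by simp
qed

lemma cube_line:
 assumes "x \<in> cube 0 (2 * R)" "\<bar>x $ i + t\<bar> <= R"
 shows "x + t *\<^sub>R axis i 1 \<in> cube 0 (2 * R)"
 using assms by (auto simp: mem_cube axis_def)

text \<open>Stone-Weierstrass controls values only, so the set \<open>J\<close> of controlled
  derivatives grows one direction at a time: the i-th derivative of \<open>f\<close> is approximated
  together with its own derivatives along \<open>J\<close>, and the result is integrated in the i-th
  coordinate from a face on which \<open>f\<close> vanishes.\<close>

lemma C1_weierstrass_real:
 fixes f :: "real^'n => real"
 assumes "finite J" and R: "R > 0"
 shows "smooth_on UNIV f ==> (!!x i. \<bar>x $ i\<bar> >= R ==> f x = 0) ==> \<epsilon> > 0 ==>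
  \<exists>q. real_polynomial_function q \<and> (\<forall>x\<in>cube 0 (2 * R). \<bar>q x - f x\<bar> <= \<epsilon> \<and> (\<forall>j\<in>J. \<bar>grad q x $ j - grad f x $ j\<bar> <= \<epsilon>))"
 using \<open>finite J\<close>
proof (induction J arbitrary: f \<epsilon> rule: finite_induct)
 case empty
 have "continuous_on (cube 0 (2 * R)) f"
  using smooth_on_continuous[OF empty(1)] continuous_on_subset by blast
 from Stone_Weierstrass_real_polynomial_function[OF compact_cube this empty(3)]
 obtain q where "real_polynomial_function q" "!!x. x \<in> cube 0 (2 * R) ==> \<bar>f x - q x\<bar> < \<epsilon>" by blast
 then show ?case by (intro exI[of _ q]) (auto simp: abs_minus_commute less_imp_le)
next
 case (insert i J)
 \<comment> \<open>Integration runs over a length of at most 2 R and multiplies the error by that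
   much.\<close>
 define \<epsilon>' where "\<epsilon>' = min \<epsilon> (\<epsilon> / (2 * R))"
 have \<epsilon>': "\<epsilon>' > 0" "\<epsilon>' <= \<epsilon>" "2 * R * \<epsilon>' <= \<epsilon>"
 proof -
  have "2 * R * \<epsilon>' <= 2 * R * (\<epsilon> / (2 * R))" using R by (intro mult_left_mono) (auto simp: \<epsilon>'_def)
  then show "2 * R * \<epsilon>' <= \<epsilon>" using R by simp
 qed (use R insert.prems(3) in \<open>auto simp: \<epsilon>'_def\<close>)
 have sf: "smooth_on UNIV f" by (rule insert.prems(1))
 \<comment> \<open>The induction hypothesis is applied to this derivative, so it must inherit the
   vanishing. On the faces orthogonal to the i-th axis only the outward difference quotient is known
   to be 0, which determines the derivative since it exists.\<close>
 have f0: "grad f x $ i = 0" if "\<bar>x $ k\<bar> >= R" for x k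
 proof (cases "k = i")
  case False
  have "((%t. f (x + t *\<^sub>R axis i 1)) has_vector_derivative grad f x $ i) (at 0)"
   using smooth_line_derivative[OF open_UNIV sf, of x 0 "axis i 1"] by (simp add: grad_nth)
  moreover have "(%t. f (x + t *\<^sub>R axis i 1)) = (%t. 0)"
   using that False by (intro ext insert.prems(2)[of _ k]) (auto simp: axis_def)
  ultimately have "((%t. 0) has_vector_derivative grad f x $ i) (at (0::real))" by simp
  from vector_derivative_unique_at[OF this has_vector_derivative_const] show ?thesis by simp
 next
  case True
  define \<sigma> where "\<sigma> = sgn (x $ i)"
  have \<sigma>: "\<bar>\<sigma>\<bar> = 1" "\<bar>x $ i + t * \<sigma>\<bar> >= R" if "t >= 0" for t
   using that \<open>\<bar>x $ k\<bar> >= R\<close> R True unfolding \<sigma>_def by (auto simp: sgn_real_def)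
  have d: "((%t. f (x + t *\<^sub>R (\<sigma> *\<^sub>R axis i 1))) has_vector_derivative \<sigma> *\<^sub>R (grad f x $ i)) (at 0)"
   using smooth_line_derivative[OF open_UNIV sf, of x 0 "\<sigma> *\<^sub>R axis i 1"]
    linear_cmul[OF has_derivative_linear[OF smooth_on_has_derivative[OF open_UNIV sf, of x]], of \<sigma> "axis i 1"] by (simp add: grad_nth)
  have "f (x + t *\<^sub>R (\<sigma> *\<^sub>R axis i 1)) = 0" if "t >= 0" for t
   using \<sigma>(2)[OF that] by (intro insert.prems(2)[of _ i]) (auto simp: axis_def)
  then have "norm (\<sigma> *\<^sub>R (grad f x $ i)) <= 0"
   using insert.prems(2)[OF that] by (intro right_difference_bound[OF d zero_less_one]) simp
  then show ?thesis using \<sigma>(1)[of 0] by auto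
 qed
 have "\<exists>q. real_polynomial_function q \<and> (\<forall>x\<in>cube 0 (2 * R). \<bar>q x - grad f x $ i\<bar> <= \<epsilon>' \<and>
   (\<forall>j\<in>J. \<bar>grad q x $ j - grad (%x. grad f x $ i) x $ j\<bar> <= \<epsilon>'))"
  by (rule insert.IH[OF smooth_on_pd[OF sf] _ \<epsilon>'(1)]) (rule f0)
 then obtain q where q: "real_polynomial_function q" and qq: "\<forall>x\<in>cube 0 (2 * R). \<bar>q x - grad f x $ i\<bar> <= \<epsilon>' \<and>
   (\<forall>j\<in>J. \<bar>grad q x $ j - grad (%x. grad f x $ i) x $ j\<bar> <= \<epsilon>')"
  by (elim exE conjE)
 have qf: "\<bar>q x - grad f x $ i\<bar> <= \<epsilon>'" "j \<in> J ==> \<bar>grad q x $ j - grad (%x. grad f x $ i) x $ j\<bar> <= \<epsilon>'"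
  if "x \<in> cube 0 (2 * R)" for x j using bspec[OF qq that] by auto
 obtain A where A: "real_polynomial_function A" "!!x. x $ i = - R ==> A x = 0" "!!x. grad A x $ i = q x"
  using real_polynomial_antiderivative[OF q, of i "- R"] by blast
 define r where "r x = q x - grad f x $ i" for x
 define g where "g x = A x - f x" for x
 have sA: "smooth_on UNIV A" and sq: "smooth_on UNIV q" using real_polynomial_smooth A(1) q by auto
 have sg: "smooth_on UNIV g" unfolding g_def[abs_def] by (intro smooth_on_diff sA sf open_UNIV)
 have sr: "smooth_on UNIV r" unfolding r_def[abs_def] by (intro smooth_on_diff sq smooth_on_pd sf open_UNIV)
 have diff: "h differentiable at x" if "smooth_on UNIV h" for h :: "real^'n => real" and x
  by (rule smooth_on_differentiable[OF open_UNIV that UNIV_I])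
 have gg: "grad g x $ j = grad A x $ j - grad f x $ j" for x j
  unfolding g_def[abs_def] by (simp add: grad_diff[OF diff[OF sA] diff[OF sf]])
 have gr: "grad r x $ j = grad q x $ j - grad (%x. grad f x $ i) x $ j" for x j
  unfolding r_def[abs_def] by (simp add: grad_diff[OF diff[OF sq] diff[OF smooth_on_pd[OF sf]]])
 have line: "((%t. h (x + t *\<^sub>R axis k 1)) has_vector_derivative grad h (x + t *\<^sub>R axis k 1) $ k) (at t)"
  if "smooth_on UNIV h" for h :: "real^'n => real" and x t k
  using smooth_line_derivative[OF open_UNIV that, of x t "axis k 1"] by (simp add: grad_nth)
 have bdry: "g x = 0" if "x $ i = - R" for x
  using A(2)[OF that] insert.prems(2)[of x i] that R by (simp add: g_def)
 have rbound: "\<bar>r x\<bar> <= \<epsilon>'" if "x \<in> cube 0 (2 * R)" for x using qf(1)[OF that] by (simp add: r_def)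
 have gbound: "\<bar>g x\<bar> <= \<epsilon>" if x: "x \<in> cube 0 (2 * R)" for x
 proof -
  have xi: "\<bar>x $ i\<bar> <= R" using x by (auto simp: mem_cube)
  have "norm (g (x + 0 *\<^sub>R axis i 1) - g (x + (- R - x $ i) *\<^sub>R axis i 1)) <= \<epsilon>' * \<bar>0 - (- R - x $ i)\<bar>"
  proof (rule vector_derivative_bound[OF line[OF sg]])
   fix s assume "s \<in> closed_segment (- R - x $ i) 0"
   then have "x + s *\<^sub>R axis i 1 \<in> cube 0 (2 * R)"
    using xi by (intro cube_line x) (auto simp: closed_segment_eq_real_ivl split: if_splits)
   then show "norm (grad g (x + s *\<^sub>R axis i 1) $ i) <= \<epsilon>'"
    using rbound by (simp add: gg A(3) r_def)
  qed
  also have "g (x + (- R - x $ i) *\<^sub>R axis i 1) = 0" by (rule bdry) (simp add: axis_def)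
  also have "\<epsilon>' * \<bar>0 - (- R - x $ i)\<bar> <= \<epsilon>' * (2 * R)" using xi \<epsilon>' by (intro mult_left_mono) auto
  finally show ?thesis using \<epsilon>' by (simp add: mult.commute)
 qed
 have jbound: "\<bar>grad g x $ j\<bar> <= \<epsilon>" if x: "x \<in> cube 0 (2 * R)" and j: "j \<in> J" for x j
 proof -
  have ij: "i \<noteq> j" using insert.hyps j by auto
  have xi: "\<bar>x $ i\<bar> <= R" and xj: "\<bar>x $ j\<bar> <= R" using x by (auto simp: mem_cube)
  \<comment> \<open>The sign that points towards the centre, so that increments up to R remain in
    the cube.\<close>
  define \<sigma> where "\<sigma> = (if x $ j <= 0 then 1 else - 1 :: real)"
  have \<sigma>: "\<bar>\<sigma>\<bar> = 1" "0 <= s ==> s <= R ==> \<bar>x $ j + s * \<sigma>\<bar> <= R" for s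
   using xj by (auto simp: \<sigma>_def)
  have rj: "\<bar>r (y + (s * \<sigma>) *\<^sub>R axis j 1) - r y\<bar> <= \<epsilon>' * s" if y: "y \<in> cube 0 (2 * R)" "y $ j = x $ j" and s: "0 <= s" "s <= R" for y s
  proof -
   have "norm (r (y + (s * \<sigma>) *\<^sub>R axis j 1) - r (y + 0 *\<^sub>R axis j 1)) <= \<epsilon>' * \<bar>s * \<sigma> - 0\<bar>"
   proof (rule vector_derivative_bound[OF line[OF sr]])
    fix t assume "t \<in> closed_segment 0 (s * \<sigma>)"
    then have "\<bar>y $ j + t\<bar> <= R"
     using \<sigma>(2)[OF s] xj unfolding y(2) by (auto simp: closed_segment_eq_real_ivl split: if_splits)
    then have "y + t *\<^sub>R axis j 1 \<in> cube 0 (2 * R)" by (intro cube_line y)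
    then show "norm (grad r (y + t *\<^sub>R axis j 1) $ j) <= \<epsilon>'"
     using qf(2)[OF _ j] by (simp add: gr)
   qed
   then show ?thesis using s \<sigma>(1) by (simp add: abs_mult)
  qed
  \<comment> \<open>The increment of the error in direction j, followed along the i-th axis. It
    vanishes on the starting face, and its t-derivative is the increment of \<open>r\<close>,
    already known to be of order s. No interchange of partial derivatives is required.\<close>
  define h where "h s t = g (x + t *\<^sub>R axis i 1 + (s * \<sigma>) *\<^sub>R axis j 1) - g (x + t *\<^sub>R axis i 1)" for s t
  have hb: "\<bar>h s 0\<bar> <= (2 * R * \<epsilon>') * s" if s: "0 <= s" "s <= R" for s
  proof -
   have "norm (h s 0 - h s (- R - x $ i)) <= (\<epsilon>' * s) * \<bar>0 - (- R - x $ i)\<bar>"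
   proof (rule vector_derivative_bound)
    fix t assume t: "t \<in> closed_segment (- R - x $ i) 0"
    have "((%t. g ((x + (s * \<sigma>) *\<^sub>R axis j 1) + t *\<^sub>R axis i 1) - g (x + t *\<^sub>R axis i 1)) has_vector_derivative
      grad g ((x + (s * \<sigma>) *\<^sub>R axis j 1) + t *\<^sub>R axis i 1) $ i - grad g (x + t *\<^sub>R axis i 1) $ i) (at t)"
     by (intro has_vector_derivative_diff line sg)
    then show "(h s has_vector_derivative
      r (x + t *\<^sub>R axis i 1 + (s * \<sigma>) *\<^sub>R axis j 1) - r (x + t *\<^sub>R axis i 1)) (at t)"
     by (simp add: h_def[abs_def] gg A(3) r_def algebra_simps)
    have "x + t *\<^sub>R axis i 1 \<in> cube 0 (2 * R)"
     using xi t by (intro cube_line x) (auto simp: closed_segment_eq_real_ivl split: if_splits)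
    then show "norm (r (x + t *\<^sub>R axis i 1 + (s * \<sigma>) *\<^sub>R axis j 1) - r (x + t *\<^sub>R axis i 1)) <= \<epsilon>' * s"
     using rj[OF _ _ s, of "x + t *\<^sub>R axis i 1"] ij by (simp add: axis_def)
   qed
   also have "h s (- R - x $ i) = 0"
    using ij by (simp add: h_def bdry axis_def)
   also have "(\<epsilon>' * s) * \<bar>0 - (- R - x $ i)\<bar> <= (\<epsilon>' * s) * (2 * R)" using xi \<epsilon>' s by (intro mult_left_mono) auto
   finally show ?thesis by (simp add: mult.commute mult.left_commute)
  qed
  have d: "((%t. g (x + t *\<^sub>R (\<sigma> *\<^sub>R axis j 1))) has_vector_derivative \<sigma> *\<^sub>R (grad g x $ j)) (at 0)"
   using smooth_line_derivative[OF open_UNIV sg, of x 0 "\<sigma> *\<^sub>R axis j 1"]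
    linear_cmul[OF has_derivative_linear[OF smooth_on_has_derivative[OF open_UNIV sg, of x]], of \<sigma> "axis j 1"] by (simp add: grad_nth)
  have "norm (\<sigma> *\<^sub>R (grad g x $ j)) <= 2 * R * \<epsilon>'"
  proof (rule right_difference_bound[OF d R])
   fix s assume "0 < s" "s < R"
   then show "norm (g (x + s *\<^sub>R (\<sigma> *\<^sub>R axis j 1)) - g (x + 0 *\<^sub>R (\<sigma> *\<^sub>R axis j 1))) <= 2 * R * \<epsilon>' * s"
    using hb[of s] by (simp add: h_def)
  qed
  then show ?thesis using \<sigma>(1) \<epsilon>' by (simp add: abs_mult)
 qed
 show ?case
 proof (intro exI[of _ A] conjI A(1) ballI)
  fix x :: "real^'n" assume x: "x \<in> cube 0 (2 * R)"
  show "\<bar>A x - f x\<bar> <= \<epsilon>" using gbound[OF x] by (simp add: g_def)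
  fix j assume "j \<in> insert i J"
  then show "\<bar>grad A x $ j - grad f x $ j\<bar> <= \<epsilon>"
   using jbound[OF x, of j] rbound[OF x] \<epsilon>' by (auto simp: gg A(3) r_def)
 qed
qed

lemma polynomial_function_Complex:
 fixes a b :: "'a::real_normed_vector => real"
 assumes "real_polynomial_function a" "real_polynomial_function b"
 shows "polynomial_function (%x. Complex (a x) (b x))"
 unfolding polynomial_function_def
proof (intro allI impI)
 fix f :: "complex => real" assume f: "bounded_linear f"
 have "Complex u v = u *\<^sub>R 1 + v *\<^sub>R \<i>" for u v by (simp add: complex_eq_iff)
 then have "f \<circ> (%x. Complex (a x) (b x)) = (%x. a x * f 1 + b x * f \<i>)"
  using f by (auto simp: o_def linear_add linear_cmul bounded_linear.linear)
 then show "real_polynomial_function (f \<circ> (%x. Complex (a x) (b x)))"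
  using assms by (simp only:) (intro real_polynomial_function.intros(2-4))
qed


lemma smooth_on_Complex:
 fixes a b :: "real^'n => real"
 assumes "open S" "smooth_on S a" "smooth_on S b"
 shows "smooth_on S (%x. Complex (a x) (b x))"
proof -
 have "smooth_on S (%x. complex_of_real (a x) + \<i> * complex_of_real (b x))"
  by (intro smooth_on_add smooth_on_mult smooth_on_const smooth_on_complex_of_real assms)
 then show ?thesis by (simp add: Complex_eq)
qed

lemma grad_Re: "f differentiable (at x) ==> grad (%x. Re (f x)) x $ j = Re (grad f x $ j)"
 and grad_Im: "f differentiable (at x) ==> grad (%x. Im (f x)) x $ j = Im (grad f x $ j)"
 by (rule grad_linear_compose[OF bounded_linear_Re], assumption, rule grad_linear_compose[OF bounded_linear_Im], assumption)

lemma C1_weierstrass: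
 fixes u :: "real^'n => complex" and p :: "real^'n"
 assumes u: "u \<in> test_functions G" and \<epsilon>: "\<epsilon> > 0"
 shows "\<exists>P. polynomial_function P \<and> smooth_on UNIV P \<and>
  (\<forall>x\<in>cube p d. cmod (P x - u x) <= \<epsilon> \<and> (\<forall>j. cmod (grad P x $ j - grad u x $ j) <= \<epsilon>))"
proof -
 obtain K where K: "smooth_on UNIV u" "compact K" "!!x. x \<notin> K ==> u x = 0" using test_functionsD[OF u] by metis
 obtain R0 where R0: "\<forall>x\<in>K. norm x <= R0" using compact_imp_bounded[OF K(2)] unfolding bounded_iff by blast
 define R where "R = \<bar>R0\<bar> + norm p + \<bar>d\<bar> + 1"
 have R: "R > 0" by (simp add: R_def add_nonneg_pos)
 have out: "u x = 0" if "\<bar>x $ i\<bar> >= R" for x i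
 proof (rule K(3))
  have "norm x >= R" using that component_le_norm_cart[of x i] by linarith
  then have "norm x > R0" unfolding R_def using norm_ge_zero[of p] by linarith
  then show "x \<notin> K" using R0 by force
 qed
 have sub: "cube p d \<subseteq> cube 0 (2 * R)"
 proof
  fix x assume x: "x \<in> cube p d"
  have "\<bar>x $ i\<bar> <= R" for i
  proof -
   have "\<bar>x $ i - p $ i\<bar> <= d / 2" using x unfolding mem_cube by blast
   then show ?thesis using component_le_norm_cart[of p i] unfolding R_def by linarith
  qed
  then show "x \<in> cube 0 (2 * R)" by (simp add: mem_cube)
 qed
 have sRe: "smooth_on UNIV (%x. Re (u x))" and sIm: "smooth_on UNIV (%x. Im (u x))"
  using smooth_on_Re[OF open_UNIV K(1)] smooth_on_Im[OF open_UNIV K(1)] by auto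
 have e2: "\<epsilon> / 2 > 0" using \<epsilon> by simp
 obtain q1 where q1: "real_polynomial_function q1" "!!x. x \<in> cube 0 (2 * R) ==> \<bar>q1 x - Re (u x)\<bar> <= \<epsilon> / 2"
  "!!x j. x \<in> cube 0 (2 * R) ==> \<bar>grad q1 x $ j - grad (%x. Re (u x)) x $ j\<bar> <= \<epsilon> / 2"
  using C1_weierstrass_real[of "UNIV :: 'n set" R, OF finite R sRe _ e2] out by auto
 obtain q2 where q2: "real_polynomial_function q2" "!!x. x \<in> cube 0 (2 * R) ==> \<bar>q2 x - Im (u x)\<bar> <= \<epsilon> / 2"
  "!!x j. x \<in> cube 0 (2 * R) ==> \<bar>grad q2 x $ j - grad (%x. Im (u x)) x $ j\<bar> <= \<epsilon> / 2"
  using C1_weierstrass_real[of "UNIV :: 'n set" R, OF finite R sIm _ e2] out by auto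
 define P where "P x = Complex (q1 x) (q2 x)" for x
 have sP: "smooth_on UNIV P" unfolding P_def[abs_def]
  by (intro smooth_on_Complex open_UNIV real_polynomial_smooth q1(1) q2(1))
 have diffP: "P differentiable (at x)" and diffu: "u differentiable (at x)" for x
  using smooth_on_differentiable[OF open_UNIV _ UNIV_I] sP K(1) by auto
 have gP: "Re (grad P x $ j) = grad q1 x $ j" "Im (grad P x $ j) = grad q2 x $ j" for x j
  using grad_Re[OF diffP, of x j] grad_Im[OF diffP, of x j] by (simp_all add: P_def)
 have "cmod (P x - u x) <= \<epsilon> \<and> (\<forall>j. cmod (grad P x $ j - grad u x $ j) <= \<epsilon>)" if "x \<in> cube p d" for x
 proof (intro conjI allI)
  have x: "x \<in> cube 0 (2 * R)" using that sub by auto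
  show "cmod (P x - u x) <= \<epsilon>"
   using cmod_le[of "P x - u x"] q1(2)[OF x] q2(2)[OF x] by (simp add: P_def)
  fix j
  show "cmod (grad P x $ j - grad u x $ j) <= \<epsilon>"
   using cmod_le[of "grad P x $ j - grad u x $ j"] q1(3)[OF x, of j] q2(3)[OF x, of j]
   by (simp add: gP grad_Re[OF diffu] grad_Im[OF diffu])
 qed
 moreover have "polynomial_function P"
  unfolding P_def[abs_def] by (rule polynomial_function_Complex[OF q1(1) q2(1)])
 ultimately show ?thesis using sP by blast
qed

section \<open>Generic polynomials by affine perturbation\<close>

lemma grad_has_derivative:
 fixes f :: "real^'n => real"
 assumes "smooth_on UNIV f"
 shows "(grad f has_derivative (%h. \<chi> j. frechet_derivative (%x. grad f x $ j) (at x) h)) (at x)"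
 unfolding has_derivative_componentwise_within[of "grad f"]
proof
 fix b :: "real^'n" assume "b \<in> Basis"
 then obtain i where b: "b = axis i 1" by (auto simp: Basis_vec_def)
 show "((%x. grad f x \<bullet> b) has_derivative (%h. (\<chi> j. frechet_derivative (%x. grad f x $ j) (at x) h) \<bullet> b)) (at x)"
  using smooth_on_has_derivative[OF open_UNIV smooth_on_pd[OF assms], of x i] by (simp add: b inner_axis)
qed

text \<open>Dependent pairs are parametrised by a vector and an angle, that is by n + 1 numbers.
  This economical count is what the dimension argument of the perturbation needs.\<close>

lemma dependent_pair_common_direction:
 fixes g h :: "'a::real_vector"
 assumes "\<not> (g \<noteq> h \<and> independent {g, h})"
 obtains r t where "g = cos t *\<^sub>R r" "h = sin t *\<^sub>R r"
proof -
 have "\<exists>\<alpha> \<beta> r. \<alpha>^2 + \<beta>^2 > 0 \<and> g = \<alpha> *\<^sub>R r \<and> h = \<beta> *\<^sub>R (r::'a)"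
 proof (cases "h = 0")
  case True
  then show ?thesis by (intro exI[of _ 1] exI[of _ 0] exI[of _ g]) simp
 next
  case False
  have "g \<in> span {h}"
   using assms False by (cases "g = h") (auto simp: independent_insert span_base)
  then obtain k where "g = k *\<^sub>R h" by (auto simp: span_singleton)
  then show ?thesis by (intro exI[of _ k] exI[of _ 1] exI[of _ h]) (simp add: add_nonneg_pos)
 qed
 then obtain \<alpha> \<beta> r where r: "\<alpha>^2 + \<beta>^2 > 0" "g = \<alpha> *\<^sub>R r" "h = \<beta> *\<^sub>R r" by blast
 define \<rho> where "\<rho> = sqrt (\<alpha>^2 + \<beta>^2)"
 have \<rho>: "\<rho> > 0" "\<rho>^2 = \<alpha>^2 + \<beta>^2" using r(1) by (auto simp: \<rho>_def)
 have "(\<alpha> / \<rho>)^2 + (\<beta> / \<rho>)^2 = (\<alpha>^2 + \<beta>^2) / \<rho>^2" by (simp add: power_divide add_divide_distrib)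
 also have "\<dots> = 1" unfolding \<rho>(2)[symmetric] using \<rho>(1) by simp
 finally have "(\<alpha> / \<rho>)^2 + (\<beta> / \<rho>)^2 = 1" .
 then obtain t where t: "\<alpha> / \<rho> = cos t" "\<beta> / \<rho> = sin t" using sincos_total_2pi by metis
 show ?thesis
 proof (rule that)
  show "g = cos t *\<^sub>R (\<rho> *\<^sub>R r)" "h = sin t *\<^sub>R (\<rho> *\<^sub>R r)"
   using \<rho>(1) by (simp_all add: t[symmetric] r(2,3))
 qed
qed

text \<open>A perturbation that fails at x has gradients cos t r and sin t r there and makes the
  value at x zero; its coefficients are thereby determined by (x, r, t). The map from these 2 n + 1
  parameters to the 2 n + 2 coefficients is differentiable and has a null image, so good
  coefficients exist in every ball.\<close>

lemma generic_perturbation: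
 fixes P :: "real^'n => complex"
 assumes P: "polynomial_function P" and sP: "smooth_on UNIV P" and \<delta>: "\<delta> > 0"
 obtains b1 b2 :: "real^'n" and c1 c2 :: real where "norm b1 < \<delta>" "norm b2 < \<delta>" "\<bar>c1\<bar> < \<delta>" "\<bar>c2\<bar> < \<delta>"
  "!!Q. generic_poly Q (%x. P x + Complex (b1 \<bullet> x + c1) (b2 \<bullet> x + c2))"
proof -
 define F where "F x = Re (P x)" for x
 define H where "H x = Im (P x)" for x
 have sF: "smooth_on UNIV F" and sH: "smooth_on UNIV H"
  unfolding F_def[abs_def] H_def[abs_def] using smooth_on_Re[OF open_UNIV sP] smooth_on_Im[OF open_UNIV sP] by auto
 \<comment> \<open>The coefficients for which the perturbed polynomial vanishes at x with gradients
   of real and imaginary part cos t r and sin t r: the slopes are read off from the gradients, the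
   constants from the vanishing value.\<close>
 define \<Psi> where "\<Psi> = (%z :: (real^'n) \<times> (real^'n) \<times> real. let x = fst z; r = fst (snd z); t = snd (snd z) in
  (cos t *\<^sub>R r - grad F x, sin t *\<^sub>R r - grad H x, - F x - (cos t *\<^sub>R r - grad F x) \<bullet> x, - H x - (sin t *\<^sub>R r - grad H x) \<bullet> x))"
 have "\<exists>D. (\<Psi> has_derivative D) (at z)" for z
 proof -
  have fst: "(fst has_derivative fst) (at z)" by (rule has_derivative_fst[OF has_derivative_ident])
  note D = has_derivative_compose[OF fst grad_has_derivative[OF sF]] has_derivative_compose[OF fst grad_has_derivative[OF sH]]
   has_derivative_compose[OF fst smooth_on_has_derivative[OF open_UNIV sF UNIV_I]]
   has_derivative_compose[OF fst smooth_on_has_derivative[OF open_UNIV sH UNIV_I]]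
  show ?thesis unfolding \<Psi>_def Let_def by (rule exI) (rule derivative_intros D)+
 qed
 then have "\<Psi> differentiable_on UNIV"
  unfolding differentiable_on_def differentiable_def by auto
 then have neg: "negligible (range \<Psi>)"
  by (rule negligible_differentiable_image_lowdim[rotated]) simp
 have "\<not> ball 0 \<delta> \<subseteq> range \<Psi>"
  using open_not_negligible[of "ball (0 :: (real^'n) \<times> (real^'n) \<times> real \<times> real) \<delta>"] \<delta> negligible_subset[OF neg] by auto
 then obtain b1 b2 c1 c2 where b: "(b1, b2, c1, c2) \<in> ball 0 \<delta>" and nr: "(b1, b2, c1, c2) \<notin> range \<Psi>"
  by (metis subsetI prod_cases4)
 have nb: "norm (b1, b2, c1, c2) < \<delta>" using b by simp
 have n1: "norm b1 <= norm (b1, b2, c1, c2)" using norm_fst_le[of b1 "(b2, c1, c2)"] .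
 have n2: "norm b2 <= norm (b1, b2, c1, c2)"
  using norm_fst_le[of b2 "(c1, c2)"] norm_snd_le[of "(b2, c1, c2)" b1] by linarith
 have n3: "\<bar>c1\<bar> <= norm (b1, b2, c1, c2)"
  using norm_fst_le[of c1 c2] norm_snd_le[of "(c1, c2)" b2] norm_snd_le[of "(b2, c1, c2)" b1] unfolding real_norm_def by linarith
 have n4: "\<bar>c2\<bar> <= norm (b1, b2, c1, c2)"
  using norm_snd_le[of c2 c1] norm_snd_le[of "(c1, c2)" b2] norm_snd_le[of "(b2, c1, c2)" b1] unfolding real_norm_def by linarith
 let ?P = "%x. P x + Complex (b1 \<bullet> x + c1) (b2 \<bullet> x + c2)"
 have lin: "real_polynomial_function (%x. b \<bullet> x + c)" for b :: "real^'n" and c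
  by (intro real_polynomial_function.intros bounded_linear_inner_right)
 have poly: "polynomial_function ?P"
  by (intro polynomial_function_add P polynomial_function_Complex lin)
 have "generic_poly Q ?P" for Q
  unfolding generic_poly_def
 proof (intro conjI poly exI[of _ UNIV] ballI impI)
  fix x assume 0: "?P x = 0"
  have diffb: "(%x. b \<bullet> x + c) differentiable (at x)" for b :: "real^'n" and c
   by (rule smooth_on_differentiable[OF open_UNIV real_polynomial_smooth[OF lin] UNIV_I])
  have gb: "grad (%x. b \<bullet> x + c) x = b" for b :: "real^'n" and c
  proof -
   have "((%x. b \<bullet> x + c) has_derivative (%h. b \<bullet> h)) (at x)"
    by (auto intro!: derivative_eq_intros)
   from grad_eqI[OF this] show ?thesis by (simp add: vec_eq_iff inner_axis)
  qed
  have g1: "grad (%y. Re (?P y)) x = grad F x + b1"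
   using grad_add[OF smooth_on_differentiable[OF open_UNIV sF UNIV_I] diffb[of b1 c1]] gb by (simp add: F_def)
  have g2: "grad (%y. Im (?P y)) x = grad H x + b2"
   using grad_add[OF smooth_on_differentiable[OF open_UNIV sH UNIV_I] diffb[of b2 c2]] gb by (simp add: H_def)
  have c: "c1 = - F x - b1 \<bullet> x" "c2 = - H x - b2 \<bullet> x"
   using 0 by (simp_all add: complex_eq_iff F_def H_def)
  have "grad F x + b1 \<noteq> grad H x + b2 \<and> independent {grad F x + b1, grad H x + b2}"
  proof (rule ccontr)
   assume "\<not> ?thesis"
   then obtain r t where "grad F x + b1 = cos t *\<^sub>R r" "grad H x + b2 = sin t *\<^sub>R r"
    by (rule dependent_pair_common_direction)
   then have "b1 = cos t *\<^sub>R r - grad F x" "b2 = sin t *\<^sub>R r - grad H x" by (simp_all add: algebra_simps)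
   then have "(b1, b2, c1, c2) = \<Psi> (x, r, t)" using c by (simp add: \<Psi>_def)
   with nr show False by blast
  qed
  then show "let g = grad (%y. Re (?P y)) x; h = grad (%y. Im (?P y)) x in g \<noteq> h \<and> independent {g, h}"
   unfolding g1 g2 Let_def .
 qed auto
 with nb n1 n2 n3 n4 show ?thesis by (intro that[of b1 b2 c1 c2]) auto
qed

subsection \<open>Semi-inner products and L2 spaces\<close>

text \<open>Vectors are functions and not classes modulo null sets, so the forms are only
  semidefinite. Square-integrable functions, the magnetic form and its shifts are instances. Closure
  under f + c g yields sums, differences and multiples at once.\<close>

locale semi_inner =
 fixes T :: "('a => complex) set" and B :: "('a => complex) => ('a => complex) => complex"
 assumes closed: "!!f g c. f \<in> T ==> g \<in> T ==> (%x. f x + c * g x) \<in> T"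
  and lin: "!!f g h c. f \<in> T ==> g \<in> T ==> h \<in> T ==> B (%x. f x + c * g x) h = B f h + c * B g h"
  and herm: "!!f g. f \<in> T ==> g \<in> T ==> B g f = cnj (B f g)"
  and nonneg: "!!f. f \<in> T ==> 0 <= Re (B f f)"
begin

definition nrm :: "('a => complex) => real" where "nrm f = sqrt (Re (B f f))"

lemma nrm_nonneg: "f \<in> T ==> 0 <= nrm f"
 by (simp add: nrm_def nonneg)

lemma nrm_square: "f \<in> T ==> (nrm f)^2 = Re (B f f)"
 by (simp add: nrm_def nonneg)

lemma B_real: "f \<in> T ==> B f f = complex_of_real (Re (B f f))"
 using herm[of f f] by (simp add: complex_eq_iff)

lemma lin2: "f \<in> T ==> g \<in> T ==> h \<in> T ==> B h (%x. f x + c * g x) = B h f + cnj c * B h g"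
 using herm[of "%x. f x + c * g x" h] herm[of f h] herm[of g h] by (simp add: closed lin)

lemma diff_closed: "f \<in> T ==> g \<in> T ==> (%x. f x - g x) \<in> T"
 using closed[of f g "-1"] by simp

lemma zero_closed: "f \<in> T ==> (%x. 0) \<in> T"
 using diff_closed[of f f] by simp

lemma scale_closed: "f \<in> T ==> (%x. c * f x) \<in> T"
 using closed[of "%x. 0" f c] zero_closed[of f] by simp

lemma lin_diff: "f \<in> T ==> g \<in> T ==> h \<in> T ==> B (%x. f x - g x) h = B f h - B g h"
 using lin[of f g h "-1"] by simp

lemma lin2_diff: "f \<in> T ==> g \<in> T ==> h \<in> T ==> B h (%x. f x - g x) = B h f - B h g"
 using lin2[of f g h "-1"] by simp

lemma zero_left: "h \<in> T ==> B (%x. 0) h = 0"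
 using lin_diff[of h h h] by simp

lemma expand: "f \<in> T ==> g \<in> T ==>
  Re (B (%x. f x + c * g x) (%x. f x + c * g x)) = Re (B f f) + 2 * Re (cnj c * B f g) + (cmod c)^2 * Re (B g g)"
proof -
 assume fg: "f \<in> T" "g \<in> T"
 have e1: "B (%x. f x + c * g x) (%x. f x + c * g x) = B f f + cnj c * B f g + (c * cnj (B f g) + c * cnj c * B g g)"
  unfolding lin[OF fg closed[OF fg]] lin2[OF fg fg(1)] lin2[OF fg fg(2)] herm[OF fg] by (simp add: distrib_left mult.assoc)
 have e2: "c * cnj (B f g) = cnj (cnj c * B f g)" by simp
 have e3: "c * cnj c * B g g = complex_of_real ((cmod c)^2 * Re (B g g))"
  by (subst B_real[OF fg(2)]) (simp only: complex_norm_square[symmetric] of_real_mult)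
 show ?thesis unfolding e1 e2 e3 by simp
qed

lemma cauchy_schwarz: "f \<in> T ==> g \<in> T ==> cmod (B f g) <= nrm f * nrm g"
proof -
 assume fg: "f \<in> T" "g \<in> T"
 let ?b = "B f g"
 \<comment> \<open>Positivity at f - s B(f,g) g. The case of a degenerate g is settled by choosing s
   too large for the inequality, the other one by the optimal s.\<close>
 have ineq: "2 * s * (cmod ?b)^2 <= Re (B f f) + s^2 * (cmod ?b)^2 * Re (B g g)" for s :: real
 proof -
  let ?c = "- (complex_of_real s * ?b)"
  have "0 <= Re (B (%x. f x + ?c * g x) (%x. f x + ?c * g x))" by (intro nonneg closed fg)
  also have "\<dots> = Re (B f f) + 2 * Re (cnj ?c * ?b) + (cmod ?c)^2 * Re (B g g)" by (rule expand[OF fg])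
  also have "cnj ?c * ?b = - (complex_of_real s * (?b * cnj ?b))" by simp
  also have "\<dots> = - complex_of_real (s * (cmod ?b)\<^sup>2)"
   unfolding complex_norm_square[symmetric] by simp
  also have "(cmod ?c)^2 = s^2 * (cmod ?b)^2" by (simp add: norm_mult power_mult_distrib)
  finally show ?thesis by simp
 qed
 have "(cmod ?b)^2 <= Re (B f f) * Re (B g g)"
 proof (cases "Re (B g g) = 0")
  case True
  have "?b = 0"
  proof (rule ccontr)
   assume "?b \<noteq> 0"
   then have p: "(cmod ?b)^2 > 0" by simp
   have "2 * ((Re (B f f) + 1) / (2 * (cmod ?b)^2)) * (cmod ?b)^2 <= Re (B f f)"
    using ineq[of "(Re (B f f) + 1) / (2 * (cmod ?b)^2)"] True by simp
   then show False using p by simp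
  qed
  then show ?thesis using True by simp
 next
  case False
  then have p: "Re (B g g) > 0" using nonneg[OF fg(2)] by simp
  have "2 * (1 / Re (B g g)) * (cmod ?b)^2 <= Re (B f f) + (1 / Re (B g g))^2 * (cmod ?b)^2 * Re (B g g)" by (rule ineq)
  then have "(cmod ?b)^2 / Re (B g g) <= Re (B f f)" using p by (simp add: power2_eq_square)
  then show ?thesis using p by (simp add: pos_divide_le_eq)
 qed
 then have "(cmod ?b)^2 <= (nrm f * nrm g)^2" by (simp add: power_mult_distrib nrm_square fg)
 then show ?thesis using nrm_nonneg fg by (simp add: abs_le_square_iff[symmetric] abs_mult)
qed

lemma triangle: "f \<in> T ==> g \<in> T ==> nrm (%x. f x + c * g x) <= nrm f + cmod c * nrm g"
proof -
 assume fg: "f \<in> T" "g \<in> T"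
 have "Re (cnj c * B f g) <= cmod c * (nrm f * nrm g)"
 proof -
  have "Re (cnj c * B f g) <= cmod (cnj c * B f g)" by (rule complex_Re_le_cmod)
  also have "\<dots> <= cmod c * (nrm f * nrm g)"
   unfolding norm_mult by (simp add: mult_left_mono cauchy_schwarz fg)
  finally show ?thesis .
 qed
 then have "(nrm (%x. f x + c * g x))^2 <= (nrm f + cmod c * nrm g)^2"
  unfolding nrm_square[OF closed[OF fg]] expand[OF fg]
  by (simp add: power2_sum power_mult_distrib nrm_square fg algebra_simps)
 then show ?thesis using nrm_nonneg closed fg by (simp add: abs_le_square_iff[symmetric])
qed

lemma nrm_diff_commute: "f \<in> T ==> g \<in> T ==> nrm (%x. f x - g x) = nrm (%x. g x - f x)"
 by (simp add: nrm_def lin_diff lin2_diff diff_closed)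

lemma triangle3: "f \<in> T ==> g \<in> T ==> h \<in> T ==> nrm (%x. f x - h x) <= nrm (%x. f x - g x) + nrm (%x. g x - h x)"
 using triangle[of "%x. f x - g x" "%x. g x - h x" 1] by (simp add: diff_closed)

lemma nrm_diff_le: "f \<in> T ==> g \<in> T ==> \<bar>nrm f - nrm g\<bar> <= nrm (%x. f x - g x)"
 using triangle[of g "%x. f x - g x" 1] triangle[of f "%x. g x - f x" 1] nrm_diff_commute[of f g]
 by (simp add: diff_closed)

lemma scale_self: "f \<in> T ==> Re (B (%x. c * f x) (%x. c * f x)) = (cmod c)^2 * Re (B f f)"
 using expand[of "%x. 0" f c] zero_left[of f] zero_left[OF zero_closed[of f]] zero_closed[of f] by simp

lemma parallelogram: "f \<in> T ==> g \<in> T ==>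
  Re (B (%x. f x - g x) (%x. f x - g x)) + Re (B (%x. f x + 1 * g x) (%x. f x + 1 * g x)) = 2 * Re (B f f) + 2 * Re (B g g)"
 using expand[of f g "-1"] expand[of f g 1] by simp

end

text \<open>Kept for an arbitrary measure, because both Lebesgue measure and its restriction to the
  domain are needed.\<close>

definition sq :: "'a measure => ('a => complex) set" where
 "sq M = {f \<in> borel_measurable M. integrable M (%x. (cmod (f x))^2)}"

definition cip :: "'a measure => ('a => complex) => ('a => complex) => complex" where
 "cip M f g = (\<integral>x. f x * cnj (g x) \<partial>M)"

lemma sq_measurable: "f \<in> sq M ==> f \<in> borel_measurable M"
 by (simp add: sq_def)

lemma sq_integrable: "f \<in> sq M ==> integrable M (%x. (cmod (f x))^2)"
 by (simp add: sq_def)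

lemma sqI_bound:
 assumes "f \<in> borel_measurable M" "integrable M h" "AE x in M. (cmod (f x))^2 <= h x"
 shows "f \<in> sq M"
proof -
 have [measurable]: "f \<in> borel_measurable M" by fact
 have "integrable M (%x. (cmod (f x))^2)"
  by (rule Bochner_Integration.integrable_bound[OF assms(2)]) (use assms(3) in auto)
 then show ?thesis by (simp add: sq_def)
qed

lemma sq_closed: "f \<in> sq M ==> g \<in> sq M ==> (%x. f x + c * g x) \<in> sq M"
proof -
 assume fg: "f \<in> sq M" "g \<in> sq M"
 have [measurable]: "f \<in> borel_measurable M" "g \<in> borel_measurable M" using fg by (auto simp: sq_def)
 show ?thesis
 proof (rule sqI_bound)
  show "integrable M (%x. 2 * (cmod (f x))^2 + (2 * (cmod c)^2) * (cmod (g x))^2)"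
   using fg by (intro Bochner_Integration.integrable_add integrable_mult_right sq_integrable)
  have "(cmod (f x + c * g x))^2 <= 2 * (cmod (f x))^2 + (2 * (cmod c)^2) * (cmod (g x))^2" for x
  proof -
   have "(cmod (f x + c * g x))^2 <= (cmod (f x) + cmod (c * g x))^2" by (intro power_mono norm_triangle_ineq) auto
   also have "\<dots> <= 2 * (cmod (f x))^2 + 2 * (cmod (c * g x))^2"
    using zero_le_power2[of "cmod (f x) - cmod (c * g x)"] by (simp add: power2_sum power2_diff)
   finally show ?thesis by (simp add: norm_mult power_mult_distrib)
  qed
  then show "AE x in M. (cmod (f x + c * g x))^2 <= 2 * (cmod (f x))^2 + (2 * (cmod c)^2) * (cmod (g x))^2" by simp
 qed measurable
qed

lemma sq_prod_integrable: "f \<in> sq M ==> g \<in> sq M ==> integrable M (%x. f x * cnj (g x))"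
proof -
 assume fg: "f \<in> sq M" "g \<in> sq M"
 have [measurable]: "f \<in> borel_measurable M" "g \<in> borel_measurable M" using fg by (auto simp: sq_def)
 have [measurable]: "(%x. cnj (g x)) \<in> borel_measurable M"
  by (rule borel_measurable_continuous_on[OF linear_continuous_on[OF bounded_linear_cnj]]) measurable
 show ?thesis
 proof (rule Bochner_Integration.integrable_bound)
  show "integrable M (%x. (cmod (f x))^2 + (cmod (g x))^2)"
   using fg by (intro Bochner_Integration.integrable_add sq_integrable)
  have "cmod (f x * cnj (g x)) <= (cmod (f x))^2 + (cmod (g x))^2" for x
   using zero_le_power2[of "cmod (f x) - cmod (g x)"] mult_nonneg_nonneg[OF norm_ge_zero norm_ge_zero, of "f x" "g x"]
   unfolding power2_diff norm_mult complex_mod_cnj by linarith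
  then show "AE x in M. norm (f x * cnj (g x)) <= norm ((cmod (f x))^2 + (cmod (g x))^2)"
   by simp
 qed measurable
qed

lemma cip_self: "cip M f f = complex_of_real (\<integral>x. (cmod (f x))^2 \<partial>M)"
 unfolding cip_def by (simp add: complex_norm_square[symmetric] flip: of_real_power)

interpretation sq: semi_inner "sq M" "cip M" for M
proof
 show "(%x. f x + c * g x) \<in> sq M" if "f \<in> sq M" "g \<in> sq M" for f g c using sq_closed that .
 show "cip M (%x. f x + c * g x) h = cip M f h + c * cip M g h" if "f \<in> sq M" "g \<in> sq M" "h \<in> sq M" for f g h c
  using that sq_prod_integrable[of f M h] sq_prod_integrable[of g M h]
  by (simp add: cip_def distrib_right mult.assoc)
 show "cip M g f = cnj (cip M f g)" for f g
  unfolding cip_def Bochner_Integration.integral_cnj[symmetric] by (simp add: mult.commute)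
 show "0 <= Re (cip M f f)" for f by (simp add: cip_self)
qed

lemma sq_nrm: "sq.nrm M f = sqrt (\<integral>x. (cmod (f x))^2 \<partial>M)"
 by (simp add: sq.nrm_def cip_self)

lemma sq_nrm_zero_AE:
 assumes "f \<in> sq M" "sq.nrm M f = 0" shows "AE x in M. f x = 0"
proof -
 have "(\<integral>x. (cmod (f x))^2 \<partial>M) = 0" using assms(2) by (simp add: sq_nrm)
 then have "AE x in M. (cmod (f x))^2 = 0"
  using integral_nonneg_eq_0_iff_AE[OF sq_integrable[OF assms(1)]] by simp
 then show ?thesis by simp
qed

lemma sq_AE_subseq:
 assumes f: "!!k. f k \<in> sq M" and g: "g \<in> sq M" and lim: "(%k. sq.nrm M (%x. f k x - g x)) \<longlonglongrightarrow> 0"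
 obtains r where "strict_mono r" "AE x in M. (%k. f (r k) x) \<longlonglongrightarrow> g x"
proof -
 have "(%k. (sq.nrm M (%x. f k x - g x))^2) \<longlonglongrightarrow> 0^2" by (intro tendsto_power lim)
 then have "(%k. \<integral>x. norm ((cmod (f k x - g x))^2) \<partial>M) \<longlonglongrightarrow> 0"
  by (simp add: sq_nrm)
 from tendsto_L1_AE_subseq[OF sq_integrable[OF sq.diff_closed[OF f g]] this]
 obtain r where r: "strict_mono r" "AE x in M. (%k. (cmod (f (r k) x - g x))^2) \<longlonglongrightarrow> 0" by blast
 have "AE x in M. (%k. f (r k) x) \<longlonglongrightarrow> g x"
  using r(2)
 proof eventually_elim
  fix x assume "(%k. (cmod (f (r k) x - g x))^2) \<longlonglongrightarrow> 0"
  then have "(%k. sqrt ((cmod (f (r k) x - g x))^2)) \<longlonglongrightarrow> sqrt 0" by (rule tendsto_real_sqrt)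
  then have "(%k. f (r k) x - g x) \<longlonglongrightarrow> 0" by (simp add: tendsto_norm_zero_iff)
  then show "(%k. f (r k) x) \<longlonglongrightarrow> g x" by (rule LIM_zero_cancel)
 qed
 with r(1) show ?thesis by (rule that)
qed

text \<open>The Riesz-Fischer theorem: a fast subsequence converges almost everywhere, and the Fatou
  lemma identifies the limit in the norm.\<close>

lemma sq_complete:
 assumes f: "!!k. f k \<in> sq M" and C: "!!e. e > 0 ==> \<exists>N. \<forall>k\<ge>N. \<forall>m\<ge>N. sq.nrm M (%x. f k x - f m x) < e"
 obtains g where "g \<in> sq M" "(%k. sq.nrm M (%x. f k x - g x)) \<longlonglongrightarrow> 0"
proof -
 have [measurable]: "f k \<in> borel_measurable M" for k using f by (auto simp: sq_def)
 obtain N where N: "!!i k m. k >= N i ==> m >= N i ==> sq.nrm M (%x. f k x - f m x) < (1 / 2) ^ i"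
  using C[of "(1 / 2) ^ i" for i] by (metis zero_less_power half_gt_zero zero_less_one)
 \<comment> \<open>Adding up the thresholds makes both \<open>r i\<close> and
   \<open>r (Suc i)\<close> exceed \<open>N i\<close>, so consecutive members of the subsequence are
   close; the summand i sends \<open>r i\<close> to infinity.\<close>
 define r where "r i = (\<Sum>j\<le>i. N j) + i" for i
 have r: "r i >= N i" "r i >= i" for i
  unfolding r_def using member_le_sum[of i "{..i}" N] by auto
 have rS: "r (Suc i) >= N i" for i unfolding r_def using member_le_sum[of i "{..Suc i}" N] by auto
 \<comment> \<open>The squared norms of the differences decay like 4^-i. The weight 2^i leaves a
   summable sequence of integrals and, at points where the sum is finite, geometric decay of the
   differences themselves.\<close>
 define D where "D i x = 2 ^ i * (cmod (f (r (Suc i)) x - f (r i) x))^2" for i x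
 have [measurable]: "D i \<in> borel_measurable M" for i unfolding D_def by measurable
 have Dn: "0 <= D i x" for i x by (simp add: D_def)
 have Di: "(\<integral>\<^sup>+x. ennreal (D i x) \<partial>M) <= ennreal ((1 / 2) ^ i)" for i
 proof -
  let ?n = "sq.nrm M (%x. f (r (Suc i)) x - f (r i) x)"
  have int: "integrable M (%x. (cmod (f (r (Suc i)) x - f (r i) x))^2)"
   by (rule sq_integrable[OF sq.diff_closed[OF f f]])
  have "(\<integral>\<^sup>+x. ennreal (D i x) \<partial>M) = ennreal (\<integral>x. D i x \<partial>M)"
   using Dn int by (intro nn_integral_eq_integral) (auto simp: D_def)
  also have "(\<integral>x. D i x \<partial>M) = 2 ^ i * ?n^2"
   unfolding D_def sq_nrm by simp
  also have "\<dots> <= 2 ^ i * ((1 / 2) ^ i)^2"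
  proof (intro mult_left_mono power_mono)
   show "?n <= (1 / 2) ^ i" using N[OF rS[of i] r(1)[of i]] by simp
   show "0 <= ?n" by (rule sq.nrm_nonneg[OF sq.diff_closed[OF f f]])
  qed simp
  also have "\<dots> = (1 / 2) ^ i" by (simp add: power2_eq_square power_divide)
  finally show ?thesis by (simp add: ennreal_leI)
 qed
 have "(\<integral>\<^sup>+x. (\<Sum>i. ennreal (D i x)) \<partial>M) = (\<Sum>i. \<integral>\<^sup>+x. ennreal (D i x) \<partial>M)"
  by (rule nn_integral_suminf) measurable
 also have "\<dots> <= (\<Sum>i. ennreal ((1 / 2) ^ i))" by (intro suminf_le Di) auto
 also have "\<dots> = ennreal (\<Sum>i. (1 / 2) ^ i)" by (intro suminf_ennreal2) (auto intro: summable_geometric)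
 also have "\<dots> < \<infinity>" by simp
 finally have "(\<integral>\<^sup>+x. (\<Sum>i. ennreal (D i x)) \<partial>M) \<noteq> \<infinity>" by simp
 then have "AE x in M. (\<Sum>i. ennreal (D i x)) \<noteq> \<infinity>"
  by (intro nn_integral_noteq_infinite) measurable
 then have AEconv: "AE x in M. convergent (%i. f (r i) x)"
 proof eventually_elim
  fix x assume fin: "(\<Sum>i. ennreal (D i x)) \<noteq> \<infinity>"
  define S where "S = enn2real (\<Sum>i. ennreal (D i x))"
  have S: "(\<Sum>i. ennreal (D i x)) = ennreal S" "S >= 0" using fin by (auto simp: S_def less_top)
  have DS: "D i x <= S" for i
  proof -
   have "ennreal (D i x) <= (\<Sum>i. ennreal (D i x))" using sum_le_suminf[of "%i. ennreal (D i x)" "{i}"] by simp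
   then show ?thesis using S by simp
  qed
  have "summable (%i. f (r (Suc i)) x - f (r i) x)"
  proof (rule summable_comparison_test)
   show "\<exists>N. \<forall>i\<ge>N. norm (f (r (Suc i)) x - f (r i) x) <= sqrt S * (sqrt (1 / 2)) ^ i"
   proof (intro exI[of _ 0] allI impI)
    fix i
    have "(cmod (f (r (Suc i)) x - f (r i) x))^2 <= S * (1 / 2) ^ i"
     using DS[of i] by (simp add: D_def field_simps)
    then have "sqrt ((cmod (f (r (Suc i)) x - f (r i) x))^2) <= sqrt (S * (1 / 2) ^ i)" by (rule real_sqrt_le_mono)
    then have "norm (f (r (Suc i)) x - f (r i) x) <= sqrt (S * (1 / 2) ^ i)"
     by (simp only: real_sqrt_abs abs_norm_cancel)
    then show "norm (f (r (Suc i)) x - f (r i) x) <= sqrt S * (sqrt (1 / 2)) ^ i"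
     by (simp only: real_sqrt_mult real_sqrt_power)
   qed
   have "sqrt (1 / 2) < sqrt 1" by (rule real_sqrt_less_mono) simp
   then show "summable (%i. sqrt S * (sqrt (1 / 2)) ^ i)"
    by (intro summable_mult summable_geometric) simp
  qed
  then have "convergent (%i. \<Sum>j<i. f (r (Suc j)) x - f (r j) x)" by (simp add: summable_iff_convergent)
  then have "convergent (%i. f (r 0) x + (\<Sum>j<i. f (r (Suc j)) x - f (r j) x))"
   by (intro convergent_add convergent_const)
  moreover have "(\<Sum>j<i. f (r (Suc j)) x - f (r j) x) = f (r i) x - f (r 0) x" for i
   by (rule sum_lessThan_telescope)
  ultimately show "convergent (%i. f (r i) x)" by simp
 qed
 define g where "g x = lim (%i. f (r i) x)" for x
 have [measurable]: "g \<in> borel_measurable M" unfolding g_def by measurable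
 have AElim: "AE x in M. (%i. f (r i) x) \<longlonglongrightarrow> g x"
  using AEconv by eventually_elim (simp add: g_def convergent_LIMSEQ_iff)
 \<comment> \<open>The difference to the limit is the almost everywhere limit of the differences to
   the later members, which the Cauchy condition bounds.\<close>
 have fatou: "(\<integral>\<^sup>+x. ennreal ((cmod (f k x - g x))^2) \<partial>M) <= ennreal (e^2)"
  if k: "!!m. m >= K ==> sq.nrm M (%x. f k x - f m x) <= e" for k K e
 proof -
  have "(\<integral>\<^sup>+x. ennreal ((cmod (f k x - g x))^2) \<partial>M) = (\<integral>\<^sup>+x. liminf (%i. ennreal ((cmod (f k x - f (r i) x))^2)) \<partial>M)"
  proof (rule nn_integral_cong_AE)
   show "AE x in M. ennreal ((cmod (f k x - g x))^2) = liminf (%i. ennreal ((cmod (f k x - f (r i) x))^2))"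
    using AElim
   proof eventually_elim
    fix x assume "(%i. f (r i) x) \<longlonglongrightarrow> g x"
    then have t: "(%i. ennreal ((cmod (f k x - f (r i) x))^2)) \<longlonglongrightarrow> ennreal ((cmod (f k x - g x))^2)"
     by (intro tendsto_intros)
    show "ennreal ((cmod (f k x - g x))^2) = liminf (%i. ennreal ((cmod (f k x - f (r i) x))^2))"
     by (rule lim_imp_Liminf[OF trivial_limit_sequentially t, symmetric])
   qed
  qed
  also have "\<dots> <= liminf (%i. \<integral>\<^sup>+x. ennreal ((cmod (f k x - f (r i) x))^2) \<partial>M)"
   by (rule nn_integral_liminf) measurable
  also have "\<dots> <= liminf (%i. ennreal (e^2))"
  proof (rule Liminf_mono, rule eventually_sequentiallyI[of K])
   fix i assume "K <= i"
   have int: "integrable M (%x. (cmod (f k x - f (r i) x))^2)" by (rule sq_integrable[OF sq.diff_closed[OF f f]])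
   have "(\<integral>\<^sup>+x. ennreal ((cmod (f k x - f (r i) x))^2) \<partial>M) = ennreal ((sq.nrm M (%x. f k x - f (r i) x))^2)"
    using int by (subst nn_integral_eq_integral) (auto simp: sq_nrm)
   also have "\<dots> <= ennreal (e^2)"
    using k[of "r i"] r(2)[of i] \<open>K <= i\<close> sq.nrm_nonneg[OF sq.diff_closed[OF f f]]
    by (intro ennreal_leI power_mono) auto
   finally show "(\<integral>\<^sup>+x. ennreal ((cmod (f k x - f (r i) x))^2) \<partial>M) <= ennreal (e^2)" .
  qed
  also have "\<dots> = ennreal (e^2)" by (simp add: Liminf_const)
  finally show ?thesis .
 qed
 have diffsq: "(%x. f k x - g x) \<in> sq M" if "!!m. m >= K ==> sq.nrm M (%x. f k x - f m x) <= e" for k K e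
 proof -
  have "(\<integral>\<^sup>+x. ennreal ((cmod (f k x - g x))^2) \<partial>M) <= ennreal (e^2)" by (rule fatou[of K]) (rule that)
  then have "(\<integral>\<^sup>+x. ennreal ((cmod (f k x - g x))^2) \<partial>M) < \<infinity>" by (rule le_less_trans) simp
  then have "integrable M (%x. (cmod (f k x - g x))^2)"
   by (intro integrableI_bounded) auto
  then show ?thesis by (simp add: sq_def)
 qed
 obtain K1 where K1: "!!k m. k >= K1 ==> m >= K1 ==> sq.nrm M (%x. f k x - f m x) < 1" using C[of 1] by auto
 have "(%x. f K1 x - g x) \<in> sq M" by (rule diffsq[of K1 _ 1]) (use K1 in \<open>auto intro: less_imp_le\<close>)
 from sq.diff_closed[OF f[of K1] this] have g: "g \<in> sq M" by simp
 moreover have "(%k. sq.nrm M (%x. f k x - g x)) \<longlonglongrightarrow> 0"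
 proof (rule LIMSEQ_I)
  fix e :: real assume e: "e > 0"
  then obtain K where K: "!!k m. k >= K ==> m >= K ==> sq.nrm M (%x. f k x - f m x) < e / 2" using C[of "e / 2"] by auto
  have "norm (sq.nrm M (%x. f k x - g x) - 0) < e" if "k >= K" for k
  proof -
   have le: "!!m. m >= K ==> sq.nrm M (%x. f k x - f m x) <= e / 2" using K[OF that] by (auto intro: less_imp_le)
   have "ennreal ((sq.nrm M (%x. f k x - g x))^2) = (\<integral>\<^sup>+x. ennreal ((cmod (f k x - g x))^2) \<partial>M)"
    using sq_integrable[OF sq.diff_closed[OF f g]] by (subst nn_integral_eq_integral) (auto simp: sq_nrm)
   also have "\<dots> <= ennreal ((e / 2)^2)" by (rule fatou[OF le])
   finally have "(sq.nrm M (%x. f k x - g x))^2 <= (e / 2)^2" by simp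
   then have "sq.nrm M (%x. f k x - g x) <= e / 2" by (rule power2_le_imp_le) (use e in simp)
   then show ?thesis using e sq.nrm_nonneg[OF sq.diff_closed[OF f g], of k] by simp
  qed
  then show "\<exists>no. \<forall>n\<ge>no. norm (sq.nrm M (%x. f n x - g x) - 0) < e" by blast
 qed
 ultimately show ?thesis by (rule that)
qed

subsection \<open>The fundamental lemma of the calculus of variations\<close>

text \<open>The product \<open>P\<close> of flat functions is positive exactly on the open box, so a
  step of k times P is eventually 1 at each point of it.\<close>

lemma box_cutoff:
 fixes l u :: "real^'n"
 obtains \<psi> :: "nat => real^'n => real" where "!!k. \<psi> k \<in> test_functions UNIV" "!!k x. 0 <= \<psi> k x \<and> \<psi> k x <= indicator (cbox l u) x"
  "!!x. (%k. \<psi> k x) \<longlonglongrightarrow> indicator (box l u) x"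
proof -
 define P where "P x = (\<Prod>i\<in>UNIV. flat_family 1 (x $ i - l $ i) * flat_family 1 (u $ i - x $ i))" for x
 define \<psi> where "\<psi> k x = smooth_step (real k * P x)" for k :: nat and x
 have P0: "P x >= 0" for x unfolding P_def by (intro prod_nonneg) (simp add: flat_family_1_nonneg)
 have Pbox: "P x > 0" if "x \<in> box l u" for x
  unfolding P_def using that by (intro prod_pos) (auto simp: mem_box_cart intro!: mult_pos_pos flat_family_1_pos)
 have Pout: "P x = 0" if nb: "x \<notin> box l u" for x
 proof -
  obtain i where "\<not> (l $ i < x $ i \<and> x $ i < u $ i)" using nb unfolding mem_box_cart by blast
  then have "x $ i - l $ i <= 0 \<or> u $ i - x $ i <= 0" by linarith
  then have "flat_family 1 (x $ i - l $ i) * flat_family 1 (u $ i - x $ i) = 0" by (auto simp: flat_family_1_zero)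
  then show ?thesis unfolding P_def by (intro prod_zero) auto
 qed
 have sP: "smooth_on UNIV P" unfolding P_def[abs_def]
  by (intro smooth_on_prod smooth_on_mult smooth_on_flat smooth_on_diff smooth_on_coord smooth_on_const open_UNIV)
 have s\<psi>: "smooth_on UNIV (\<psi> k)" for k
  unfolding \<psi>_def[abs_def] by (intro smooth_on_step smooth_on_mult smooth_on_const sP open_UNIV)
 have out: "\<psi> k x = 0" if "x \<notin> box l u" for k x using Pout[OF that] by (simp add: \<psi>_def smooth_step_0)
 show ?thesis
 proof (rule that)
  show "\<psi> k \<in> test_functions UNIV" for k
   by (rule test_functionsI[OF s\<psi> compact_cbox[of l u]]) (use out box_subset_cbox in blast)+
  show "0 <= \<psi> k x \<and> \<psi> k x <= indicator (cbox l u) x" for k x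
   using out[of x k] box_subset_cbox[of l u] smooth_step_range by (cases "x \<in> box l u") (auto simp: \<psi>_def indicator_def)
  show "(%k. \<psi> k x) \<longlonglongrightarrow> indicator (box l u) x" for x
  proof (cases "x \<in> box l u")
   case True
   obtain N :: nat where N: "1 / P x < real N" using reals_Archimedean2 by blast
   have "\<psi> k x = 1" if "k >= N" for k
   proof -
    have "1 / P x <= real k" using N that by linarith
    then have "1 <= real k * P x" using Pbox[OF True] by (simp add: pos_divide_le_eq)
    then show ?thesis by (simp add: \<psi>_def smooth_step_1)
   qed
   then have "(%k. \<psi> k x) \<longlonglongrightarrow> 1" by (intro tendsto_eventually eventually_sequentiallyI)
   then show ?thesis using True by simp
  qed (simp add: out)
 qed
qed

text \<open>Test functions approximate open boxes, so \<open>g\<close> integrates to 0 over these.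
  Open boxes are stable under intersection and generate the Borel sets; hence \<open>g\<close>
  integrates to 0 over all Borel sets inside a large box, and uniqueness of densities
  finishes.\<close>

lemma fundamental_lemma_real:
 fixes g :: "real^'n => real"
 assumes [measurable]: "g \<in> borel_measurable lborel"
  and loc: "!!l u. integrable lborel (%x. indicator (cbox l u) x * g x)"
  and orth: "!!\<psi>. \<psi> \<in> test_functions UNIV ==> (\<integral>x. \<psi> x * g x \<partial>lborel) = 0"
 shows "AE x in lborel. g x = 0"
proof -
 have box0: "(\<integral>x. indicator (box l u) x * g x \<partial>lborel) = 0" for l u
 proof -
  obtain \<psi> :: "nat => real^'n => real" where \<psi>: "!!k. \<psi> k \<in> test_functions UNIV" "!!k x. 0 <= \<psi> k x \<and> \<psi> k x <= indicator (cbox l u) x"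
   "!!x. (%k. \<psi> k x) \<longlonglongrightarrow> indicator (box l u) x" using box_cutoff by blast
  have [measurable]: "\<psi> k \<in> borel_measurable borel" for k by (intro smooth_borel test_functions_smooth[OF \<psi>(1)])
  have "(%k. \<integral>x. \<psi> k x * g x \<partial>lborel) \<longlonglongrightarrow> (\<integral>x. indicator (box l u) x * g x \<partial>lborel)"
  proof (rule integral_dominated_convergence)
   show "integrable lborel (%x. norm (indicator (cbox l u) x * g x))" using loc by (rule integrable_norm)
   show "AE x in lborel. (%k. \<psi> k x * g x) \<longlonglongrightarrow> indicator (box l u) x * g x"
    by (intro AE_I2 tendsto_mult \<psi> tendsto_const)
   show "AE x in lborel. norm (\<psi> k x * g x) <= norm (indicator (cbox l u) x * g x)" for k
    using \<psi>(2) by (intro AE_I2) (auto simp: abs_mult intro!: mult_right_mono)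
  qed measurable
  then show ?thesis using orth[OF \<psi>(1)] by (simp add: LIMSEQ_const_iff)
 qed
 have "AE x in lborel. indicator (box (- real m *\<^sub>R One) (real m *\<^sub>R One)) x * g x = 0" for m :: nat
 proof -
  let ?B = "box (- real m *\<^sub>R One) (real m *\<^sub>R One) :: (real^'n) set"
  let ?f = "%x. indicator ?B x * g x"
  have fi: "integrable lborel ?f"
  proof (rule Bochner_Integration.integrable_bound[OF loc[of "- real m *\<^sub>R One" "real m *\<^sub>R One"]])
   show "AE x in lborel. norm (?f x) <= norm (indicator (cbox (- real m *\<^sub>R One) (real m *\<^sub>R One)) x * g x)"
    using box_subset_cbox by (intro AE_I2) (auto simp: indicator_def)
  qed measurable
  have inds: "(%x. indicator A x *\<^sub>R ?f x) = (%x. indicator (A \<inter> ?B) x * g x)" for A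
   by (auto simp: indicator_def)
  let ?E = "range (%(a, b). box a b :: (real^'n) set)"
  have sA: "set_integrable lborel A ?f" if "A \<in> sets borel" for A
   unfolding set_integrable_def by (rule integrable_mult_indicator[OF _ fi]) (use that in simp)
  have Is: "Int_stable ?E" by (auto simp: Int_stable_def box_Int_box)
  have pw: "?E \<subseteq> Pow UNIV" by simp
  have A: "(\<integral>x\<in>A. ?f x \<partial>lborel) = 0" if "A \<in> sigma_sets UNIV ?E" for A
   using Is pw that
  proof (induction rule: sigma_sets_induct_disjoint)
   case (basic A)
   then obtain a b where A: "A = box a b" by auto
   obtain a' b' where "A \<inter> ?B = box a' b'" unfolding A box_Int_box by blast
   then show ?case unfolding set_lebesgue_integral_def inds by (simp add: box0)
  next
   case empty
   show ?case by (simp add: set_lebesgue_integral_def)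
  next
   case (compl A)
   then have [measurable]: "A \<in> sets borel" by (simp add: borel_eq_box)
   have "(\<integral>x\<in>UNIV. ?f x \<partial>lborel) = 0" unfolding set_lebesgue_integral_def inds by (simp add: box0)
   moreover have "(\<integral>x\<in>UNIV. ?f x \<partial>lborel) = (\<integral>x\<in>A. ?f x \<partial>lborel) + (\<integral>x\<in>UNIV - A. ?f x \<partial>lborel)"
    by (subst set_integral_Un[symmetric]) (intro sA | simp)+
   ultimately show ?case using compl.IH by simp
  next
   case (union A)
   then have [measurable]: "A i \<in> sets borel" for i by (auto simp: borel_eq_box)
   have "(\<integral>x\<in>(\<Union>i. A i). ?f x \<partial>lborel) = (\<Sum>i. (\<integral>x\<in>A i. ?f x \<partial>lborel))"
   proof (rule lebesgue_integral_countable_add)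
    show "set_integrable lborel (\<Union>i. A i) ?f" by (rule sA) simp
    show "A i \<inter> A j = {}" if "i \<noteq> j" for i j
     using union.hyps that by (auto simp: disjoint_family_on_def)
   qed simp
   then show ?case using union.IH by simp
  qed
  show ?thesis
   by (rule density_unique_real[OF fi integrable_zero]) (use A in \<open>auto simp: borel_eq_box\<close>)
 qed
 then have "AE x in lborel. \<forall>m::nat. indicator (box (- real m *\<^sub>R One) (real m *\<^sub>R One)) x * g x = 0"
  by (intro AE_all_countable[THEN iffD2] allI)
 then show ?thesis
 proof eventually_elim
  fix x :: "real^'n" assume *: "\<forall>m::nat. indicator (box (- real m *\<^sub>R One) (real m *\<^sub>R One)) x * g x = 0"
  have "x \<in> (\<Union>m::nat. box (- (real m *\<^sub>R One)) (real m *\<^sub>R One))" unfolding UN_box_eq_UNIV by simp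
  with * show "g x = 0" by (auto simp: indicator_def split: if_splits)
 qed
qed

text \<open>Reduction to the real Borel case: real and imaginary part are treated separately, each
  replaced by a Borel function equal to it almost everywhere.\<close>

lemma fundamental_lemma:
 fixes g :: "real^'n => complex"
 assumes g: "g \<in> sq lebesgue"
  and orth: "!!\<psi>. \<psi> \<in> test_functions UNIV ==> (\<integral>x. complex_of_real (\<psi> x) * g x \<partial>lebesgue) = 0"
 shows "AE x in lebesgue. g x = 0"
proof -
 have [measurable]: "g \<in> borel_measurable lebesgue" using g by (simp add: sq_def)
 have gi: "integrable lebesgue (%x. complex_of_real (\<psi> x) * g x)" if "\<psi> \<in> borel_measurable lebesgue" "!!x. \<bar>\<psi> x\<bar> <= c * indicator (cbox l u) x" for \<psi> l u c
 proof (rule Bochner_Integration.integrable_bound)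
  have [measurable]: "\<psi> \<in> borel_measurable lebesgue" by fact
  have "integrable lborel (%x :: real^'n. indicator (cbox l u) x *\<^sub>R (1::real))" by (intro borel_integrable_compact) auto
  then have "integrable lebesgue (%x :: real^'n. indicator (cbox l u) x *\<^sub>R (1::real))"
   by (subst integrable_completion) auto
  then show "integrable lebesgue (%x. \<bar>c\<bar> * (indicator (cbox l u) x *\<^sub>R 1 + (cmod (g x))^2))"
   by (intro integrable_mult_right Bochner_Integration.integrable_add sq_integrable[OF g])
  show "(%x. complex_of_real (\<psi> x) * g x) \<in> borel_measurable lebesgue" by measurable
  show "AE x in lebesgue. norm (complex_of_real (\<psi> x) * g x) <= norm (\<bar>c\<bar> * (indicator (cbox l u) x *\<^sub>R 1 + (cmod (g x))^2))"
  proof (rule AE_I2)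
   fix x
   have "norm (complex_of_real (\<psi> x) * g x) = \<bar>\<psi> x\<bar> * cmod (g x)" by (simp add: norm_mult)
   also have "\<dots> <= (\<bar>c\<bar> * indicator (cbox l u) x) * cmod (g x)"
    using that(2)[of x] abs_ge_self[of c] by (intro mult_right_mono) (auto simp: indicator_def split: if_splits)
   also have "\<dots> <= \<bar>c\<bar> * (indicator (cbox l u) x *\<^sub>R 1 + (cmod (g x))^2)"
   proof -
    have "cmod (g x) <= 1 + (cmod (g x))^2"
    proof -
     have "2 * cmod (g x) <= (cmod (g x))^2 + 1" using zero_le_power2[of "cmod (g x) - 1"] by (simp add: power2_diff)
     then show ?thesis using norm_ge_zero[of "g x"] by linarith
    qed
    then have "indicator (cbox l u) x * cmod (g x) <= indicator (cbox l u) x + (cmod (g x))^2"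
     by (auto simp: indicator_def)
    then show ?thesis by (simp add: mult.assoc mult_left_mono)
   qed
   finally show "norm (complex_of_real (\<psi> x) * g x) <= norm (\<bar>c\<bar> * (indicator (cbox l u) x *\<^sub>R 1 + (cmod (g x))^2))"
    by (simp add: abs_mult)
  qed
 qed
 have part: "AE x in lebesgue. L (g x) = 0" if L: "bounded_linear L" and Lm: "!!r z. L (complex_of_real r * z) = r * L z" for L :: "complex => real"
 proof -
  have [measurable]: "(%x. L (g x)) \<in> borel_measurable lebesgue"
   by (rule borel_measurable_continuous_on[OF linear_continuous_on[OF L]]) measurable
  then obtain g' where [measurable]: "g' \<in> borel_measurable lborel" and g': "AE x in lborel. L (g x) = g' x"
   using completion_ex_borel_measurable_real[of "%x. L (g x)" lborel] by auto
  have g'': "AE x in lebesgue. L (g x) = g' x" using AE_completion[OF g'] .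
  have conv: "integrable lborel (%x. \<psi> x * g' x)" "(\<integral>x. \<psi> x * g' x \<partial>lborel) = L (\<integral>x. complex_of_real (\<psi> x) * g x \<partial>lebesgue)"
   if \<psi>[measurable]: "\<psi> \<in> borel_measurable borel" and b: "!!x. \<bar>\<psi> x\<bar> <= c * indicator (cbox l u) x" for \<psi> c l u
  proof -
   have \<psi>'[measurable]: "\<psi> \<in> borel_measurable lebesgue" using \<psi> by (simp add: measurable_completion)
   have [measurable]: "g' \<in> borel_measurable lebesgue" by (simp add: measurable_completion)
   have i: "integrable lebesgue (%x. L (complex_of_real (\<psi> x) * g x))"
    by (rule integrable_bounded_linear[OF L gi[OF \<psi>' b]])
   have ae: "AE x in lebesgue. L (complex_of_real (\<psi> x) * g x) = \<psi> x * g' x"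
    using g'' by eventually_elim (simp add: Lm)
   have i': "integrable lebesgue (%x. \<psi> x * g' x)"
    using i by (subst integrable_cong_AE[symmetric, OF _ _ ae]) (auto simp: borel_measurable_integrable)
   then show "integrable lborel (%x. \<psi> x * g' x)" by (subst (asm) integrable_completion) auto
   have "L (\<integral>x. complex_of_real (\<psi> x) * g x \<partial>lebesgue) = (\<integral>x. L (complex_of_real (\<psi> x) * g x) \<partial>lebesgue)"
    by (rule integral_bounded_linear[OF L gi[OF \<psi>' b], symmetric])
   also have "\<dots> = (\<integral>x. \<psi> x * g' x \<partial>lebesgue)"
    using i i' ae by (intro integral_cong_AE) (auto simp: borel_measurable_integrable)
   also have "\<dots> = (\<integral>x. \<psi> x * g' x \<partial>lborel)" by (rule integral_completion) measurable
   finally show "(\<integral>x. \<psi> x * g' x \<partial>lborel) = L (\<integral>x. complex_of_real (\<psi> x) * g x \<partial>lebesgue)" by simp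
  qed
  have "AE x in lborel. g' x = 0"
  proof (rule fundamental_lemma_real)
   show "integrable lborel (%x. indicator (cbox l u) x * g' x)" for l u
    by (rule conv(1)[of _ 1 l u]) auto
   fix \<psi> :: "real^'n => real" assume \<psi>: "\<psi> \<in> test_functions UNIV"
   obtain K where K: "smooth_on UNIV \<psi>" "compact K" "!!x. x \<notin> K ==> \<psi> x = 0" using test_functionsD[OF \<psi>] by metis
   obtain l where l: "K \<subseteq> cbox (- l) l" using bounded_subset_cbox_symmetric[OF compact_imp_bounded[OF K(2)]] by blast
   have "compact (\<psi> ` K)" using K smooth_on_continuous continuous_on_subset by (blast intro: compact_continuous_image)
   from compact_imp_bounded[OF this] obtain c where "\<forall>y\<in>\<psi> ` K. norm y <= c" unfolding bounded_iff by blast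
   then have "\<bar>\<psi> x\<bar> <= max 0 c * indicator (cbox (- l) l) x" for x
    using K(3)[of x] l by (cases "x \<in> K") (auto simp: indicator_def le_max_iff_disj)
   from conv(2)[OF smooth_borel[OF K(1)] this] show "(\<integral>x. \<psi> x * g' x \<partial>lborel) = 0"
    using orth[OF \<psi>] L by (simp add: linear_0 bounded_linear.linear)
  qed measurable
  from AE_completion[OF this] g'' show ?thesis by eventually_elim simp
 qed
 have "AE x in lebesgue. Re (g x) = 0" by (rule part[OF bounded_linear_Re]) simp
 moreover have "AE x in lebesgue. Im (g x) = 0" by (rule part[OF bounded_linear_Im]) simp
 ultimately show ?thesis by eventually_elim (simp add: complex_eq_iff)
qed

subsection \<open>The magnetic form on test functions\<close>

locale magnetic =
 fixes \<Omega> :: "(real^'n) set" and V :: "real^'n => real" and a :: "real^'n => real^'n"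
 assumes open_dom: "open \<Omega>" and ne: "\<Omega> \<noteq> {}" and V_loc: "L1_loc \<Omega> V"
  and V_nonneg: "AE x in lebesgue. x \<in> \<Omega> \<longrightarrow> 0 <= V x" and a_loc: "Linf_loc_closure \<Omega> a"
begin

abbreviation M :: "(real^'n) measure" where "M \<equiv> lebesgue_on \<Omega>"

abbreviation T :: "(real^'n => complex) set" where "T \<equiv> test_functions \<Omega>"

lemma dom_sets [measurable]: "\<Omega> \<in> sets lebesgue"
 using open_dom by (simp add: borel_open)

lemma integral_M: "(LINT x:\<Omega>|lebesgue. f x) = (\<integral>x. f x \<partial>M)" for f :: "real^'n => 'b::{banach, second_countable_topology}"
 using integral_restrict_space[of \<Omega> lebesgue f] dom_sets by (simp add: set_lebesgue_integral_def)

lemma integrable_M: "integrable M f \<longleftrightarrow> set_integrable lebesgue \<Omega> f" for f :: "real^'n => 'b::{banach, second_countable_topology}"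
 using integrable_restrict_space[of \<Omega> lebesgue f] dom_sets by (simp add: set_integrable_def)

lemma AE_M: "(AE x in M. P x) \<longleftrightarrow> (AE x in lebesgue. x \<in> \<Omega> \<longrightarrow> P x)"
 using AE_restrict_space_iff[of \<Omega> lebesgue P] dom_sets by simp

lemma a_measurable [measurable]: "(%x. a x $ j) \<in> borel_measurable M"
proof -
 have "(%x. if x \<in> \<Omega> then a x $ j else 0) \<in> borel_measurable lebesgue"
  using a_loc by (simp add: Linf_loc_closure_def Linf_loc_def)
 then have "(%x. if x \<in> \<Omega> then a x $ j else 0) \<in> borel_measurable M"
  by (rule measurable_restrict_space1)
 moreover have "(%x. if x \<in> \<Omega> then a x $ j else 0) \<in> borel_measurable M \<longleftrightarrow> (%x. a x $ j) \<in> borel_measurable M"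
  by (rule measurable_cong) simp
 ultimately show ?thesis by simp
qed

text \<open>\<open>K\<close> may leave the domain: the bound holds up to the boundary. This is what
  makes the potential bounded on a cube that sticks out of the domain.\<close>

lemma a_bounded:
 assumes "compact K"
 obtains B where "B >= 0" "AE x in M. x \<in> K \<longrightarrow> norm (a x) <= B" "!!j. AE x in M. x \<in> K \<longrightarrow> \<bar>a x $ j\<bar> <= B"
proof -
 have "\<exists>B. AE x in lebesgue. x \<in> K \<longrightarrow> \<bar>if x \<in> \<Omega> then a x $ j else 0\<bar> <= B" for j
  using a_loc assms by (simp add: Linf_loc_closure_def Linf_loc_def)
 then have "\<exists>B. \<forall>j. AE x in lebesgue. x \<in> K \<longrightarrow> \<bar>if x \<in> \<Omega> then a x $ j else 0\<bar> <= B j"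
  by (intro choice allI)
 then obtain B where B: "!!j. AE x in lebesgue. x \<in> K \<longrightarrow> \<bar>if x \<in> \<Omega> then a x $ j else 0\<bar> <= B j"
  by blast
 define C where "C = (\<Sum>j\<in>UNIV. \<bar>B j\<bar>)"
 have BC: "B j <= C" for j
 proof -
  have "\<bar>B j\<bar> <= (\<Sum>j\<in>UNIV. \<bar>B j\<bar>)" by (rule member_le_sum) auto
  then show ?thesis unfolding C_def by linarith
 qed
 have all: "AE x in lebesgue. \<forall>j. x \<in> K \<longrightarrow> \<bar>if x \<in> \<Omega> then a x $ j else 0\<bar> <= B j"
 proof -
  have "AE x in lebesgue. \<forall>j\<in>UNIV. x \<in> K \<longrightarrow> \<bar>if x \<in> \<Omega> then a x $ j else 0\<bar> <= B j"
   by (subst AE_finite_all[OF finite]) (intro ballI B)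
  then show ?thesis by simp
 qed
 show ?thesis
 proof (rule that)
  show "C >= 0" by (simp add: C_def sum_nonneg)
  show "AE x in M. x \<in> K \<longrightarrow> norm (a x) <= C"
   unfolding AE_M using all
  proof eventually_elim
   fix x assume *: "\<forall>j. x \<in> K \<longrightarrow> \<bar>if x \<in> \<Omega> then a x $ j else 0\<bar> <= B j"
   show "x \<in> \<Omega> \<longrightarrow> x \<in> K \<longrightarrow> norm (a x) <= C"
   proof (intro impI)
    assume "x \<in> \<Omega>" "x \<in> K"
    then have "\<bar>a x $ j\<bar> <= \<bar>B j\<bar>" for j using spec[OF *, of j] abs_ge_self[of "B j"] by simp
    then have "(\<Sum>j\<in>UNIV. \<bar>a x $ j\<bar>) <= C" unfolding C_def by (intro sum_mono)
    then show "norm (a x) <= C" using norm_le_l1_cart[of "a x"] by linarith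
   qed
  qed
  show "AE x in M. x \<in> K \<longrightarrow> \<bar>a x $ j\<bar> <= C" for j
   unfolding AE_M using B[of j]
  proof eventually_elim
   fix x assume "x \<in> K \<longrightarrow> \<bar>if x \<in> \<Omega> then a x $ j else 0\<bar> <= B j"
   then show "x \<in> \<Omega> \<longrightarrow> x \<in> K \<longrightarrow> \<bar>a x $ j\<bar> <= C" using BC[of j] by auto
  qed
 qed
qed

lemma V_integrable: "compact K ==> K \<subseteq> \<Omega> ==> integrable M (%x. indicator K x * V x)"
proof -
 assume K: "compact K" "K \<subseteq> \<Omega>"
 then have "integrable lebesgue (%x. indicator K x *\<^sub>R V x)"
  using V_loc by (simp add: L1_loc_def set_integrable_def)
 moreover have "(%x. indicator \<Omega> x *\<^sub>R (indicator K x * V x)) = (%x. indicator K x *\<^sub>R V x)"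
  using K(2) by (auto simp: fun_eq_iff split: split_indicator)
 ultimately show ?thesis by (simp add: integrable_M set_integrable_def)
qed

lemma V_nonneg_M: "AE x in M. 0 <= V x"
 using V_nonneg by (simp add: AE_M)

lemma borel_M: "f \<in> borel_measurable borel ==> f \<in> borel_measurable M"
 by (intro measurable_restrict_space1 measurable_completion) simp

lemma T_closed: "u \<in> T ==> v \<in> T ==> (%x. u x + c * v x) \<in> T"
proof -
 assume uv: "u \<in> T" "v \<in> T"
 obtain K where K: "smooth_on UNIV u" "compact K" "K \<subseteq> \<Omega>" "!!x. x \<notin> K ==> u x = 0" using test_functionsD[OF uv(1)] by metis
 obtain L where L: "smooth_on UNIV v" "compact L" "L \<subseteq> \<Omega>" "!!x. x \<notin> L ==> v x = 0" using test_functionsD[OF uv(2)] by metis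
 show ?thesis
 proof (rule test_functionsI[where K = "K \<union> L"])
  show "smooth_on UNIV (%x. u x + c * v x)"
   by (intro smooth_on_add smooth_on_mult smooth_on_const K(1) L(1) open_UNIV)
 qed (use K L in auto)
qed

lemma mag_grad_linear:
 assumes "u \<in> T" "v \<in> T"
 shows "mag_grad a (%x. u x + c * v x) x $ j = mag_grad a u x $ j + c * mag_grad a v x $ j"
proof -
 have su: "smooth_on UNIV u" and sv: "smooth_on UNIV v" using assms test_functions_smooth by auto
 have d: "f differentiable (at x)" if "smooth_on UNIV f" for f :: "real^'n => complex"
  by (rule smooth_on_differentiable[OF open_UNIV that UNIV_I])
 have sc: "smooth_on UNIV (%x::real^'n. c)" by (rule smooth_on_const[OF open_UNIV])
 have scv: "smooth_on UNIV (%x. c * v x)" by (intro smooth_on_mult sc sv open_UNIV)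
 have "grad (%x. u x + c * v x) x $ j = grad u x $ j + c * grad v x $ j"
  unfolding grad_add[OF d[OF su] d[OF scv]] vector_add_component grad_mult[OF d[OF sc] d[OF sv]]
  by (simp add: grad_const)
 then show ?thesis by (simp add: mag_grad_def algebra_simps)
qed

lemma T_sq: "u \<in> T ==> u \<in> sq M"
proof -
 assume u: "u \<in> T"
 obtain K where K: "smooth_on UNIV u" "compact K" "!!x. x \<notin> K ==> u x = 0" using test_functionsD[OF u] by metis
 have "continuous_on UNIV (%x. (cmod (u x))^2)" using smooth_on_continuous[OF K(1)] by (intro continuous_intros)
 then have "integrable lebesgue (%x. (cmod (u x))^2)"
  by (rule integrable_compact_support(2)[OF _ K(2)]) (simp add: K(3))
 then have "integrable M (%x. (cmod (u x))^2)"
  unfolding integrable_M set_integrable_def by (intro integrable_mult_indicator dom_sets)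
 then show ?thesis by (simp add: sq_def borel_M smooth_borel K(1))
qed

lemma test_pd: "u \<in> T ==> (%x. grad u x $ j) \<in> T"
proof -
 assume u: "u \<in> T"
 obtain K where K: "smooth_on UNIV u" "compact K" "K \<subseteq> \<Omega>" "!!x. x \<notin> K ==> grad u x = 0" using test_functionsD[OF u] by metis
 show ?thesis by (rule test_functionsI[OF smooth_on_pd[OF K(1)] K(2,3)]) (simp add: K(4))
qed

lemma a_mult_sq: "u \<in> sq M ==> compact K ==> (!!x. x \<notin> K ==> u x = 0) ==> (%x. complex_of_real (a x $ j) * u x) \<in> sq M"
proof -
 assume u: "u \<in> sq M" and K: "compact K" and 0: "!!x. x \<notin> K ==> u x = 0"
 obtain B where B: "B >= 0" "!!j. AE x in M. x \<in> K \<longrightarrow> \<bar>a x $ j\<bar> <= B" by (rule a_bounded[OF K]) blast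
 have [measurable]: "u \<in> borel_measurable M" by (rule sq_measurable[OF u])
 show ?thesis
 proof (rule sqI_bound)
  show "integrable M (%x. B^2 * (cmod (u x))^2)" by (intro integrable_mult_right sq_integrable u)
  show "AE x in M. (cmod (complex_of_real (a x $ j) * u x))^2 <= B^2 * (cmod (u x))^2"
   using B(2)[of j]
  proof eventually_elim
   fix x assume *: "x \<in> K \<longrightarrow> \<bar>a x $ j\<bar> <= B"
   show "(cmod (complex_of_real (a x $ j) * u x))^2 <= B^2 * (cmod (u x))^2"
   proof (cases "x \<in> K")
    case True
    then have "\<bar>a x $ j\<bar>^2 <= B^2" using * by (intro power_mono) auto
    then show ?thesis by (simp add: norm_mult power_mult_distrib mult_right_mono)
   qed (simp add: 0)
  qed
 qed measurable
qed

lemma mag_grad_nth: "mag_grad a u x $ j = grad u x $ j + \<i> * (complex_of_real (a x $ j) * u x)"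
 by (simp add: mag_grad_def)

lemma mag_grad_sq: "u \<in> T ==> (%x. mag_grad a u x $ j) \<in> sq M"
proof -
 assume u: "u \<in> T"
 obtain K where K: "compact K" "!!x. x \<notin> K ==> u x = 0" using test_functionsD[OF u] by metis
 show ?thesis unfolding mag_grad_nth
  by (rule sq_closed[OF T_sq[OF test_pd[OF u]] a_mult_sq[OF T_sq[OF u] K]])
qed

text \<open>The potential part of the form as the square of an \<open>L2\<close> norm. The maximum
  with 0 makes the root total, since V is nonnegative only almost everywhere.\<close>

definition Zp :: "(real^'n => complex) => real^'n => complex" where
 "Zp u x = complex_of_real (sqrt (max 0 (V x))) * u x"

lemma Zp_norm: "AE x in M. (cmod (Zp u x))^2 = V x * (cmod (u x))^2"
 using V_nonneg_M by eventually_elim (simp add: Zp_def norm_mult power_mult_distrib)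

text \<open>V is accessible through its integrability on compact subsets, so it is first cut down to
  the support of u, on which u is bounded.\<close>

lemma Zp_sq: "u \<in> T ==> Zp u \<in> sq M"
proof -
 assume u: "u \<in> T"
 obtain K where K: "smooth_on UNIV u" "compact K" "K \<subseteq> \<Omega>" "!!x. x \<notin> K ==> u x = 0" using test_functionsD[OF u] by metis
 have Vi: "integrable M (%x. indicator K x * V x)" by (rule V_integrable[OF K(2,3)])
 have [measurable]: "u \<in> borel_measurable M" by (rule borel_M[OF smooth_borel[OF K(1)]])
 have [measurable]: "(%x. indicator K x * V x) \<in> borel_measurable M" using Vi by simp
 have eq: "Zp u = (%x. complex_of_real (sqrt (max 0 (indicator K x * V x))) * u x)"
  using K(4) by (auto simp: Zp_def fun_eq_iff indicator_def)
 have "compact (u ` K)" using continuous_on_subset[OF smooth_on_continuous[OF K(1)]] K(2) by (intro compact_continuous_image) auto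
 from compact_imp_bounded[OF this] obtain c where "\<forall>y\<in>u ` K. norm y <= c" unfolding bounded_iff by blast
 then have c: "(cmod (u x))^2 <= c^2" if "x \<in> K" for x using that by (intro power_mono) auto
 show ?thesis
 proof (rule sqI_bound)
  show "Zp u \<in> borel_measurable M" unfolding eq by measurable
  show "integrable M (%x. c^2 * (indicator K x * V x))" by (intro integrable_mult_right Vi)
  show "AE x in M. (cmod (Zp u x))^2 <= c^2 * (indicator K x * V x)"
   using Zp_norm[of u] V_nonneg_M
  proof eventually_elim
   fix x assume "(cmod (Zp u x))^2 = V x * (cmod (u x))^2" "0 <= V x"
   then show "(cmod (Zp u x))^2 <= c^2 * (indicator K x * V x)"
    using c[of x] K(4)[of x] by (cases "x \<in> K") (auto simp: mult.commute mult_left_mono)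
  qed
 qed
qed

lemma Zp_linear: "Zp (%x. u x + c * v x) = (%x. Zp u x + c * Zp v x)"
 by (simp add: Zp_def fun_eq_iff algebra_simps)

text \<open>As a sum of \<open>L2\<close> inner products the form inherits linearity, symmetry and
  positivity, and closability becomes a question about limits in \<open>L2\<close>.\<close>

lemma mag_form_eq:
 assumes "u \<in> T" "v \<in> T"
 shows "mag_form \<Omega> a V u v = (\<Sum>j\<in>UNIV. cip M (%x. mag_grad a u x $ j) (%x. mag_grad a v x $ j)) + cip M (Zp u) (Zp v)"
proof -
 let ?D = "%u j x. mag_grad a u x $ j"
 have i1: "integrable M (%x. ?D u j x * cnj (?D v j x))" for j
  by (rule sq_prod_integrable[OF mag_grad_sq mag_grad_sq]) (use assms in auto)
 have i2: "integrable M (%x. Zp u x * cnj (Zp v x))"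
  by (rule sq_prod_integrable[OF Zp_sq Zp_sq]) (use assms in auto)
 have ae: "AE x in M. Zp u x * cnj (Zp v x) = complex_of_real (V x) * u x * cnj (v x)"
  using V_nonneg_M
 proof eventually_elim
  fix x assume "0 <= V x"
  then have "complex_of_real (sqrt (V x)) * complex_of_real (sqrt (V x)) = complex_of_real (V x)"
   by (simp flip: of_real_mult)
  moreover have "Zp u x * cnj (Zp v x) = (complex_of_real (sqrt (V x)) * complex_of_real (sqrt (V x))) * (u x * cnj (v x))"
   using \<open>0 <= V x\<close> by (simp add: Zp_def mult_ac)
  ultimately show "Zp u x * cnj (Zp v x) = complex_of_real (V x) * u x * cnj (v x)" by (simp add: mult_ac)
 qed
 have "(\<Sum>j\<in>UNIV. cip M (?D u j) (?D v j)) + cip M (Zp u) (Zp v)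
   = (\<integral>x. (\<Sum>j\<in>UNIV. ?D u j x * cnj (?D v j x)) + Zp u x * cnj (Zp v x) \<partial>M)"
  unfolding cip_def using i1 i2 by (subst Bochner_Integration.integral_add) (auto simp: Bochner_Integration.integral_sum)
 also have "\<dots> = (\<integral>x. (\<Sum>j\<in>UNIV. ?D u j x * cnj (?D v j x)) + complex_of_real (V x) * u x * cnj (v x) \<partial>M)"
 proof (rule integral_cong_AE)
  have m1: "(%x. \<Sum>j\<in>UNIV. ?D u j x * cnj (?D v j x)) \<in> borel_measurable M"
   using i1 by (intro borel_measurable_sum) auto
  show "(%x. (\<Sum>j\<in>UNIV. ?D u j x * cnj (?D v j x)) + Zp u x * cnj (Zp v x)) \<in> borel_measurable M"
   using m1 i2 by (intro borel_measurable_add) auto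
  obtain K where K: "compact K" "K \<subseteq> \<Omega>" "!!x. x \<notin> K ==> u x = 0" using test_functionsD[OF assms(1)] by metis
  have [measurable]: "(%x. indicator K x * V x) \<in> borel_measurable M" using V_integrable[OF K(1,2)] by simp
  have [measurable]: "u \<in> borel_measurable M" "v \<in> borel_measurable M" using T_sq assms sq_measurable by auto
  have [measurable]: "(%x. cnj (v x)) \<in> borel_measurable M"
   by (rule borel_measurable_continuous_on[OF linear_continuous_on[OF bounded_linear_cnj]]) measurable
  have "(%x. complex_of_real (V x) * u x * cnj (v x)) = (%x. complex_of_real (indicator K x * V x) * u x * cnj (v x))"
   using K(3) by (auto simp: fun_eq_iff indicator_def)
  moreover have "(%x. complex_of_real (indicator K x * V x) * u x * cnj (v x)) \<in> borel_measurable M" by measurable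
  ultimately have "(%x. complex_of_real (V x) * u x * cnj (v x)) \<in> borel_measurable M" by (simp only:)
  then show "(%x. (\<Sum>j\<in>UNIV. ?D u j x * cnj (?D v j x)) + complex_of_real (V x) * u x * cnj (v x)) \<in> borel_measurable M"
   using m1 by (intro borel_measurable_add)
  show "AE x in M. (\<Sum>j\<in>UNIV. ?D u j x * cnj (?D v j x)) + Zp u x * cnj (Zp v x) = (\<Sum>j\<in>UNIV. ?D u j x * cnj (?D v j x)) + complex_of_real (V x) * u x * cnj (v x)"
   using ae by eventually_elim simp
 qed
 also have "\<dots> = mag_form \<Omega> a V u v" by (simp add: mag_form_def integral_M)
 finally show ?thesis by simp
qed

sublocale frm: semi_inner T "mag_form \<Omega> a V"
proof
 show "(%x. f x + c * g x) \<in> T" if "f \<in> T" "g \<in> T" for f g c using T_closed that .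
 show "mag_form \<Omega> a V (%x. f x + c * g x) h = mag_form \<Omega> a V f h + c * mag_form \<Omega> a V g h" if "f \<in> T" "g \<in> T" "h \<in> T" for f g h c
  using that by (simp add: mag_form_eq T_closed mag_grad_linear Zp_linear sq.lin mag_grad_sq Zp_sq sum.distrib sum_distrib_left algebra_simps)
 show "mag_form \<Omega> a V g f = cnj (mag_form \<Omega> a V f g)" if "f \<in> T" "g \<in> T" for f g
 proof -
  have 1: "cip M (%x. mag_grad a g x $ j) (%x. mag_grad a f x $ j) = cnj (cip M (%x. mag_grad a f x $ j) (%x. mag_grad a g x $ j))" for j
   by (rule sq.herm[OF mag_grad_sq mag_grad_sq]) (use that in auto)
  have 2: "cip M (Zp g) (Zp f) = cnj (cip M (Zp f) (Zp g))"
   by (rule sq.herm[OF Zp_sq Zp_sq]) (use that in auto)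
  show ?thesis unfolding mag_form_eq[OF that] mag_form_eq[OF that(2,1)] 1 2 by simp
 qed
 show "0 <= Re (mag_form \<Omega> a V f f)" if "f \<in> T" for f
  unfolding mag_form_eq[OF that that] by (simp add: cip_self sum_nonneg)
qed

lemma mag_energy_integrable: "u \<in> T ==> integrable M (%x. (norm (mag_grad a u x))^2 + V x * (cmod (u x))^2)"
proof -
 assume u: "u \<in> T"
 have 1: "integrable M (%x. (norm (mag_grad a u x))^2)"
  unfolding norm_vec_def L2_set_def
  using sq_integrable[OF mag_grad_sq[OF u]] by (simp add: sum_nonneg)
 obtain K where K: "compact K" "K \<subseteq> \<Omega>" "!!x. x \<notin> K ==> u x = 0" using test_functionsD[OF u] by metis
 have [measurable]: "(%x. indicator K x * V x) \<in> borel_measurable M" using V_integrable[OF K(1,2)] by simp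
 have [measurable]: "u \<in> borel_measurable M" using T_sq u sq_measurable by auto
 have "(%x. V x * (cmod (u x))^2) = (%x. (indicator K x * V x) * (cmod (u x))^2)"
  using K(3) by (auto simp: fun_eq_iff indicator_def)
 then have m: "(%x. V x * (cmod (u x))^2) \<in> borel_measurable M" by simp
 have 2: "integrable M (%x. V x * (cmod (u x))^2)"
  by (rule integrable_cong_AE_imp[OF sq_integrable[OF Zp_sq[OF u]] m]) (use Zp_norm[of u] in \<open>auto elim: eventually_mono\<close>)
 from 1 2 show ?thesis by (rule Bochner_Integration.integrable_add)
qed

lemma mag_energy_eq: "u \<in> T ==> mag_energy \<Omega> a V u = Re (mag_form \<Omega> a V u u)"
proof -
 assume u: "u \<in> T"
 have "integrable M (%x. \<Sum>j\<in>UNIV. mag_grad a u x $ j * cnj (mag_grad a u x $ j))"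
  by (intro Bochner_Integration.integrable_sum sq_prod_integrable mag_grad_sq u)
 have eq: "(%x. (\<Sum>j\<in>UNIV. mag_grad a u x $ j * cnj (mag_grad a u x $ j)) + complex_of_real (V x) * u x * cnj (u x))
   = (%x. complex_of_real ((norm (mag_grad a u x))^2 + V x * (cmod (u x))^2))"
 proof
  fix x
  have "(\<Sum>j\<in>UNIV. mag_grad a u x $ j * cnj (mag_grad a u x $ j)) = complex_of_real ((norm (mag_grad a u x))^2)"
   unfolding norm_vec_def L2_set_def complex_norm_square[symmetric] by (simp add: sum_nonneg)
  moreover have "complex_of_real (V x) * u x * cnj (u x) = complex_of_real (V x * (cmod (u x))^2)"
   unfolding mult.assoc complex_norm_square[symmetric] by simp
  ultimately show "(\<Sum>j\<in>UNIV. mag_grad a u x $ j * cnj (mag_grad a u x $ j)) + complex_of_real (V x) * u x * cnj (u x)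
   = complex_of_real ((norm (mag_grad a u x))^2 + V x * (cmod (u x))^2)" by simp
 qed
 show ?thesis
  unfolding mag_form_def mag_energy_def integral_M eq by (simp only: integral_complex_of_real Re_complex_of_real)
qed

lemma mag_energy_nn: "u \<in> T ==> ennreal (mag_energy \<Omega> a V u)
  = (\<integral>\<^sup>+x\<in>\<Omega>. ennreal ((norm (mag_grad a u x))^2 + V x * (cmod (u x))^2) \<partial>lebesgue)"
proof -
 assume u: "u \<in> T"
 have "AE x in M. 0 <= (norm (mag_grad a u x))^2 + V x * (cmod (u x))^2"
  using V_nonneg_M by eventually_elim simp
 from nn_integral_eq_integral[OF mag_energy_integrable[OF u] this]
 have "ennreal (mag_energy \<Omega> a V u) = (\<integral>\<^sup>+x. ennreal ((norm (mag_grad a u x))^2 + V x * (cmod (u x))^2) \<partial>M)"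
  by (simp add: mag_energy_def integral_M)
 also have "\<dots> = (\<integral>\<^sup>+x\<in>\<Omega>. ennreal ((norm (mag_grad a u x))^2 + V x * (cmod (u x))^2) \<partial>lebesgue)"
  by (rule nn_integral_restrict_space) (use dom_sets in simp)
 finally show ?thesis .
qed

lemma test_norm_integral: "u \<in> T ==> (LINT x:\<Omega>|lebesgue. (cmod (u x))^2) = (\<integral>x. (cmod (u x))^2 \<partial>lborel)"
proof -
 assume u: "u \<in> T"
 obtain K where K: "smooth_on UNIV u" "K \<subseteq> \<Omega>" "!!x. x \<notin> K ==> u x = 0" using test_functionsD[OF u] by metis
 have [measurable]: "u \<in> borel_measurable lborel" using smooth_borel[OF K(1)] by simp
 have "(%x. indicator \<Omega> x *\<^sub>R (cmod (u x))^2) = (%x. (cmod (u x))^2)"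
  using K by (auto simp: fun_eq_iff indicator_def)
 then show ?thesis unfolding set_lebesgue_integral_def by (simp add: integral_completion)
qed

end

subsection \<open>Closability and the spectrum of the operator\<close>

context magnetic
begin

lemma L2_eq: "L2 \<Omega> = sq M"
proof -
 have "set_borel_measurable lebesgue \<Omega> u \<longleftrightarrow> u \<in> borel_measurable M" for u :: "real^'n => complex"
  unfolding set_borel_measurable_def by (rule borel_measurable_restrict_space_iff[symmetric]) (use dom_sets in simp)
 then show ?thesis by (auto simp: L2_def sq_def integrable_M)
qed

lemma L2_inner_eq: "L2_inner \<Omega> u v = cip M u v"
 by (simp add: L2_inner_def cip_def integral_M)

lemma L2_norm_eq: "L2_norm \<Omega> u = sq.nrm M u"
 by (simp add: L2_norm_def sq_nrm integral_M)

abbreviation hf where "hf \<equiv> mag_form \<Omega> a V"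

lemma energy_nrm: "u \<in> T ==> mag_energy \<Omega> a V u = (frm.nrm u)^2"
 by (simp add: mag_energy_eq frm.nrm_square)

lemma energy_parts: "u \<in> T ==> (frm.nrm u)^2 = (\<Sum>j\<in>UNIV. (sq.nrm M (%x. mag_grad a u x $ j))^2) + (sq.nrm M (Zp u))^2"
 by (simp add: frm.nrm_square mag_form_eq sq.nrm_square mag_grad_sq Zp_sq)

lemma mag_grad_diff: "u \<in> T ==> v \<in> T ==> mag_grad a (%x. u x - v x) x $ j = mag_grad a u x $ j - mag_grad a v x $ j"
 using mag_grad_linear[of u v "-1" x j] by simp

lemma Zp_diff: "Zp (%x. u x - v x) = (%x. Zp u x - Zp v x)"
 using Zp_linear[of u "-1" v] by simp

lemma part_le: "u \<in> T ==> sq.nrm M (%x. mag_grad a u x $ j) <= frm.nrm u" "u \<in> T ==> sq.nrm M (Zp u) <= frm.nrm u"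
proof -
 assume u: "u \<in> T"
 have "(sq.nrm M (%x. mag_grad a u x $ j))^2 <= (\<Sum>j\<in>UNIV. (sq.nrm M (%x. mag_grad a u x $ j))^2)"
  by (rule member_le_sum) auto
 then have "(sq.nrm M (%x. mag_grad a u x $ j))^2 <= (frm.nrm u)^2" unfolding energy_parts[OF u] by (smt (verit) zero_le_power2)
 then show "sq.nrm M (%x. mag_grad a u x $ j) <= frm.nrm u" by (rule power2_le_imp_le) (rule frm.nrm_nonneg[OF u])
 have "(sq.nrm M (Zp u))^2 <= (frm.nrm u)^2" unfolding energy_parts[OF u] by (simp add: sum_nonneg)
 then show "sq.nrm M (Zp u) <= frm.nrm u" by (rule power2_le_imp_le) (rule frm.nrm_nonneg[OF u])
qed

lemma T_integral_M:
 fixes f :: "real^'n => complex"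
 assumes u: "u \<in> T" and f: "continuous_on UNIV f"
 shows "cip M u f = (\<integral>x. u x * cnj (f x) \<partial>lborel)"
proof -
 obtain K where K: "smooth_on UNIV u" "K \<subseteq> \<Omega>" "!!x. x \<notin> K ==> u x = 0" using test_functionsD[OF u] by metis
 have c: "continuous_on UNIV (%x. u x * cnj (f x))" using smooth_on_continuous[OF K(1)] f by (intro continuous_intros)
 have "(%x. indicator \<Omega> x *\<^sub>R (u x * cnj (f x))) = (%x. u x * cnj (f x))"
  using K by (auto simp: fun_eq_iff indicator_def)
 then have "cip M u f = (\<integral>x. u x * cnj (f x) \<partial>lebesgue)"
  unfolding cip_def integral_M[symmetric] set_lebesgue_integral_def by simp
 also have "\<dots> = (\<integral>x. u x * cnj (f x) \<partial>lborel)"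
  using borel_measurable_continuous_onI[OF c] by (intro integral_completion) simp
 finally show ?thesis .
qed

lemma real_test_sq:
 assumes "\<psi> \<in> test_functions UNIV"
 shows "(%x. complex_of_real (\<psi> x)) \<in> sq M"
proof -
 obtain K where K: "smooth_on UNIV \<psi>" "compact K" "!!x. x \<notin> K ==> \<psi> x = 0" using test_functionsD[OF assms] by metis
 have "continuous_on UNIV (%x. (cmod (complex_of_real (\<psi> x)))^2)" using smooth_on_continuous[OF K(1)] by (intro continuous_intros)
 then have "integrable lebesgue (%x. (cmod (complex_of_real (\<psi> x)))^2)"
  by (rule integrable_compact_support(2)[OF _ K(2)]) (simp add: K(3))
 then have "integrable M (%x. (cmod (complex_of_real (\<psi> x)))^2)"
  unfolding integrable_M set_integrable_def by (intro integrable_mult_indicator dom_sets)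
 then show ?thesis by (simp add: sq_def borel_M smooth_borel smooth_on_complex_of_real K(1))
qed

lemma sq_pairing_tendsto:
 assumes "!!k. f k \<in> sq M" "g \<in> sq M" "v \<in> sq M" "(%k. sq.nrm M (%x. f k x - g x)) \<longlonglongrightarrow> 0"
 shows "(%k. cip M (f k) v) \<longlonglongrightarrow> cip M g v"
proof (rule LIM_zero_cancel, rule tendsto_norm_zero_cancel, rule tendsto_sandwich[OF _ _ tendsto_const])
 show "\<forall>\<^sub>F k in sequentially. norm (cip M (f k) v - cip M g v) <= sq.nrm M (%x. f k x - g x) * sq.nrm M v"
  using sq.cauchy_schwarz[OF sq.diff_closed[OF assms(1,2)] assms(3)] by (simp add: sq.lin_diff assms)
 show "(%k. sq.nrm M (%x. f k x - g x) * sq.nrm M v) \<longlonglongrightarrow> 0"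
  using tendsto_mult[OF assms(4) tendsto_const] by simp
qed simp

text \<open>Each component of the magnetic gradients and each potential part converges in
  \<open>L2\<close>, and the limits must be shown to vanish. For the gradients this is done by
  pairing with test functions, for the potential part by almost everywhere convergence along a
  subsequence.\<close>

lemma form_closable:
 assumes \<phi>: "!!k. \<phi> k \<in> T" and lim: "(%k. sq.nrm M (\<phi> k)) \<longlonglongrightarrow> 0"
  and C: "!!e. e > 0 ==> \<exists>N. \<forall>k\<ge>N. \<forall>m\<ge>N. frm.nrm (%x. \<phi> k x - \<phi> m x) < e"
 shows "(%k. frm.nrm (\<phi> k)) \<longlonglongrightarrow> 0"
proof -
 have zero: "(%x. 0) \<in> sq M" using sq.zero_closed[OF T_sq[OF \<phi>]] .
 have lim0: "(%k. sq.nrm M (%x. \<phi> k x - 0)) \<longlonglongrightarrow> 0" using lim by simp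
 have to0: "(%k. sq.nrm M (f k)) \<longlonglongrightarrow> 0"
  if f: "!!k. f k \<in> sq M" and g: "g \<in> sq M" "AE x in M. g x = 0" "(%k. sq.nrm M (%x. f k x - g x)) \<longlonglongrightarrow> 0" for f g
 proof -
  have "sq.nrm M (%x. f k x - g x) = sq.nrm M (f k)" for k
  proof -
   have "(\<integral>x. (cmod (f k x - g x))^2 \<partial>M) = (\<integral>x. (cmod (f k x))^2 \<partial>M)"
    using g(2) sq_integrable[OF f[of k]] sq_integrable[OF sq.diff_closed[OF f[of k] g(1)]]
    by (intro integral_cong_AE) (auto elim: eventually_mono)
   then show ?thesis by (simp add: sq_nrm)
  qed
  then show ?thesis using g(3) by simp
 qed
 have Dlim: "(%k. sq.nrm M (%x. mag_grad a (\<phi> k) x $ j)) \<longlonglongrightarrow> 0" for j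
 proof -
  have "\<exists>N. \<forall>k\<ge>N. \<forall>m\<ge>N. sq.nrm M (%x. mag_grad a (\<phi> k) x $ j - mag_grad a (\<phi> m) x $ j) < e" if e: "e > 0" for e
  proof -
   obtain N where N: "\<forall>k\<ge>N. \<forall>m\<ge>N. frm.nrm (%x. \<phi> k x - \<phi> m x) < e" using C[OF e] by blast
   have "sq.nrm M (%x. mag_grad a (\<phi> k) x $ j - mag_grad a (\<phi> m) x $ j) <= frm.nrm (%x. \<phi> k x - \<phi> m x)" for k m
    using part_le(1)[OF frm.diff_closed[OF \<phi> \<phi>], of k m j] by (simp add: mag_grad_diff \<phi>)
   with N show ?thesis by (meson le_less_trans)
  qed
  from this obtain g where g: "g \<in> sq M" "(%k. sq.nrm M (%x. mag_grad a (\<phi> k) x $ j - g x)) \<longlonglongrightarrow> 0"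
   by (rule sq_complete[of "%k x. mag_grad a (\<phi> k) x $ j" M, OF mag_grad_sq[OF \<phi>]]) blast
  have orth: "cip M g (%x. complex_of_real (\<psi> x)) = 0" if \<psi>: "\<psi> \<in> test_functions UNIV" for \<psi>
  proof -
   obtain K where K: "smooth_on UNIV \<psi>" "compact K" "!!x. x \<notin> K ==> \<psi> x = 0" "!!x. x \<notin> K ==> grad \<psi> x = 0"
    using test_functionsD[OF \<psi>] by metis
   let ?\<psi> = "%x. complex_of_real (\<psi> x)" and ?\<psi>' = "%x. complex_of_real (grad \<psi> x $ j)"
   have s\<psi>: "smooth_on UNIV ?\<psi>" "smooth_on UNIV ?\<psi>'" by (intro smooth_on_complex_of_real smooth_on_pd K(1) open_UNIV)+
   have \<psi>'t: "(%x. grad \<psi> x $ j) \<in> test_functions UNIV"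
    by (rule test_functionsI[OF smooth_on_pd[OF K(1)] K(2)]) (auto simp: K(4))
   have \<psi>sq: "?\<psi> \<in> sq M" "?\<psi>' \<in> sq M" using real_test_sq[OF \<psi>] real_test_sq[OF \<psi>'t] by auto
   have a\<psi>: "(%x. complex_of_real (a x $ j) * ?\<psi> x) \<in> sq M" by (rule a_mult_sq[OF \<psi>sq(1) K(2)]) (simp add: K(3))
   \<comment> \<open>Derivative and multiplication by the potential are moved to \<psi>, on whose
     support a is bounded. What remains pairs \<phi> k, which tends to 0, with fixed
     square-integrable functions. The support of \<psi> may leave the domain, as that of \<phi> k
     does not.\<close>
   have eq: "cip M (%x. mag_grad a (\<phi> k) x $ j) ?\<psi> = - cip M (\<phi> k) ?\<psi>' + \<i> * cip M (\<phi> k) (%x. complex_of_real (a x $ j) * ?\<psi> x)" for k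
   proof -
    obtain L where L: "smooth_on UNIV (\<phi> k)" "compact L" "!!x. x \<notin> L ==> \<phi> k x = 0" "!!x. x \<notin> L ==> grad (\<phi> k) x = 0"
     using test_functionsD[OF \<phi>[of k]] by metis
    have a\<phi>: "(%x. complex_of_real (a x $ j) * \<phi> k x) \<in> sq M" by (rule a_mult_sq[OF T_sq[OF \<phi>] L(2,3)])
    have "cip M (%x. mag_grad a (\<phi> k) x $ j) ?\<psi> = cip M (%x. grad (\<phi> k) x $ j) ?\<psi> + \<i> * cip M (%x. complex_of_real (a x $ j) * \<phi> k x) ?\<psi>"
     unfolding mag_grad_nth by (rule sq.lin[OF T_sq[OF test_pd[OF \<phi>]] a\<phi> \<psi>sq(1)])
    also have "cip M (%x. complex_of_real (a x $ j) * \<phi> k x) ?\<psi> = cip M (\<phi> k) (%x. complex_of_real (a x $ j) * ?\<psi> x)"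
     by (simp add: cip_def mult_ac)
    also have "cip M (%x. grad (\<phi> k) x $ j) ?\<psi> = (\<integral>x. grad (\<phi> k) x $ j * ?\<psi> x \<partial>lborel)"
     by (subst T_integral_M[OF test_pd[OF \<phi>] smooth_on_continuous[OF s\<psi>(1)]]) simp
    also have "\<dots> = - (\<integral>x. \<phi> k x * grad ?\<psi> x $ j \<partial>lborel)"
     by (rule integral_by_parts(1)[OF bounded_bilinear_mult L(1) s\<psi>(1) L(2)]) (auto simp: L(3))
    also have "(%x. grad ?\<psi> x $ j) = ?\<psi>'"
     by (intro ext grad_linear_compose[OF bounded_linear_of_real] smooth_on_differentiable[OF open_UNIV K(1)]) simp
    also have "(\<integral>x. \<phi> k x * ?\<psi>' x \<partial>lborel) = cip M (\<phi> k) ?\<psi>'"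
     by (subst T_integral_M[OF \<phi> smooth_on_continuous[OF s\<psi>(2)]]) simp
    finally show ?thesis .
   qed
   have z: "cip M (%x. 0) v = 0" for v by (simp add: cip_def)
   have "(%k. - cip M (\<phi> k) ?\<psi>' + \<i> * cip M (\<phi> k) (%x. complex_of_real (a x $ j) * ?\<psi> x)) \<longlonglongrightarrow>
     - cip M (%x. 0) ?\<psi>' + \<i> * cip M (%x. 0) (%x. complex_of_real (a x $ j) * ?\<psi> x)"
    by (intro tendsto_intros sq_pairing_tendsto[OF T_sq[OF \<phi>] zero _ lim0] \<psi>sq a\<psi>)
   then have "(%k. cip M (%x. mag_grad a (\<phi> k) x $ j) ?\<psi>) \<longlonglongrightarrow> 0" unfolding eq z by simp
   with sq_pairing_tendsto[OF mag_grad_sq[OF \<phi>] g(1) \<psi>sq(1) g(2)] show ?thesis by (rule LIMSEQ_unique)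
  qed
  \<comment> \<open>The fundamental lemma is about the whole space, so the limit is continued by 0
    off the domain.\<close>
  define G where "G x = indicator \<Omega> x *\<^sub>R g x" for x
  have "G \<in> sq lebesgue"
  proof -
   have "G \<in> borel_measurable lebesgue"
    unfolding G_def using sq_measurable[OF g(1)] dom_sets by (subst borel_measurable_restrict_space_iff[symmetric]) auto
   moreover have "integrable lebesgue (%x. indicator \<Omega> x *\<^sub>R (cmod (g x))^2)"
    using sq_integrable[OF g(1)] unfolding integrable_M set_integrable_def .
   moreover have "(%x. indicator \<Omega> x *\<^sub>R (cmod (g x))^2) = (%x. (cmod (G x))^2)"
    by (auto simp: G_def fun_eq_iff indicator_def)
   ultimately show ?thesis by (simp add: sq_def)
  qed
  moreover have "(\<integral>x. complex_of_real (\<psi> x) * G x \<partial>lebesgue) = 0" if \<psi>: "\<psi> \<in> test_functions UNIV" for \<psi>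
  proof -
   have "(\<integral>x. complex_of_real (\<psi> x) * G x \<partial>lebesgue) = (LINT x:\<Omega>|lebesgue. g x * cnj (complex_of_real (\<psi> x)))"
    unfolding set_lebesgue_integral_def by (rule Bochner_Integration.integral_cong) (auto simp: G_def indicator_def)
   also have "\<dots> = 0" using orth[OF \<psi>] by (simp only: integral_M cip_def)
   finally show ?thesis .
  qed
  ultimately have "AE x in lebesgue. G x = 0" by (rule fundamental_lemma)
  then have "AE x in M. g x = 0" unfolding AE_M by eventually_elim (auto simp: G_def indicator_def)
  from to0[OF mag_grad_sq[OF \<phi>] g(1) this g(2)] show ?thesis .
 qed
 have Zlim: "(%k. sq.nrm M (Zp (\<phi> k))) \<longlonglongrightarrow> 0"
 proof -
  have "\<exists>N. \<forall>k\<ge>N. \<forall>m\<ge>N. sq.nrm M (%x. Zp (\<phi> k) x - Zp (\<phi> m) x) < e" if e: "e > 0" for e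
  proof -
   obtain N where N: "\<forall>k\<ge>N. \<forall>m\<ge>N. frm.nrm (%x. \<phi> k x - \<phi> m x) < e" using C[OF e] by blast
   have "sq.nrm M (%x. Zp (\<phi> k) x - Zp (\<phi> m) x) <= frm.nrm (%x. \<phi> k x - \<phi> m x)" for k m
    using part_le(2)[OF frm.diff_closed[OF \<phi> \<phi>], of k m] by (simp add: Zp_diff)
   with N show ?thesis by (meson le_less_trans)
  qed
  from this obtain g where g: "g \<in> sq M" "(%k. sq.nrm M (%x. Zp (\<phi> k) x - g x)) \<longlonglongrightarrow> 0"
   by (rule sq_complete[of "%k. Zp (\<phi> k)" M, OF Zp_sq[OF \<phi>]]) blast
  \<comment> \<open>Multiplication by the root of V may be unbounded on \<open>L2\<close>, but at
    almost every point it preserves convergence to 0.\<close>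
  obtain r where r: "strict_mono r" "AE x in M. (%k. \<phi> (r k) x) \<longlonglongrightarrow> 0"
   by (rule sq_AE_subseq[of \<phi> M "%x. 0", OF T_sq[OF \<phi>] zero lim0]) blast
  have "(%k. sq.nrm M (%x. Zp (\<phi> (r k)) x - g x)) \<longlonglongrightarrow> 0"
   using LIMSEQ_subseq_LIMSEQ[OF g(2) r(1)] by (simp add: o_def)
  from this obtain s where s: "strict_mono s" "AE x in M. (%k. Zp (\<phi> (r (s k))) x) \<longlonglongrightarrow> g x"
   by (rule sq_AE_subseq[of "%k. Zp (\<phi> (r k))" M g, OF Zp_sq[OF \<phi>] g(1)]) blast
  have "AE x in M. g x = 0"
   using r(2) s(2)
  proof eventually_elim
   fix x assume 1: "(%k. \<phi> (r k) x) \<longlonglongrightarrow> 0" and 2: "(%k. Zp (\<phi> (r (s k))) x) \<longlonglongrightarrow> g x"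
   have "(%k. complex_of_real (sqrt (max 0 (V x))) * \<phi> (r (s k)) x) \<longlonglongrightarrow> complex_of_real (sqrt (max 0 (V x))) * 0"
    using LIMSEQ_subseq_LIMSEQ[OF 1 s(1)] by (intro tendsto_intros) (simp add: o_def)
   then have "(%k. Zp (\<phi> (r (s k))) x) \<longlonglongrightarrow> 0" by (simp add: Zp_def)
   with 2 show "g x = 0" by (rule LIMSEQ_unique)
  qed
  from to0[OF Zp_sq[OF \<phi>] g(1) this g(2)] show ?thesis .
 qed
 have "(%k. sqrt ((\<Sum>j\<in>UNIV. (sq.nrm M (%x. mag_grad a (\<phi> k) x $ j))^2) + (sq.nrm M (Zp (\<phi> k)))^2)) \<longlonglongrightarrow> sqrt ((\<Sum>j\<in>(UNIV::'n set). 0^2) + 0^2)"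
  by (intro tendsto_real_sqrt tendsto_add tendsto_sum tendsto_power Dlim Zlim)
 then show ?thesis
  unfolding energy_parts[OF \<phi>, symmetric] using frm.nrm_nonneg[OF \<phi>] by simp
qed

definition apx :: "(nat => real^'n => complex) => (real^'n => complex) => bool" where
 "apx \<phi> u \<longleftrightarrow> u \<in> sq M \<and> (\<forall>k. \<phi> k \<in> T) \<and> (%k. sq.nrm M (%x. \<phi> k x - u x)) \<longlonglongrightarrow> 0 \<and>
   (\<forall>e>0. \<exists>N. \<forall>k\<ge>N. \<forall>m\<ge>N. frm.nrm (%x. \<phi> k x - \<phi> m x) < e)"

lemma form_approx_eq: "form_approx \<Omega> a V \<phi> u \<longleftrightarrow> apx \<phi> u"
proof (cases "\<forall>k. \<phi> k \<in> T")
 case True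
 have *: "mag_energy \<Omega> a V (%x. \<phi> k x - \<phi> m x) = (frm.nrm (%x. \<phi> k x - \<phi> m x))^2" for k m
  using True by (intro energy_nrm frm.diff_closed) auto
 have nn: "0 <= frm.nrm (%x. \<phi> k x - \<phi> m x)" for k m using True by (intro frm.nrm_nonneg frm.diff_closed) auto
 have "(\<forall>e>0. \<exists>N. \<forall>k\<ge>N. \<forall>m\<ge>N. (frm.nrm (%x. \<phi> k x - \<phi> m x))^2 < e) \<longleftrightarrow> (\<forall>e>0. \<exists>N. \<forall>k\<ge>N. \<forall>m\<ge>N. frm.nrm (%x. \<phi> k x - \<phi> m x) < e)"
 proof (intro iffI allI impI)
  fix e :: real assume A: "\<forall>e>0. \<exists>N. \<forall>k\<ge>N. \<forall>m\<ge>N. (frm.nrm (%x. \<phi> k x - \<phi> m x))^2 < e" and e: "e > 0"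
  obtain N where "\<forall>k\<ge>N. \<forall>m\<ge>N. (frm.nrm (%x. \<phi> k x - \<phi> m x))^2 < e^2" using A e by (metis zero_less_power)
  then show "\<exists>N. \<forall>k\<ge>N. \<forall>m\<ge>N. frm.nrm (%x. \<phi> k x - \<phi> m x) < e" using e by (meson power2_less_imp_less less_imp_le)
 next
  fix e :: real assume A: "\<forall>e>0. \<exists>N. \<forall>k\<ge>N. \<forall>m\<ge>N. frm.nrm (%x. \<phi> k x - \<phi> m x) < e" and e: "e > 0"
  obtain N where N: "\<forall>k\<ge>N. \<forall>m\<ge>N. frm.nrm (%x. \<phi> k x - \<phi> m x) < sqrt e" using A e by (metis real_sqrt_gt_zero)
  have "(frm.nrm (%x. \<phi> k x - \<phi> m x))^2 < e" if "k >= N" "m >= N" for k m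
  proof -
   have "(frm.nrm (%x. \<phi> k x - \<phi> m x))^2 < (sqrt e)^2" using N that nn by (intro power_strict_mono) auto
   then show ?thesis using e by simp
  qed
  then show "\<exists>N. \<forall>k\<ge>N. \<forall>m\<ge>N. (frm.nrm (%x. \<phi> k x - \<phi> m x))^2 < e" by blast
 qed
 then show ?thesis unfolding form_approx_def apx_def L2_eq L2_norm_eq * by (simp only: True simp_thms)
qed (auto simp: form_approx_def apx_def)

lemma apxD:
 assumes "apx \<phi> u"
 shows "u \<in> sq M" "\<phi> k \<in> T" "(%k. sq.nrm M (%x. \<phi> k x - u x)) \<longlonglongrightarrow> 0"
  "e > 0 ==> \<exists>N. \<forall>k\<ge>N. \<forall>m\<ge>N. frm.nrm (%x. \<phi> k x - \<phi> m x) < e"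
 using assms by (auto simp: apx_def)

lemma apx_linear:
 assumes "apx \<phi> u" "apx \<psi> v"
 shows "apx (%k x. \<phi> k x + c * \<psi> k x) (%x. u x + c * v x)"
 unfolding apx_def
proof (intro conjI allI impI)
 note A = apxD[OF assms(1)] and B = apxD[OF assms(2)]
 show "(%x. u x + c * v x) \<in> sq M" by (rule sq_closed[OF A(1) B(1)])
 show "(%x. \<phi> k x + c * \<psi> k x) \<in> T" for k by (rule T_closed[OF A(2) B(2)])
 have e1: "(%x. \<phi> k x + c * \<psi> k x - (u x + c * v x)) = (%x. (\<phi> k x - u x) + c * (\<psi> k x - v x))" for k
  by (auto simp: algebra_simps)
 show "(%k. sq.nrm M (%x. \<phi> k x + c * \<psi> k x - (u x + c * v x))) \<longlonglongrightarrow> 0"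
 proof (rule tendsto_sandwich[OF _ _ tendsto_const])
  show "\<forall>\<^sub>F k in sequentially. sq.nrm M (%x. \<phi> k x + c * \<psi> k x - (u x + c * v x)) <= sq.nrm M (%x. \<phi> k x - u x) + cmod c * sq.nrm M (%x. \<psi> k x - v x)"
   unfolding e1 by (intro always_eventually allI sq.triangle sq.diff_closed T_sq A B)
  have "(%k. sq.nrm M (%x. \<phi> k x - u x) + cmod c * sq.nrm M (%x. \<psi> k x - v x)) \<longlonglongrightarrow> 0 + cmod c * 0"
   by (intro tendsto_intros A(3) B(3))
  then show "(%k. sq.nrm M (%x. \<phi> k x - u x) + cmod c * sq.nrm M (%x. \<psi> k x - v x)) \<longlonglongrightarrow> 0" by simp
  show "\<forall>\<^sub>F k in sequentially. 0 <= sq.nrm M (%x. \<phi> k x + c * \<psi> k x - (u x + c * v x))"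
   unfolding e1 by (intro always_eventually allI sq.nrm_nonneg sq_closed sq.diff_closed T_sq A B)
 qed
 fix e :: real assume e: "e > 0"
 have e2: "(%x. \<phi> k x + c * \<psi> k x - (\<phi> m x + c * \<psi> m x)) = (%x. (\<phi> k x - \<phi> m x) + c * (\<psi> k x - \<psi> m x))" for k m
  by (auto simp: algebra_simps)
 obtain N1 where N1: "\<forall>k\<ge>N1. \<forall>m\<ge>N1. frm.nrm (%x. \<phi> k x - \<phi> m x) < e / 2" using A(4)[of "e / 2"] e by auto
 have "e / (2 * (cmod c + 1)) > 0" using e by (simp add: add_nonneg_pos)
 then obtain N2 where N2: "\<forall>k\<ge>N2. \<forall>m\<ge>N2. frm.nrm (%x. \<psi> k x - \<psi> m x) < e / (2 * (cmod c + 1))" using B(4) by meson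
 have "frm.nrm (%x. \<phi> k x + c * \<psi> k x - (\<phi> m x + c * \<psi> m x)) < e" if "k >= max N1 N2" "m >= max N1 N2" for k m
 proof -
  have "frm.nrm (%x. \<phi> k x + c * \<psi> k x - (\<phi> m x + c * \<psi> m x)) <= frm.nrm (%x. \<phi> k x - \<phi> m x) + cmod c * frm.nrm (%x. \<psi> k x - \<psi> m x)"
   unfolding e2 by (intro frm.triangle frm.diff_closed A B)
  also have "\<dots> <= frm.nrm (%x. \<phi> k x - \<phi> m x) + (cmod c + 1) * (e / (2 * (cmod c + 1)))"
   using N2 that frm.nrm_nonneg[OF frm.diff_closed[OF B(2) B(2)]] by (intro add_left_mono mult_mono) (auto simp: less_imp_le)
  also have "(cmod c + 1) * (e / (2 * (cmod c + 1))) = e / 2"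
  proof -
   have "s * (e / (2 * s)) = e / 2" if "s > 0" for s :: real using that by simp
   then show ?thesis by (simp only: add_nonneg_pos norm_ge_zero zero_less_one)
  qed
  also have "frm.nrm (%x. \<phi> k x - \<phi> m x) + e / 2 < e / 2 + e / 2" using N1 that by (intro add_strict_right_mono) auto
  finally show ?thesis by simp
 qed
 then show "\<exists>N. \<forall>k\<ge>N. \<forall>m\<ge>N. frm.nrm (%x. \<phi> k x + c * \<psi> k x - (\<phi> m x + c * \<psi> m x)) < e" by blast
qed

lemma apx_const: "u \<in> T ==> apx (%k. u) u"
proof -
 assume u: "u \<in> T"
 have z: "frm.nrm (%x. 0) = 0" "sq.nrm M (%x. 0) = 0"
  using frm.zero_left[OF frm.zero_closed[OF u]] sq_nrm[of M "%x. 0"] by (simp_all add: frm.nrm_def)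
 show ?thesis unfolding apx_def using u T_sq[OF u] z by auto
qed

lemma apx_bounded: "apx \<phi> u ==> \<exists>C N. C >= 0 \<and> (\<forall>k\<ge>N. frm.nrm (\<phi> k) <= C)"
proof -
 assume A: "apx \<phi> u"
 obtain N where N: "\<forall>k\<ge>N. \<forall>m\<ge>N. frm.nrm (%x. \<phi> k x - \<phi> m x) < 1" using apxD(4)[OF A, of 1] by auto
 have "frm.nrm (\<phi> k) <= frm.nrm (\<phi> N) + 1" if "k >= N" for k
 proof -
  have "\<bar>frm.nrm (\<phi> k) - frm.nrm (\<phi> N)\<bar> <= frm.nrm (%x. \<phi> k x - \<phi> N x)"
   by (rule frm.nrm_diff_le[OF apxD(2)[OF A] apxD(2)[OF A]])
  also have "\<dots> < 1" using N that by blast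
  finally show ?thesis by linarith
 qed
 then show ?thesis using frm.nrm_nonneg[OF apxD(2)[OF A], of N] by (intro exI[of _ "frm.nrm (\<phi> N) + 1"] exI[of _ N]) auto
qed

end

context magnetic
begin

text \<open>The difference of two approximating sequences of the same function approximates 0, to
  which closability applies.\<close>

lemma apx_same_limit:
 assumes "apx \<phi> u" "apx \<phi>' u"
 shows "(%k. frm.nrm (%x. \<phi> k x - \<phi>' k x)) \<longlonglongrightarrow> 0"
proof -
 have A: "apx (%k x. \<phi> k x + (-1) * \<phi>' k x) (%x. u x + (-1) * u x)" by (rule apx_linear[OF assms])
 show ?thesis
  using form_closable[of "%k x. \<phi> k x - \<phi>' k x"] apxD[OF A] by simp
qed

lemma pairing_difference:
 assumes A: "apx \<phi> u" "apx \<phi>' u'" "apx \<psi> v" "apx \<psi>' v'"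
  and l1: "(%k. frm.nrm (%x. \<phi> k x - \<phi>' k x)) \<longlonglongrightarrow> 0" and l2: "(%k. frm.nrm (%x. \<psi> k x - \<psi>' k x)) \<longlonglongrightarrow> 0"
 shows "(%k. hf (\<phi> k) (\<psi> k) - hf (\<phi>' k) (\<psi>' k)) \<longlonglongrightarrow> 0"
proof -
 obtain C1 N1 where C1: "C1 >= 0" "\<forall>k\<ge>N1. frm.nrm (\<psi> k) <= C1" using apx_bounded[OF A(3)] by blast
 obtain C2 N2 where C2: "C2 >= 0" "\<forall>k\<ge>N2. frm.nrm (\<phi>' k) <= C2" using apx_bounded[OF A(2)] by blast
 note t = apxD(2)[OF A(1)] apxD(2)[OF A(2)] apxD(2)[OF A(3)] apxD(2)[OF A(4)]
 have "cmod (hf (\<phi> k) (\<psi> k) - hf (\<phi>' k) (\<psi>' k)) <= frm.nrm (%x. \<phi> k x - \<phi>' k x) * C1 + C2 * frm.nrm (%x. \<psi> k x - \<psi>' k x)"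
  if k: "k >= max N1 N2" for k
 proof -
  have e: "hf (\<phi> k) (\<psi> k) - hf (\<phi>' k) (\<psi>' k) = hf (%x. \<phi> k x - \<phi>' k x) (\<psi> k) + hf (\<phi>' k) (%x. \<psi> k x - \<psi>' k x)"
   unfolding frm.lin_diff[OF t(1,2,3)] frm.lin2_diff[OF t(3,4,2)] by simp
  have "cmod (hf (\<phi> k) (\<psi> k) - hf (\<phi>' k) (\<psi>' k)) <= frm.nrm (%x. \<phi> k x - \<phi>' k x) * frm.nrm (\<psi> k) + frm.nrm (\<phi>' k) * frm.nrm (%x. \<psi> k x - \<psi>' k x)"
    unfolding e by (rule norm_triangle_mono[OF frm.cauchy_schwarz[OF frm.diff_closed[OF t(1,2)] t(3)] frm.cauchy_schwarz[OF t(2) frm.diff_closed[OF t(3,4)]]])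
  also have "\<dots> <= frm.nrm (%x. \<phi> k x - \<phi>' k x) * C1 + C2 * frm.nrm (%x. \<psi> k x - \<psi>' k x)"
  proof (rule add_mono)
   show "frm.nrm (%x. \<phi> k x - \<phi>' k x) * frm.nrm (\<psi> k) <= frm.nrm (%x. \<phi> k x - \<phi>' k x) * C1"
    by (rule mult_left_mono[OF _ frm.nrm_nonneg[OF frm.diff_closed[OF t(1,2)]]]) (use k C1 in simp)
   show "frm.nrm (\<phi>' k) * frm.nrm (%x. \<psi> k x - \<psi>' k x) <= C2 * frm.nrm (%x. \<psi> k x - \<psi>' k x)"
    by (rule mult_right_mono[OF _ frm.nrm_nonneg[OF frm.diff_closed[OF t(3,4)]]]) (use k C2 in simp)
  qed
  finally show ?thesis .
 qed
 then have ev: "\<forall>\<^sub>F k in sequentially. norm (hf (\<phi> k) (\<psi> k) - hf (\<phi>' k) (\<psi>' k)) <= frm.nrm (%x. \<phi> k x - \<phi>' k x) * C1 + C2 * frm.nrm (%x. \<psi> k x - \<psi>' k x)"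
  by (rule eventually_sequentiallyI)
 have "(%k. frm.nrm (%x. \<phi> k x - \<phi>' k x) * C1 + C2 * frm.nrm (%x. \<psi> k x - \<psi>' k x)) \<longlonglongrightarrow> 0 * C1 + C2 * 0"
  by (intro tendsto_intros l1 l2)
 then have "(%k. frm.nrm (%x. \<phi> k x - \<phi>' k x) * C1 + C2 * frm.nrm (%x. \<psi> k x - \<psi>' k x)) \<longlonglongrightarrow> 0" by simp
 show ?thesis by (rule Lim_null_comparison[OF ev]) fact
qed

lemma pairing_convergent:
 assumes A: "apx \<phi> u" "apx \<psi> v"
 shows "convergent (%k. hf (\<phi> k) (\<psi> k))"
proof -
 obtain C1 N1 where C1: "C1 >= 0" "\<forall>k\<ge>N1. frm.nrm (\<psi> k) <= C1" using apx_bounded[OF A(2)] by blast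
 obtain C2 N2 where C2: "C2 >= 0" "\<forall>k\<ge>N2. frm.nrm (\<phi> k) <= C2" using apx_bounded[OF A(1)] by blast
 note t = apxD(2)[OF A(1)] apxD(2)[OF A(2)]
 have "Cauchy (%k. hf (\<phi> k) (\<psi> k))"
 proof (rule CauchyI)
  fix e :: real assume e: "e > 0"
  define d where "d = e / (2 * (C1 + C2 + 1))"
  have d: "d > 0" "d * (C1 + C2) < e"
  proof -
   show "d > 0" using e C1 C2 by (simp add: d_def)
   have "d * (C1 + C2) <= d * (C1 + C2 + 1)" using \<open>d > 0\<close> by (intro mult_left_mono) auto
   also have "\<dots> = e / 2" using C1(1) C2(1) by (simp add: d_def field_simps)
   finally show "d * (C1 + C2) < e" using e by simp
  qed
  obtain K1 where K1: "\<forall>k\<ge>K1. \<forall>m\<ge>K1. frm.nrm (%x. \<phi> k x - \<phi> m x) < d" using apxD(4)[OF A(1) d(1)] by blast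
  obtain K2 where K2: "\<forall>k\<ge>K2. \<forall>m\<ge>K2. frm.nrm (%x. \<psi> k x - \<psi> m x) < d" using apxD(4)[OF A(2) d(1)] by blast
  have "norm (hf (\<phi> k) (\<psi> k) - hf (\<phi> m) (\<psi> m)) < e"
   if k: "k >= Max {N1, N2, K1, K2}" and m: "m >= Max {N1, N2, K1, K2}" for k m
  proof -
   have e: "hf (\<phi> k) (\<psi> k) - hf (\<phi> m) (\<psi> m) = hf (%x. \<phi> k x - \<phi> m x) (\<psi> k) + hf (\<phi> m) (%x. \<psi> k x - \<psi> m x)"
    unfolding frm.lin_diff[OF t(1) t(1) t(2)] frm.lin2_diff[OF t(2) t(2) t(1)] by simp
   have "cmod (hf (\<phi> k) (\<psi> k) - hf (\<phi> m) (\<psi> m)) <= frm.nrm (%x. \<phi> k x - \<phi> m x) * frm.nrm (\<psi> k) + frm.nrm (\<phi> m) * frm.nrm (%x. \<psi> k x - \<psi> m x)"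
    unfolding e by (rule norm_triangle_mono[OF frm.cauchy_schwarz[OF frm.diff_closed[OF t(1) t(1)] t(2)] frm.cauchy_schwarz[OF t(1) frm.diff_closed[OF t(2) t(2)]]])
   also have "\<dots> <= d * C1 + C2 * d"
   proof (rule add_mono)
    have "frm.nrm (%x. \<phi> k x - \<phi> m x) <= d" "frm.nrm (\<psi> k) <= C1" using K1 C1 k m by (simp_all add: less_imp_le)
    then show "frm.nrm (%x. \<phi> k x - \<phi> m x) * frm.nrm (\<psi> k) <= d * C1"
     by (rule mult_mono[OF _ _ less_imp_le[OF d(1)] frm.nrm_nonneg[OF t(2)]])
    have "frm.nrm (\<phi> m) <= C2" "frm.nrm (%x. \<psi> k x - \<psi> m x) <= d" using K2 C2 k m by (simp_all add: less_imp_le)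
    then show "frm.nrm (\<phi> m) * frm.nrm (%x. \<psi> k x - \<psi> m x) <= C2 * d"
     by (rule mult_mono[OF _ _ C2(1) frm.nrm_nonneg[OF frm.diff_closed[OF t(2) t(2)]]])
   qed
   also have "\<dots> < e" using d(2) by (simp add: algebra_simps)
   finally show ?thesis .
  qed
  then show "\<exists>N. \<forall>m\<ge>N. \<forall>n\<ge>N. norm (hf (\<phi> m) (\<psi> m) - hf (\<phi> n) (\<psi> n)) < e" by blast
 qed
 then show ?thesis by (rule Cauchy_convergent)
qed

text \<open>The limit does not depend on the approximating sequences, which is what gives the
  definite description in \<open>closed_form\<close> its meaning.\<close>

lemma closed_form_tendsto:
 assumes A: "apx \<phi> u" "apx \<psi> v"
 shows "(%k. hf (\<phi> k) (\<psi> k)) \<longlonglongrightarrow> closed_form \<Omega> a V u v"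
proof -
 obtain c where c: "(%k. hf (\<phi> k) (\<psi> k)) \<longlonglongrightarrow> c" using pairing_convergent[OF A] by (auto simp: convergent_def)
 have "closed_form \<Omega> a V u v = c"
  unfolding closed_form_def form_approx_eq
 proof (rule the_equality)
  show "\<exists>\<phi> \<psi>. apx \<phi> u \<and> apx \<psi> v \<and> (%k. hf (\<phi> k) (\<psi> k)) \<longlonglongrightarrow> c" using A c by blast
  fix d assume "\<exists>\<phi> \<psi>. apx \<phi> u \<and> apx \<psi> v \<and> (%k. hf (\<phi> k) (\<psi> k)) \<longlonglongrightarrow> d"
  then obtain \<phi>' \<psi>' where B: "apx \<phi>' u" "apx \<psi>' v" "(%k. hf (\<phi>' k) (\<psi>' k)) \<longlonglongrightarrow> d" by blast
  have "(%k. hf (\<phi>' k) (\<psi>' k) - hf (\<phi> k) (\<psi> k)) \<longlonglongrightarrow> 0"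
   by (rule pairing_difference[OF B(1) A(1) B(2) A(2) apx_same_limit[OF B(1) A(1)] apx_same_limit[OF B(2) A(2)]])
  moreover have "(%k. hf (\<phi>' k) (\<psi>' k) - hf (\<phi> k) (\<psi> k)) \<longlonglongrightarrow> d - c" by (rule tendsto_diff[OF B(3) c])
  ultimately show "d = c" using LIMSEQ_unique by fastforce
 qed
 with c show ?thesis by simp
qed

lemma form_dom_eq: "form_dom \<Omega> a V = {u. \<exists>\<phi>. apx \<phi> u}"
 by (simp add: form_dom_def form_approx_eq)

lemma cip_tendsto:
 assumes "apx \<phi> u" "apx \<psi> v"
 shows "(%k. cip M (\<phi> k) (\<psi> k)) \<longlonglongrightarrow> cip M u v"
proof -
 note A = apxD[OF assms(1)] and B = apxD[OF assms(2)]
 have n: "(%k. sq.nrm M (\<psi> k)) \<longlonglongrightarrow> sq.nrm M v"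
 proof (rule LIM_zero_cancel, rule Lim_null_comparison[OF _ B(3)])
  show "\<forall>\<^sub>F k in sequentially. norm (sq.nrm M (\<psi> k) - sq.nrm M v) <= sq.nrm M (%x. \<psi> k x - v x)"
   using sq.nrm_diff_le[OF T_sq[OF B(2)] B(1)] by (simp add: always_eventually)
 qed
 have ev: "\<forall>\<^sub>F k in sequentially. norm (cip M (\<phi> k) (\<psi> k) - cip M u v) <= sq.nrm M (%x. \<phi> k x - u x) * sq.nrm M (\<psi> k) + sq.nrm M u * sq.nrm M (%x. \<psi> k x - v x)"
 proof (intro always_eventually allI)
  fix k
  have e: "cip M (\<phi> k) (\<psi> k) - cip M u v = cip M (%x. \<phi> k x - u x) (\<psi> k) + cip M u (%x. \<psi> k x - v x)"
   unfolding sq.lin_diff[OF T_sq[OF A(2)] A(1) T_sq[OF B(2)]] sq.lin2_diff[OF T_sq[OF B(2)] B(1) A(1)] by simp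
  show "norm (cip M (\<phi> k) (\<psi> k) - cip M u v) <= sq.nrm M (%x. \<phi> k x - u x) * sq.nrm M (\<psi> k) + sq.nrm M u * sq.nrm M (%x. \<psi> k x - v x)"
    unfolding e by (rule norm_triangle_mono[OF sq.cauchy_schwarz[OF sq.diff_closed[OF T_sq[OF A(2)] A(1)] T_sq[OF B(2)]] sq.cauchy_schwarz[OF A(1) sq.diff_closed[OF T_sq[OF B(2)] B(1)]]])
 qed
 have "(%k. sq.nrm M (%x. \<phi> k x - u x) * sq.nrm M (\<psi> k) + sq.nrm M u * sq.nrm M (%x. \<psi> k x - v x)) \<longlonglongrightarrow> 0 * sq.nrm M v + sq.nrm M u * 0"
  by (intro tendsto_intros A(3) B(3) n)
 then have "(%k. sq.nrm M (%x. \<phi> k x - u x) * sq.nrm M (\<psi> k) + sq.nrm M u * sq.nrm M (%x. \<psi> k x - v x)) \<longlonglongrightarrow> 0" by simp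
 show ?thesis by (rule LIM_zero_cancel, rule Lim_null_comparison[OF ev]) fact
qed

end

context magnetic
begin

definition bounded_below :: "real => bool" where
 "bounded_below l \<longleftrightarrow> (\<forall>u\<in>T. l * (sq.nrm M u)^2 <= (frm.nrm u)^2)"

text \<open>The form of the operator minus the real number \<open>x\<close>. It is positive
  semidefinite whenever \<open>x\<close> is a lower bound.\<close>

definition shf :: "real => (real^'n => complex) => (real^'n => complex) => complex" where
 "shf x f g = hf f g - complex_of_real x * cip M f g"

lemma Re_shf: "f \<in> T ==> Re (shf x f f) = (frm.nrm f)^2 - x * (sq.nrm M f)^2"
 by (simp add: shf_def frm.nrm_square sq.nrm_square T_sq)

lemma shf_semi_inner:
 assumes "bounded_below x"
 shows "semi_inner T (shf x)"
proof
 fix f g c assume fg: "f \<in> T" "g \<in> T"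
 then show "(%x. f x + c * g x) \<in> T" by (rule T_closed)
 have "hf g f = cnj (hf f g)" by (rule frm.herm[OF fg])
 moreover have "cip M g f = cnj (cip M f g)" by (rule sq.herm[OF T_sq[OF fg(1)] T_sq[OF fg(2)]])
 ultimately show "shf x g f = cnj (shf x f g)" unfolding shf_def by simp
 fix h assume h: "h \<in> T"
 show "shf x (%x. f x + c * g x) h = shf x f h + c * shf x g h"
  unfolding shf_def frm.lin[OF fg h] sq.lin[OF T_sq[OF fg(1)] T_sq[OF fg(2)] T_sq[OF h]] by (simp add: algebra_simps)
next
 fix f assume f: "f \<in> T"
 then show "0 <= Re (shf x f f)" using assms by (simp add: Re_shf bounded_below_def)
qed

lemma bounded_below_mono: "bounded_below l ==> x <= l ==> bounded_below x"
 unfolding bounded_below_def by (meson mult_right_mono order_trans zero_le_power2)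

text \<open>The functional whose minimiser solves (H - x) u = g weakly.\<close>

definition J :: "real => (real^'n => complex) => (real^'n => complex) => real" where
 "J x g f = Re (shf x f f) - 2 * Re (cip M f g)"

context
 fixes l x :: real and g :: "real^'n => complex"
 assumes bb: "bounded_below l" and xl: "x < l" and g: "g \<in> sq M"
begin

interpretation q: semi_inner T "shf x"
 by (rule shf_semi_inner[OF bounded_below_mono[OF bb less_imp_le[OF xl]]])

lemma shf_coercive: "f \<in> T ==> (l - x) * (sq.nrm M f)^2 <= Re (shf x f f)"
 using bb by (simp add: Re_shf bounded_below_def left_diff_distrib)

lemma J_lower: "f \<in> T ==> - ((sq.nrm M g)\<^sup>2 / (l - x)) <= J x g f"
proof -
 assume f: "f \<in> T"
 let ?s = "sq.nrm M f" and ?t = "sq.nrm M g"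
 have c: "Re (cip M f g) <= ?s * ?t"
  using complex_Re_le_cmod sq.cauchy_schwarz[OF T_sq[OF f] g] by (rule order_trans)
 have p: "l - x > 0" using xl by simp
 have "0 <= ((l - x) * ?s - ?t)^2 / (l - x)" using p by simp
 also have "\<dots> = (l - x) * ?s^2 - 2 * (?s * ?t) + ?t^2 / (l - x)"
 proof -
  have "(y * s - t)^2 / y = y * s^2 - 2 * (s * t) + t^2 / y" if "y > 0" for y s t :: real
   using that by (simp add: field_simps power2_eq_square)
  from this[OF p] show ?thesis .
 qed
 finally show ?thesis unfolding J_def using c shf_coercive[OF f] by linarith
qed

definition Jmin :: real where "Jmin = Inf (J x g ` T)"

lemma Jmin_le: "f \<in> T ==> Jmin <= J x g f"
 unfolding Jmin_def by (rule cInf_lower) (auto intro!: bdd_belowI2 J_lower)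

text \<open>Compares the values at \<open>f\<close> and \<open>h\<close> with the value at their
  midpoint, which is at least the infimum. Hence minimising sequences are Cauchy for the shifted
  form.\<close>

lemma J_parallelogram:
 assumes f: "f \<in> T" "h \<in> T"
 shows "Re (shf x (%y. f y - h y) (%y. f y - h y)) <= 2 * (J x g f - Jmin) + 2 * (J x g h - Jmin)"
proof -
 let ?s = "%y. f y + 1 * h y" and ?m = "%y. (1/2) * (f y + 1 * h y)"
 have s: "?s \<in> T" by (rule T_closed[OF f])
 have m: "?m \<in> T" by (rule q.scale_closed[OF s])
 have j1: "Jmin <= J x g ?m" by (rule Jmin_le[OF m])
 have j2: "Re (shf x ?m ?m) = (1/4) * Re (shf x ?s ?s)"
  unfolding q.scale_self[OF s] by (simp add: norm_divide power_divide)
 have j3: "Re (cip M ?m g) = (1/2) * (Re (cip M f g) + Re (cip M h g))"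
 proof -
  have "cip M ?m g = (1/2) * cip M ?s g" by (simp add: cip_def mult.assoc)
  also have "cip M ?s g = cip M f g + 1 * cip M h g" by (rule sq.lin[OF T_sq[OF f(1)] T_sq[OF f(2)] g])
  finally have "cip M ?m g = (1/2) * (cip M f g + cip M h g)" by simp
  from arg_cong[OF this, of Re] show ?thesis by simp
 qed
 have aux: "m <= A - 2 * B ==> A = (1/4) * S ==> B = (1/2) * (c + d) ==> D + S = 2 * p + 2 * r ==> D <= 2 * (p - 2 * c - m) + 2 * (r - 2 * d - m)"
  for m A B S c d D p r :: real by argo
 show ?thesis unfolding J_def by (rule aux[OF j1[unfolded J_def] j2 j3 q.parallelogram[OF f]])
qed

text \<open>A quantitative Euler-Lagrange equation. Moving from \<open>f\<close> along a suitable
  multiple of \<open>v\<close> lowers the functional by an amount comparable to the squared defect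
  of the weak equation, but never below the infimum.\<close>

lemma J_variation:
 assumes f: "f \<in> T" "v \<in> T"
 shows "(cmod (shf x f v - cip M g v))^2 <= (J x g f - Jmin) * (Re (shf x v v) + 1)"
proof -
 let ?b = "shf x f v - cip M g v" and ?q = "Re (shf x v v)"
 \<comment> \<open>Small enough that the quadratic term takes back at most half of the linear gain;
   the added 1 covers a degenerate \<open>v\<close>.\<close>
 define s where "s = 1 / (?q + 1)"
 have q0: "0 <= ?q" by (rule q.nonneg[OF f(2)])
 have s: "s > 0" "s * ?q <= 1" "1 / s = ?q + 1" using q0 by (auto simp: s_def field_simps)
 let ?c = "- (complex_of_real s * ?b)"
 have h: "(%y. f y + ?c * v y) \<in> T" by (rule T_closed[OF f])
 have bb: "?b * cnj ?b = complex_of_real ((cmod ?b)^2)" by (rule complex_norm_square[symmetric])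
 have e1: "Re (shf x (%y. f y + ?c * v y) (%y. f y + ?c * v y)) = Re (shf x f f) + 2 * Re (cnj ?c * shf x f v) + (cmod ?c)^2 * ?q"
  by (rule q.expand[OF f])
 have e2: "cip M (%y. f y + ?c * v y) g = cip M f g + ?c * cip M v g"
  by (rule sq.lin[OF T_sq[OF f(1)] T_sq[OF f(2)] g])
 have e3: "Re (?c * cip M v g) = Re (cnj ?c * cip M g v)"
 proof -
  have "cip M v g = cnj (cip M g v)" by (rule sq.herm[OF g T_sq[OF f(2)]])
  then have "?c * cip M v g = cnj (cnj ?c * cip M g v)" by simp
  then show ?thesis by (simp only: cnj.sel)
 qed
 have e4: "Re (cnj ?c * shf x f v) - Re (cnj ?c * cip M g v) = - s * (cmod ?b)\<^sup>2"
 proof -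
  have "cnj ?c * shf x f v - cnj ?c * cip M g v = - (complex_of_real s * (?b * cnj ?b))" by (simp add: algebra_simps)
  also have "\<dots> = complex_of_real (- s * (cmod ?b)\<^sup>2)" unfolding bb by simp
  finally show ?thesis by (metis Re_complex_of_real minus_complex.sel(1))
 qed
 have e5: "(cmod ?c)^2 * ?q = s * (s * ?q) * (cmod ?b)^2"
  by (simp add: norm_mult power_mult_distrib power2_eq_square)
 have "Jmin <= J x g (%y. f y + ?c * v y)" by (rule Jmin_le[OF h])
 also have "\<dots> = J x g f + 2 * (- s * (cmod ?b)\<^sup>2) + s * (s * ?q) * (cmod ?b)\<^sup>2"
  unfolding J_def e1 e2 e5 e4[symmetric] using e3 by (simp only: plus_complex.sel) argo
 also have "\<dots> <= J x g f + 2 * (- s * (cmod ?b)\<^sup>2) + s * 1 * (cmod ?b)\<^sup>2"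
  using s by (intro add_left_mono mult_right_mono mult_left_mono) auto
 finally have "s * (cmod ?b)^2 <= J x g f - Jmin" by simp
 then have "(cmod ?b)^2 <= (J x g f - Jmin) * (1 / s)" using s(1) by (simp add: field_simps)
 then show ?thesis unfolding s(3) .
qed

text \<open>A minimising sequence of \<open>J\<close> is Cauchy for the shifted form, hence in
  \<open>L2\<close> and in the energy, and its limit lies in the form domain. The weak equation is
  the limit of the approximate ones along it.\<close>

lemma resolvent_real: "\<exists>u. mag_op \<Omega> a V u (%y. g y + complex_of_real x * u y)"
proof -
 have T0: "(%y. 0) \<in> T" by (rule test_functionsI[of _ "{}"]) (auto intro: smooth_on_const)
 have "\<exists>f\<in>T. J x g f < Jmin + 1 / (real k + 1)" for k :: nat
 proof -
  have "Inf (J x g ` T) < Jmin + 1 / (real k + 1)" by (simp add: Jmin_def[symmetric])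
  then show ?thesis using T0 by (subst (asm) cInf_less_iff) (auto intro!: bdd_belowI2 J_lower)
 qed
 then obtain \<phi> where \<phi>: "!!k. \<phi> k \<in> T" "!!k. J x g (\<phi> k) < Jmin + 1 / (real k + 1)" by metis
 have qd: "Re (shf x (%y. \<phi> k y - \<phi> m y) (%y. \<phi> k y - \<phi> m y)) <= 4 / (real N + 1)" if "k >= N" "m >= N" for k m N
 proof -
  have "1 / (real k + 1) <= 1 / (real N + 1)" "1 / (real m + 1) <= 1 / (real N + 1)"
   using that by (auto intro!: divide_left_mono)
  then show ?thesis using J_parallelogram[OF \<phi>(1)[of k] \<phi>(1)[of m]] \<phi>(2)[of k] \<phi>(2)[of m] by simp
 qed
 have d: "l - x > 0" using xl by simp
 \<comment> \<open>One constant through which the shifted form controls both the \<open>L2\<close>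
   norm and the energy; the last summand pays for undoing the shift.\<close>
 define K where "K = 1 + 1 / (l - x) + \<bar>x\<bar> / (l - x)"
 have K: "K > 0" using d by (simp add: K_def add_pos_nonneg)
 have both: "(sq.nrm M f)^2 <= K * Re (shf x f f)" "(frm.nrm f)^2 <= K * Re (shf x f f)" if f: "f \<in> T" for f
 proof -
  let ?q = "Re (shf x f f)"
  have q0: "0 <= ?q" by (rule q.nonneg[OF f])
  have n: "(sq.nrm M f)^2 <= ?q / (l - x)" using shf_coercive[OF f] d by (simp add: field_simps)
  have "x * (sq.nrm M f)^2 <= \<bar>x\<bar> * (?q / (l - x))"
   using n by (intro mult_mono) auto
  then have "(frm.nrm f)^2 <= ?q + \<bar>x\<bar> * (?q / (l - x))" unfolding Re_shf[OF f] by linarith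
  also have "\<dots> <= K * ?q"
  proof -
   have "K * ?q = ?q + \<bar>x\<bar> * (?q / (l - x)) + ?q / (l - x)" by (simp add: K_def distrib_right)
   then show ?thesis using q0 d by simp
  qed
  finally show "(frm.nrm f)^2 <= K * ?q" .
  have "K * ?q = ?q / (l - x) + (?q + \<bar>x\<bar> * ?q / (l - x))" by (simp add: K_def distrib_right)
  moreover have "0 <= \<bar>x\<bar> * ?q / (l - x)" using q0 d by simp
  ultimately show "(sq.nrm M f)^2 <= K * ?q" using n q0 by linarith
 qed
 have small: "\<exists>N. \<forall>k\<ge>N. \<forall>m\<ge>N. K * Re (shf x (%y. \<phi> k y - \<phi> m y) (%y. \<phi> k y - \<phi> m y)) < e^2" if e: "e > 0" for e :: real
 proof -
  obtain N :: nat where N: "4 * K / e^2 < real N" using reals_Archimedean2 by blast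
  have "K * Re (shf x (%y. \<phi> k y - \<phi> m y) (%y. \<phi> k y - \<phi> m y)) < e^2" if "k >= N" "m >= N" for k m
  proof -
   have "K * Re (shf x (%y. \<phi> k y - \<phi> m y) (%y. \<phi> k y - \<phi> m y)) <= K * (4 / (real N + 1))"
    using K qd[OF that] by (intro mult_left_mono) auto
   also have "\<dots> < e^2" using N e by (simp add: field_simps add_strict_increasing)
   finally show ?thesis .
  qed
  then show ?thesis by blast
 qed
 have Cs: "\<exists>N. \<forall>k\<ge>N. \<forall>m\<ge>N. sq.nrm M (%y. \<phi> k y - \<phi> m y) < e" if e: "e > 0" for e
 proof -
  obtain N where N: "\<forall>k\<ge>N. \<forall>m\<ge>N. K * Re (shf x (%y. \<phi> k y - \<phi> m y) (%y. \<phi> k y - \<phi> m y)) < e^2" using small[OF e] by blast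
  have "sq.nrm M (%y. \<phi> k y - \<phi> m y) < e" if "k >= N" "m >= N" for k m
   by (rule power2_less_imp_less[OF le_less_trans[OF both(1)[OF q.diff_closed[OF \<phi>(1) \<phi>(1)]]]]) (use N that e in auto)
  then show ?thesis by blast
 qed
 have Cf: "\<exists>N. \<forall>k\<ge>N. \<forall>m\<ge>N. frm.nrm (%y. \<phi> k y - \<phi> m y) < e" if e: "e > 0" for e
 proof -
  obtain N where N: "\<forall>k\<ge>N. \<forall>m\<ge>N. K * Re (shf x (%y. \<phi> k y - \<phi> m y) (%y. \<phi> k y - \<phi> m y)) < e^2" using small[OF e] by blast
  have "frm.nrm (%y. \<phi> k y - \<phi> m y) < e" if "k >= N" "m >= N" for k m
   by (rule power2_less_imp_less[OF le_less_trans[OF both(2)[OF q.diff_closed[OF \<phi>(1) \<phi>(1)]]]]) (use N that e in auto)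
  then show ?thesis by blast
 qed
 obtain u where u: "u \<in> sq M" "(%k. sq.nrm M (%y. \<phi> k y - u y)) \<longlonglongrightarrow> 0"
  by (rule sq_complete[of \<phi> M, OF T_sq[OF \<phi>(1)] Cs]) blast+
 have ax: "apx \<phi> u" unfolding apx_def using u \<phi>(1) Cf by blast
 have "closed_form \<Omega> a V u v = cip M (%y. g y + complex_of_real x * u y) v" if v: "v \<in> form_dom \<Omega> a V" for v
 proof -
  obtain \<psi> where \<psi>: "apx \<psi> v" using v by (auto simp: form_dom_eq)
  note B = apxD[OF \<psi>]
  obtain C N where C: "C >= 0" "\<forall>k\<ge>N. frm.nrm (\<psi> k) <= C" using apx_bounded[OF \<psi>] by blast
  have n: "(%k. sq.nrm M (\<psi> k)) \<longlonglongrightarrow> sq.nrm M v"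
  proof (rule LIM_zero_cancel, rule Lim_null_comparison[OF _ B(3)])
   show "\<forall>\<^sub>F k in sequentially. norm (sq.nrm M (\<psi> k) - sq.nrm M v) <= sq.nrm M (%x. \<psi> k x - v x)"
    using sq.nrm_diff_le[OF T_sq[OF B(2)] B(1)] by (simp add: always_eventually)
  qed
  have lim1: "(%k. shf x (\<phi> k) (\<psi> k)) \<longlonglongrightarrow> closed_form \<Omega> a V u v - complex_of_real x * cip M u v"
   unfolding shf_def by (intro tendsto_intros closed_form_tendsto[OF ax \<psi>] cip_tendsto[OF ax \<psi>])
  have lim2: "(%k. cip M g (\<psi> k)) \<longlonglongrightarrow> cip M g v"
  proof (rule LIM_zero_cancel, rule Lim_null_comparison)
   show "\<forall>\<^sub>F k in sequentially. norm (cip M g (\<psi> k) - cip M g v) <= sq.nrm M g * sq.nrm M (%y. \<psi> k y - v y)"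
    using sq.cauchy_schwarz[OF g sq.diff_closed[OF T_sq[OF B(2)] B(1)]]
    unfolding sq.lin2_diff[OF T_sq[OF B(2)] B(1) g] by (intro always_eventually allI)
   show "(%k. sq.nrm M g * sq.nrm M (%y. \<psi> k y - v y)) \<longlonglongrightarrow> 0"
    using tendsto_mult[OF tendsto_const B(3), of "sq.nrm M g"] by simp
  qed
  \<comment> \<open>The defect of the weak equation at \<open>\<phi> k\<close> is bounded by the
    distance to the infimum, at most 1 / (k + 1), times a quantity that converges along the
    approximating sequence of \<open>v\<close>.\<close>
  have lim3: "(%k. shf x (\<phi> k) (\<psi> k) - cip M g (\<psi> k)) \<longlonglongrightarrow> 0"
  proof -
   have b: "(cmod (shf x (\<phi> k) (\<psi> k) - cip M g (\<psi> k)))^2 <= 1 / (real k + 1) * (C^2 + \<bar>x\<bar> * (sq.nrm M (\<psi> k))^2 + 1)" if k: "k >= N" for k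
   proof -
    have "(frm.nrm (\<psi> k))^2 <= C^2" using C k frm.nrm_nonneg[OF B(2)] by (intro power_mono) auto
    moreover have "- (x * (sq.nrm M (\<psi> k))\<^sup>2) <= \<bar>x\<bar> * (sq.nrm M (\<psi> k))\<^sup>2"
     using mult_right_mono[of "- x" "\<bar>x\<bar>" "(sq.nrm M (\<psi> k))\<^sup>2"] by simp
    ultimately have "Re (shf x (\<psi> k) (\<psi> k)) + 1 <= C^2 + \<bar>x\<bar> * (sq.nrm M (\<psi> k))^2 + 1" unfolding Re_shf[OF B(2)] by linarith
    moreover have "0 <= Re (shf x (\<psi> k) (\<psi> k)) + 1" using q.nonneg[OF B(2)[of k]] by simp
    moreover have "J x g (\<phi> k) - Jmin <= 1 / (real k + 1)" using \<phi>(2)[of k] by simp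
    ultimately have "(J x g (\<phi> k) - Jmin) * (Re (shf x (\<psi> k) (\<psi> k)) + 1) <= 1 / (real k + 1) * (C^2 + \<bar>x\<bar> * (sq.nrm M (\<psi> k))^2 + 1)"
     by (intro mult_mono) auto
    with J_variation[OF \<phi>(1) B(2)] show ?thesis by (rule order_trans)
   qed
   have "(%k. 1 / (real k + 1)) \<longlonglongrightarrow> 0"
    using LIMSEQ_inverse_real_of_nat by (simp add: inverse_eq_divide add.commute)
   then have "(%k. 1 / (real k + 1) * (C^2 + \<bar>x\<bar> * (sq.nrm M (\<psi> k))^2 + 1)) \<longlonglongrightarrow> 0 * (C^2 + \<bar>x\<bar> * (sq.nrm M v)^2 + 1)"
    by (intro tendsto_intros n)
   then have z: "(%k. 1 / (real k + 1) * (C^2 + \<bar>x\<bar> * (sq.nrm M (\<psi> k))^2 + 1)) \<longlonglongrightarrow> 0" by (simp only: mult_zero_left)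
   have "(%k. (cmod (shf x (\<phi> k) (\<psi> k) - cip M g (\<psi> k)))^2) \<longlonglongrightarrow> 0"
   proof (rule Lim_null_comparison[OF _ z])
    show "\<forall>\<^sub>F k in sequentially. norm ((cmod (shf x (\<phi> k) (\<psi> k) - cip M g (\<psi> k)))^2) <= 1 / (real k + 1) * (C^2 + \<bar>x\<bar> * (sq.nrm M (\<psi> k))^2 + 1)"
     using b by (intro eventually_sequentiallyI[of N]) simp
   qed
   then have "(%k. sqrt ((cmod (shf x (\<phi> k) (\<psi> k) - cip M g (\<psi> k)))^2)) \<longlonglongrightarrow> sqrt 0" by (rule tendsto_real_sqrt)
   then have "(%k. cmod (shf x (\<phi> k) (\<psi> k) - cip M g (\<psi> k))) \<longlonglongrightarrow> 0" by (simp only: real_sqrt_abs abs_norm_cancel real_sqrt_zero)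
   then show ?thesis by (rule tendsto_norm_zero_cancel)
  qed
  have "(%k. shf x (\<phi> k) (\<psi> k) - cip M g (\<psi> k)) \<longlonglongrightarrow> closed_form \<Omega> a V u v - complex_of_real x * cip M u v - cip M g v"
   by (rule tendsto_diff[OF lim1 lim2])
  with lim3 have "closed_form \<Omega> a V u v - complex_of_real x * cip M u v - cip M g v = 0" using LIMSEQ_unique by blast
  then show ?thesis unfolding sq.lin[OF g u(1) B(1)] by (simp add: algebra_simps)
 qed
 moreover have "u \<in> form_dom \<Omega> a V" using ax by (auto simp: form_dom_eq)
 moreover have "(%y. g y + complex_of_real x * u y) \<in> sq M" by (rule sq_closed[OF g u(1)])
 ultimately show ?thesis unfolding mag_op_def L2_eq L2_inner_eq by blast
qed

end

end

context magnetic
begin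

lemma mag_opD:
 assumes "mag_op \<Omega> a V u f"
 obtains \<phi> where "apx \<phi> u" "f \<in> sq M" "!!v. v \<in> form_dom \<Omega> a V ==> closed_form \<Omega> a V u v = cip M f v"
 using assms unfolding mag_op_def L2_eq L2_inner_eq form_dom_eq by blast

lemma mag_op_diff:
 assumes "mag_op \<Omega> a V u f" "mag_op \<Omega> a V w h"
 shows "mag_op \<Omega> a V (%x. u x - w x) (%x. f x - h x)"
proof -
 obtain \<phi> where \<phi>: "apx \<phi> u" "f \<in> sq M" "!!v. v \<in> form_dom \<Omega> a V ==> closed_form \<Omega> a V u v = cip M f v"
  by (rule mag_opD[OF assms(1)]) blast
 obtain \<psi> where \<psi>: "apx \<psi> w" "h \<in> sq M" "!!v. v \<in> form_dom \<Omega> a V ==> closed_form \<Omega> a V w v = cip M h v"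
  by (rule mag_opD[OF assms(2)]) blast
 have "apx (%k x. \<phi> k x + (-1) * \<psi> k x) (%x. u x + (-1) * w x)" by (rule apx_linear[OF \<phi>(1) \<psi>(1)])
 then have d: "apx (%k x. \<phi> k x - \<psi> k x) (%x. u x - w x)" by simp
 have "closed_form \<Omega> a V (%x. u x - w x) v = cip M (%x. f x - h x) v" if v: "v \<in> form_dom \<Omega> a V" for v
 proof -
  obtain \<eta> where \<eta>: "apx \<eta> v" using v by (auto simp: form_dom_eq)
  have "(%k. hf (\<phi> k) (\<eta> k) - hf (\<psi> k) (\<eta> k)) \<longlonglongrightarrow> closed_form \<Omega> a V u v - closed_form \<Omega> a V w v"
   by (rule tendsto_diff[OF closed_form_tendsto[OF \<phi>(1) \<eta>] closed_form_tendsto[OF \<psi>(1) \<eta>]])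
  moreover have "(%k. hf (\<phi> k) (\<eta> k) - hf (\<psi> k) (\<eta> k)) \<longlonglongrightarrow> closed_form \<Omega> a V (%x. u x - w x) v"
   using closed_form_tendsto[OF d \<eta>] unfolding frm.lin_diff[OF apxD(2)[OF \<phi>(1)] apxD(2)[OF \<psi>(1)] apxD(2)[OF \<eta>]] .
  ultimately have "closed_form \<Omega> a V (%x. u x - w x) v = closed_form \<Omega> a V u v - closed_form \<Omega> a V w v"
   using LIMSEQ_unique by blast
  then show ?thesis unfolding \<phi>(3)[OF v] \<psi>(3)[OF v] sq.lin_diff[OF \<phi>(2) \<psi>(2) apxD(1)[OF \<eta>]] .
 qed
 then show ?thesis
  unfolding mag_op_def L2_eq L2_inner_eq using d sq.diff_closed[OF \<phi>(2) \<psi>(2)] by (auto simp: form_dom_eq)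
qed

text \<open>The real part of the pairing of (H - z) u with u is at least (l - Re z) times the
  squared norm of u; then Cauchy-Schwarz.\<close>

lemma mag_op_bound:
 assumes m: "mag_op \<Omega> a V u f" and l: "bounded_below l"
 shows "(l - Re z) * sq.nrm M u <= sq.nrm M (%x. f x - z * u x)"
proof -
 obtain \<phi> where \<phi>: "apx \<phi> u" and f: "f \<in> sq M" and cf: "!!v. v \<in> form_dom \<Omega> a V ==> closed_form \<Omega> a V u v = cip M f v"
  by (rule mag_opD[OF m]) blast
 note A = apxD[OF \<phi>]
 have u: "u \<in> sq M" by (rule A(1))
 have "(%k. Re (hf (\<phi> k) (\<phi> k)) - l * Re (cip M (\<phi> k) (\<phi> k))) \<longlonglongrightarrow> Re (closed_form \<Omega> a V u u) - l * Re (cip M u u)"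
  by (intro tendsto_intros closed_form_tendsto[OF \<phi> \<phi>] cip_tendsto[OF \<phi> \<phi>])
 moreover have "0 <= Re (hf (\<phi> k) (\<phi> k)) - l * Re (cip M (\<phi> k) (\<phi> k))" for k
  using l A(2)[of k] by (simp add: bounded_below_def frm.nrm_square sq.nrm_square T_sq)
 ultimately have "0 <= Re (closed_form \<Omega> a V u u) - l * Re (cip M u u)" by (intro LIMSEQ_le_const) auto
 then have lo: "l * (sq.nrm M u)^2 <= Re (cip M f u)"
 proof -
  have "u \<in> form_dom \<Omega> a V" using \<phi> by (auto simp: form_dom_eq)
  from cf[OF this] \<open>0 <= Re (closed_form \<Omega> a V u u) - l * Re (cip M u u)\<close> show ?thesis by (simp add: sq.nrm_square[OF u])
 qed
 have d: "(%x. f x - z * u x) \<in> sq M" by (rule sq.diff_closed[OF f sq.scale_closed[OF u]])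
 have e: "cip M (%x. f x - z * u x) u = cip M f u - z * cip M u u"
  using sq.lin[OF f u u, of "-z"] by simp
 have "cip M u u = complex_of_real ((sq.nrm M u)^2)" using sq.B_real[OF u] sq.nrm_square[OF u] by simp
 then have "Re (cip M (%x. f x - z * u x) u) = Re (cip M f u) - Re z * (sq.nrm M u)^2" unfolding e by simp
 then have "(l - Re z) * (sq.nrm M u)^2 <= Re (cip M (%x. f x - z * u x) u)" using lo by (simp add: left_diff_distrib)
 also have "\<dots> <= sq.nrm M (%x. f x - z * u x) * sq.nrm M u"
  using complex_Re_le_cmod sq.cauchy_schwarz[OF d u] by (rule order_trans)
 finally have "((l - Re z) * sq.nrm M u) * sq.nrm M u <= sq.nrm M (%x. f x - z * u x) * sq.nrm M u"
  by (simp add: power2_eq_square mult.assoc)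
 then show ?thesis
  using sq.nrm_nonneg[OF u] sq.nrm_nonneg[OF d] by (cases "sq.nrm M u = 0") (auto simp: mult_le_cancel_right)
qed

text \<open>Equations obtained by completeness hold up to null sets, while \<open>mag_op\<close> is
  applied to concrete functions.\<close>

lemma mag_op_cong_AE:
 assumes m: "mag_op \<Omega> a V u f" and h: "h \<in> sq M" and AE: "AE x in M. f x = h x"
 shows "mag_op \<Omega> a V u h"
proof -
 obtain \<phi> where \<phi>: "apx \<phi> u" and f: "f \<in> sq M" and cf: "!!v. v \<in> form_dom \<Omega> a V ==> closed_form \<Omega> a V u v = cip M f v"
  by (rule mag_opD[OF m]) blast
 have "cip M f v = cip M h v" if v: "v \<in> form_dom \<Omega> a V" for v
 proof -
  have "v \<in> sq M" using v apxD(1) by (auto simp: form_dom_eq)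
  then show ?thesis unfolding cip_def
   using AE sq_prod_integrable[OF f] sq_prod_integrable[OF h]
   by (intro integral_cong_AE borel_measurable_integrable) auto
 qed
 then show ?thesis unfolding mag_op_def L2_eq L2_inner_eq using cf h \<phi> by (auto simp: form_dom_eq)
qed

text \<open>(H - z) u = g is rewritten as (H - x) u = g + c u with c = z - x. The real resolvent has
  norm at most 1 / (l - x), so the iteration contracts with ratio \<theta> < 1.\<close>

lemma resolvent_complex:
 assumes l: "bounded_below l" and z: "Re z < l" and g: "g \<in> sq M"
 shows "\<exists>u. mag_op \<Omega> a V u (%y. g y + z * u y)"
proof -
 define \<delta> where "\<delta> = l - Re z"
 have \<delta>: "\<delta> > 0" using z by (simp add: \<delta>_def)
 \<comment> \<open>far enough to the left, the disc of radius \<open>l - x\<close> about \<open>x\<close> contains \<open>z\<close>\<close>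
 define x where "x = Re z - (Im z)^2 / (2 * \<delta>)"
 define c where "c = z - complex_of_real x"
 define \<theta> where "\<theta> = cmod c / (l - x)"
 have lx: "l - x > 0"
 proof -
  have "0 <= (Im z)^2 / (2 * \<delta>)" using \<delta> by simp
  then show ?thesis using z unfolding x_def by linarith
 qed
 have "(cmod c)^2 < (l - x)^2"
 proof -
  define t where "t = (Im z)^2 / (2 * \<delta>)"
  have t: "(Im z)^2 = 2 * \<delta> * t" using \<delta> by (simp add: t_def)
  have "(cmod c)^2 = t^2 + (Im z)^2" by (simp add: cmod_power2 c_def x_def t_def)
  also have "\<dots> < (\<delta> + t)^2" unfolding t using \<delta> by (simp add: power2_sum)
  also have "\<delta> + t = l - x" by (simp add: \<delta>_def x_def t_def)
  finally show ?thesis .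
 qed
 then have "cmod c < l - x" by (rule power2_less_imp_less[OF _ less_imp_le[OF lx]])
 then have \<theta>: "0 <= \<theta>" "\<theta> < 1" using lx by (auto simp: \<theta>_def)
 \<comment> \<open>Solutions are unique up to null sets only, so one is chosen for each right-hand
   side. The contraction and the fixed point are therefore expressed in the seminorm and corrected
   at the end.\<close>
 define R where "R h = (SOME u. mag_op \<Omega> a V u (%y. h y + complex_of_real x * u y))" for h
 have R: "mag_op \<Omega> a V (R h) (%y. h y + complex_of_real x * R h y)" if "h \<in> sq M" for h
  unfolding R_def by (rule someI_ex[of "%u. mag_op \<Omega> a V u (%y. h y + complex_of_real x * u y)"]) (rule resolvent_real[OF l _ that], use lx in simp)
 have Rsq: "R h \<in> sq M" if "h \<in> sq M" for h by (rule mag_opD[OF R[OF that]]) (rule apxD(1))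
 have contr: "sq.nrm M (%y. R (%y. g y + c * v y) y - R (%y. g y + c * w y) y) <= \<theta> * sq.nrm M (%y. v y - w y)"
  if v: "v \<in> sq M" and w: "w \<in> sq M" for v w
 proof -
  let ?v = "%y. g y + c * v y" and ?w = "%y. g y + c * w y"
  have vw: "?v \<in> sq M" "?w \<in> sq M" by (rule sq_closed[OF g v], rule sq_closed[OF g w])
  have e: "(%y. (?v y + complex_of_real x * R ?v y) - (?w y + complex_of_real x * R ?w y) - complex_of_real x * (R ?v y - R ?w y)) = (%y. c * (v y - w y))"
   by (auto simp: algebra_simps)
  have "(l - x) * sq.nrm M (%y. R ?v y - R ?w y) <= sq.nrm M (%y. c * (v y - w y))"
   using mag_op_bound[OF mag_op_diff[OF R[OF vw(1)] R[OF vw(2)]] l, of "complex_of_real x"] unfolding e by simp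
  also have "\<dots> = cmod c * sq.nrm M (%y. v y - w y)"
   unfolding sq.nrm_def sq.scale_self[OF sq.diff_closed[OF v w]] by (simp add: real_sqrt_mult)
  finally show ?thesis using lx by (simp add: \<theta>_def field_simps)
 qed
 define U where "U n = ((%u. R (%y. g y + c * u y)) ^^ n) g" for n
 have U0: "U 0 = g" and US: "U (Suc n) = R (%y. g y + c * U n y)" for n by (simp_all add: U_def)
 have Usq: "U n \<in> sq M" for n
 proof (induction n)
  case (Suc n) then show ?case unfolding US by (intro Rsq sq_closed[OF g])
 qed (simp add: U0 g)
 define K where "K = sq.nrm M (%y. U 1 y - U 0 y)"
 have K: "0 <= K" unfolding K_def by (rule sq.nrm_nonneg[OF sq.diff_closed[OF Usq Usq]])
 have step: "sq.nrm M (%y. U (Suc n) y - U n y) <= \<theta> ^ n * K" for n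
 proof (induction n)
  case (Suc n)
  have "sq.nrm M (%y. U (Suc (Suc n)) y - U (Suc n) y) <= \<theta> * sq.nrm M (%y. U (Suc n) y - U n y)"
   using contr[OF Usq Usq, of "Suc n" n] by (simp only: US)
  also have "\<dots> <= \<theta> * (\<theta> ^ n * K)" by (rule mult_left_mono[OF Suc \<theta>(1)])
  finally show ?case by (simp add: mult.assoc)
 qed (simp add: K_def)
 have tele: "sq.nrm M (%y. U (n + k) y - U n y) <= \<theta> ^ n * K * ((1 - \<theta> ^ k) / (1 - \<theta>))" for n k
 proof (induction k)
  case 0 show ?case using sq.zero_left[OF sq.zero_closed[OF g]] by (simp add: sq.nrm_def)
 next
  case (Suc k)
  have "sq.nrm M (%y. U (n + Suc k) y - U n y) <= sq.nrm M (%y. U (Suc (n + k)) y - U (n + k) y) + sq.nrm M (%y. U (n + k) y - U n y)"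
   using sq.triangle3[OF Usq Usq Usq, of "Suc (n + k)" n "n + k"] by simp
  also have "\<dots> <= \<theta> ^ (n + k) * K + \<theta> ^ n * K * ((1 - \<theta> ^ k) / (1 - \<theta>))" by (rule add_mono[OF step Suc])
  also have "\<dots> = \<theta> ^ n * K * (\<theta> ^ k + (1 - \<theta> ^ k) / (1 - \<theta>))" by (simp add: power_add distrib_left)
  also have "\<theta> ^ k + (1 - \<theta> ^ k) / (1 - \<theta>) = (1 - \<theta> ^ Suc k) / (1 - \<theta>)" using \<theta>(2) by (simp add: field_simps)
  finally show ?case .
 qed
 have tele2: "sq.nrm M (%y. U m y - U n y) <= \<theta> ^ n * K / (1 - \<theta>)" if "m >= n" for m n
 proof -
  have "sq.nrm M (%y. U m y - U n y) <= \<theta> ^ n * K * ((1 - \<theta> ^ (m - n)) / (1 - \<theta>))" using tele[of n "m - n"] that by simp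
  also have "\<dots> <= \<theta> ^ n * K * (1 / (1 - \<theta>))"
   using \<theta> K by (intro mult_left_mono divide_right_mono) auto
  finally show ?thesis by simp
 qed
 have pw: "(%n. \<theta> ^ n * K / (1 - \<theta>)) \<longlonglongrightarrow> 0"
  using tendsto_mult_left_zero[OF LIMSEQ_realpow_zero[OF \<theta>], of "K / (1 - \<theta>)"] by simp
 have "\<exists>N. \<forall>k\<ge>N. \<forall>m\<ge>N. sq.nrm M (%y. U k y - U m y) < e" if e: "e > 0" for e
 proof -
  obtain N where N: "\<forall>n\<ge>N. \<theta> ^ n * K / (1 - \<theta>) < e" using order_tendstoD(2)[OF pw e] by (auto simp: eventually_sequentially)
  have "sq.nrm M (%y. U k y - U m y) < e" if "k >= N" "m >= N" for k m
  proof (cases "m <= k")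
   case True then show ?thesis using tele2[OF True] N that by (meson le_less_trans)
  next
   case False
   then have "sq.nrm M (%y. U m y - U k y) < e" using tele2[of k m] N that by (meson le_less_trans nle_le)
   then show ?thesis unfolding sq.nrm_diff_commute[OF Usq Usq, of k m] .
  qed
  then show ?thesis by blast
 qed
 from this obtain W where W: "W \<in> sq M" "(%n. sq.nrm M (%y. U n y - W y)) \<longlonglongrightarrow> 0"
  by (rule sq_complete[of U M, OF Usq]) blast
 define u where "u = R (%y. g y + c * W y)"
 have u: "u \<in> sq M" unfolding u_def by (rule Rsq[OF sq_closed[OF g W(1)]])
 have "sq.nrm M (%y. u y - W y) <= 0"
 proof (rule LIMSEQ_le_const)
  have "(%n. \<theta> * sq.nrm M (%y. U n y - W y) + sq.nrm M (%y. U (Suc n) y - W y)) \<longlonglongrightarrow> \<theta> * 0 + 0"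
   using LIMSEQ_Suc[OF W(2)] by (intro tendsto_intros W(2))
  then show "(%n. \<theta> * sq.nrm M (%y. U n y - W y) + sq.nrm M (%y. U (Suc n) y - W y)) \<longlonglongrightarrow> 0" by simp
  have "sq.nrm M (%y. u y - W y) <= \<theta> * sq.nrm M (%y. U n y - W y) + sq.nrm M (%y. U (Suc n) y - W y)" for n
  proof -
   have "sq.nrm M (%y. u y - U (Suc n) y) <= \<theta> * sq.nrm M (%y. W y - U n y)"
    using contr[OF W(1) Usq, of n] by (simp only: u_def US)
   then show ?thesis
    using sq.triangle3[OF u Usq W(1), of "Suc n"] unfolding sq.nrm_diff_commute[OF W(1) Usq, of n] by linarith
  qed
  then show "\<exists>N. \<forall>n\<ge>N. sq.nrm M (%y. u y - W y) <= \<theta> * sq.nrm M (%y. U n y - W y) + sq.nrm M (%y. U (Suc n) y - W y)" by blast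
 qed
 then have "sq.nrm M (%y. u y - W y) = 0" using sq.nrm_nonneg[OF sq.diff_closed[OF u W(1)]] by linarith
 then have "AE y in M. u y - W y = 0" by (rule sq_nrm_zero_AE[OF sq.diff_closed[OF u W(1)]])
 then have AE: "AE y in M. (g y + c * W y) + complex_of_real x * u y = g y + z * u y"
  by eventually_elim (simp add: c_def algebra_simps)
 show ?thesis
 proof (rule exI, rule mag_op_cong_AE[OF _ sq_closed[OF g u] AE])
  show "mag_op \<Omega> a V u (%y. (g y + c * W y) + complex_of_real x * u y)"
   unfolding u_def by (rule R[OF sq_closed[OF g W(1)]])
 qed
qed

lemma resolvent_half_plane:
 assumes l: "bounded_below l" and z: "Re z < l"
 shows "z \<in> mag_resolvent_set \<Omega> a V"
proof -
 have "L2_norm \<Omega> u <= 1 / (l - Re z) * L2_norm \<Omega> (%x. f x - z * u x)" if "mag_op \<Omega> a V u f" for u f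
  using mag_op_bound[OF that l, of z] z by (simp add: L2_norm_eq field_simps)
 then show ?thesis unfolding mag_resolvent_set_def L2_eq using resolvent_complex[OF l z] by blast
qed

text \<open>Let u solve (H - l) u = \<phi>. The squared norm of \<phi> is the shifted form at u and
  \<phi>, so by Cauchy-Schwarz its square is at most the form at u times the form at \<phi>. The
  former is at most C times the squared norm of \<phi>, by boundedness of the inverse; cancelling
  gives the lower bound l + 1 / C.\<close>

lemma resolvent_improves_bound:
 assumes l: "bounded_below l" and r: "complex_of_real l \<in> mag_resolvent_set \<Omega> a V"
 shows "\<exists>l'>l. bounded_below l'"
proof -
 obtain C0 where C0: "!!u f. mag_op \<Omega> a V u f ==> sq.nrm M u <= C0 * sq.nrm M (%x. f x - complex_of_real l * u x)"
  using r by (auto simp: mag_resolvent_set_def L2_norm_eq)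
 define C where "C = max C0 1"
 have C: "C > 0" "C0 <= C" by (auto simp: C_def)
 interpret q: semi_inner T "shf l" by (rule shf_semi_inner[OF l])
 have "(sq.nrm M \<phi>)^2 <= C * Re (shf l \<phi> \<phi>)" if \<phi>: "\<phi> \<in> T" for \<phi>
 proof -
  obtain u where u: "mag_op \<Omega> a V u (%y. \<phi> y + complex_of_real l * u y)"
   using r T_sq[OF \<phi>] by (auto simp: mag_resolvent_set_def L2_eq)
  obtain \<eta> where \<eta>: "apx \<eta> u" and cf: "!!v. v \<in> form_dom \<Omega> a V ==> closed_form \<Omega> a V u v = cip M (%y. \<phi> y + complex_of_real l * u y) v"
   by (rule mag_opD[OF u]) blast
  note A = apxD[OF \<eta>]
  let ?n = "sq.nrm M \<phi>"
  have n0: "0 <= ?n" by (rule sq.nrm_nonneg[OF T_sq[OF \<phi>]])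
  have d: "u \<in> form_dom \<Omega> a V" "\<phi> \<in> form_dom \<Omega> a V" using \<eta> apx_const[OF \<phi>] by (auto simp: form_dom_eq)
  have un: "sq.nrm M u <= C * ?n"
   using C0[OF u] mult_right_mono[OF C(2) n0] by simp
  have cf2: "closed_form \<Omega> a V u v - complex_of_real l * cip M u v = cip M \<phi> v" if v: "v \<in> form_dom \<Omega> a V" "v \<in> sq M" for v
   unfolding cf[OF v(1)] sq.lin[OF T_sq[OF \<phi>] A(1) v(2)] by simp
  have l1: "(%k. shf l (\<eta> k) \<phi>) \<longlonglongrightarrow> cip M \<phi> \<phi>"
   unfolding shf_def cf2[OF d(2) T_sq[OF \<phi>], symmetric]
   by (intro tendsto_intros closed_form_tendsto[OF \<eta> apx_const[OF \<phi>]] cip_tendsto[OF \<eta> apx_const[OF \<phi>]])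
  have l2: "(%k. Re (shf l (\<eta> k) (\<eta> k))) \<longlonglongrightarrow> Re (cip M \<phi> u)"
   unfolding shf_def cf2[OF d(1) A(1), symmetric]
   by (intro tendsto_intros closed_form_tendsto[OF \<eta> \<eta>] cip_tendsto[OF \<eta> \<eta>])
  have "(cmod (shf l (\<eta> k) \<phi>))^2 <= Re (shf l (\<eta> k) (\<eta> k)) * Re (shf l \<phi> \<phi>)" for k
   using power_mono[OF q.cauchy_schwarz[OF A(2) \<phi>] norm_ge_zero, of k 2]
   by (simp only: power_mult_distrib q.nrm_square[OF A(2)] q.nrm_square[OF \<phi>])
  then have "(cmod (cip M \<phi> \<phi>))^2 <= Re (cip M \<phi> u) * Re (shf l \<phi> \<phi>)"
   by (intro LIMSEQ_le[OF tendsto_power[OF tendsto_norm[OF l1]] tendsto_mult[OF l2 tendsto_const]]) auto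
  also have "\<dots> <= (?n * (C * ?n)) * Re (shf l \<phi> \<phi>)"
  proof (rule mult_right_mono[OF _ q.nonneg[OF \<phi>]])
   have "Re (cip M \<phi> u) <= ?n * sq.nrm M u"
    using complex_Re_le_cmod sq.cauchy_schwarz[OF T_sq[OF \<phi>] A(1)] by (rule order_trans)
   also have "\<dots> <= ?n * (C * ?n)" by (rule mult_left_mono[OF un n0])
   finally show "Re (cip M \<phi> u) <= ?n * (C * ?n)" .
  qed
  also have "cmod (cip M \<phi> \<phi>) = ?n^2"
   using sq.B_real[OF T_sq[OF \<phi>]] sq.nrm_square[OF T_sq[OF \<phi>]] by (metis abs_of_nonneg norm_of_real zero_le_power2)
  finally have *: "?n^2 * ?n^2 <= ?n^2 * (C * Re (shf l \<phi> \<phi>))" by (simp add: power2_eq_square mult_ac)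
  show ?thesis
  proof (cases "?n = 0")
   case True then show ?thesis using q.nonneg[OF \<phi>] C by simp
  next
   case False
   then have "?n^2 > 0" by simp
   then show ?thesis by (rule mult_left_le_imp_le[OF *])
  qed
 qed
 then have "bounded_below (l + 1 / C)"
  unfolding bounded_below_def Re_shf using C by (auto simp: Re_shf field_simps)
 then show ?thesis using C by (intro exI[of _ "l + 1 / C"]) auto
qed

text \<open>Makes the set of admissible constants bounded above, so that a best constant
  exists.\<close>

lemma nonzero_test_function: "\<exists>u\<in>T. sq.nrm M u > 0"
proof -
 obtain p where p: "p \<in> \<Omega>" using ne by blast
 obtain e where e: "e > 0" "ball p e \<subseteq> \<Omega>" using open_dom p by (meson open_contains_ball)
 \<comment> \<open>The distance from the centre is at most the sum of the coordinate deviations,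
   here n d / 2 = e / 2.\<close>
 define d where "d = e / real (CARD('n))"
 have d: "d > 0" using e by (simp add: d_def)
 have sub: "cube p d \<subseteq> \<Omega>"
 proof
  fix x assume "x \<in> cube p d"
  then have "\<bar>(x - p) $ i\<bar> <= d / 2" for i by (simp add: mem_cube)
  then have "norm (x - p) <= (\<Sum>i\<in>(UNIV::'n set). d / 2)" by (intro order_trans[OF norm_le_l1_cart] sum_mono)
  also have "\<dots> < e" using e by (simp add: d_def)
  finally show "x \<in> \<Omega>" using e(2) by (auto simp: dist_norm norm_minus_commute)
 qed
 define \<rho> where "\<rho> = cutoff p (d / 8) (d / 4)"
 have \<rho>: "\<rho> \<in> test_functions (interior (cube p d))"
  unfolding \<rho>_def by (rule cutoff_test) (use d in auto)
 obtain K where K: "smooth_on UNIV \<rho>" "compact K" "K \<subseteq> interior (cube p d)" "!!x. x \<notin> K ==> \<rho> x = 0" using test_functionsD[OF \<rho>] by metis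
 let ?u = "%x. complex_of_real (\<rho> x)"
 have u: "?u \<in> T"
  by (rule test_functionsI[OF smooth_on_complex_of_real[OF open_UNIV K(1)] K(2)]) (use K(3,4) interior_subset[of "cube p d"] sub in \<open>blast, simp\<close>)
 have "sq.nrm M ?u \<noteq> 0"
 proof
  assume "sq.nrm M ?u = 0"
  then have "AE x in M. ?u x = 0" by (rule sq_nrm_zero_AE[OF T_sq[OF u]])
  then have "AE x in lebesgue. x \<notin> cube p (d / 8)"
   unfolding AE_M
  proof eventually_elim
   case (elim x)
   show ?case
   proof
    assume x: "x \<in> cube p (d / 8)"
    then have "\<bar>x $ i - p $ i\<bar> <= d / 8" for i using x d order_trans[of "\<bar>x $ i - p $ i\<bar> * 16" d "d * 2"] by (simp add: mem_cube)
    then have "\<rho> x = 1" unfolding \<rho>_def using d by (intro cutoff_eq_1) auto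
    moreover have "\<bar>x $ i - p $ i\<bar> <= d / 2" for i using \<open>\<bar>x $ i - p $ i\<bar> <= d / 8\<close> d by linarith
    then have "x \<in> cube p d" by (simp add: mem_cube)
    then have "x \<in> \<Omega>" using sub by blast
    ultimately show False using elim by simp
   qed
  qed
  then have "emeasure lebesgue (cube p (d / 8)) = 0"
   by (subst (asm) AE_iff_measurable[of "cube p (d / 8)"]) (auto simp: lmeasurable_iff_integrable)
  then show False using d emeasure_cube[of "d / 8" p] by simp
 qed
 then show ?thesis using u sq.nrm_nonneg[OF T_sq[OF u]] by (intro bexI[of _ ?u]) auto
qed

lemma best_constant_exists: "\<exists>l. best_constant \<Omega> a V l"
proof -
 define S where "S = {c. 0 <= c \<and> (\<forall>u\<in>T. c * (LINT x:\<Omega>|lebesgue. (cmod (u x))^2) <= mag_energy \<Omega> a V u)}"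
 have n: "(LINT x:\<Omega>|lebesgue. (cmod (u x))^2) = (sq.nrm M u)^2" if "u \<in> T" for u
  using that by (simp add: integral_M sq.nrm_square T_sq cip_self)
 have S: "c \<in> S \<longleftrightarrow> 0 <= c \<and> (\<forall>u\<in>T. c * (sq.nrm M u)^2 <= (frm.nrm u)^2)" for c
  by (auto simp: S_def n energy_nrm)
 have zero: "0 \<in> S" by (simp add: S)
 obtain u0 where u0: "u0 \<in> T" "sq.nrm M u0 > 0" using nonzero_test_function by blast
 have "c <= (frm.nrm u0)^2 / (sq.nrm M u0)^2" if "c \<in> S" for c
  using that u0 by (simp add: S pos_le_divide_eq)
 then have bdd: "bdd_above S" by (rule bdd_aboveI)
 have "Sup S * (sq.nrm M u)^2 <= (frm.nrm u)^2" if u: "u \<in> T" for u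
 proof (cases "sq.nrm M u = 0")
  case False
  then have p: "(sq.nrm M u)^2 > 0" by simp
  have "Sup S <= (frm.nrm u)^2 / (sq.nrm M u)^2"
   by (rule cSup_least) (use zero in blast, use u p in \<open>auto simp: S pos_le_divide_eq\<close>)
  then show ?thesis using p by (simp add: pos_le_divide_eq)
 qed simp
 moreover have "0 <= Sup S" by (rule cSup_upper[OF zero bdd])
 ultimately have "Sup S \<in> S" by (simp add: S)
 then have "best_constant \<Omega> a V (Sup S)"
  unfolding best_constant_def Let_def S_def[symmetric] using cSup_upper[OF _ bdd] by blast
 then show ?thesis ..
qed

lemma best_constantD:
 assumes "best_constant \<Omega> a V l"
 shows "0 <= l" "bounded_below l" "!!c. bounded_below c ==> c <= l"
proof -
 have n: "(LINT x:\<Omega>|lebesgue. (cmod (u x))^2) = (sq.nrm M u)^2" if "u \<in> T" for u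
  using that by (simp add: integral_M sq.nrm_square T_sq cip_self)
 show l: "0 <= l" "bounded_below l"
  using assms by (auto simp: best_constant_def bounded_below_def Let_def n energy_nrm)
 fix c assume c: "bounded_below c"
 show "c <= l"
 proof (cases "0 <= c")
  case True
  then show ?thesis using assms c by (auto simp: best_constant_def bounded_below_def Let_def n energy_nrm)
 qed (use l in linarith)
qed

theorem spectrum_bottom_best_constant: "best_constant \<Omega> a V (spectrum_bottom \<Omega> a V)"
proof -
 obtain l where l: "best_constant \<Omega> a V l" using best_constant_exists by blast
 note D = best_constantD[OF l]
 have "complex_of_real l \<in> mag_spectrum \<Omega> a V"
  unfolding mag_spectrum_def using resolvent_improves_bound[OF D(2)] D(3) by force
 moreover have "l <= Re z" if "z \<in> mag_spectrum \<Omega> a V" for z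
  using resolvent_half_plane[OF D(2), of z] that by (force simp: mag_spectrum_def)
 ultimately have "spectrum_bottom \<Omega> a V = l"
  unfolding spectrum_bottom_def by (intro cInf_eq_minimum) (auto intro!: image_eqI[of _ _ "complex_of_real l"])
 with l show ?thesis by simp
qed

end

subsection \<open>The upper bound\<close>

text \<open>Meant for \<open>h\<close> the integrand of a gauge energy, which need not be
  measurable: the integral is then monotone but not additive. So \<open>g\<close> is subtracted on
  the measurable side, and only monotonicity is applied to \<open>h\<close>.\<close>

lemma nn_integral_le_add_cmult:
 fixes f h :: "'a => ennreal" and g :: "'a => real"
 assumes [measurable]: "f \<in> borel_measurable N" "g \<in> borel_measurable N"
  and k: "k > 0" and le: "AE x in N. f x <= ennreal (g x) + ennreal k * h x"
 shows "(\<integral>\<^sup>+x. f x \<partial>N) <= (\<integral>\<^sup>+x. ennreal (g x) \<partial>N) + ennreal k * (\<integral>\<^sup>+x. h x \<partial>N)"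
proof -
 have kk: "ennreal k * (ennreal (1 / k) * y) = y" for y
  using k by (simp add: mult.assoc[symmetric] ennreal_mult[symmetric])
 have "AE x in N. ennreal (1 / k) * (f x - ennreal (g x)) <= h x"
  using le
 proof eventually_elim
  case (elim x)
  then have "f x - ennreal (g x) <= (ennreal (g x) + ennreal k * h x) - ennreal (g x)" by (rule ennreal_minus_mono) simp
  then have "f x - ennreal (g x) <= ennreal k * h x" by simp
  then have "ennreal (1 / k) * (f x - ennreal (g x)) <= ennreal (1 / k) * (ennreal k * h x)" by (rule mult_left_mono) simp
  also have "\<dots> = h x" using k by (simp add: mult.assoc[symmetric] ennreal_mult[symmetric])
  finally show ?case .
 qed
 then have "(\<integral>\<^sup>+x. ennreal (1 / k) * (f x - ennreal (g x)) \<partial>N) <= (\<integral>\<^sup>+x. h x \<partial>N)" by (rule nn_integral_mono_AE)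
 then have 1: "ennreal (1 / k) * (\<integral>\<^sup>+x. f x - ennreal (g x) \<partial>N) <= (\<integral>\<^sup>+x. h x \<partial>N)" by (simp add: nn_integral_cmult)
 have "(\<integral>\<^sup>+x. f x \<partial>N) <= (\<integral>\<^sup>+x. ennreal (g x) + (f x - ennreal (g x)) \<partial>N)"
 proof (rule nn_integral_mono)
  fix x show "f x <= ennreal (g x) + (f x - ennreal (g x))"
  proof (cases "ennreal (g x) <= f x")
   case True then show ?thesis by (simp add: add_diff_inverse_ennreal)
  next
   case False
   then have "f x <= ennreal (g x)" by simp
   also have "\<dots> <= ennreal (g x) + (f x - ennreal (g x))" by simp
   finally show ?thesis .
  qed
 qed
 also have "\<dots> = (\<integral>\<^sup>+x. ennreal (g x) \<partial>N) + (\<integral>\<^sup>+x. f x - ennreal (g x) \<partial>N)" by (rule nn_integral_add) measurable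
 also have "(\<integral>\<^sup>+x. f x - ennreal (g x) \<partial>N) = ennreal k * (ennreal (1 / k) * (\<integral>\<^sup>+x. f x - ennreal (g x) \<partial>N))" by (simp only: kk)
 also have "(\<integral>\<^sup>+x. ennreal (g x) \<partial>N) + \<dots> <= (\<integral>\<^sup>+x. ennreal (g x) \<partial>N) + ennreal k * (\<integral>\<^sup>+x. h x \<partial>N)"
  by (intro add_left_mono mult_left_mono 1) simp
 finally show ?thesis .
qed

context magnetic
begin

text \<open>The test function is \<rho> \<omega>. As |\<omega>| = 1, its magnetic gradient is
  \<omega> times the sum of the gradient of \<rho> and i \<rho> times the vector in the gauge
  energy. The square of the sum is split with factor 2.\<close>

lemma gauge_test_function:
 assumes W: "open W" "smooth_on W \<omega>" "!!x. x \<in> W ==> cmod (\<omega> x) = 1"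
  and K: "compact K" "K \<subseteq> W" "K \<subseteq> \<Omega>" "K \<subseteq> S" and \<rho>: "smooth_on UNIV \<rho>" "!!x. x \<notin> K ==> \<rho> x = 0" "!!x. \<bar>\<rho> x\<bar> <= B"
  and B: "B > 0" and r: "r >= 0" "gauge_energy a V S \<omega> <= ennreal r" and l: "bounded_below l"
 shows "l * (\<integral>x. (\<rho> x)^2 \<partial>lborel) <= 2 * dirichlet \<rho> + 2 * B^2 * r"
proof -
 define u where "u x = complex_of_real (\<rho> x) * \<omega> x" for x
 have oK: "open (- K)" using K(1) by (simp add: compact_imp_closed open_Compl)
 have \<rho>W: "smooth_on W (%x. complex_of_real (\<rho> x))"
  using smooth_on_complex_of_real[OF open_UNIV \<rho>(1)] by (rule smooth_on_subset) simp
 \<comment> \<open>\<omega> is smooth only on \<open>W\<close>; the product is glued with 0 on the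
   complement of the support of \<rho>.\<close>
 have su: "smooth_on UNIV u"
 proof -
  have "smooth_on W u" unfolding u_def[abs_def] by (rule smooth_on_mult[OF W(1) \<rho>W W(2)])
  moreover have "smooth_on (- K) u" by (rule smooth_on_cong[OF oK smooth_on_const[OF oK, of 0]]) (simp add: u_def \<rho>(2))
  ultimately have "smooth_on (W \<union> - K) u" by (rule smooth_on_Un[OF W(1) oK])
  moreover have "W \<union> - K = UNIV" using K(2) by blast
  ultimately show ?thesis by simp
 qed
 have u0: "u x = 0" if "x \<notin> K" for x using that by (simp add: u_def \<rho>(2))
 have u: "u \<in> T" by (rule test_functionsI[OF su K(1,3) u0])
 have \<rho>t: "\<rho> \<in> test_functions UNIV" by (rule test_functionsI[OF \<rho>(1) K(1) _ \<rho>(2)]) auto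
 have norm_u: "(cmod (u x))^2 = (\<rho> x)^2" for x
  using W(3) K(2) \<rho>(2) by (cases "x \<in> K") (auto simp: u_def norm_mult power_mult_distrib)
 let ?X = "%x. (norm (\<chi> j. grad \<omega> x $ j / (\<i> * \<omega> x) + complex_of_real (a x $ j)))^2 + V x"
 let ?e = "%x. (norm (mag_grad a u x))^2 + V x * (cmod (u x))^2"
 have pw: "?e x <= 2 * (norm (grad \<rho> x))^2 + 2 * B^2 * ?X x" if x: "x \<in> K" and V: "0 <= V x" for x
 proof -
  have xW: "x \<in> W" using x K(2) by blast
  have nz: "\<omega> x \<noteq> 0" using W(3)[OF xW] by auto
  have d: "(%x. complex_of_real (\<rho> x)) differentiable (at x)" "\<omega> differentiable (at x)" "\<rho> differentiable (at x)"
   using smooth_on_differentiable[OF W(1) \<rho>W xW] smooth_on_differentiable[OF W(1,2) xW] smooth_on_differentiable[OF open_UNIV \<rho>(1)] by auto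
  have g: "mag_grad a u x $ j = \<omega> x * complex_of_real (grad \<rho> x $ j) + complex_of_real (\<rho> x) * (\<i> * \<omega> x) * (grad \<omega> x $ j / (\<i> * \<omega> x) + complex_of_real (a x $ j))" for j
  proof -
   have "grad u x $ j = complex_of_real (\<rho> x) * grad \<omega> x $ j + grad (%x. complex_of_real (\<rho> x)) x $ j * \<omega> x"
    unfolding u_def[abs_def] by (rule grad_bilinear[OF bounded_bilinear_mult d(1,2)])
   also have "grad (%x. complex_of_real (\<rho> x)) x $ j = complex_of_real (grad \<rho> x $ j)"
    by (rule grad_linear_compose[OF bounded_linear_of_real d(3)])
   finally have e: "grad u x $ j = complex_of_real (\<rho> x) * grad \<omega> x $ j + complex_of_real (grad \<rho> x $ j) * \<omega> x" .
   have "s * (\<i> * w) * (y / (\<i> * w) + c) = s * y + \<i> * c * (s * w)" if "w \<noteq> 0" for s w y c :: complex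
    using that by (simp add: field_simps)
   from this[OF nz] show ?thesis by (simp add: mag_grad_def u_def e)
  qed
  have "(cmod (mag_grad a u x $ j))^2 <= 2 * (grad \<rho> x $ j)^2 + 2 * B^2 * (cmod (grad \<omega> x $ j / (\<i> * \<omega> x) + complex_of_real (a x $ j)))^2" for j
  proof -
   let ?b = "grad \<omega> x $ j / (\<i> * \<omega> x) + complex_of_real (a x $ j)"
   have "(cmod (mag_grad a u x $ j))^2 <= (1 + 1) * (cmod (\<omega> x * complex_of_real (grad \<rho> x $ j)))^2 + (1 + 1 / 1) * (cmod (complex_of_real (\<rho> x) * (\<i> * \<omega> x) * ?b))^2"
    unfolding g by (rule norm_add_square_le) simp
   also have "\<dots> = 2 * (grad \<rho> x $ j)^2 + 2 * ((\<rho> x)^2 * (cmod ?b)^2)"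
    using W(3)[OF xW] by (simp add: norm_mult power_mult_distrib)
   also have "\<dots> <= 2 * (grad \<rho> x $ j)^2 + 2 * (B^2 * (cmod ?b)^2)"
    using \<rho>(3)[of x] B by (intro add_left_mono mult_left_mono mult_right_mono) (auto simp: abs_le_square_iff[symmetric])
   finally show ?thesis by simp
  qed
  then have "(norm (mag_grad a u x))^2 <= (\<Sum>j\<in>UNIV. 2 * (grad \<rho> x $ j)^2 + 2 * B^2 * (cmod (grad \<omega> x $ j / (\<i> * \<omega> x) + complex_of_real (a x $ j)))^2)"
   unfolding norm_vec_def L2_set_def by (simp add: sum_nonneg sum_mono)
  also have "\<dots> = 2 * (norm (grad \<rho> x))^2 + 2 * B^2 * (norm (\<chi> j. grad \<omega> x $ j / (\<i> * \<omega> x) + complex_of_real (a x $ j)))^2"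
   unfolding norm_vec_def L2_set_def by (simp add: sum_nonneg sum.distrib sum_distrib_left)
  finally have 1: "(norm (mag_grad a u x))^2 <= 2 * (norm (grad \<rho> x))^2 + 2 * B^2 * (norm (\<chi> j. grad \<omega> x $ j / (\<i> * \<omega> x) + complex_of_real (a x $ j)))^2" .
  have "(\<rho> x)^2 <= B^2" using \<rho>(3)[of x] B abs_le_square_iff[of "\<rho> x" B] by simp
  then have "(\<rho> x)^2 <= 2 * B^2" using zero_le_power2[of B] by linarith
  then have "V x * (cmod (u x))^2 <= 2 * B^2 * V x" unfolding norm_u using V by (simp add: mult.commute mult_left_mono)
  with 1 show ?thesis by (simp add: distrib_left)
 qed
 have off: "mag_grad a u x = 0" if "x \<notin> K" for x
 proof -
  have "grad u x = grad (%x. 0) x" by (rule grad_cong_open[OF oK]) (use that u0 in auto)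
  then show ?thesis using u0[OF that] by (simp add: mag_grad_def grad_const vec_eq_iff)
 qed
 have "ennreal (mag_energy \<Omega> a V u) = (\<integral>\<^sup>+x\<in>\<Omega>. ennreal (?e x) \<partial>lebesgue)" by (rule mag_energy_nn[OF u])
 also have "\<dots> <= (\<integral>\<^sup>+x. ennreal (2 * (norm (grad \<rho> x))^2) \<partial>lebesgue) + ennreal (2 * B^2) * gauge_energy a V S \<omega>"
  unfolding gauge_energy_def
 proof (rule nn_integral_le_add_cmult)
  have "(%x. indicator \<Omega> x *\<^sub>R ?e x) \<in> borel_measurable lebesgue"
   using mag_energy_integrable[OF u] unfolding integrable_M set_integrable_def by (rule borel_measurable_integrable)
  then have "(%x. ennreal (indicator \<Omega> x *\<^sub>R ?e x)) \<in> borel_measurable lebesgue" by measurable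
  then show "(%x. ennreal (?e x) * indicator \<Omega> x) \<in> borel_measurable lebesgue"
   by (rule measurable_cong[THEN iffD1, rotated]) (auto simp: indicator_def)
  show "(%x. 2 * (norm (grad \<rho> x))^2) \<in> borel_measurable lebesgue"
   using smooth_grad_borel[OF \<rho>(1)] by (intro measurable_completion) measurable
  show "2 * B^2 > 0" using B by simp
  show "AE x in lebesgue. ennreal (?e x) * indicator \<Omega> x <= ennreal (2 * (norm (grad \<rho> x))^2) + ennreal (2 * B^2) * (ennreal (?X x) * indicator S x)"
   using V_nonneg
  proof eventually_elim
   case (elim x)
   show ?case
   proof (cases "x \<in> K")
    case True
    then have x: "x \<in> \<Omega>" "x \<in> S" using K by auto
    then have V: "0 <= V x" using elim by simp
    have "ennreal (?e x) <= ennreal (2 * (norm (grad \<rho> x))^2 + 2 * B^2 * ?X x)" by (rule ennreal_leI[OF pw[OF True V]])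
    also have "\<dots> = ennreal (2 * (norm (grad \<rho> x))^2) + ennreal (2 * B^2 * ?X x)"
     by (rule ennreal_plus) (use V in auto)
    also have "ennreal (2 * B^2 * ?X x) = ennreal (2 * B^2) * ennreal (?X x)"
     by (rule ennreal_mult) (use V in auto)
    finally show ?thesis using x by simp
   next
    case False
    then show ?thesis by (simp add: off u0)
   qed
  qed
 qed
 also have "(\<integral>\<^sup>+x. ennreal (2 * (norm (grad \<rho> x))^2) \<partial>lebesgue) = ennreal (2 * dirichlet \<rho>)"
 proof -
  have "(\<integral>\<^sup>+x. ennreal (2 * (norm (grad \<rho> x))^2) \<partial>lebesgue) = ennreal 2 * (\<integral>\<^sup>+x. ennreal ((norm (grad \<rho> x))^2) \<partial>lborel)"
   unfolding nn_integral_completion ennreal_mult'[OF zero_le_power2] using smooth_grad_borel[OF \<rho>(1)]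
   by (subst nn_integral_cmult[symmetric]) (auto simp: ennreal_mult')
  then show ?thesis unfolding dirichlet_eq[OF \<rho>t] by (simp add: ennreal_mult' dirichlet_nonneg)
 qed
 also have "ennreal (2 * dirichlet \<rho>) + ennreal (2 * B^2) * gauge_energy a V S \<omega> <= ennreal (2 * dirichlet \<rho>) + ennreal (2 * B^2) * ennreal r"
  by (intro add_left_mono mult_left_mono r) simp
 also have "\<dots> = ennreal (2 * dirichlet \<rho> + 2 * B^2 * r)"
  using r(1) dirichlet_nonneg[of \<rho>] by (subst ennreal_plus) (auto simp: ennreal_mult)
 finally have "mag_energy \<Omega> a V u <= 2 * dirichlet \<rho> + 2 * B^2 * r"
  using r(1) dirichlet_nonneg[of \<rho>] by (subst (asm) ennreal_le_iff) auto
 moreover have "l * (\<integral>x. (\<rho> x)^2 \<partial>lborel) <= mag_energy \<Omega> a V u"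
 proof -
  have "(sq.nrm M u)^2 = (\<integral>x. (\<rho> x)^2 \<partial>lborel)"
   using test_norm_integral[OF u] by (simp add: sq.nrm_square[OF T_sq[OF u]] cip_self integral_M norm_u)
  then show ?thesis using l u by (auto simp: bounded_below_def energy_nrm)
 qed
 ultimately show ?thesis by linarith
qed

lemma smooth_pair_bound:
 assumes sp: "smooth_pairs (cube p d) F \<omega>" and F: "compact F" "cube p d - \<Omega> \<subseteq> F"
  and g: "g \<in> test_functions (interior (cube p d) - F)" "!!x. \<bar>g x\<bar> <= B" "B > 0"
  and r: "r >= 0" "gauge_energy a V (cube p d - F) \<omega> <= ennreal r" and l: "bounded_below l"
 shows "l * (\<integral>x. (g x)^2 \<partial>lborel) <= 2 * dirichlet g + 2 * B^2 * r"
proof -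
 let ?Q = "cube p d"
 obtain e U where e': "compact e \<and> e \<subseteq> top_of_set ?Q interior_of F \<and> open U \<and> ?Q - e \<subseteq> U \<and> smooth_on U \<omega> \<and> (\<forall>x\<in>?Q - e. cmod (\<omega> x) = 1)"
  using sp unfolding smooth_pairs_def by blast
 then have e: "compact e" "e \<subseteq> top_of_set ?Q interior_of F" "open U" "?Q - e \<subseteq> U" "smooth_on U \<omega>" by simp_all
 have e6: "cmod (\<omega> x) = 1" if "x \<in> ?Q - e" for x using e' that by simp
 have eF: "e \<subseteq> F" by (rule subset_trans[OF e(2) interior_of_subset])
 obtain K where K: "smooth_on UNIV g" "compact K" "K \<subseteq> interior ?Q - F" "!!x. x \<notin> K ==> g x = 0" using test_functionsD[OF g(1)] by metis
 have iQ: "interior ?Q \<subseteq> ?Q" by (rule interior_subset)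
 have W: "open (interior ?Q - e)" using e(1) by (simp add: compact_imp_closed open_Diff)
 have WU: "interior ?Q - e \<subseteq> U" "interior ?Q - e \<subseteq> ?Q - e" using e(4) iQ by blast+
 show ?thesis
 proof (rule gauge_test_function[OF W smooth_on_subset[OF e(5) WU(1)] _ K(2) _ _ _ K(1,4) g(2,3) r l])
  show "cmod (\<omega> x) = 1" if "x \<in> interior ?Q - e" for x by (rule e6[OF subsetD[OF WU(2) that]])
  show "K \<subseteq> interior ?Q - e" using K(3) eF by blast
  show "K \<subseteq> \<Omega>" "K \<subseteq> ?Q - F" using K(3) F(2) iQ by blast+
 qed
qed

end

section \<open>Zeros and phases of generic polynomials\<close>

text \<open>Near a zero with gradient v the function increases along the rays that issue from x0 -
  v, so each such ray meets the local zero set at most once. Closed sets of this kind are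
  null.\<close>

lemma regular_zero_set_negligible:
 fixes f :: "real^'n => real"
 assumes f: "smooth_on UNIV f"
 shows "negligible {x. f x = 0 \<and> grad f x \<noteq> 0}"
 unfolding locally_negligible_alt[of "{x. f x = 0 \<and> grad f x \<noteq> 0}"]
proof
 let ?S = "{x. f x = 0 \<and> grad f x \<noteq> 0}"
 fix x0 assume x0: "x0 \<in> ?S"
 define v where "v = grad f x0"
 have v: "norm v > 0" using x0 by (simp add: v_def)
 have "isCont (grad f) x0" using smooth_grad_continuous[OF f] by (simp add: continuous_on_eq_continuous_at)
 then obtain e where e: "e > 0" "!!y. dist y x0 < e ==> dist (grad f y) v < norm v / 4"
  unfolding continuous_at_eps_delta v_def using v[unfolded v_def] by (metis divide_pos_pos zero_less_numeral)
 \<comment> \<open>Both the ray direction and the gradient then differ from v by at most a quarter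
   of its length, which keeps their inner product positive.\<close>
 define r where "r = min (e / 2) (norm v / 4)"
 have r: "r > 0" "r < e" "r <= norm v / 4" using e(1) v by (auto simp: r_def)
 define Z where "Z = {x. f x = 0} \<inter> cball x0 r"
 have "closed {x. f x = 0}" using closed_Collect_eq[OF smooth_on_continuous[OF f] continuous_on_const] .
 then have clZ: "closed Z" unfolding Z_def by (intro closed_Int) auto
 have cv: "a + s *\<^sub>R x \<in> cball x0 r" if s: "s1 <= s" "s <= s2" "a + s1 *\<^sub>R x \<in> cball x0 r" "a + s2 *\<^sub>R x \<in> cball x0 r" for s s1 s2 and a x :: "real^'n"
 proof (cases "s1 = s2")
  case True then show ?thesis using s by (metis order_antisym)
 next
  case False
  then have d: "s2 - s1 > 0" using s by simp
  define t where "t = (s - s1) / (s2 - s1)"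
  have t: "0 <= t" "t <= 1" "s = (1 - t) * s1 + t * s2"
  proof -
   have m: "t * (s2 - s1) = s - s1" using d by (simp add: t_def)
   show "0 <= t" "t <= 1" using s d by (auto simp: t_def)
   show "s = (1 - t) * s1 + t * s2" using m by (simp add: algebra_simps)
  qed
  have "(1 - t) *\<^sub>R (a + s1 *\<^sub>R x) + t *\<^sub>R (a + s2 *\<^sub>R x) \<in> cball x0 r"
   by (rule convexD[OF convex_cball s(3,4)]) (use t in auto)
  also have "(1 - t) *\<^sub>R (a + s1 *\<^sub>R x) + t *\<^sub>R (a + s2 *\<^sub>R x) = a + s *\<^sub>R x" unfolding t(3) by (simp add: algebra_simps)
  finally show ?thesis .
 qed
 define a where "a = x0 - v"
 have pos: "0 < x \<bullet> grad f y" if "a + x \<in> cball x0 r" "y \<in> cball x0 r" for x y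
 proof -
  define e1 e2 where "e1 = x - v" and "e2 = grad f y - v"
  have e1: "norm e1 <= norm v / 4" using that(1) r(3) by (simp add: e1_def a_def dist_norm norm_minus_commute algebra_simps)
  have e2: "norm e2 <= norm v / 4" using e(2)[of y] that(2) r(2) by (simp add: e2_def dist_norm norm_minus_commute)
  have "\<bar>v \<bullet> e2\<bar> <= norm v * (norm v / 4)" "\<bar>e1 \<bullet> v\<bar> <= norm v / 4 * norm v" "\<bar>e1 \<bullet> e2\<bar> <= norm v / 4 * (norm v / 4)"
   using Cauchy_Schwarz_ineq2[of v e2] Cauchy_Schwarz_ineq2[of e1 v] Cauchy_Schwarz_ineq2[of e1 e2]
    mult_left_mono[OF e2, of "norm v"] mult_right_mono[OF e1, of "norm v"] mult_mono[OF e1 e2] by auto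
  moreover have "x \<bullet> grad f y = v \<bullet> v + v \<bullet> e2 + e1 \<bullet> v + e1 \<bullet> e2"
  proof -
   have "x = v + e1" "grad f y = v + e2" by (simp_all add: e1_def e2_def)
   then show ?thesis by (simp add: inner_add_left inner_add_right)
  qed
  moreover have "v \<bullet> v = norm v * norm v" by (simp add: power2_norm_eq_inner[symmetric] power2_eq_square)
  moreover have "norm v * norm v > 0" using v by simp
  ultimately show ?thesis by argo
 qed
 have der: "((%t. f (a + t *\<^sub>R x)) has_real_derivative x \<bullet> grad f (a + t *\<^sub>R x)) (at t)" for x t
 proof -
  have "frechet_derivative f (at (a + t *\<^sub>R x)) x = x \<bullet> grad f (a + t *\<^sub>R x)"
   unfolding smooth_on_frechet_expansion[OF open_UNIV f UNIV_I] by (simp add: inner_vec_def)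
  then show ?thesis using smooth_line_derivative[OF open_UNIV f UNIV_I, where x = a and t = t and v = x]
   by (simp add: has_real_derivative_iff_has_vector_derivative)
 qed
 have "negligible Z"
 proof (rule starlike_negligible[OF clZ, of a])
  fix c x assume c: "a + c *\<^sub>R x \<in> Z" "0 <= c" "a + x \<in> Z"
  then have Zs: "a + c *\<^sub>R x \<in> cball x0 r" "a + 1 *\<^sub>R x \<in> cball x0 r" "f (a + c *\<^sub>R x) = 0" "f (a + 1 *\<^sub>R x) = 0" by (simp_all add: Z_def)
  have x: "a + x \<in> cball x0 r" using Zs(2) by simp
  show "c = 1"
  proof (rule ccontr)
   assume "c \<noteq> 1"
   then consider "c < 1" | "1 < c" by linarith
   then show False
   proof cases
    case 1
    have "f (a + c *\<^sub>R x) < f (a + 1 *\<^sub>R x)"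
     by (rule DERIV_pos_imp_increasing[OF 1]) (use der pos[OF x cv[OF _ _ Zs(1,2)]] in blast)
    then show False using Zs by simp
   next
    case 2
    have "f (a + 1 *\<^sub>R x) < f (a + c *\<^sub>R x)"
     by (rule DERIV_pos_imp_increasing[OF 2]) (use der pos[OF x cv[OF _ _ Zs(2,1)]] in blast)
    then show False using Zs by simp
   qed
  qed
 qed
 then have "negligible (?S \<inter> ball x0 r)" by (rule negligible_subset) (auto simp: Z_def)
 moreover have "openin (top_of_set ?S) (?S \<inter> ball x0 r)" by (simp add: openin_open_Int)
 moreover have "x0 \<in> ?S \<inter> ball x0 r" using x0 r(1) by simp
 ultimately show "\<exists>U. openin (top_of_set ?S) U \<and> x0 \<in> U \<and> negligible U" by blast
qed

lemma polynomial_function_smooth: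
 fixes P :: "real^'n => complex"
 assumes "polynomial_function P"
 shows "smooth_on UNIV (%x. Re (P x))" "smooth_on UNIV (%x. Im (P x))" "smooth_on UNIV P"
proof -
 show 1: "smooth_on UNIV (%x. Re (P x))" "smooth_on UNIV (%x. Im (P x))"
  using assms bounded_linear_Re bounded_linear_Im unfolding polynomial_function_def o_def by (auto intro!: real_polynomial_smooth)
 have "smooth_on UNIV (%x. Complex (Re (P x)) (Im (P x)))" by (rule smooth_on_Complex[OF open_UNIV 1])
 then show "smooth_on UNIV P" by simp
qed

text \<open>For a unit number z = P / |P| this combination of gradients is |P| times the gradient of
  the phase. Independence keeps it nonzero at zeros of P, for every unit z.\<close>

lemma generic_polyD:
 fixes P :: "real^'n => complex"
 assumes "generic_poly Q P" "x \<in> Q" "P x = 0" "cmod z = 1"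
 shows "Re z *\<^sub>R grad (%y. Im (P y)) x - Im z *\<^sub>R grad (%y. Re (P y)) x \<noteq> 0" "grad (%y. Re (P y)) x \<noteq> 0"
proof -
 let ?g = "grad (%y. Re (P y)) x" and ?h = "grad (%y. Im (P y)) x"
 have gh: "?g \<noteq> ?h" "independent {?g, ?h}"
  using assms(1-3) unfolding generic_poly_def Let_def by blast+
 show g0: "?g \<noteq> 0" using gh(2) dependent_zero[of "{?g, ?h}"] by auto
 show "Re z *\<^sub>R ?h - Im z *\<^sub>R ?g \<noteq> 0"
 proof
  assume eq: "Re z *\<^sub>R ?h - Im z *\<^sub>R ?g = 0"
  show False
  proof (cases "Re z = 0")
   case True
   then have "Im z *\<^sub>R ?g = 0" using eq by simp
   then have "Im z = 0" using g0 by simp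
   then have "z = 0" using True by (simp add: complex_eq_iff)
   then show False using assms(4) by simp
  next
   case False
   have "Re z *\<^sub>R ?h = Im z *\<^sub>R ?g" using eq by simp
   then have "inverse (Re z) *\<^sub>R (Re z *\<^sub>R ?h) = (inverse (Re z) * Im z) *\<^sub>R ?g" by simp
   then have "?h = (inverse (Re z) * Im z) *\<^sub>R ?g" using False by simp
   then have "?h \<in> span {?g}" by (metis span_base span_scale singletonI)
   moreover have "{?g, ?h} - {?h} = {?g}" using gh(1) by auto
   ultimately show False using gh(2) unfolding dependent_def by (metis insertCI)
  qed
 qed
qed

text \<open>The phase P / |P| has no limit at a zero, so it is replaced by a free unit number. The
  resulting function is continuous and positive on the product of \<open>Q\<close> with the circle,
  and attains its minimum.\<close>

lemma generic_poly_compactness: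
 fixes P :: "real^'n => complex"
 assumes P: "generic_poly Q P" and Q: "compact Q"
 obtains c where "c > 0" "!!x z. x \<in> Q ==> cmod z = 1 ==>
   c <= cmod (P x) + norm (Re z *\<^sub>R grad (%y. Im (P y)) x - Im z *\<^sub>R grad (%y. Re (P y)) x)"
proof (cases "Q = {}")
 case True
 then show ?thesis using that[of 1] by simp
next
 case False
 have pf: "polynomial_function P" using P by (simp add: generic_poly_def)
 note s = polynomial_function_smooth[OF pf]
 let ?G = "grad (%y. Re (P y))" and ?H = "grad (%y. Im (P y))"
 let ?\<Phi> = "%(x, z). cmod (P x) + norm (Re z *\<^sub>R ?H x - Im z *\<^sub>R ?G x)"
 have c: "continuous_on (Q \<times> sphere 0 1) (%w. f (fst w))" if "continuous_on UNIV f" for f :: "real^'n => 'b::topological_space"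
  by (rule continuous_on_compose2[OF that continuous_on_fst[OF continuous_on_id]]) auto
 have "continuous_on (Q \<times> sphere (0::complex) 1) ?\<Phi>"
  unfolding case_prod_unfold
  by (intro continuous_intros c smooth_on_continuous s smooth_grad_continuous)
 moreover have "compact (Q \<times> sphere (0::complex) 1)" using Q by (intro compact_Times) auto
 moreover have "Q \<times> sphere (0::complex) 1 \<noteq> {}" using False by (auto intro!: exI[of _ 1])
 ultimately obtain w where w: "w \<in> Q \<times> sphere 0 1" "\<forall>v\<in>Q \<times> sphere 0 1. ?\<Phi> w <= ?\<Phi> v"
  using continuous_attains_inf by blast
 obtain x z where xz: "w = (x, z)" "x \<in> Q" "cmod z = 1" using w(1) by auto
 have "?\<Phi> w > 0"
  using generic_polyD(1)[OF P xz(2) _ xz(3)] unfolding xz by (cases "P x = 0") (auto intro: add_pos_nonneg)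
 moreover have "?\<Phi> w <= cmod (P x) + norm (Re z *\<^sub>R ?H x - Im z *\<^sub>R ?G x)" if "x \<in> Q" "cmod z = 1" for x z
  using w(2) that by (metis (no_types, lifting) SigmaI case_prod_conv dist_0_norm mem_sphere)
 ultimately show ?thesis by (rule that)
qed

text \<open>The third claim is the formula for the gradient of the phase in terms of the real and
  imaginary part of P; only the real part is stated because this is enough to bound the gauge vector
  from below.\<close>

lemma phase_smooth:
 fixes P :: "real^'n => complex"
 assumes P: "polynomial_function P"
 shows "open {x. P x \<noteq> 0}" "smooth_on {x. P x \<noteq> 0} (%x. P x / complex_of_real (cmod (P x)))"
  "P x \<noteq> 0 ==> Re (grad (%x. P x / complex_of_real (cmod (P x))) x $ j / (\<i> * (P x / complex_of_real (cmod (P x)))))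
    = (Re (P x / complex_of_real (cmod (P x))) * grad (%y. Im (P y)) x $ j - Im (P x / complex_of_real (cmod (P x))) * grad (%y. Re (P y)) x $ j) / cmod (P x)"
proof -
 note s = polynomial_function_smooth[OF P]
 let ?W = "{x. P x \<noteq> 0}" and ?\<omega> = "%x. P x / complex_of_real (cmod (P x))"
 show W: "open ?W" using open_Collect_neq[OF smooth_on_continuous[OF s(3)] continuous_on_const] .
 have sub: "smooth_on ?W f" if "smooth_on UNIV f" for f :: "real^'n => 'b::real_normed_vector"
  using that by (rule smooth_on_subset) simp
 have n2: "(Re (P x))^2 + (Im (P x))^2 > 0" if "x \<in> ?W" for x
  using that by (simp add: cmod_power2[symmetric])
 have pw: "smooth_on ?W (%x. ((Re (P x))^2 + (Im (P x))^2) powr t)" for t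
  by (rule smooth_on_powr[OF W n2], assumption) (intro smooth_on_add smooth_on_power W sub s)
 have nrm: "smooth_on ?W (%x. cmod (P x))"
 proof (rule smooth_on_cong[OF W pw[of "1/2"]])
  fix x assume "x \<in> ?W"
  show "((Re (P x))^2 + (Im (P x))^2) powr (1 / 2) = cmod (P x)" by (simp add: cmod_power2[symmetric] powr_half_sqrt)
 qed
 show sm: "smooth_on ?W ?\<omega>"
 proof (rule smooth_on_cong[OF W])
  show "smooth_on ?W (%x. P x * complex_of_real (inverse (cmod (P x))))"
   by (intro smooth_on_mult smooth_on_complex_of_real smooth_on_inverse W nrm sub s) simp
 qed (simp add: divide_inverse)
 assume x: "P x \<noteq> 0"
 then have xW: "x \<in> ?W" by simp
 define n where "n = cmod (P x)"
 define w where "w = P x / complex_of_real n"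
 have n: "n > 0" using x by (simp add: n_def)
 have w1: "cmod w = 1" using n by (simp add: w_def norm_divide n_def)
 have d: "?\<omega> differentiable (at x)" "(%x. cmod (P x)) differentiable (at x)" "(%x. complex_of_real (cmod (P x))) differentiable (at x)" "P differentiable (at x)"
  using smooth_on_differentiable[OF W sm xW] smooth_on_differentiable[OF W nrm xW] smooth_on_differentiable[OF W smooth_on_complex_of_real[OF W nrm] xW]
   smooth_on_differentiable[OF open_UNIV s(3)] by auto
 \<comment> \<open>The product rule for P = \<omega> |P| spares the computation of the derivative of
   |P|: after multiplication by the conjugate of \<omega> that derivative contributes a real number,
   invisible in the imaginary part.\<close>
 have "grad P x = grad (%x. ?\<omega> x * complex_of_real (cmod (P x))) x"
  by (rule grad_cong_open[OF W xW]) simp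
 then have "grad P x $ j = ?\<omega> x * grad (%x. complex_of_real (cmod (P x))) x $ j + grad ?\<omega> x $ j * complex_of_real (cmod (P x))"
  by (simp only: grad_bilinear[OF bounded_bilinear_mult d(1,3)])
 also have "grad (%x. complex_of_real (cmod (P x))) x $ j = complex_of_real (grad (%x. cmod (P x)) x $ j)"
  by (rule grad_linear_compose[OF bounded_linear_of_real d(2)])
 finally have e: "grad P x $ j = w * complex_of_real (grad (%x. cmod (P x)) x $ j) + grad ?\<omega> x $ j * complex_of_real n"
  by (simp add: w_def n_def)
 have aux: "Re (y / (\<i> * w)) = (Re w * Im b - Im w * Re b) / n" if "b = w * complex_of_real m + y * complex_of_real n" for y b m
 proof -
  have ww: "w * cnj w = 1" using w1 by (simp add: complex_norm_square[symmetric])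
  have w0: "w \<noteq> 0" using w1 by auto
  have "(- \<i> * y * cnj w) * (\<i> * w) = y * (w * cnj w)" by (simp add: mult_ac)
  then have "y / (\<i> * w) = - \<i> * y * cnj w" using w0 unfolding ww by (simp add: divide_eq_eq)
  then have "Re (y / (\<i> * w)) = Im y * Re w - Re y * Im w" by (simp add: algebra_simps)
  moreover have "Re w * Im b - Im w * Re b = n * (Im y * Re w - Re y * Im w)" unfolding that by (simp add: algebra_simps)
  ultimately show ?thesis using n by simp
 qed
 have gP: "grad (%y. Im (P y)) x $ j = Im (grad P x $ j)" "grad (%y. Re (P y)) x $ j = Re (grad P x $ j)"
  by (rule grad_Im[OF d(4)], rule grad_Re[OF d(4)])
 show "Re (grad ?\<omega> x $ j / (\<i> * ?\<omega> x)) = (Re (?\<omega> x) * grad (%y. Im (P y)) x $ j - Im (?\<omega> x) * grad (%y. Re (P y)) x $ j) / cmod (P x)"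
  unfolding gP using aux[OF e] by (simp only: w_def n_def)
qed

context magnetic
begin

text \<open>By genericity c <= |P| (1 + |phase gradient|), so 1 / |P|^2 is bounded by a multiple of
  1 + |phase gradient|^2. The phase gradient differs from the vector in the gauge energy by
  \<open>a\<close>, which is bounded on \<open>K\<close>.\<close>

lemma inverse_square_integrable:
 assumes P: "generic_poly (cube p d) P" and K: "compact K" "K \<subseteq> cube p d" "K \<subseteq> \<Omega>" "K \<subseteq> S"
  and r: "gauge_energy a V S (%x. P x / complex_of_real (cmod (P x))) < \<infinity>"
 shows "integrable lborel (%x. indicator (K \<inter> {x. P x \<noteq> 0}) x * (1 / (cmod (P x))^2))"
proof -
 have pf: "polynomial_function P" using P by (simp add: generic_poly_def)
 note s = polynomial_function_smooth[OF pf]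
 let ?\<omega> = "%x. P x / complex_of_real (cmod (P x))" and ?G = "grad (%y. Re (P y))" and ?H = "grad (%y. Im (P y))"
 obtain c where c: "c > 0" "!!x z. x \<in> cube p d ==> cmod z = 1 ==> c <= cmod (P x) + norm (Re z *\<^sub>R ?H x - Im z *\<^sub>R ?G x)"
  by (rule generic_poly_compactness[OF P compact_cube]) blast
 obtain A where A: "A >= 0" "AE x in M. x \<in> K \<longrightarrow> norm (a x) <= A" by (rule a_bounded[OF K(1)]) blast
 let ?X = "%x. (norm (\<chi> j. grad ?\<omega> x $ j / (\<i> * ?\<omega> x) + complex_of_real (a x $ j)))^2 + V x"
 let ?f = "%x. indicator (K \<inter> {x. P x \<noteq> 0}) x * (1 / (cmod (P x))^2)"
 define k1 where "k1 = 4 / c^2"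
 define k2 where "k2 = (4 * A^2 + 2) / c^2"
 have k: "k1 > 0" "k2 >= 0" using c(1) A(1) by (auto simp: k1_def k2_def)
 have pw: "1 / (cmod (P x))^2 <= k2 + k1 * ?X x" if x: "x \<in> K" "P x \<noteq> 0" and V: "0 <= V x" and a: "norm (a x) <= A" for x
 proof -
  define n where "n = cmod (P x)"
  have n: "n > 0" using x(2) by (simp add: n_def)
  define z where "z = P x / complex_of_real n"
  have z: "cmod z = 1" using n by (simp add: z_def norm_divide n_def)
  \<comment> \<open>The gradient of the phase at x.\<close>
  define R where "R = (Re z *\<^sub>R ?H x - Im z *\<^sub>R ?G x) /\<^sub>R n"
  have Rj: "R $ j = Re (grad ?\<omega> x $ j / (\<i> * ?\<omega> x))" for j
   unfolding phase_smooth(3)[OF pf x(2)] R_def z_def n_def by (simp add: divide_inverse mult.commute)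
  have "c <= n + norm (Re z *\<^sub>R ?H x - Im z *\<^sub>R ?G x)" unfolding n_def using c(2)[OF _ z] x(1) K(2) by blast
  also have "norm (Re z *\<^sub>R ?H x - Im z *\<^sub>R ?G x) = n * norm R" using n by (simp add: R_def)
  finally have "c <= n * (1 + norm R)" by (simp add: distrib_left)
  then have "c^2 <= (n * (1 + norm R))^2" by (rule power_mono[OF _ less_imp_le[OF c(1)]])
  then have 0: "c^2 <= n^2 * (1 + norm R)^2" by (simp only: power_mult_distrib)
  have "1 / N <= q / C" if "C <= N * q" "N > 0" "C > 0" for N C q :: real using that by (simp add: field_simps)
  from this[OF 0] have 1: "1 / n^2 <= (1 + norm R)^2 / c^2" using n c(1) by simp
  have 2: "(1 + norm R)^2 <= 2 + 2 * (norm R)^2"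
   using zero_le_power2[of "1 - norm R"] by (simp add: power2_sum power2_diff)
  have "(norm R)\<^sup>2 = (norm ((R + a x) + (- a x)))\<^sup>2" by simp
  also have "\<dots> <= (1 + 1) * (norm (R + a x))\<^sup>2 + (1 + 1 / 1) * (norm (- a x))\<^sup>2" by (rule norm_add_square_le) simp
  also have "\<dots> <= 2 * (norm (R + a x))^2 + 2 * A^2" using power_mono[OF a norm_ge_zero, of 2] by simp
  also have "(norm (R + a x))^2 <= (norm (\<chi> j. grad ?\<omega> x $ j / (\<i> * ?\<omega> x) + complex_of_real (a x $ j)))^2"
  proof (intro power_mono norm_ge_zero norm_le_componentwise_cart)
   fix j
   have "norm ((R + a x) $ j) = \<bar>Re (grad ?\<omega> x $ j / (\<i> * ?\<omega> x) + complex_of_real (a x $ j))\<bar>" by (simp add: Rj)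
   also have "\<dots> <= cmod (grad ?\<omega> x $ j / (\<i> * ?\<omega> x) + complex_of_real (a x $ j))" by (rule abs_Re_le_cmod)
   finally show "norm ((R + a x) $ j) <= norm ((\<chi> j. grad ?\<omega> x $ j / (\<i> * ?\<omega> x) + complex_of_real (a x $ j)) $ j)" by simp
  qed
  finally have "(norm R)^2 <= 2 * ?X x + 2 * A^2" using V by simp
  then have "(1 + norm R)^2 <= 4 * ?X x + (4 * A^2 + 2)" using 2 by linarith
  then have "(1 + norm R)^2 / c^2 <= (4 * ?X x + (4 * A^2 + 2)) / c^2" by (rule divide_right_mono) simp
  with 1 have "1 / n^2 <= (4 * ?X x + (4 * A^2 + 2)) / c^2" by (rule order_trans)
  also have "\<dots> = k2 + k1 * ?X x" by (simp add: k1_def k2_def add_divide_distrib)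
  finally show ?thesis by (simp add: n_def)
 qed
 have Kb [measurable]: "K \<in> sets borel" using K(1) by (simp add: borel_compact)
 have Pb [measurable]: "P \<in> borel_measurable borel" by (rule smooth_borel[OF s(3)])
 have fb [measurable]: "?f \<in> borel_measurable borel" by measurable
 have "(\<integral>\<^sup>+x. ennreal (?f x) \<partial>lebesgue) <= (\<integral>\<^sup>+x. ennreal (k2 * indicator K x) \<partial>lebesgue) + ennreal k1 * gauge_energy a V S ?\<omega>"
  unfolding gauge_energy_def
 proof (rule nn_integral_le_add_cmult)
  show "(%x. ennreal (?f x)) \<in> borel_measurable lebesgue" by (intro measurable_completion) measurable
  show "(%x. k2 * indicator K x) \<in> borel_measurable lebesgue" by (intro measurable_completion) measurable
  show "k1 > 0" by (rule k)
  show "AE x in lebesgue. ennreal (?f x) <= ennreal (k2 * indicator K x) + ennreal k1 * (ennreal (?X x) * indicator S x)"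
   using V_nonneg A(2)[unfolded AE_M]
  proof eventually_elim
   case (elim x)
   show ?case
   proof (cases "x \<in> K \<and> P x \<noteq> 0")
    case True
    then have x: "x \<in> K" "P x \<noteq> 0" "x \<in> \<Omega>" "x \<in> S" using K by auto
    then have V: "0 <= V x" "norm (a x) <= A" using elim by auto
    have "ennreal (1 / (cmod (P x))^2) <= ennreal (k2 + k1 * ?X x)" by (rule ennreal_leI[OF pw[OF x(1,2) V]])
    also have "\<dots> = ennreal k2 + ennreal (k1 * ?X x)" using k V by (intro ennreal_plus) auto
    also have "ennreal (k1 * ?X x) = ennreal k1 * ennreal (?X x)" using k V by (intro ennreal_mult) auto
    finally show ?thesis using x by simp
   next
    case False
    then show ?thesis by (simp add: indicator_def)
   qed
  qed
 qed
 also have "\<dots> < \<infinity>"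
 proof -
  have "(\<integral>\<^sup>+x. ennreal (k2 * indicator K x) \<partial>lebesgue) = ennreal k2 * emeasure lborel K"
  proof -
   have "(%x. ennreal (k2 * indicator K x)) = (%x. ennreal k2 * indicator K x)" by (auto simp: indicator_def fun_eq_iff)
   then show ?thesis by (simp add: nn_integral_completion nn_integral_cmult_indicator)
  qed
  also have "\<dots> < \<infinity>" using emeasure_bounded_finite[OF compact_imp_bounded[OF K(1)]] by (simp add: ennreal_mult_less_top)
  finally show ?thesis using r by (simp add: ennreal_mult_less_top)
 qed
 finally have "(\<integral>\<^sup>+x. ennreal (?f x) \<partial>lborel) < \<infinity>" by (simp only: nn_integral_completion)
 then show ?thesis by (intro integrableI_nonneg) auto
qed

text \<open>Here \<omega> is not smooth at the zeros of P, so \<open>g\<close> is multiplied by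
  cutoffs that vanish near them. Their gradients live on shells where |P| is comparable to
  \<epsilon> and are bounded by a multiple of 1 / |P|; integrability of 1 / |P|^2 makes the extra
  energy tend to 0.\<close>

lemma polynomial_pair_bound:
 assumes pp: "polynomial_pairs (cube p d) F \<omega>" and F: "compact F" "cube p d - \<Omega> \<subseteq> F"
  and g: "g \<in> test_functions (interior (cube p d) - F)" "!!x. \<bar>g x\<bar> <= B" "B > 0"
  and r: "r >= 0" "gauge_energy a V (cube p d - F) \<omega> <= ennreal r" and l: "bounded_below l"
 shows "l * (\<integral>x. (g x)^2 \<partial>lborel) <= 4 * dirichlet g + 2 * B^2 * r"
proof -
 let ?Q = "cube p d"
 obtain P where P: "generic_poly ?Q P" and \<omega>: "\<omega> = (%x. P x / complex_of_real (cmod (P x)))"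
  using pp unfolding polynomial_pairs_def by blast
 have pf: "polynomial_function P" using P by (simp add: generic_poly_def)
 note s = polynomial_function_smooth[OF pf]
 let ?W = "{x. P x \<noteq> 0}"
 note ph = phase_smooth(1,2)[OF pf, folded \<omega>]
 obtain K where K: "smooth_on UNIV g" "compact K" "K \<subseteq> interior ?Q - F" "!!x. x \<notin> K ==> g x = 0" "!!x. x \<notin> K ==> grad g x = 0" using test_functionsD[OF g(1)] by metis
 have KQ: "K \<subseteq> ?Q" "K \<subseteq> \<Omega>" "K \<subseteq> ?Q - F" using K(3) F(2) interior_subset[of ?Q] by blast+
 let ?I = "%x. indicator (K \<inter> ?W) x * (1 / (cmod (P x))^2)"
 have I: "integrable lborel ?I"
  by (rule inverse_square_integrable[OF P K(2) KQ]) (use r(2) in \<open>simp add: \<omega>[symmetric] order_le_less_trans\<close>)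
 let ?G = "grad (%y. Re (P y))" and ?H = "grad (%y. Im (P y))"
 have "continuous_on ?Q (%x. norm (?G x) + norm (?H x))"
  by (intro continuous_intros continuous_on_subset[OF smooth_grad_continuous[OF s(1)]] continuous_on_subset[OF smooth_grad_continuous[OF s(2)]]) auto
 then obtain L where L: "!!x. x \<in> ?Q ==> norm (?G x) + norm (?H x) <= L"
  using compact_continuous_image[OF _ compact_cube] by (metis (no_types, lifting) bounded_imp_bdd_above compact_imp_bounded cSup_upper image_eqI)
 define m where "m x = (Re (P x))^2 + (Im (P x))^2" for x
 have m: "m x = (cmod (P x))^2" for x by (simp add: m_def cmod_power2)
 have sm: "smooth_on UNIV m" unfolding m_def[abs_def] by (intro smooth_on_add smooth_on_power s open_UNIV)
 \<comment> \<open>A function of |P|^2, hence smooth everywhere: 0 for |P|^2 <= e^2 and 1 for |P|^2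
   >= 2 e^2.\<close>
 define \<eta> where "\<eta> e x = smooth_step (m x * (1 / e^2) - 1)" for e x
 have s\<eta>: "smooth_on UNIV (\<eta> e)" for e unfolding \<eta>_def[abs_def] by (intro smooth_on_step smooth_on_diff smooth_on_mult sm smooth_on_const open_UNIV)
 have \<eta>01: "0 <= \<eta> e x" "\<eta> e x <= 1" for e x by (simp_all add: \<eta>_def smooth_step_range)
 define C where "C = 64 * step_slope^2 * L^2"
 have \<eta>g: "(norm (grad (\<eta> e) x))^2 <= C * (indicator {x. P x \<noteq> 0 \<and> m x <= 2 * e^2} x * (1 / (cmod (P x))^2))" if e: "e > 0" and x: "x \<in> ?Q" for e x
 proof -
  let ?t = "m x * (1 / e^2) - 1"
  have dm: "m differentiable (at x)" using smooth_on_differentiable[OF open_UNIV sm] by simp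
  have dF: "(%x. Re (P x)) differentiable (at x)" "(%x. Im (P x)) differentiable (at x)"
   using smooth_on_differentiable[OF open_UNIV s(1)] smooth_on_differentiable[OF open_UNIV s(2)] by auto
  have gm: "grad m x $ j = 2 * Re (P x) * ?G x $ j + 2 * Im (P x) * ?H x $ j" for j
  proof -
   have "((%x. m x) has_derivative (%h. 2 * Re (P x) * frechet_derivative (%x. Re (P x)) (at x) h + 2 * Im (P x) * frechet_derivative (%x. Im (P x)) (at x) h)) (at x)"
    unfolding m_def power2_eq_square
    by (rule has_derivative_eq_rhs, rule has_derivative_add[OF has_derivative_mult[OF dF(1,1)[unfolded frechet_derivative_works]] has_derivative_mult[OF dF(2,2)[unfolded frechet_derivative_works]]]) (auto simp: algebra_simps)
   from grad_eqI[OF this] show ?thesis by (simp add: grad_nth)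
  qed
  have gmn: "norm (grad m x) <= 2 * cmod (P x) * L"
  proof -
   have "grad m x = (2 * Re (P x)) *\<^sub>R ?G x + (2 * Im (P x)) *\<^sub>R ?H x" by (simp add: vec_eq_iff gm)
   then have "norm (grad m x) <= norm ((2 * Re (P x)) *\<^sub>R ?G x) + norm ((2 * Im (P x)) *\<^sub>R ?H x)" by (simp only: norm_triangle_ineq)
   also have "\<dots> <= 2 * cmod (P x) * norm (?G x) + 2 * cmod (P x) * norm (?H x)"
    using abs_Re_le_cmod[of "P x"] abs_Im_le_cmod[of "P x"] by (intro add_mono) (auto simp: abs_mult intro!: mult_right_mono)
   also have "\<dots> <= 2 * cmod (P x) * L" using L[OF x] by (simp add: distrib_left[symmetric] mult_left_mono)
   finally show ?thesis .
  qed
  have d: "((%t. smooth_step (t * (1 / e^2) - 1)) has_real_derivative deriv smooth_step ?t * (1 / e^2)) (at (m x))"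
  proof (rule DERIV_chain2[OF smooth_step_deriv(1)])
   have "((%t. t * q - 1) has_real_derivative q) (at s)" for q s :: real by (auto intro!: derivative_eq_intros)
   then show "((%t. t * (1 / e^2) - 1) has_real_derivative (1 / e^2)) (at (m x))" .
  qed
  have "grad (\<eta> e) x $ j = (deriv smooth_step ?t * (1 / e^2)) * grad m x $ j" for j
   unfolding \<eta>_def[abs_def] by (rule grad_real_compose[OF dm d])
  then have "grad (\<eta> e) x = (deriv smooth_step ?t * (1 / e^2)) *\<^sub>R grad m x" by (simp add: vec_eq_iff)
  then have n: "norm (grad (\<eta> e) x) = \<bar>deriv smooth_step ?t\<bar> * (1 / e^2) * norm (grad m x)" by (simp add: abs_mult)
  show ?thesis
  proof (cases "?t < 0 \<or> ?t > 1")
   case True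
   then show ?thesis using n deriv_smooth_step_zero[OF True] step_slope by (simp add: C_def)
  next
   case False
   then have b: "e^2 <= m x" "m x <= 2 * e^2" using e by (auto simp: field_simps)
   then have nz: "P x \<noteq> 0" using e m[of x] by auto
   then have mp: "m x > 0" by (simp add: m)
   have "norm (grad (\<eta> e) x) <= step_slope * (1 / e^2) * (2 * cmod (P x) * L)"
    unfolding n using gmn smooth_step_deriv(2)[of ?t] step_slope(1) by (intro mult_mono) auto
   then have "(norm (grad (\<eta> e) x))^2 <= (step_slope * (1 / e^2) * (2 * cmod (P x) * L))^2" by (rule power_mono) simp
   also have "\<dots> = 4 * step_slope^2 * L^2 * (m x * (1 / e^2)^2)"
   proof -
    have "(s * q * (2 * t * L))^2 = 4 * s^2 * L^2 * (t^2 * q^2)" for s q t :: real by (simp add: power_mult_distrib mult_ac)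
    then show ?thesis unfolding m .
   qed
   also have "\<dots> <= 4 * step_slope^2 * L^2 * (4 * (1 / m x))"
   proof (rule mult_left_mono)
    \<comment> \<open>On the shell e^2 and |P|^2 differ by at most a factor 2, so |P|^2 / e^4 is at
      most 4 / |P|^2.\<close>
    have "m x * (1 / e^2) <= 2" using b e by (simp add: field_simps)
    then have "(m x * (1 / e^2))^2 <= 2^2" using mp e by (intro power_mono) auto
    then have "m x * (1 / e^2)^2 * m x <= 4" by (simp add: power2_eq_square mult_ac)
    then show "m x * (1 / e^2)^2 <= 4 * (1 / m x)" using mp by (simp add: pos_le_divide_eq)
   qed simp
   also have "\<dots> <= C * (1 / m x)" unfolding C_def using mp by (simp add: divide_right_mono mult_right_mono)
   finally show ?thesis using nz b(2) by (simp add: m)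
  qed
 qed
 define \<epsilon> where "\<epsilon> k = 1 / (real k + 1)" for k :: nat
 have \<epsilon>: "\<epsilon> k > 0" for k by (simp add: \<epsilon>_def add_pos_nonneg)
 have \<epsilon>0: "\<epsilon> \<longlonglongrightarrow> 0" unfolding \<epsilon>_def[abs_def] using LIMSEQ_inverse_real_of_nat by (simp add: inverse_eq_divide add.commute)
 \<comment> \<open>A majorant of the squared gradient of the k-th cutoff on \<open>K\<close>. The
   sets in the indicator shrink to the empty set because the zeros of P are excluded.\<close>
 define X where "X k x = C * (indicator (K \<inter> {x. P x \<noteq> 0 \<and> m x <= 2 * (\<epsilon> k)^2}) x * (1 / (cmod (P x))^2))" for k x
 have Kb [measurable]: "K \<in> sets borel" using K(2) by (simp add: borel_compact)
 have Pb [measurable]: "P \<in> borel_measurable borel" by (rule smooth_borel[OF s(3)])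
 have mb [measurable]: "m \<in> borel_measurable borel" by (rule smooth_borel[OF sm])
 have gb [measurable]: "g \<in> borel_measurable borel" by (rule smooth_borel[OF K(1)])
 have \<eta>b [measurable]: "\<eta> e \<in> borel_measurable borel" for e by (rule smooth_borel[OF s\<eta>])
 have C0: "C >= 0" by (simp add: C_def)
 have small: "\<forall>\<^sub>F k in sequentially. 2 * (\<epsilon> k)^2 < m x" if "P x \<noteq> 0" for x
 proof -
  have "(%k. 2 * (\<epsilon> k)^2) \<longlonglongrightarrow> 2 * 0^2" by (intro tendsto_intros \<epsilon>0)
  moreover have "2 * 0^2 < m x" using that by (simp add: m)
  ultimately show ?thesis by (rule order_tendstoD(2))
 qed
 have Xlim: "(%k. \<integral>x. X k x \<partial>lborel) \<longlonglongrightarrow> 0" and Xi: "!!k. integrable lborel (X k)"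
 proof -
  have lim: "AE x in lborel. (%k. X k x) \<longlonglongrightarrow> 0"
  proof (rule AE_I2)
   fix x
   have "\<forall>\<^sub>F k in sequentially. X k x = 0"
   proof (cases "P x = 0")
    case False
    show ?thesis using small[OF False] by eventually_elim (simp add: X_def indicator_def)
   qed (simp add: X_def)
   then show "(%k. X k x) \<longlonglongrightarrow> 0" by (rule tendsto_eventually)
  qed
  have bd: "AE x in lborel. norm (X k x) <= C * ?I x" for k
   using C0 by (intro AE_I2) (auto simp: X_def indicator_def)
  have Xm: "X k \<in> borel_measurable lborel" for k unfolding X_def[abs_def] by measurable
  have i: "integrable lborel (%x. C * ?I x)" by (rule integrable_mult_right) (rule I)
  show "(%k. \<integral>x. X k x \<partial>lborel) \<longlonglongrightarrow> 0"
   using integral_dominated_convergence[OF _ Xm i lim bd] by simp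
  show "integrable lborel (X k)" for k by (rule integrable_dominated_convergence2[OF _ Xm i lim bd]) simp
 qed
 have g2i: "integrable lborel (%x. (g x)^2)"
  by (rule integrable_compact_support(1)[OF _ K(2)]) (intro continuous_intros smooth_on_continuous[OF K(1)], simp add: K(4))
 \<comment> \<open>The cutoffs tend to 1 only off the zeros, so the zeros must be null for the mass
   of \<open>g\<close> to survive in the limit. The real part alone already gives this.\<close>
 have Zero: "AE x in lborel. x \<in> K \<longrightarrow> P x \<noteq> 0"
 proof -
  have "negligible {x. Re (P x) = 0 \<and> ?G x \<noteq> 0}" by (rule regular_zero_set_negligible[OF s(1)])
  moreover have "{x \<in> K. P x = 0} \<subseteq> {x. Re (P x) = 0 \<and> ?G x \<noteq> 0}"
  proof
   fix x assume "x \<in> {x \<in> K. P x = 0}"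
   then have "x \<in> ?Q" "P x = 0" using KQ by auto
   then show "x \<in> {x. Re (P x) = 0 \<and> ?G x \<noteq> 0}" using generic_polyD(2)[OF P, of x 1] by simp
  qed
  ultimately have n: "negligible {x \<in> K. P x = 0}" by (rule negligible_subset)
  have "{x \<in> K. P x = 0} \<in> sets borel" by measurable
  then have "{x \<in> K. P x = 0} \<in> null_sets lborel"
   using n by (simp add: negligible_iff_null_sets null_sets_def)
  then show ?thesis by (rule AE_I') auto
 qed
 have rlim: "(%k. \<integral>x. (g x * \<eta> (\<epsilon> k) x)^2 \<partial>lborel) \<longlonglongrightarrow> (\<integral>x. (g x)^2 \<partial>lborel)"
 proof (rule integral_dominated_convergence[OF _ _ g2i])
  show "AE x in lborel. (%k. (g x * \<eta> (\<epsilon> k) x)^2) \<longlonglongrightarrow> (g x)^2"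
   using Zero
  proof eventually_elim
   case (elim x)
   show ?case
   proof (cases "x \<in> K")
    case True
    have "\<forall>\<^sub>F k in sequentially. (g x * \<eta> (\<epsilon> k) x)^2 = (g x)^2"
     using small[OF elim[rule_format, OF True]]
    proof eventually_elim
     case (elim k)
     then have "1 <= m x * (1 / (\<epsilon> k)^2) - 1" using \<epsilon>[of k] by (simp add: field_simps)
     then show ?case by (simp add: \<eta>_def smooth_step_1)
    qed
    then show ?thesis by (rule tendsto_eventually)
   qed (simp add: K(4))
  qed
  show "AE x in lborel. norm ((g x * \<eta> (\<epsilon> k) x)^2) <= (g x)^2" for k
  proof (rule AE_I2)
   fix x
   have "(\<eta> (\<epsilon> k) x)^2 <= 1" using \<eta>01[of "\<epsilon> k" x] by (simp add: power_le_one)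
   then have "(g x)^2 * (\<eta> (\<epsilon> k) x)^2 <= (g x)^2" by (simp add: mult_left_le)
   then show "norm ((g x * \<eta> (\<epsilon> k) x)^2) <= (g x)^2" by (simp add: power_mult_distrib)
  qed
 qed measurable
 have step: "l * (\<integral>x. (g x * \<eta> (\<epsilon> k) x)^2 \<partial>lborel) <= 4 * dirichlet g + 4 * B^2 * (\<integral>x. X k x \<partial>lborel) + 2 * B^2 * r" for k
 proof -
  let ?\<rho> = "%x. g x * \<eta> (\<epsilon> k) x"
  define K' where "K' = K \<inter> {x. (\<epsilon> k)^2 <= m x}"
  have "closed {x. (\<epsilon> k)^2 <= m x}" by (rule closed_Collect_le[OF continuous_on_const smooth_on_continuous[OF sm]])
  then have K'c: "compact K'" unfolding K'_def by (rule compact_Int_closed[OF K(2)])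
  have K'W: "K' \<subseteq> ?W"
  proof
   fix x assume "x \<in> K'"
   then have "(\<epsilon> k)^2 <= (cmod (P x))^2" by (simp add: K'_def m)
   then show "x \<in> ?W" using \<epsilon>[of k] by auto
  qed
  have K'K: "K' \<subseteq> K" by (simp add: K'_def)
  have s\<rho>: "smooth_on UNIV ?\<rho>" by (rule smooth_on_mult[OF open_UNIV K(1) s\<eta>])
  have \<rho>0: "?\<rho> x = 0" if "x \<notin> K'" for x
  proof (cases "x \<in> K")
   case True
   then have "m x < (\<epsilon> k)^2" using that by (simp add: K'_def)
   then have "m x * (1 / (\<epsilon> k)^2) - 1 <= 0" using \<epsilon>[of k] by (simp add: field_simps)
   then show ?thesis by (simp add: \<eta>_def smooth_step_0)
  qed (simp add: K(4))
  have \<rho>B: "\<bar>?\<rho> x\<bar> <= B" for x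
   using mult_mono[OF g(2) \<eta>01(2) less_imp_le[OF g(3)] \<eta>01(1), of x "\<epsilon> k" x] \<eta>01(1)[of "\<epsilon> k" x] by (simp add: abs_mult)
  have "l * (\<integral>x. (?\<rho> x)^2 \<partial>lborel) <= 2 * dirichlet ?\<rho> + 2 * B^2 * r"
  proof (rule gauge_test_function[OF ph(1,2) _ K'c K'W _ _ s\<rho> \<rho>0 \<rho>B g(3) r l])
   show "cmod (\<omega> x) = 1" if "x \<in> ?W" for x using that by (simp add: \<omega> norm_divide)
   show "K' \<subseteq> \<Omega>" "K' \<subseteq> ?Q - F" using K'K KQ by blast+
  qed
  moreover have "dirichlet ?\<rho> <= 2 * dirichlet g + 2 * B^2 * (\<integral>x. X k x \<partial>lborel)"
  proof -
   have \<rho>t: "?\<rho> \<in> test_functions UNIV" by (rule test_functionsI[OF s\<rho> K'c _ \<rho>0]) auto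
   have gt: "g \<in> test_functions UNIV" using g(1) test_functions_mono[of _ UNIV] by blast
   have "dirichlet ?\<rho> <= (\<integral>x. 2 * (norm (grad g x))^2 + 2 * B^2 * X k x \<partial>lborel)"
    unfolding dirichlet_def
   proof (rule integral_mono[OF test_integrable_grad[OF \<rho>t]])
    show "integrable lborel (%x. 2 * (norm (grad g x))^2 + 2 * B^2 * X k x)"
     using test_integrable_grad[OF gt] Xi[of k] by simp
    fix x
    show "(norm (grad ?\<rho> x))^2 <= 2 * (norm (grad g x))^2 + 2 * B^2 * X k x"
    proof (cases "x \<in> K")
     case True
     have dg: "g differentiable (at x)" "\<eta> (\<epsilon> k) differentiable (at x)"
      using smooth_on_differentiable[OF open_UNIV K(1)] smooth_on_differentiable[OF open_UNIV s\<eta>] by auto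
     have "grad ?\<rho> x = \<eta> (\<epsilon> k) x *\<^sub>R grad g x + g x *\<^sub>R grad (\<eta> (\<epsilon> k)) x"
      by (simp add: vec_eq_iff grad_bilinear[OF bounded_bilinear_mult dg] mult.commute)
     then have gr: "grad ?\<rho> x = \<eta> (\<epsilon> k) x *\<^sub>R grad g x + g x *\<^sub>R grad (\<eta> (\<epsilon> k)) x" .
     have "(norm (grad ?\<rho> x))^2 <= (1 + 1) * (norm (\<eta> (\<epsilon> k) x *\<^sub>R grad g x))^2 + (1 + 1 / 1) * (norm (g x *\<^sub>R grad (\<eta> (\<epsilon> k)) x))^2"
      unfolding gr by (rule norm_add_square_le) simp
     also have "\<dots> = 2 * ((\<eta> (\<epsilon> k) x)^2 * (norm (grad g x))^2) + 2 * ((g x)^2 * (norm (grad (\<eta> (\<epsilon> k)) x))^2)"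
      by (simp add: power_mult_distrib)
     also have "\<dots> <= 2 * (1 * (norm (grad g x))^2) + 2 * (B^2 * X k x)"
     proof (intro add_mono mult_left_mono mult_mono)
      show "(\<eta> (\<epsilon> k) x)^2 <= 1" using \<eta>01[of "\<epsilon> k" x] by (simp add: power_le_one)
      show "(g x)^2 <= B^2" using power_mono[OF g(2), of x 2] by simp
      show "(norm (grad (\<eta> (\<epsilon> k)) x))^2 <= X k x"
       using \<eta>g[OF \<epsilon>, of x k] True KQ(1) by (auto simp: X_def indicator_def)
     qed auto
     finally show ?thesis by simp
    next
     case False
     have oK: "open (- K)" using K(2) by (simp add: compact_imp_closed open_Compl)
     have "grad ?\<rho> x = grad (%x. 0) x" by (rule grad_cong_open[OF oK]) (use False K(4) in auto)
     then show ?thesis using False C0 by (simp add: grad_const X_def)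
    qed
   qed
   also have "\<dots> = 2 * dirichlet g + 2 * B^2 * (\<integral>x. X k x \<partial>lborel)"
    unfolding dirichlet_def using test_integrable_grad[OF gt] Xi[of k] by simp
   finally show ?thesis .
  qed
  ultimately show ?thesis by linarith
 qed
 have "(%k. 4 * dirichlet g + 4 * B^2 * (\<integral>x. X k x \<partial>lborel) + 2 * B^2 * r) \<longlonglongrightarrow> 4 * dirichlet g + 4 * B^2 * 0 + 2 * B^2 * r"
  by (intro tendsto_intros Xlim)
 then have "(%k. 4 * dirichlet g + 4 * B^2 * (\<integral>x. X k x \<partial>lborel) + 2 * B^2 * r) \<longlonglongrightarrow> 4 * dirichlet g + 2 * B^2 * r"
  by simp
 from LIMSEQ_le[OF tendsto_mult[OF tendsto_const rlim] this] step show ?thesis by blast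
qed

end

theorem spectrum_upper:
 assumes n: "CARD('n::finite) >= 2" and \<gamma>: "0 < \<gamma>" "\<gamma> < 1"
 shows "\<exists>C>0. \<forall>(\<Omega> :: (real^'n) set) V a A l p d. magnetic \<Omega> V a \<and> A \<in> {smooth_pairs, polynomial_pairs} \<and> magnetic.bounded_below \<Omega> V a l \<and> d > 0 \<and>
   ennreal (d ^ (CARD('n) - 2)) >= (INF (F, \<omega>) \<in> {(F, \<omega>). F \<in> admissible_sets \<Omega> \<gamma> p d \<and> A (cube p d) F \<omega>}. gauge_energy a V (cube p d - F) \<omega>)
   \<longrightarrow> l * d^2 <= C"
proof -
 obtain B C c where BC: "B > 0" "C > 0" "c > 0" and cut: "!!(p :: real^'n) d F. d > 0 ==> compact F ==>
   wiener_cap p d F <= ennreal \<gamma> * wiener_cap p d (cube p d) ==>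
   (\<exists>g::real^'n => real. g \<in> test_functions (interior (cube p d) - F) \<and> (\<forall>x. \<bar>g x\<bar> <= B) \<and>
    dirichlet g <= C * d ^ (CARD('n) - 2) \<and> c * d ^ CARD('n) <= (\<integral>x. (g x)^2 \<partial>lborel))"
  using capacity_cutoff[OF n \<gamma>] by metis
 define C' where "C' = (4 * C + 4 * B^2) / c"
 have C': "C' > 0" using BC by (simp add: C'_def add_pos_nonneg)
 have "l * d^2 <= C'"
  if mg: "magnetic \<Omega> V a" and A: "A \<in> {smooth_pairs, polynomial_pairs}" and l: "magnetic.bounded_below \<Omega> V a l" and d: "d > 0"
   and le: "ennreal (d ^ (CARD('n) - 2)) >= (INF (F, \<omega>) \<in> {(F, \<omega>). F \<in> admissible_sets \<Omega> \<gamma> p d \<and> A (cube p d) F \<omega>}. gauge_energy a V (cube p d - F) \<omega>)"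
  for \<Omega> :: "(real^'n) set" and V a A l p d
 proof (cases "l <= 0")
  case True
  then have "l * d^2 <= 0" by (simp add: mult_nonpos_nonneg)
  then show ?thesis using C' by linarith
 next
  case False
  interpret magnetic \<Omega> V a by (rule mg)
  define D where "D = d ^ (CARD('n) - 2)"
  have D: "D > 0" using d by (simp add: D_def)
  have dn: "d ^ CARD('n) = D * d^2" unfolding D_def using n by (metis power_add le_add_diff_inverse2)
  \<comment> \<open>The infimum need not be attained; giving away a factor 2 provides an actual
    pair.\<close>
  have "ennreal D < ennreal (2 * D)" using D by (simp add: ennreal_less_iff)
  with le have "(INF (F, \<omega>) \<in> {(F, \<omega>). F \<in> admissible_sets \<Omega> \<gamma> p d \<and> A (cube p d) F \<omega>}. gauge_energy a V (cube p d - F) \<omega>) < ennreal (2 * D)"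
   unfolding D_def by (rule le_less_trans)
  then obtain F \<omega> where F: "F \<in> admissible_sets \<Omega> \<gamma> p d" "A (cube p d) F \<omega>" "gauge_energy a V (cube p d - F) \<omega> < ennreal (2 * D)"
   unfolding Inf_less_iff by auto
  have Fa: "compact F" "cube p d - \<Omega> \<subseteq> F" "wiener_cap p d F <= ennreal \<gamma> * wiener_cap p d (cube p d)"
   using F(1) by (auto simp: admissible_sets_def)
  obtain g where g: "g \<in> test_functions (interior (cube p d) - F)" "!!x. \<bar>g x\<bar> <= B"
    "dirichlet g <= C * D" "c * d ^ CARD('n) <= (\<integral>x. (g x)^2 \<partial>lborel)"
   using cut[OF d Fa(1,3)] unfolding D_def by blast
  have r: "2 * D >= 0" "gauge_energy a V (cube p d - F) \<omega> <= ennreal (2 * D)" using D F(3) by auto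
  have "l * (\<integral>x. (g x)^2 \<partial>lborel) <= 4 * dirichlet g + 2 * B^2 * (2 * D)"
  proof (cases "A = smooth_pairs")
   case True
   have "l * (\<integral>x. (g x)^2 \<partial>lborel) <= 2 * dirichlet g + 2 * B^2 * (2 * D)"
    by (rule smooth_pair_bound[OF _ Fa(1,2) g(1,2) BC(1) r l]) (use F(2) True in simp)
   then show ?thesis using dirichlet_nonneg[of g] by linarith
  next
   case False
   then have "polynomial_pairs (cube p d) F \<omega>" using A F(2) by auto
   then show ?thesis by (rule polynomial_pair_bound[OF _ Fa(1,2) g(1,2) BC(1) r l])
  qed
  also have "\<dots> <= (4 * C + 4 * B^2) * D" using g(3) by (simp add: algebra_simps)
  finally have "l * (c * (D * d^2)) <= (4 * C + 4 * B^2) * D"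
   using mult_left_mono[OF g(4), of l] False unfolding dn by linarith
  then have "(l * d^2 * c) * D <= (4 * C + 4 * B^2) * D" by (simp add: mult_ac)
  then have "l * d^2 * c <= 4 * C + 4 * B^2" using D by (simp add: mult_le_cancel_right)
  then show ?thesis using BC by (simp add: C'_def pos_le_divide_eq)
 qed
 then show ?thesis using C' by (intro exI[of _ C']) blast
qed

subsection \<open>The lower bound\<close>

lemma generic_approximation:
 fixes u :: "real^'n => complex" and p :: "real^'n"
 assumes u: "u \<in> test_functions G" and \<epsilon>: "\<epsilon> > 0"
 obtains P where "polynomial_function P" "!!Q. generic_poly Q P"
  "!!x. x \<in> cube p d ==> cmod (P x - u x) <= \<epsilon>" "!!x j. x \<in> cube p d ==> cmod (grad P x $ j - grad u x $ j) <= \<epsilon>"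
proof -
 obtain P0 where P0: "polynomial_function P0" "smooth_on UNIV P0"
   "!!x. x \<in> cube p d ==> cmod (P0 x - u x) <= \<epsilon> / 2" "!!x j. x \<in> cube p d ==> cmod (grad P0 x $ j - grad u x $ j) <= \<epsilon> / 2"
  using C1_weierstrass[OF u, of "\<epsilon> / 2" p d] \<epsilon> by auto
 obtain R where R: "R > 0" "!!x. x \<in> cube p d ==> norm x <= R"
  using compact_imp_bounded[OF compact_cube[of p d]] by (auto simp: bounded_pos)
 \<comment> \<open>On the cube each of the two affine perturbations is at most \<delta> (R + 1), so
   together they cost \<epsilon> / 2; the other half is spent on the Weierstrass
   approximation.\<close>
 define \<delta> where "\<delta> = \<epsilon> / (4 * (R + 1))"
 have \<delta>: "\<delta> > 0" "2 * (\<delta> * (R + 1)) = \<epsilon> / 2"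
 proof -
  show "\<delta> > 0" using \<epsilon> R(1) by (simp add: \<delta>_def)
  have "2 * (\<epsilon> / (4 * s) * s) = \<epsilon> / 2" if "s > 0" for s :: real using that by simp
  then show "2 * (\<delta> * (R + 1)) = \<epsilon> / 2" using R(1) unfolding \<delta>_def by (simp only: add_pos_pos zero_less_one)
 qed
 have \<delta>2: "2 * \<delta> <= \<epsilon> / 2"
 proof -
  have "\<delta> * 1 <= \<delta> * (R + 1)" using \<delta>(1) R(1) by (intro mult_left_mono) auto
  then show ?thesis using \<delta>(2) by simp
 qed
 obtain b1 b2 :: "real^'n" and c1 c2 where b: "norm b1 < \<delta>" "norm b2 < \<delta>" "\<bar>c1\<bar> < \<delta>" "\<bar>c2\<bar> < \<delta>"
  and gen: "!!Q. generic_poly Q (%x. P0 x + Complex (b1 \<bullet> x + c1) (b2 \<bullet> x + c2))"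
  by (rule generic_perturbation[OF P0(1,2) \<delta>(1)]) blast
 let ?e = "%x. Complex (b1 \<bullet> x + c1) (b2 \<bullet> x + c2)" and ?P = "%x. P0 x + Complex (b1 \<bullet> x + c1) (b2 \<bullet> x + c2)"
 show ?thesis
 proof (rule that[of ?P])
  show "polynomial_function ?P" using gen[of "{}"] by (simp add: generic_poly_def)
  show "generic_poly Q ?P" for Q by (rule gen)
  fix x assume x: "x \<in> cube p d"
  have bx: "\<bar>b \<bullet> x + c\<bar> <= \<delta> * (R + 1)" if "norm b < \<delta>" "\<bar>c\<bar> < \<delta>" for b c
  proof -
   have "\<bar>b \<bullet> x\<bar> <= norm b * norm x" by (rule Cauchy_Schwarz_ineq2)
   also have "\<dots> <= \<delta> * R" using that(1) R(2)[OF x] \<delta>(1) by (intro mult_mono) auto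
   finally show ?thesis using that(2) abs_triangle_ineq[of "b \<bullet> x" c] by (simp add: distrib_left)
  qed
  have "cmod (?P x - u x) <= cmod (P0 x - u x) + cmod (?e x)"
   using norm_triangle_ineq[of "P0 x - u x" "?e x"] by (simp add: algebra_simps)
  also have "\<dots> <= \<epsilon> / 2 + (\<delta> * (R + 1) + \<delta> * (R + 1))"
   using cmod_le[of "?e x"] bx[OF b(1,3)] bx[OF b(2,4)] by (intro add_mono P0(3)[OF x]) simp
  also have "\<dots> = \<epsilon>" using \<delta>(2) by simp
  finally show "cmod (?P x - u x) <= \<epsilon>" .
  fix j
  have "(?e has_derivative (%h. Complex (b1 \<bullet> h) (b2 \<bullet> h))) (at x)"
   unfolding Complex_eq by (auto intro!: derivative_eq_intros)
  then have ge: "?e differentiable (at x)" "grad ?e x $ j = Complex (b1 $ j) (b2 $ j)"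
   using grad_eqI[of ?e] by (auto simp: differentiable_def inner_axis)
  have "grad ?P x $ j = grad P0 x $ j + Complex (b1 $ j) (b2 $ j)"
   by (subst grad_add[OF smooth_on_differentiable[OF open_UNIV P0(2) UNIV_I] ge(1)]) (simp add: ge(2))
  then have "cmod (grad ?P x $ j - grad u x $ j) <= cmod (grad P0 x $ j - grad u x $ j) + cmod (Complex (b1 $ j) (b2 $ j))"
   using norm_triangle_ineq[of "grad P0 x $ j - grad u x $ j" "Complex (b1 $ j) (b2 $ j)"] by (simp add: algebra_simps)
  also have "\<dots> <= \<epsilon> / 2 + (\<delta> + \<delta>)"
   using cmod_le[of "Complex (b1 $ j) (b2 $ j)"] component_le_norm_cart[of b1 j] component_le_norm_cart[of b2 j] b
   by (intro add_mono P0(4)[OF x]) simp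
  also have "\<dots> <= \<epsilon>" using \<delta>2 by simp
  finally show "cmod (grad ?P x $ j - grad u x $ j) <= \<epsilon>" .
 qed
qed

text \<open>The vector in the gauge energy is real for a unimodular \<omega>. It is the imaginary
  part of the magnetic gradient of P, turned by the conjugate phase and divided by |P|;
  \<open>s\<close> stands for a component of the vector potential.\<close>

lemma phase_gauge_le:
 fixes P :: "real^'n => complex"
 assumes P: "polynomial_function P" and x: "P x \<noteq> 0"
 shows "cmod (grad (%x. P x / complex_of_real (cmod (P x))) x $ j / (\<i> * (P x / complex_of_real (cmod (P x)))) + complex_of_real s)
   <= cmod (grad P x $ j + \<i> * complex_of_real s * P x) / cmod (P x)"
proof -
 let ?W = "{x. P x \<noteq> 0}" and ?\<omega> = "%x. P x / complex_of_real (cmod (P x))"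
 note ph = phase_smooth[OF P] and sP = polynomial_function_smooth(3)[OF P]
 have xW: "x \<in> ?W" using x by simp
 define w where "w = ?\<omega> x"
 define y where "y = grad ?\<omega> x $ j"
 have w1: "cmod w = 1" using x by (simp add: w_def norm_divide)
 have ww: "w * cnj w = 1" using w1 by (simp add: complex_norm_square[symmetric])
 have w0: "w \<noteq> 0" using w1 by auto
 have d: "?\<omega> differentiable (at x)" by (rule smooth_on_differentiable[OF ph(1,2) xW])
 \<comment> \<open>Differentiating |\<omega>|^2 = 1 shows that grad \<omega> times the conjugate of
   \<omega> is purely imaginary.\<close>
 have "grad (%x. ?\<omega> x * cnj (?\<omega> x)) x $ j = ?\<omega> x * grad (%x. cnj (?\<omega> x)) x $ j + grad ?\<omega> x $ j * cnj (?\<omega> x)"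
  by (rule grad_bilinear[OF bounded_bilinear_mult d]) (rule differentiable_compose[OF bounded_linear_imp_differentiable[OF bounded_linear_cnj] d])
 also have "grad (%x. cnj (?\<omega> x)) x $ j = cnj (grad ?\<omega> x $ j)" by (rule grad_linear_compose[OF bounded_linear_cnj d])
 also have "grad (%x. ?\<omega> x * cnj (?\<omega> x)) x = grad (%x. 1) x"
 proof (rule grad_cong_open[OF ph(1) xW])
  fix z assume "z \<in> ?W"
  then have "cmod (?\<omega> z) = 1" by (simp add: norm_divide)
  then show "?\<omega> z * cnj (?\<omega> z) = 1" by (simp only: complex_norm_square[symmetric] of_real_1 power_one)
 qed
 finally have "w * cnj y + y * cnj w = 0" by (simp add: w_def y_def grad_const)
 from arg_cong[OF this, of Re] have re0: "Re (y * cnj w) = 0" by (simp add: algebra_simps)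
 have "(- \<i> * y * cnj w) * (\<i> * w) = y * (w * cnj w)" by (simp add: mult_ac)
 then have yw: "y / (\<i> * w) = - \<i> * y * cnj w" using w0 unfolding ww by (simp add: divide_eq_eq)
 have im0: "Im (y / (\<i> * w)) = 0" unfolding yw using re0 by simp
 have dP: "P differentiable (at x)" by (rule smooth_on_differentiable[OF open_UNIV sP UNIV_I])
 have rr: "Re (y / (\<i> * w)) = Im (grad P x $ j * cnj w) / cmod (P x)"
  unfolding y_def w_def ph(3)[OF x] grad_Re[OF dP] grad_Im[OF dP] by (simp add: algebra_simps diff_divide_distrib)
 have n: "cmod (P x) > 0" using x by simp
 have Pw: "P x * cnj w = complex_of_real (cmod (P x))"
 proof -
  have "P x = complex_of_real (cmod (P x)) * w" using x by (simp add: w_def)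
  then have "P x * cnj w = complex_of_real (cmod (P x)) * (w * cnj w)" by (metis mult.assoc)
  then show ?thesis unfolding ww by simp
 qed
 have "y / (\<i> * w) + complex_of_real s = complex_of_real (Im (grad P x $ j * cnj w) / cmod (P x) + s)"
  using im0 rr by (simp add: complex_eq_iff)
 also have "Im (grad P x $ j * cnj w) / cmod (P x) + s = Im ((grad P x $ j + \<i> * complex_of_real s * P x) * cnj w) / cmod (P x)"
 proof -
  have "(grad P x $ j + \<i> * complex_of_real s * P x) * cnj w = grad P x $ j * cnj w + \<i> * complex_of_real s * (P x * cnj w)" by (simp add: algebra_simps)
  then have "Im ((grad P x $ j + \<i> * complex_of_real s * P x) * cnj w) = Im (grad P x $ j * cnj w) + s * cmod (P x)" unfolding Pw by simp
  then show ?thesis using n by (simp add: add_divide_distrib)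
 qed
 finally have "cmod (y / (\<i> * w) + complex_of_real s) = \<bar>Im ((grad P x $ j + \<i> * complex_of_real s * P x) * cnj w)\<bar> / cmod (P x)"
  using n by (simp only: norm_of_real abs_divide abs_norm_cancel)
 also have "\<dots> <= cmod ((grad P x $ j + \<i> * complex_of_real s * P x) * cnj w) / cmod (P x)"
  by (rule divide_right_mono[OF abs_Im_le_cmod]) simp
 also have "\<dots> = cmod (grad P x $ j + \<i> * complex_of_real s * P x) / cmod (P x)" using w1 by (simp add: norm_mult)
 finally show ?thesis unfolding y_def w_def .
qed

text \<open>The diamagnetic inequality for a smooth substitute of |u|, which has no gradient at
  zeros of u. The derivative of w^2 involves the real part of conj(u) times the magnetic gradient,
  in which the vector potential cancels; so the bound holds for every \<open>a\<close>.\<close>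

lemma regularized_modulus:
 fixes u :: "real^'n => complex"
 assumes u: "smooth_on UNIV u" and \<epsilon>: "\<epsilon> > 0"
 defines "w \<equiv> %x. sqrt ((cmod (u x))^2 + \<epsilon>^2)"
 shows "smooth_on UNIV w" "w x > 0" "(w x)^2 = (cmod (u x))^2 + \<epsilon>^2" "norm (grad w x) <= norm (mag_grad a u x)"
proof -
 have pos: "(cmod (u x))^2 + \<epsilon>^2 > 0" for x using \<epsilon> by (simp add: add_nonneg_pos)
 note re = smooth_on_Re[OF open_UNIV u] and im = smooth_on_Im[OF open_UNIV u]
 show w0: "w x > 0" for x using pos by (simp add: w_def)
 show w2: "(w x)^2 = (cmod (u x))^2 + \<epsilon>^2" for x using pos[of x] by (simp add: w_def)
 have eq: "(cmod (u x))^2 + \<epsilon>^2 = (Re (u x))^2 + (Im (u x))^2 + \<epsilon>^2" for x by (simp add: cmod_power2)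
 show sw: "smooth_on UNIV w"
 proof (rule smooth_on_cong[OF open_UNIV])
  show "smooth_on UNIV (%x. ((Re (u x))^2 + (Im (u x))^2 + \<epsilon>^2) powr (1/2))"
  proof (rule smooth_on_powr[OF open_UNIV])
   show "(Re (u x))^2 + (Im (u x))^2 + \<epsilon>^2 > 0" for x using pos[of x] unfolding eq .
   show "smooth_on UNIV (%x. (Re (u x))^2 + (Im (u x))^2 + \<epsilon>^2)"
    by (intro smooth_on_add smooth_on_power smooth_on_const open_UNIV re im)
  qed
  show "((Re (u x))^2 + (Im (u x))^2 + \<epsilon>^2) powr (1/2) = w x" for x
   using pos[of x] unfolding eq by (simp add: w_def eq powr_half_sqrt)
 qed
 have du: "u differentiable (at x)" by (rule smooth_on_differentiable[OF open_UNIV u UNIV_I])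
 have d: "w differentiable (at x)" "(%x. Re (u x)) differentiable (at x)" "(%x. Im (u x)) differentiable (at x)"
  using smooth_on_differentiable[OF open_UNIV sw] smooth_on_differentiable[OF open_UNIV re] smooth_on_differentiable[OF open_UNIV im] by auto
 have wj: "\<bar>grad w x $ j\<bar> <= cmod (mag_grad a u x $ j)" for j
 proof -
  have "grad (%x. w x * w x) x = grad (%x. (Re (u x) * Re (u x) + Im (u x) * Im (u x)) + \<epsilon>^2) x"
   using w2 by (simp add: power2_eq_square[symmetric] cmod_power2)
  also have "\<dots> = grad (%x. Re (u x) * Re (u x)) x + grad (%x. Im (u x) * Im (u x)) x"
   using d by (simp add: grad_add grad_const)
  finally have "2 * (w x * grad w x $ j) = 2 * (Re (u x) * Re (grad u x $ j) + Im (u x) * Im (grad u x $ j))"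
   using grad_bilinear[OF bounded_bilinear_mult d(1,1), of j] grad_bilinear[OF bounded_bilinear_mult d(2,2), of j] grad_bilinear[OF bounded_bilinear_mult d(3,3), of j]
   by (simp add: grad_Re[OF du] grad_Im[OF du] vec_eq_iff algebra_simps)
  then have "w x * grad w x $ j = Re (cnj (u x) * mag_grad a u x $ j)"
   by (simp add: mag_grad_def algebra_simps)
  then have "w x * \<bar>grad w x $ j\<bar> = \<bar>Re (cnj (u x) * mag_grad a u x $ j)\<bar>" using w0[of x] by (metis abs_mult abs_of_pos)
  also have "\<dots> <= cmod (u x) * cmod (mag_grad a u x $ j)"
   by (rule order_trans[OF abs_Re_le_cmod]) (simp add: norm_mult)
  also have "\<dots> <= w x * cmod (mag_grad a u x $ j)"
  proof (rule mult_right_mono)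
   show "cmod (u x) <= w x" unfolding w_def by (rule real_le_rsqrt) simp
  qed simp
  finally show ?thesis using w0[of x] by simp
 qed
 show "norm (grad w x) <= norm (mag_grad a u x)"
  by (rule norm_le_componentwise_cart) (use wj in simp)
qed

text \<open>The competitor is a cutoff of the cube times a step of w. Where the step is not 0, w is
  below m / 2 and hence (w - m)^2 is at least m^2 / 4; this bounds the term with the gradient of the
  cutoff. The doubled cube enters because the cutoff reaches beyond the cube.\<close>

lemma sublevel_capacity_le:
 fixes w :: "real^'n => real" and p :: "real^'n"
 assumes w: "smooth_on UNIV w" and m: "m > 0" and d: "d > 0" and X: "X >= 0" and Y: "Y >= 0"
  and iX: "(\<integral>\<^sup>+x. ennreal ((w x - m)^2) * indicator (cube p (2 * d)) x \<partial>lborel) <= ennreal X"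
  and iY: "(\<integral>\<^sup>+x. ennreal ((norm (grad w x))^2) * indicator (cube p (2 * d)) x \<partial>lborel) <= ennreal Y"
 shows "wiener_cap p d {x \<in> cube p d. w x <= m / 4} <= ennreal (8 * (20 * real CARD('n) * step_slope / (3 * d))^2 / m^2 * X + 72 * step_slope^2 / m^2 * Y)"
proof -
 let ?n = "real CARD('n)" and ?Q2 = "cube p (2 * d)" and ?a = "3 * d / 5" and ?b = "9 * d / 10"
 define \<zeta> where "\<zeta> = cutoff p ?a ?b"
 have ab: "0 < ?a" "?a < ?b" using d by auto
 define G where "G = 20 * ?n * step_slope / (3 * d)"
 have g\<zeta>: "norm (grad \<zeta> x) <= G" for x
  using norm_grad_cutoff[OF ab, of p x] d by (simp add: \<zeta>_def G_def field_simps)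
 have s\<zeta>: "smooth_on UNIV \<zeta>" unfolding \<zeta>_def by (rule smooth_on_cutoff[OF ab])
 have \<zeta>r: "0 <= \<zeta> x" "\<zeta> x <= 1" for x unfolding \<zeta>_def by (rule cutoff_range[OF ab])+
 \<comment> \<open>The step is 1 for w <= m / 3 and 0 for w >= m / 2. The first level lies above m /
   4, so the competitor is 1 on a neighbourhood of the sublevel set.\<close>
 define h where "h x = smooth_step (3 - 6 / m * w x)" for x
 have sh: "smooth_on UNIV h" unfolding h_def[abs_def]
  by (intro smooth_on_step smooth_on_diff smooth_on_mult smooth_on_const open_UNIV w)
 define \<psi> where "\<psi> x = \<zeta> x * h x" for x
 have s\<psi>: "smooth_on UNIV \<psi>" unfolding \<psi>_def[abs_def] by (rule smooth_on_mult[OF open_UNIV s\<zeta> sh])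
 have \<zeta>0: "\<zeta> x = 0" if "x \<notin> cube p (2 * ?b)" for x using cutoff_eq_0_cube[OF ab that] by (simp add: \<zeta>_def)
 have "\<psi> \<in> test_functions (interior ?Q2)"
  by (rule test_functionsI[OF s\<psi> compact_cube[of p "2 * ?b"] cube_subset_interior]) (use d in \<open>auto simp: \<psi>_def \<zeta>0\<close>)
 then have \<psi>t: "\<psi> \<in> test_functions (cap_dom p d)" using test_functions_mono[OF cap_dom_subset] by blast
 define N where "N = interior (cube p (2 * ?a)) \<inter> {x. w x < m / 3}"
 have oN: "open N" unfolding N_def by (intro open_Int open_interior open_Collect_less smooth_on_continuous[OF w] continuous_on_const)
 have FN: "{x \<in> cube p d. w x <= m / 4} \<subseteq> N"
 proof -
  have "cube p d \<subseteq> interior (cube p (2 * ?a))" by (rule cube_subset_interior) (use d in simp)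
  then show ?thesis using m by (auto simp: N_def)
 qed
 have N1: "\<psi> x = 1" if "x \<in> N" for x
 proof -
  have "\<bar>x $ i - p $ i\<bar> <= ?a" for i using that unfolding N_def mem_interior_cube[of x p "2 * ?a"] Int_iff by (auto intro: less_imp_le)
  then have "\<zeta> x = 1" unfolding \<zeta>_def by (rule cutoff_eq_1[OF ab])
  moreover have "h x = 1"
  proof -
   have "w x < m / 3" using that by (simp add: N_def)
   then have "1 <= 3 - 6 / m * w x" using m by (simp add: field_simps)
   then show ?thesis unfolding h_def by (rule smooth_step_1)
  qed
  ultimately show ?thesis by (simp add: \<psi>_def)
 qed
 have pw: "(norm (grad \<psi> x))^2 <= (8 * G^2 / m^2) * (w x - m)^2 + (72 * step_slope^2 / m^2) * (norm (grad w x))^2" for x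
 proof -
  have dw: "w differentiable (at x)" "\<zeta> differentiable (at x)" "h differentiable (at x)"
   using smooth_on_differentiable[OF open_UNIV w] smooth_on_differentiable[OF open_UNIV s\<zeta>] smooth_on_differentiable[OF open_UNIV sh] by auto
  let ?s = "deriv smooth_step (3 - 6 / m * w x)"
  have der: "((%t. smooth_step (3 - 6 / m * t)) has_real_derivative ?s * (- (6 / m))) (at (w x))"
  proof (rule DERIV_chain2[OF smooth_step_deriv(1)])
   have "((%t. 3 - q * t) has_real_derivative - q) (at s)" for q s :: real by (auto intro!: derivative_eq_intros)
   then show "((%t. 3 - 6 / m * t) has_real_derivative - (6 / m)) (at (w x))" .
  qed
  have gh: "grad h x = (?s * (- (6 / m))) *\<^sub>R grad w x"
   unfolding h_def[abs_def] vec_eq_iff by (simp only: grad_real_compose[OF dw(1) der] vector_scaleR_component real_scaleR_def simp_thms)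
  have "norm (grad h x) = \<bar>?s\<bar> * (6 / m) * norm (grad w x)" unfolding gh using m by (simp add: abs_mult)
  also have "\<dots> <= step_slope * (6 / m) * norm (grad w x)"
   using smooth_step_deriv(2)[of "3 - 6 / m * w x"] m by (intro mult_right_mono) auto
  finally have ghn: "(norm (grad h x))^2 <= (step_slope * (6 / m) * norm (grad w x))^2" by (rule power_mono) simp
  have h2: "(h x)^2 <= 4 / m^2 * (w x - m)^2"
  proof (cases "w x >= m / 2")
   case True
   then have "3 - 6 / m * w x <= 0" using m by (simp add: field_simps)
   then show ?thesis by (simp add: h_def smooth_step_0)
  next
   case False
   then have "(m / 2)^2 <= (m - w x)^2" using m by (intro power_mono) auto
   then have "1 <= 4 / m^2 * (w x - m)^2" using m by (simp add: power2_commute[of m] field_simps power_divide)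
   moreover have "(h x)^2 <= 1" by (simp add: h_def smooth_step_range power_le_one)
   ultimately show ?thesis by linarith
  qed
  have "grad \<psi> x = h x *\<^sub>R grad \<zeta> x + \<zeta> x *\<^sub>R grad h x"
   unfolding \<psi>_def[abs_def] by (simp add: vec_eq_iff grad_bilinear[OF bounded_bilinear_mult dw(2,3)] mult.commute)
  then have gr: "grad \<psi> x = h x *\<^sub>R grad \<zeta> x + \<zeta> x *\<^sub>R grad h x" .
  have "(norm (grad \<psi> x))^2 <= (1 + 1) * (norm (h x *\<^sub>R grad \<zeta> x))^2 + (1 + 1 / 1) * (norm (\<zeta> x *\<^sub>R grad h x))^2"
   unfolding gr by (rule norm_add_square_le) simp
  also have "\<dots> = 2 * ((h x)^2 * (norm (grad \<zeta> x))^2) + 2 * ((\<zeta> x)^2 * (norm (grad h x))^2)"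
   by (simp add: power_mult_distrib)
  also have "\<dots> <= 2 * ((4 / m^2 * (w x - m)^2) * G^2) + 2 * (1 * (step_slope * (6 / m) * norm (grad w x))^2)"
   using \<zeta>r[of x] by (intro add_mono mult_left_mono mult_mono h2 ghn power_mono g\<zeta>) (auto simp: power_le_one)
  also have "\<dots> = (8 * G^2 / m^2) * (w x - m)^2 + (72 * step_slope^2 / m^2) * (norm (grad w x))^2"
   by (simp add: power_mult_distrib power_divide mult_ac)
  finally show ?thesis .
 qed
 have off: "grad \<psi> x = 0" if "x \<notin> ?Q2" for x
 proof -
  have o: "open (- cube p (2 * ?b))" by (simp add: compact_cube compact_imp_closed open_Compl)
  have "cube p (2 * ?b) \<subseteq> ?Q2" by (rule subset_trans[OF cube_subset_interior interior_subset]) (use d in simp)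
  then have "x \<in> - cube p (2 * ?b)" using that by blast
  then have "grad \<psi> x = grad (%x. 0) x" by (intro grad_cong_open[OF o]) (auto simp: \<psi>_def \<zeta>0)
  then show ?thesis by (simp add: grad_const)
 qed
 let ?k1 = "8 * G^2 / m^2" and ?k2 = "72 * step_slope^2 / m^2"
 have k: "?k1 >= 0" "?k2 >= 0" by auto
 have wb [measurable]: "w \<in> borel_measurable borel" "grad w \<in> borel_measurable borel" using smooth_borel[OF w] smooth_grad_borel[OF w] .
 have "ennreal (dirichlet \<psi>) = (\<integral>\<^sup>+x. ennreal ((norm (grad \<psi> x))^2) \<partial>lborel)" by (rule dirichlet_eq[OF \<psi>t, symmetric])
 also have "\<dots> <= (\<integral>\<^sup>+x. ennreal ?k1 * (ennreal ((w x - m)^2) * indicator ?Q2 x) + ennreal ?k2 * (ennreal ((norm (grad w x))^2) * indicator ?Q2 x) \<partial>lborel)"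
 proof (rule nn_integral_mono)
  fix x
  show "ennreal ((norm (grad \<psi> x))^2) <= ennreal ?k1 * (ennreal ((w x - m)^2) * indicator ?Q2 x) + ennreal ?k2 * (ennreal ((norm (grad w x))^2) * indicator ?Q2 x)"
  proof (cases "x \<in> ?Q2")
   case True
   have "ennreal ((norm (grad \<psi> x))^2) <= ennreal (?k1 * (w x - m)^2 + ?k2 * (norm (grad w x))^2)" by (rule ennreal_leI[OF pw])
   also have "\<dots> = ennreal ?k1 * ennreal ((w x - m)^2) + ennreal ?k2 * ennreal ((norm (grad w x))^2)"
    by (subst ennreal_plus) (auto simp: ennreal_mult[symmetric])
   finally show ?thesis using True by simp
  qed (simp add: off)
 qed
 also have "\<dots> = ennreal ?k1 * (\<integral>\<^sup>+x. ennreal ((w x - m)^2) * indicator ?Q2 x \<partial>lborel) + ennreal ?k2 * (\<integral>\<^sup>+x. ennreal ((norm (grad w x))^2) * indicator ?Q2 x \<partial>lborel)"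
  by (simp add: nn_integral_add nn_integral_cmult)
 also have "\<dots> <= ennreal ?k1 * ennreal X + ennreal ?k2 * ennreal Y" by (intro add_mono mult_left_mono iX iY) auto
 also have "\<dots> = ennreal (?k1 * X + ?k2 * Y)" using X Y k by (subst ennreal_plus) (auto simp: ennreal_mult[symmetric])
 finally have D: "ennreal (dirichlet \<psi>) <= ennreal (?k1 * X + ?k2 * Y)" .
 show ?thesis using order_trans[OF wiener_cap_le[OF \<psi>t oN FN N1] D] unfolding G_def .
qed

context magnetic
begin

text \<open>If the opposite inequality held at every position, integrating over all positions would
  give the inequality for the whole function; the factor 2^n is the ratio of the volumes of the two
  cubes.\<close>

lemma localized_energy:
 assumes u: "u \<in> T" and less: "mag_energy \<Omega> a V u < \<mu> * (sq.nrm M u)^2" and d: "d > 0" and \<mu>: "\<mu> > 0"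
 obtains p f where "f \<in> borel_measurable borel"
  "AE x in lebesgue. f x = ennreal ((norm (mag_grad a u x))^2 + V x * (cmod (u x))^2) * indicator \<Omega> x"
  "(\<integral>\<^sup>+x. f x * indicator (cube p (2 * d)) x \<partial>lborel) < (\<integral>\<^sup>+x. ennreal (2 ^ CARD('n) * \<mu> * (cmod (u x))^2) * indicator (cube p d) x \<partial>lborel)"
proof -
 let ?e = "%x. (norm (mag_grad a u x))^2 + V x * (cmod (u x))^2" and ?E = "mag_energy \<Omega> a V u"
 have sm: "smooth_on UNIV u" by (rule test_functions_smooth[OF u])
 have ub [measurable]: "u \<in> borel_measurable borel" by (rule smooth_borel[OF sm])
 have "(%x. indicator \<Omega> x *\<^sub>R ?e x) \<in> borel_measurable lebesgue"
  using mag_energy_integrable[OF u] unfolding integrable_M set_integrable_def by (rule borel_measurable_integrable)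
 then have "(%x. ennreal (indicator \<Omega> x *\<^sub>R ?e x)) \<in> borel_measurable lebesgue" by measurable
 then have "(%x. ennreal (?e x) * indicator \<Omega> x) \<in> borel_measurable lebesgue"
  by (rule measurable_cong[THEN iffD1, rotated]) (auto simp: indicator_def)
 \<comment> \<open>The averaging over positions uses Tonelli for Borel functions, so the energy
   density is replaced by a Borel version.\<close>
 from completion_ex_borel_measurable[OF this] obtain f where f: "f \<in> borel_measurable lborel" "AE x in lborel. ennreal (?e x) * indicator \<Omega> x = f x"
  by blast
 have fb [measurable]: "f \<in> borel_measurable borel" using f(1) by simp
 have fAE: "AE x in lebesgue. f x = ennreal (?e x) * indicator \<Omega> x"
  using AE_completion[OF f(2)] by eventually_elim simp
 have "(\<integral>\<^sup>+x. f x \<partial>lborel) = (\<integral>\<^sup>+x. f x \<partial>lebesgue)" by (simp only: nn_integral_completion)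
 also have "\<dots> = (\<integral>\<^sup>+x. ennreal (?e x) * indicator \<Omega> x \<partial>lebesgue)" by (rule nn_integral_cong_AE[OF fAE])
 also have "\<dots> = ennreal ?E" by (rule mag_energy_nn[OF u, symmetric])
 finally have fE: "(\<integral>\<^sup>+x. f x \<partial>lborel) = ennreal ?E" .
 let ?g = "%x. ennreal (2 ^ CARD('n) * \<mu> * (cmod (u x))^2)"
 have gb: "?g \<in> borel_measurable borel" by measurable
 have N: "(sq.nrm M u)^2 = (\<integral>x. (cmod (u x))^2 \<partial>lborel)"
  using test_norm_integral[OF u] by (simp add: sq.nrm_square[OF T_sq[OF u]] cip_self integral_M)
 have "integrable lborel (%x. 2 ^ CARD('n) * \<mu> * (cmod (u x))^2)"
 proof -
  obtain K where K: "compact K" "!!x. x \<notin> K ==> u x = 0" using test_functionsD[OF u] by metis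
  show ?thesis
   by (rule integrable_compact_support(1)[OF _ K(1)]) (intro continuous_intros smooth_on_continuous[OF sm], simp add: K(2))
 qed
 then have gI: "(\<integral>\<^sup>+x. ?g x \<partial>lborel) = ennreal (2 ^ CARD('n) * \<mu> * (sq.nrm M u)^2)"
  using \<mu> by (subst nn_integral_eq_integral) (auto simp: N)
 have "\<exists>p. (\<integral>\<^sup>+x. f x * indicator (cube p (2 * d)) x \<partial>lborel) < (\<integral>\<^sup>+x. ?g x * indicator (cube p d) x \<partial>lborel)"
 proof (rule ccontr)
  assume "\<not> ?thesis"
  then have le: "(\<integral>\<^sup>+x. ?g x * indicator (cube p d) x \<partial>lborel) <= (\<integral>\<^sup>+x. f x * indicator (cube p (2 * d)) x \<partial>lborel)" for p
   by (simp add: not_less)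
  have "ennreal (d ^ CARD('n)) * (\<integral>\<^sup>+x. ?g x \<partial>lborel) = (\<integral>\<^sup>+p. (\<integral>\<^sup>+x. ?g x * indicator (cube p d) x \<partial>lborel) \<partial>(lborel :: (real^'n) measure))"
   by (rule cube_average[OF gb, symmetric]) (use d in simp)
  also have "\<dots> <= (\<integral>\<^sup>+p. (\<integral>\<^sup>+x. f x * indicator (cube p (2 * d)) x \<partial>lborel) \<partial>(lborel :: (real^'n) measure))"
   by (rule nn_integral_mono[OF le])
  also have "\<dots> = ennreal ((2 * d) ^ CARD('n)) * (\<integral>\<^sup>+x. f x \<partial>lborel)"
   by (rule cube_average[OF fb]) (use d in simp)
  finally have "ennreal (d ^ CARD('n)) * ennreal (2 ^ CARD('n) * \<mu> * (sq.nrm M u)^2) <= ennreal ((2 * d) ^ CARD('n)) * ennreal ?E"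
   unfolding fE gI .
  then have "ennreal (d ^ CARD('n) * (2 ^ CARD('n) * \<mu> * (sq.nrm M u)^2)) <= ennreal ((2 * d) ^ CARD('n) * ?E)"
   using d \<mu> by (simp add: ennreal_mult[symmetric] energy_nrm[OF u])
  then have "d ^ CARD('n) * (2 ^ CARD('n) * \<mu> * (sq.nrm M u)^2) <= (2 * d) ^ CARD('n) * ?E"
   using d by (subst (asm) ennreal_le_iff) (auto simp: energy_nrm[OF u])
  then have "((2 * d) ^ CARD('n)) * (\<mu> * (sq.nrm M u)^2) <= (2 * d) ^ CARD('n) * ?E" by (simp add: power_mult_distrib mult_ac)
  then have "\<mu> * (sq.nrm M u)^2 <= ?E" by (rule mult_left_le_imp_le) (use d in simp)
  then show False using less by simp
 qed
 then show ?thesis using that fb fAE by blast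
qed

text \<open>The three conditions on \<open>c0\<close> serve in turn: the oscillation of the modulus
  is small against its mass, the sublevel set has small enough capacity, and the energy part of the
  gauge energy is at most half of the allowed amount. The same pair is shown to satisfy both
  options.\<close>

lemma good_cube:
 fixes \<gamma> c0 d :: real
 defines "N \<equiv> real CARD('n)" and "K \<equiv> 2 ^ CARD('n) :: real"
 assumes n: "CARD('n) >= 2" and \<gamma>: "\<gamma> > 0" and c0: "c0 > 0" "16 * N * K^2 * c0 <= 1"
   "c0 * (32 * (20 * N * step_slope / 3)^2 * (4 * N * K^2) + 288 * step_slope^2 * K) <= \<gamma> / (8 * N)" "1024 * K * c0 <= 1"
  and \<mu>: "\<not> bounded_below \<mu>" and d: "d > 0" "\<mu> = c0 / d^2"
 shows "\<exists>p F \<omega>. F \<in> admissible_sets \<Omega> \<gamma> p d \<and> smooth_pairs (cube p d) F \<omega> \<and> polynomial_pairs (cube p d) F \<omega> \<and>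
   gauge_energy a V (cube p d - F) \<omega> <= ennreal (d ^ (CARD('n) - 2))"
proof -
 have N: "N >= 2" using n by (simp add: N_def)
 have K: "K > 0" by (simp add: K_def)
 have \<mu>0: "\<mu> > 0" using c0 d by simp
 obtain u where u: "u \<in> T" "mag_energy \<Omega> a V u < \<mu> * (sq.nrm M u)^2"
  using \<mu> by (auto simp: bounded_below_def energy_nrm not_le)
 let ?e = "%x. (norm (mag_grad a u x))^2 + V x * (cmod (u x))^2"
 obtain p f where fb [measurable]: "f \<in> borel_measurable borel" and f: "AE x in lebesgue. f x = ennreal (?e x) * indicator \<Omega> x"
  and avg: "(\<integral>\<^sup>+x. f x * indicator (cube p (2 * d)) x \<partial>lborel) < (\<integral>\<^sup>+x. ennreal (2 ^ CARD('n) * \<mu> * (cmod (u x))^2) * indicator (cube p d) x \<partial>lborel)"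
  by (rule localized_energy[OF u d(1) \<mu>0]) blast
 obtain L where L: "smooth_on UNIV u" "compact L" "L \<subseteq> \<Omega>" "!!x. x \<notin> L ==> u x = 0" "!!x. x \<notin> L ==> grad u x = 0" using test_functionsD[OF u(1)] by metis
 let ?Q = "cube p d" and ?Q2 = "cube p (2 * d)"
 have QQ: "?Q \<subseteq> ?Q2" by (rule subset_trans[OF cube_subset_interior interior_subset]) (use d in simp)
 define D where "D = d ^ (CARD('n) - 2)"
 have D: "D > 0" using d by (simp add: D_def)
 have dn: "d ^ CARD('n) = D * d^2" unfolding D_def using n by (metis power_add le_add_diff_inverse2)
 have ub [measurable]: "u \<in> borel_measurable borel" by (rule smooth_borel[OF L(1)])
 define m0 where "m0 = (\<integral>x. indicator ?Q x *\<^sub>R (cmod (u x))^2 \<partial>lborel)"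
 have m0i: "integrable lborel (%x. indicator ?Q x *\<^sub>R (cmod (u x))^2)"
  by (intro borel_integrable_compact compact_cube continuous_intros continuous_on_subset[OF smooth_on_continuous[OF L(1)]]) auto
 have m0n: "(\<integral>\<^sup>+x. ennreal ((cmod (u x))^2) * indicator ?Q x \<partial>lborel) = ennreal m0"
 proof -
  have "(\<integral>\<^sup>+x. ennreal ((cmod (u x))^2) * indicator ?Q x \<partial>lborel) = (\<integral>\<^sup>+x. ennreal (indicator ?Q x *\<^sub>R (cmod (u x))^2) \<partial>lborel)"
   by (rule nn_integral_cong) (simp add: indicator_def)
  then show ?thesis unfolding m0_def by (simp only: nn_integral_eq_integral[OF m0i] scaleR_nonneg_nonneg indicator_pos_le zero_le_power2 AE_I2)
 qed
 have m00: "m0 >= 0" unfolding m0_def by (rule Bochner_Integration.integral_nonneg) simp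
 define Y where "Y = K * \<mu> * m0"
 have "(\<integral>\<^sup>+x. ennreal (2 ^ CARD('n) * \<mu> * (cmod (u x))^2) * indicator ?Q x \<partial>lborel) = ennreal (K * \<mu>) * (\<integral>\<^sup>+x. ennreal ((cmod (u x))^2) * indicator ?Q x \<partial>lborel)"
  unfolding K_def[symmetric] using K \<mu>0
  by (subst nn_integral_cmult[symmetric]) (auto simp: ennreal_mult mult.assoc)
 also have "\<dots> = ennreal Y" unfolding m0n Y_def using K \<mu>0 m00 by (simp add: ennreal_mult)
 finally have fY: "(\<integral>\<^sup>+x. f x * indicator ?Q2 x \<partial>lborel) < ennreal Y" using avg by simp
 \<comment> \<open>Strictness in the choice of the cube forces u to have mass on it.\<close>
 then have Y: "Y > 0" by (metis ennreal_less_zero_iff ennreal_neg not_le not_less_zero)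
 then have m0: "m0 > 0" using K \<mu>0 m00 by (metis Y_def less_eq_real_def mult_zero_right less_irrefl)
 \<comment> \<open>Fixed in terms of the mass, as m is not yet known; once the mass is bounded by 4
   m^2 d^n, the number 256 yields \<epsilon> <= m / 8.\<close>
 define \<epsilon> where "\<epsilon> = sqrt (m0 / (256 * d ^ CARD('n)))"
 have \<epsilon>: "\<epsilon> > 0" "\<epsilon>^2 = m0 / (256 * d ^ CARD('n))" using m0 d by (simp_all add: \<epsilon>_def)
 define w where "w x = sqrt ((cmod (u x))^2 + \<epsilon>^2)" for x
 note rm = regularized_modulus[OF L(1) \<epsilon>(1), folded w_def]
 have sw: "smooth_on UNIV w" using rm(1) by (simp add: w_def[abs_def])
 have w0: "w x > 0" and w2: "(w x)^2 = (cmod (u x))^2 + \<epsilon>^2" for x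
  using regularized_modulus(2,3)[OF L(1) \<epsilon>(1), of x] by (simp_all add: w_def)
 have gw: "norm (grad w x) <= norm (mag_grad b u x)" for x b
  using regularized_modulus(4)[OF L(1) \<epsilon>(1), of x b] by (simp add: w_def[abs_def])
 have wb [measurable]: "w \<in> borel_measurable borel" "grad w \<in> borel_measurable borel" using smooth_borel[OF sw] smooth_grad_borel[OF sw] .
 have iY: "(\<integral>\<^sup>+x. ennreal ((norm (grad w x))^2) * indicator ?Q2 x \<partial>lborel) <= ennreal Y"
 proof -
  have "AE x in lebesgue. ennreal ((norm (grad w x))^2) * indicator ?Q2 x <= f x * indicator ?Q2 x"
   using f V_nonneg
  proof eventually_elim
   case (elim x)
   show ?case
   proof (cases "x \<in> \<Omega>")
    case True
    then have V: "0 <= V x" using elim by simp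
    have "(norm (grad w x))^2 <= (norm (mag_grad a u x))^2" by (rule power_mono[OF gw]) simp
    also have "\<dots> <= ?e x" using V by simp
    finally have "ennreal ((norm (grad w x))^2) <= f x" using elim(1) True by (simp add: ennreal_leI)
    then show ?thesis by (rule mult_right_mono) simp
   next
    case False
    \<comment> \<open>Off the domain the density \<open>f\<close> gives no control, but u and its
      gradient vanish there; the diamagnetic inequality with zero vector potential shows that w is
      stationary.\<close>
    then have "mag_grad (%x. 0) u x = 0" using L(3,4,5) by (auto simp: mag_grad_def vec_eq_iff subset_iff)
    then have "grad w x = 0" using gw[of x "%x. 0"] by simp
    then show ?thesis by simp
   qed
  qed
  then have "AE x in lborel. ennreal ((norm (grad w x))^2) * indicator ?Q2 x <= f x * indicator ?Q2 x"
   by (simp only: AE_completion_iff)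
  then have "(\<integral>\<^sup>+x. ennreal ((norm (grad w x))^2) * indicator ?Q2 x \<partial>lborel) <= (\<integral>\<^sup>+x. f x * indicator ?Q2 x \<partial>lborel)"
   by (rule nn_integral_mono_AE)
  also note less_imp_le[OF fY]
  finally show ?thesis .
 qed
 obtain y where y: "(\<integral>\<^sup>+x. ennreal ((w x - w y)^2) * indicator ?Q2 x \<partial>lborel)
   <= ennreal (real CARD('n) * (2 * d)^2 * 2 ^ CARD('n)) * (\<integral>\<^sup>+x. ennreal ((norm (grad w x))^2) * indicator ?Q2 x \<partial>lborel)"
  using cube_poincare[OF sw, of "2 * d" p] d by auto
 define m where "m = w y"
 have m: "m > 0" unfolding m_def by (rule w0)
 define X where "X = N * (2 * d)^2 * K * Y"
 have X0: "X >= 0" using N K Y by (simp add: X_def)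
 have iX: "(\<integral>\<^sup>+x. ennreal ((w x - m)^2) * indicator ?Q2 x \<partial>lborel) <= ennreal X"
 proof -
  have "ennreal (real CARD('n) * (2 * d)^2 * 2 ^ CARD('n)) * (\<integral>\<^sup>+x. ennreal ((norm (grad w x))^2) * indicator ?Q2 x \<partial>lborel)
    <= ennreal (N * (2 * d)^2 * K) * ennreal Y" unfolding N_def K_def by (rule mult_left_mono[OF iY]) simp
  also have "\<dots> = ennreal X" unfolding X_def using Y N K by (simp add: ennreal_mult)
  finally show ?thesis using y unfolding m_def by (rule order_trans[rotated])
 qed
 have Yd: "Y * d^2 = K * c0 * m0" using d by (simp add: Y_def)
 have Xm: "X = 4 * N * K^2 * c0 * m0"
 proof -
  have "X = 4 * N * K * (Y * d^2)" by (simp add: X_def power_mult_distrib)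
  then show ?thesis unfolding Yd by (simp add: power2_eq_square)
 qed
 \<comment> \<open>The mass of u on the cube is at most twice the oscillation \<open>X\<close> plus
   twice that of the constant m, and \<open>X\<close> takes at most a quarter of the mass.\<close>
 have m0m: "m0 <= 4 * m^2 * d ^ CARD('n)"
 proof -
  have "ennreal m0 <= (\<integral>\<^sup>+x. ennreal 2 * (ennreal ((w x - m)^2) * indicator ?Q2 x) + ennreal (2 * m^2) * indicator ?Q x \<partial>lborel)"
   unfolding m0n[symmetric]
  proof (rule nn_integral_mono)
   fix x
   show "ennreal ((cmod (u x))^2) * indicator ?Q x <= ennreal 2 * (ennreal ((w x - m)^2) * indicator ?Q2 x) + ennreal (2 * m^2) * indicator ?Q x"
   proof (cases "x \<in> ?Q")
    case True
    then have x2: "x \<in> ?Q2" using QQ by blast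
    have "(cmod (u x))^2 <= (w x)^2" using w2[of x] by simp
    also have "\<dots> <= 2 * (w x - m)^2 + 2 * m^2"
     using zero_le_power2[of "w x - 2 * m"] by (simp add: power2_diff power_mult_distrib)
    finally have "ennreal ((cmod (u x))^2) <= ennreal (2 * (w x - m)^2 + 2 * m^2)" by (rule ennreal_leI)
    also have "\<dots> = ennreal 2 * ennreal ((w x - m)^2) + ennreal (2 * m^2)" by (subst ennreal_plus) (auto simp: ennreal_mult')
    finally show ?thesis using True x2 by simp
   qed simp
  qed
  also have "\<dots> = ennreal 2 * (\<integral>\<^sup>+x. ennreal ((w x - m)^2) * indicator ?Q2 x \<partial>lborel) + ennreal (2 * m^2) * emeasure lborel ?Q"
   by (simp add: nn_integral_add nn_integral_cmult)
  also have "\<dots> <= ennreal 2 * ennreal X + ennreal (2 * m^2) * ennreal (d ^ CARD('n))"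
   using d by (intro add_mono mult_left_mono iX) (auto simp: emeasure_cube)
  also have "\<dots> = ennreal (2 * X + 2 * m^2 * d ^ CARD('n))"
  proof -
   have "ennreal 2 * ennreal X = ennreal (2 * X)" by (rule ennreal_mult[symmetric]) (use X0 in auto)
   moreover have "ennreal (2 * m^2) * ennreal (d ^ CARD('n)) = ennreal (2 * m^2 * d ^ CARD('n))" by (rule ennreal_mult[symmetric]) (use d in auto)
   moreover have "ennreal (2 * X) + ennreal (2 * m^2 * d ^ CARD('n)) = ennreal (2 * X + 2 * m^2 * d ^ CARD('n))"
    by (rule ennreal_plus[symmetric]) (use X0 d in auto)
   ultimately show ?thesis by simp
  qed
  finally have "m0 <= 2 * X + 2 * m^2 * d ^ CARD('n)" using X0 d by (subst (asm) ennreal_le_iff) auto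
  moreover have "4 * X <= m0" using mult_right_mono[OF c0(2) m00] unfolding Xm by (simp add: mult_ac)
  ultimately show ?thesis by linarith
 qed
 have \<epsilon>m: "\<epsilon>^2 <= m^2 / 64"
  using m0m d m unfolding \<epsilon>(2) by (simp add: pos_divide_le_eq field_simps)
 then have "\<epsilon>^2 <= (m / 8)^2" by (simp add: power_divide)
 then have \<epsilon>m8: "\<epsilon> <= m / 8" by (rule power2_le_imp_le) (use m in simp)
 \<comment> \<open>Three nested levels are used: w = \<epsilon> <= m / 8 off the domain, the set
   \<open>e\<close> of the smooth option at m / 5, and \<open>F\<close> at m / 4.\<close>
 define F where "F = {x \<in> ?Q. w x <= m / 4}"
 have clw: "closed {x. w x <= c}" for c by (rule closed_Collect_le[OF smooth_on_continuous[OF sw] continuous_on_const])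
 have cF: "compact {x \<in> ?Q. w x <= c}" for c
  using compact_Int_closed[OF compact_cube clw[of c]] by (simp add: Int_def)
 have off: "w x = \<epsilon>" if "x \<notin> \<Omega>" for x
 proof -
  have "u x = 0" using that L(3) by (intro L(4)) blast
  then show ?thesis using \<epsilon>(1) by (simp add: w_def)
 qed
 have FO: "?Q - \<Omega> \<subseteq> F" using off \<epsilon>m8 m by (auto simp: F_def)
 have "wiener_cap p d F <= ennreal (8 * (20 * real CARD('n) * step_slope / (3 * d))^2 / m^2 * X + 72 * step_slope^2 / m^2 * Y)"
  unfolding F_def by (rule sublevel_capacity_le[OF sw m d(1) X0 less_imp_le[OF Y] iX iY])
 also have "\<dots> <= ennreal (\<gamma> * (D / (8 * N)))"
 proof (rule ennreal_leI)
  have m0D: "m0 / m^2 / d^2 <= 4 * D" using m0m m d unfolding dn by (simp add: field_simps)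
  have Yv: "Y = K * c0 * m0 / d^2" using d by (simp add: Y_def)
  have "8 * (20 * N * step_slope / (3 * d))^2 / m^2 * X + 72 * step_slope^2 / m^2 * Y
    = c0 * (8 * (20 * N * step_slope / 3)^2 * (4 * N * K^2) + 72 * step_slope^2 * K) * (m0 / m^2 / d^2)"
   unfolding Xm Yv using d m by (simp add: power_divide power_mult_distrib field_simps)
  also have "\<dots> <= c0 * (8 * (20 * N * step_slope / 3)^2 * (4 * N * K^2) + 72 * step_slope^2 * K) * (4 * D)"
   using m0D c0(1) N K by (intro mult_left_mono) auto
  also have "\<dots> = (c0 * (32 * (20 * N * step_slope / 3)^2 * (4 * N * K^2) + 288 * step_slope^2 * K)) * D" by (simp add: algebra_simps)
  also have "\<dots> <= \<gamma> / (8 * N) * D" using c0(3) D by (intro mult_right_mono) auto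
  finally show "8 * (20 * real CARD('n) * step_slope / (3 * d))^2 / m^2 * X + 72 * step_slope^2 / m^2 * Y <= \<gamma> * (D / (8 * N))"
   by (simp add: N_def)
 qed
 also have "\<dots> = ennreal \<gamma> * ennreal (d ^ (CARD('n) - 2) / (8 * real CARD('n)))"
  unfolding D_def N_def using \<gamma> d by (intro ennreal_mult) auto
 also have "\<dots> <= ennreal \<gamma> * wiener_cap p d ?Q" by (intro mult_left_mono wiener_cap_cube_lower[OF n d(1)]) simp
 finally have adm: "F \<in> admissible_sets \<Omega> \<gamma> p d"
  using FO cF[of "m / 4"] by (auto simp: admissible_sets_def F_def)
 obtain A where A: "A >= 0" "AE x in M. x \<in> ?Q \<longrightarrow> norm (a x) <= A" by (rule a_bounded[OF compact_cube]) blast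
 \<comment> \<open>The first bound keeps P away from 0: |u| exceeds 3 m / 20 where w > m / 5, and
   |P| >= m / 8 off \<open>F\<close>. The second one makes the error terms, multiplied by the bound
   of the potential on the cube, cost at most D / 2.\<close>
 define \<delta> where "\<delta> = min (3 * m / 40) (m / (16 * N * d * (1 + A)))"
 have \<delta>: "\<delta> > 0" "\<delta> <= 3 * m / 40" "\<delta> <= m / (16 * N * d * (1 + A))" using m N d A(1) by (auto simp: \<delta>_def)
 obtain P where P: "polynomial_function P" "!!Q. generic_poly Q P"
  "!!x. x \<in> ?Q ==> cmod (P x - u x) <= \<delta>" "!!x j. x \<in> ?Q ==> cmod (grad P x $ j - grad u x $ j) <= \<delta>"
  by (rule generic_approximation[OF u(1) \<delta>(1), where p = p and d = d]) blast
 let ?\<omega> = "%x. P x / complex_of_real (cmod (P x))"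
 have Pnz: "P x \<noteq> 0" if x: "x \<in> ?Q" "w x > m / 5" for x
 proof -
  have "(m / 5)^2 <= (w x)^2" using x(2) m by (intro power_mono) auto
  then have "(3 * m / 20)^2 < (cmod (u x))^2" using w2[of x] \<epsilon>m m by (simp add: power_divide power_mult_distrib) (smt (verit) zero_less_power)
  then have "3 * m / 20 < cmod (u x)" by (rule power2_less_imp_less) simp
  moreover have "cmod (u x) - cmod (P x) <= \<delta>" using P(3)[OF x(1)] norm_triangle_ineq2[of "u x" "P x"] by (simp add: norm_minus_commute)
  ultimately show ?thesis using \<delta>(2) m by auto
 qed
 have sp: "smooth_pairs ?Q F ?\<omega>"
  unfolding smooth_pairs_def
 proof (intro exI conjI)
  \<comment> \<open>A level below m / 4 leaves room for \<open>e\<close> inside the relative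
    interior of \<open>F\<close>, while P has no zeros on the rest of the cube.\<close>
  show "compact {x \<in> ?Q. w x <= m / 5}" by (rule cF)
  have "openin (top_of_set ?Q) (?Q \<inter> {x. w x < m / 4})"
   by (intro openin_open_Int open_Collect_less smooth_on_continuous[OF sw] continuous_on_const)
  then have "?Q \<inter> {x. w x < m / 4} \<subseteq> top_of_set ?Q interior_of F"
   by (rule interior_of_maximal[rotated]) (auto simp: F_def)
  moreover have "{x \<in> ?Q. w x <= m / 5} \<subseteq> ?Q \<inter> {x. w x < m / 4}" using m by auto
  ultimately show "{x \<in> ?Q. w x <= m / 5} \<subseteq> top_of_set ?Q interior_of F" by (rule subset_trans[rotated])
  show "open {x. P x \<noteq> 0}" "smooth_on {x. P x \<noteq> 0} ?\<omega>" by (rule phase_smooth[OF P(1)])+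
  have Pn: "P x \<noteq> 0" if "x \<in> ?Q - {x \<in> ?Q. w x <= m / 5}" for x by (rule Pnz) (use that in auto)
  then show "?Q - {x \<in> ?Q. w x <= m / 5} \<subseteq> {x. P x \<noteq> 0}" by blast
  show "\<forall>x\<in>?Q - {x \<in> ?Q. w x <= m / 5}. cmod (?\<omega> x) = 1"
   by (rule ballI) (use Pn in \<open>simp add: norm_divide\<close>)
 qed
 have pp: "polynomial_pairs ?Q F ?\<omega>" unfolding polynomial_pairs_def using P(2) by blast
 define k1 where "k1 = 128 / m^2"
 define k2 where "k2 = k1 * (N * (\<delta> * (1 + A))^2)"
 have k: "k1 > 0" "k2 >= 0" using m N by (auto simp: k1_def k2_def)
 let ?X = "%x. (norm (\<chi> j. grad ?\<omega> x $ j / (\<i> * ?\<omega> x) + complex_of_real (a x $ j)))^2 + V x"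
 have pw: "?X x <= k1 * ?e x + k2" if x: "x \<in> ?Q" "x \<notin> F" and V: "0 <= V x" and ax: "norm (a x) <= A" for x
 proof -
  have wx: "w x > m / 4" using x by (auto simp: F_def)
  have "(m / 4)^2 <= (w x)^2" using wx m by (intro power_mono) auto
  then have u2: "3 * m^2 / 64 <= (cmod (u x))^2" using w2[of x] \<epsilon>m by (simp add: power_divide)
  have "(m / 5)^2 <= (cmod (u x))^2" using u2 by (simp add: power_divide) (smt (verit) zero_le_power2)
  then have "m / 5 <= cmod (u x)" by (rule power2_le_imp_le) simp
  moreover have "cmod (u x) - cmod (P x) <= \<delta>" using P(3)[OF x(1)] norm_triangle_ineq2[of "u x" "P x"] by (simp add: norm_minus_commute)
  ultimately have Pm: "m / 8 <= cmod (P x)" using \<delta>(2) by linarith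
  then have P0: "P x \<noteq> 0" using m by auto
  \<comment> \<open>The magnetic gradient of P differs from that of u by at most \<delta> (1 + A) in
    each component, and |P| is at least m / 8 here.\<close>
  have j: "(cmod (grad ?\<omega> x $ j / (\<i> * ?\<omega> x) + complex_of_real (a x $ j)))^2 <= k1 * ((cmod (mag_grad a u x $ j))^2 + (\<delta> * (1 + A))^2)" for j
  proof -
   let ?b = "grad P x $ j + \<i> * complex_of_real (a x $ j) * P x"
   have "?b = mag_grad a u x $ j + ((grad P x $ j - grad u x $ j) + \<i> * complex_of_real (a x $ j) * (P x - u x))"
    by (simp add: mag_grad_def algebra_simps)
   then have "cmod ?b <= cmod (mag_grad a u x $ j) + cmod ((grad P x $ j - grad u x $ j) + \<i> * complex_of_real (a x $ j) * (P x - u x))"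
    by (metis norm_triangle_ineq)
   also have "cmod ((grad P x $ j - grad u x $ j) + \<i> * complex_of_real (a x $ j) * (P x - u x)) <= \<delta> + A * \<delta>"
   proof (rule norm_triangle_mono[OF P(4)[OF x(1)]])
    have "\<bar>a x $ j\<bar> <= A" using component_le_norm_cart[of "a x" j] ax by simp
    then have "\<bar>a x $ j\<bar> * cmod (P x - u x) <= A * \<delta>" using P(3)[OF x(1)] A(1) by (intro mult_mono) auto
    then show "cmod (\<i> * complex_of_real (a x $ j) * (P x - u x)) <= A * \<delta>" by (simp add: norm_mult)
   qed
   finally have b: "cmod ?b <= cmod (mag_grad a u x $ j) + \<delta> * (1 + A)" by (simp add: algebra_simps)
   have "cmod (grad ?\<omega> x $ j / (\<i> * ?\<omega> x) + complex_of_real (a x $ j)) <= cmod ?b / cmod (P x)"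
    by (rule phase_gauge_le[OF P(1) P0])
   also have "\<dots> <= (cmod (mag_grad a u x $ j) + \<delta> * (1 + A)) / (m / 8)"
    using b Pm m \<delta>(1) A(1) by (intro frac_le) auto
   finally have "(cmod (grad ?\<omega> x $ j / (\<i> * ?\<omega> x) + complex_of_real (a x $ j)))^2 <= ((cmod (mag_grad a u x $ j) + \<delta> * (1 + A)) / (m / 8))^2"
    by (rule power_mono) simp
   also have "\<dots> = 64 / m^2 * (cmod (mag_grad a u x $ j) + \<delta> * (1 + A))^2"
   proof -
    have "(s / (m / 8))^2 = 64 / m^2 * s^2" for s by (simp add: power_divide power_mult_distrib)
    then show ?thesis .
   qed
   also have "\<dots> <= 64 / m^2 * (2 * (cmod (mag_grad a u x $ j))^2 + 2 * (\<delta> * (1 + A))^2)"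
   proof (rule mult_left_mono)
    have "(s + t)^2 <= 2 * s^2 + 2 * t^2" for s t :: real using zero_le_power2[of "s - t"] by (simp add: power2_sum power2_diff)
    then show "(cmod (mag_grad a u x $ j) + \<delta> * (1 + A))^2 <= 2 * (cmod (mag_grad a u x $ j))^2 + 2 * (\<delta> * (1 + A))^2" .
   qed simp
   also have "\<dots> = k1 * ((cmod (mag_grad a u x $ j))^2 + (\<delta> * (1 + A))^2)"
   proof -
    have "64 / m^2 * (2 * s + 2 * t) = k1 * (s + t)" for s t :: real using m by (simp add: k1_def field_simps)
    then show ?thesis .
   qed
   finally show ?thesis .
  qed
  have "(norm (\<chi> j. grad ?\<omega> x $ j / (\<i> * ?\<omega> x) + complex_of_real (a x $ j)))^2 = (\<Sum>j\<in>UNIV. (cmod (grad ?\<omega> x $ j / (\<i> * ?\<omega> x) + complex_of_real (a x $ j)))^2)"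
   unfolding norm_vec_def L2_set_def by (simp add: sum_nonneg)
  also have "\<dots> <= (\<Sum>j\<in>UNIV. k1 * ((cmod (mag_grad a u x $ j))^2 + (\<delta> * (1 + A))^2))" by (rule sum_mono[OF j])
  also have "\<dots> = k1 * ((norm (mag_grad a u x))^2 + N * (\<delta> * (1 + A))^2)"
   unfolding norm_vec_def L2_set_def N_def by (simp add: sum_nonneg sum_distrib_left[symmetric] sum.distrib)
  finally have 1: "(norm (\<chi> j. grad ?\<omega> x $ j / (\<i> * ?\<omega> x) + complex_of_real (a x $ j)))^2 <= k1 * (norm (mag_grad a u x))^2 + k2"
   by (simp add: k2_def distrib_left)
  \<comment> \<open>Since |u|^2 is at least 3 m^2 / 64 off \<open>F\<close>, the potential is
    bounded by a multiple of its share in the energy of u.\<close>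
  have "1 <= k1 * (cmod (u x))^2" using u2 m by (simp add: k1_def pos_le_divide_eq) (smt (verit) zero_le_power2)
  then have "V x <= k1 * (V x * (cmod (u x))^2)" using mult_left_mono[OF _ V, of 1 "k1 * (cmod (u x))^2"] by (simp add: mult_ac)
  with 1 show ?thesis by (simp add: distrib_left)
 qed
 have "gauge_energy a V (?Q - F) ?\<omega> <= (\<integral>\<^sup>+x. ennreal k1 * (f x * indicator ?Q2 x) + ennreal k2 * indicator ?Q x \<partial>lebesgue)"
  unfolding gauge_energy_def
 proof (rule nn_integral_mono_AE)
  show "AE x in lebesgue. ennreal (?X x) * indicator (?Q - F) x <= ennreal k1 * (f x * indicator ?Q2 x) + ennreal k2 * indicator ?Q x"
   using f V_nonneg A(2)[unfolded AE_M]
  proof eventually_elim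
   case (elim x)
   show ?case
   proof (cases "x \<in> ?Q - F")
    case True
    then have x: "x \<in> ?Q" "x \<notin> F" "x \<in> ?Q2" "x \<in> \<Omega>" using QQ FO by blast+
    then have V: "0 <= V x" "norm (a x) <= A" using elim by auto
    have "ennreal (?X x) <= ennreal (k1 * ?e x + k2)" by (rule ennreal_leI[OF pw[OF x(1,2) V]])
    also have "\<dots> = ennreal k1 * ennreal (?e x) + ennreal k2"
     using k V by (subst ennreal_plus) (auto simp: ennreal_mult)
    also have "ennreal (?e x) = f x" using elim(1) x(4) by simp
    finally show ?thesis using x by simp
   qed simp
  qed
 qed
 also have "\<dots> = ennreal k1 * (\<integral>\<^sup>+x. f x * indicator ?Q2 x \<partial>lborel) + ennreal k2 * emeasure lborel ?Q"
  by (simp add: nn_integral_completion nn_integral_add nn_integral_cmult)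
 also have "\<dots> <= ennreal k1 * ennreal Y + ennreal k2 * ennreal (d ^ CARD('n))"
  using d less_imp_le[OF fY] by (intro add_mono mult_left_mono) (auto simp: emeasure_cube)
 also have "\<dots> = ennreal (k1 * Y + k2 * d ^ CARD('n))" using k Y d by (simp add: ennreal_mult[symmetric])
 also have "\<dots> <= ennreal D"
 proof (rule ennreal_leI)
  have "k1 * Y <= D / 2"
  proof -
   have m0D: "m0 / m^2 / d^2 <= 4 * D" using m0m m d unfolding dn by (simp add: field_simps)
   have "k1 * Y = 128 * K * c0 * (m0 / m^2 / d^2)" using d m by (simp add: k1_def Y_def field_simps)
   also have "\<dots> <= 128 * K * c0 * (4 * D)" using m0D K c0(1) by (intro mult_left_mono) auto
   also have "\<dots> = (1024 * K * c0) * D / 2" by simp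
   also have "\<dots> <= 1 * D / 2" using c0(4) D by (intro divide_right_mono mult_right_mono) auto
   finally show ?thesis by simp
  qed
  moreover have "k2 * d ^ CARD('n) <= D / 2"
  proof -
   have "\<delta> * (1 + A) <= m / (16 * N * d)"
   proof -
    have "\<delta> * (1 + A) <= m / (16 * N * d * (1 + A)) * (1 + A)" using \<delta>(3) A(1) by (intro mult_right_mono) auto
    also have "\<dots> = m / (16 * N * d)" using A(1) by simp
    finally show ?thesis .
   qed
   then have "(\<delta> * (1 + A))^2 <= (m / (16 * N * d))^2" using \<delta>(1) A(1) by (intro power_mono) auto
   then have "k2 * d ^ CARD('n) <= k1 * (N * (m / (16 * N * d))^2) * d ^ CARD('n)"
    unfolding k2_def using k N d by (intro mult_right_mono mult_left_mono) auto
   also have "\<dots> = D / (2 * N)" unfolding k1_def dn using m d N by (simp add: power2_eq_square field_simps)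
   also have "\<dots> <= D / 2" using N D by (intro divide_left_mono) auto
   finally show ?thesis .
  qed
  ultimately show "k1 * Y + k2 * d ^ CARD('n) <= D" by linarith
 qed
 finally have "gauge_energy a V (?Q - F) ?\<omega> <= ennreal (d ^ (CARD('n) - 2))" unfolding D_def .
 with adm sp pp show ?thesis by blast
qed

end

section \<open>From sizes of cubes to the diameter\<close>

lemma inverse_le_of_ge:
 assumes "ennreal r <= D" "r > 0"
 shows "inverse D <= ennreal (1 / r)"
proof (cases D rule: ennreal_cases)
 case (real s)
 then have "r <= s" using assms by (simp add: ennreal_le_iff)
 then have "inverse s <= 1 / r" using assms(2) by (simp add: inverse_eq_divide frac_le)
 then show ?thesis using real \<open>r <= s\<close> assms(2) by (simp add: inverse_ennreal ennreal_leI)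
qed simp

lemma inverse_ge_of_le:
 assumes "D <= ennreal r" "r > 0"
 shows "ennreal (1 / r) <= inverse D"
proof (cases D rule: ennreal_cases)
 case (real s)
 then have s: "0 <= s" "s <= r" using assms by (simp_all add: ennreal_le_iff)
 show ?thesis
 proof (cases "s = 0")
  case True then show ?thesis using real by simp
 next
  case False
  then have "1 / r <= inverse s" using s by (simp add: inverse_eq_divide frac_le)
  then show ?thesis using real False s by (simp add: inverse_ennreal ennreal_leI)
 qed
qed (use assms in \<open>auto simp: top_unique\<close>)

theorem theorem5p1:
  fixes \<gamma> :: real
  assumes "CARD('n::finite) \<ge> 2" and "0 < \<gamma>" and "\<gamma> < 1"
  shows "\<exists>C>0. \<forall>(\<Omega> :: (real^'n) set) (V :: real^'n \<Rightarrow> real) (a :: real^'n \<Rightarrow> real^'n).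
           open \<Omega> \<and> \<Omega> \<noteq> {} \<and> L1_loc \<Omega> V \<and> (AE x in lebesgue. x \<in> \<Omega> \<longrightarrow> 0 \<le> V x) \<and>
           Linf_loc_closure \<Omega> a \<longrightarrow>
           best_constant \<Omega> a V (spectrum_bottom \<Omega> a V) \<and>
           (\<forall>D \<in> {cap_diam smooth_pairs \<Omega> \<gamma> a V, cap_diam polynomial_pairs \<Omega> \<gamma> a V}.
              ennreal (1 / C) * (inverse D)\<^sup>2 \<le> ennreal (spectrum_bottom \<Omega> a V) \<and>
              ennreal (spectrum_bottom \<Omega> a V) \<le> ennreal C * (inverse D)\<^sup>2)"
proof -
 obtain C1 where C1': "C1 > 0 \<and> (\<forall>(\<Omega> :: (real^'n) set) V a A l p d. magnetic \<Omega> V a \<and> A \<in> {smooth_pairs, polynomial_pairs} \<and>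
   magnetic.bounded_below \<Omega> V a l \<and> d > 0 \<and>
   ennreal (d ^ (CARD('n) - 2)) >= (INF (F, \<omega>) \<in> {(F, \<omega>). F \<in> admissible_sets \<Omega> \<gamma> p d \<and> A (cube p d) F \<omega>}. gauge_energy a V (cube p d - F) \<omega>)
   \<longrightarrow> l * d^2 <= C1)"
  using spectrum_upper[OF assms] ..
 note C1 = conjunct1[OF C1'] and up = conjunct2[OF C1', rule_format, OF conjI[OF _ conjI[OF _ conjI[OF _ conjI]]]]
 define N where "N = real CARD('n)"
 define K where "K = (2 ^ CARD('n) :: real)"
 define K1 where "K1 = 32 * (20 * N * step_slope / 3)^2 * (4 * N * K^2) + 288 * step_slope^2 * K"
 have N: "N > 0" and K: "K > 0" by (simp_all add: N_def K_def)
 have K1: "K1 > 0" unfolding K1_def using N K step_slope(1) by (intro add_nonneg_pos) auto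
 \<comment> \<open>The largest number allowed by the three smallness conditions of
   \<open>good_cube\<close>.\<close>
 define c0 where "c0 = min (1 / (16 * N * K^2)) (min (\<gamma> / (8 * N) / K1) (1 / (1024 * K)))"
 have c0: "c0 > 0" using N K K1 assms(2) by (simp add: c0_def)
 have "c0 <= 1 / (16 * N * K^2)" "c0 <= \<gamma> / (8 * N) / K1" "c0 <= 1 / (1024 * K)" by (simp_all add: c0_def)
 then have c0s: "16 * N * K^2 * c0 <= 1" "c0 * K1 <= \<gamma> / (8 * N)" "1024 * K * c0 <= 1"
  using N K K1 by (simp_all only: pos_le_divide_eq mult_pos_pos zero_less_numeral zero_less_power mult.commute)
 define C where "C = max C1 (1 / c0)"
 have C: "C > 0" "C1 <= C" "1 / c0 <= C" using C1 by (auto simp: C_def)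
 show ?thesis
 proof (intro exI[of _ C] conjI allI impI, rule C(1))
  fix \<Omega> :: "(real^'n) set" and V a
  assume H: "open \<Omega> \<and> \<Omega> \<noteq> {} \<and> L1_loc \<Omega> V \<and> (AE x in lebesgue. x \<in> \<Omega> \<longrightarrow> 0 <= V x) \<and> Linf_loc_closure \<Omega> a"
  interpret magnetic \<Omega> V a by (rule magnetic.intro) (use H in auto)
  have mg: "magnetic \<Omega> V a" by (rule magnetic_axioms)
  let ?l = "spectrum_bottom \<Omega> a V"
  show bc: "best_constant \<Omega> a V ?l" by (rule spectrum_bottom_best_constant)
  note l = best_constantD[OF bc]
  show "\<forall>D \<in> {cap_diam smooth_pairs \<Omega> \<gamma> a V, cap_diam polynomial_pairs \<Omega> \<gamma> a V}.
    ennreal (1 / C) * (inverse D)^2 <= ennreal ?l \<and> ennreal ?l <= ennreal C * (inverse D)^2"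
  proof
   fix D assume "D \<in> {cap_diam smooth_pairs \<Omega> \<gamma> a V, cap_diam polynomial_pairs \<Omega> \<gamma> a V}"
   then obtain A where A: "A \<in> {smooth_pairs, polynomial_pairs}" and D: "D = cap_diam A \<Omega> \<gamma> a V" by blast
   define S where "S p d \<longleftrightarrow> d > 0 \<and> ennreal (d ^ (CARD('n) - 2)) >= (INF (F, \<omega>) \<in> {(F, \<omega>). F \<in> admissible_sets \<Omega> \<gamma> p d \<and> A (cube p d) F \<omega>}. gauge_energy a V (cube p d - F) \<omega>)" for p d
   have DS: "D = Sup {ennreal d | p d. S p d}" unfolding D cap_diam_def S_def by simp
   have lower: "ennreal (1 / C) * (inverse D)^2 <= ennreal ?l"
   proof (rule ennreal_le_epsilon)
    \<comment> \<open>A function with energy below \<mu> is only guaranteed for \<mu> above the best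
      constant, so the bound is shown for each such \<mu> first.\<close>
    fix e :: real assume e: "e > 0"
    define \<mu> where "\<mu> = ?l + e"
    have \<mu>: "\<mu> > 0" "\<not> bounded_below \<mu>" using l(1) l(3)[of \<mu>] e by (auto simp: \<mu>_def)
    define d where "d = sqrt (c0 / \<mu>)"
    have d: "d > 0" "d^2 = c0 / \<mu>" using c0 \<mu>(1) by (simp_all add: d_def)
    then have \<mu>d: "\<mu> = c0 / d^2" using c0 \<mu>(1) by simp
    obtain p F \<omega> where pF: "F \<in> admissible_sets \<Omega> \<gamma> p d" "smooth_pairs (cube p d) F \<omega>" "polynomial_pairs (cube p d) F \<omega>"
      "gauge_energy a V (cube p d - F) \<omega> <= ennreal (d ^ (CARD('n) - 2))"
     using good_cube[OF assms(1,2) c0 _ _ _ \<mu>(2) d(1) \<mu>d] c0s unfolding N_def K_def K1_def by blast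
    have "(INF (F, \<omega>) \<in> {(F, \<omega>). F \<in> admissible_sets \<Omega> \<gamma> p d \<and> A (cube p d) F \<omega>}. gauge_energy a V (cube p d - F) \<omega>)
      <= gauge_energy a V (cube p d - F) \<omega>"
     by (rule INF_lower2[of "(F, \<omega>)"]) (use pF A in auto)
    then have "S p d" unfolding S_def using pF(4) d(1) by (auto intro: order_trans)
    then have "ennreal d <= D" unfolding DS by (intro Sup_upper) blast
    then have "inverse D <= ennreal (1 / d)" by (rule inverse_le_of_ge[OF _ d(1)])
    then have "(inverse D)^2 <= (ennreal (1 / d))^2" by (rule power_mono) simp
    also have "\<dots> = ennreal ((1 / d)^2)" using d(1) by (intro ennreal_power) auto
    also have "(1 / d)^2 = \<mu> / c0" using d by (simp add: power_divide)
    finally have "ennreal (1 / C) * (inverse D)^2 <= ennreal (1 / C) * ennreal (\<mu> / c0)" by (rule mult_left_mono) simp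
    also have "\<dots> = ennreal (1 / C * (\<mu> / c0))" using C(1) \<mu>(1) c0 by (intro ennreal_mult[symmetric]) auto
    also have "\<dots> <= ennreal (?l + e)"
    proof (rule ennreal_leI)
     have "1 <= C * c0" using C(3) c0 by (simp add: pos_divide_le_eq)
     then have "\<mu> <= \<mu> * (C * c0)" using \<mu>(1) by simp
     then show "1 / C * (\<mu> / c0) <= ?l + e" using C(1) c0 by (simp add: \<mu>_def pos_divide_le_eq)
    qed
    also have "\<dots> = ennreal ?l + ennreal e" using l(1) e by simp
    finally show "ennreal (1 / C) * (inverse D)^2 <= ennreal ?l + ennreal e" .
   qed
   have upper: "ennreal ?l <= ennreal C * (inverse D)^2"
   proof (cases "?l = 0")
    case False
    then have lp: "?l > 0" using l(1) by simp
    \<comment> \<open>A bound for the sizes counted in D. If the bottom of the spectrum is 0, there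
      is nothing to show, and D may be infinite.\<close>
    define r where "r = sqrt (C / ?l)"
    have r: "r > 0" "r^2 = C / ?l" using C(1) lp by (simp_all add: r_def)
    have "d <= r" if "S p d" for p d
    proof (rule power2_le_imp_le)
     have "?l * d^2 <= C1"
      by (rule up[OF mg A l(2) conjunct1[OF that[unfolded S_def]] conjunct2[OF that[unfolded S_def]]])
     then have "?l * d^2 <= C" using C(2) by linarith
     then show "d^2 <= r^2" unfolding r(2) using lp by (simp add: pos_le_divide_eq mult.commute)
    qed (use r in simp)
    then have "D <= ennreal r" unfolding DS by (intro Sup_least) (auto intro: ennreal_leI)
    then have "ennreal (1 / r) <= inverse D" by (rule inverse_ge_of_le[OF _ r(1)])
    then have "(ennreal (1 / r))^2 <= (inverse D)^2" by (rule power_mono) simp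
    moreover have "(ennreal (1 / r))^2 = ennreal (?l / C)"
     using r by (subst ennreal_power) (auto simp: power_divide)
    ultimately have "ennreal C * ennreal (?l / C) <= ennreal C * (inverse D)^2" by (intro mult_left_mono) auto
    moreover have "ennreal C * ennreal (?l / C) = ennreal ?l" using C(1) lp by (simp add: ennreal_mult[symmetric])
    ultimately show ?thesis by simp
   qed simp
   show "ennreal (1 / C) * (inverse D)^2 <= ennreal ?l \<and> ennreal ?l <= ennreal C * (inverse D)^2"
    using lower upper by blast
  qed
 qed
qed

end
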